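(* Let $T=\varphi\cdot \mathrm{n}$ be the Gauss mass transport sending $\mu=\rho_0\,dx$ (on the compact convex set $A\subset\mathbb{R}^d$) to $\nu=\rho_1\,dx$ (on $B_R$). For $x\in A$ let $K(x)$ denote the Gauss curvature at $x$ of the boundary of the sublevel set $A_{\varphi(x)}$, and let $|D_a\varphi|$ be the density of the absolutely continuous part of the total variation measure of the distributional derivative $D\varphi$. Then for $\mu$-almost all $x\in A$ $$ K(x)\,|D_a\varphi|(x)\,\varphi(x)^{d-1}\;\rho_1(T(x))=\rho_0(x). $$
   Context: Let $A\subset\mathbb{R}^d$ be a compact convex set of positive volume, $R>0$, $B_R=\{x\in\mathbb{R}^d: |x|\le R\}$. Let $\mu=\rho_0\,dx$ be a probability measure on $A$ equivalent to Lebesgue measure restricted to $A$, and $\nu=\rho_1\,dx$ a probability measure on $B_R$ equivalent to Lebesgue measure restricted to $B_R$. Gauss mass transport: it is known that there exist a Borel mapping $T:A\to B_R$ and a continuous function $\varphi:A\to[0,R]$ with convex sublevel sets $A_s=\{x\in A:\varphi(x)\le s\}$ such that $\nu=\mu\circ T^{-1}$ and $T(x)=\varphi(x)\,\mathrm{n}(x)$ for Lebesgue-a.e. $x$, where $\mathrm{n}(x)$ is the unit outer normal to $A_{\varphi(x)}$ at $x$; $T$ is unique (a.e.) and is called the Gauss mass transport with potential $\varphi$. Since $\varphi$ has convex sublevel sets it is a BV function; $D\varphi$ is the vector-valued measure with $\int\langle D\varphi,\xi\rangle=-\int\varphi\,\mathrm{div}\,\xi\,dx$ for smooth compactly supported vector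 fields $\xi$. Alexandrov differentiability on the sphere: for $\mathrm n\in S^{d-1}$ and an orthonormal basis $e_1,\dots,e_{d-1}$ of $\mathrm n^\perp$, use local coordinates $\theta\mapsto\sum_i\theta_ie_i+\sqrt{1-|\theta|^2}\,\mathrm n$. A function $f$ on $S^{d-1}$ is twice differentiable at $\mathrm n$ in the Alexandrov sense if in these coordinates $f(\theta)=f(0)+\langle p,\theta\rangle+\frac12\langle Q\theta,\theta\rangle+o(|\theta|^2)$ with $Q$ a symmetric matrix; then $(D_\theta^2)_af(\mathrm n):=Q$. Gauss curvature of a convex surface: for a compact convex set $C$ with nonempty interior let $H_C(\theta)=\sup_{x\in C}\langle\theta,x\rangle$, $\theta\in S^{d-1}$. At $x\in\partial C$ with unique outer unit normal $\mathrm n(x)$, set $K(x)=1/\det\big(H_C\cdot\mathrm{Id}+(D^2_\theta)_aH_C\big)(\mathrm n(x))$ if $H_C$ is twice Alexandrov differentiable at $\mathrm n(x)$ and this matrix is nondegenerate; if $\mathrm n(x)$ is unique but $H_C$ is not twice Alexandrov differentiable at $\mathrm n(x)$, set $K(x)=0$. *)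

theory Defs
  imports
    "HOL-Analysis.Analysis"
    "Jordan_Normal_Form.Determinant"
begin

hide_const (open) Determinants.det Finite_Cartesian_Product.vec
hide_type (open) Finite_Cartesian_Product.vec
no_notation Matrix.scalar_prod (infix "\<bullet>" 70)
no_notation Finite_Cartesian_Product.vec_nth (infixl "$" 90)


section \<open>Finite vector measures\<close>

text \<open>A finite vector measure on the \<open>\<sigma>\<close>-algebra of \<open>M\<close> is a countably additive set function
  with values in a Euclidean space; only \<^term>\<open>space M\<close> and \<^term>\<open>sets M\<close> are used.\<close>

definition vector_measure :: "'a measure \<Rightarrow> ('a set \<Rightarrow> 'b::euclidean_space) \<Rightarrow> bool" where
  "vector_measure M D \<longleftrightarrow>
     (\<forall>E::nat \<Rightarrow> 'a set. range E \<subseteq> sets M \<longrightarrow> disjoint_family E \<longrightarrow>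
        (\<lambda>n. D (E n)) sums D (\<Union>n. E n))"

definition total_variation :: "'a measure \<Rightarrow> ('a set \<Rightarrow> 'b::euclidean_space) \<Rightarrow> 'a measure" where
  "total_variation M D = measure_of (space M) (sets M)
     (\<lambda>E. SUP F \<in> {F::nat \<Rightarrow> 'a set. range F \<subseteq> sets M \<and> disjoint_family F \<and> (\<Union>n. F n) = E}.
        \<Sum>n. ennreal (norm (D (F n))))"

text \<open>The positive part of the Jordan decomposition of a finite signed measure \<open>\<nu>\<close>
  (\<open>F = {}\<close> is admissible, so truncation by \<^const>\<open>ennreal\<close> does not change the supremum); the
  negative part is the positive part of \<open>-\<nu>\<close>.\<close>

definition positive_variation :: "'a measure \<Rightarrow> ('a set \<Rightarrow> real) \<Rightarrow> 'a measure" where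
  "positive_variation M \<nu> = measure_of (space M) (sets M)
     (\<lambda>E. SUP F \<in> {F \<in> sets M. F \<subseteq> E}. ennreal (\<nu> F))"

definition signed_integral :: "'a measure \<Rightarrow> ('a set \<Rightarrow> real) \<Rightarrow> ('a \<Rightarrow> real) \<Rightarrow> real" where
  "signed_integral M \<nu> f =
     (LINT x|positive_variation M \<nu>. f x) - (LINT x|positive_variation M (\<lambda>E. - \<nu> E). f x)"

text \<open>The integral \<open>\<integral> \<langle>dD, \<xi>\<rangle>\<close> of a vector field against a vector measure.\<close>

definition vector_measure_integral ::
    "'a measure \<Rightarrow> ('a set \<Rightarrow> 'b::euclidean_space) \<Rightarrow> ('a \<Rightarrow> 'b) \<Rightarrow> real" where
  "vector_measure_integral M D \<xi> =
     (\<Sum>b\<in>Basis. signed_integral M (\<lambda>E. D E \<bullet> b) (\<lambda>x. \<xi> x \<bullet> b))"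

text \<open>\<open>g\<close> is (a version of) the density with respect to \<open>L\<close> of the absolutely continuous part in
  the Lebesgue decomposition of \<open>M\<close>; \<open>S\<close> is the singular part.\<close>

definition is_ac_density :: "'a measure \<Rightarrow> 'a measure \<Rightarrow> ('a \<Rightarrow> real) \<Rightarrow> bool" where
  "is_ac_density L M g \<longleftrightarrow>
     g \<in> borel_measurable L \<and> (\<forall>x\<in>space L. 0 \<le> g x) \<and>
     (\<exists>S. sets S = sets L \<and>
        (\<exists>N\<in>sets L. emeasure L N = 0 \<and> emeasure S (space L - N) = 0) \<and>
        (\<forall>E\<in>sets L. emeasure M E = emeasure (density L (\<lambda>x. ennreal (g x))) E + emeasure S E))"


section \<open>Functions of bounded variation\<close>

primrec k_times_cont_diff ::
    "nat \<Rightarrow> ('a::euclidean_space \<Rightarrow> 'b::euclidean_space) \<Rightarrow> bool" where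
  "k_times_cont_diff 0 f \<longleftrightarrow> continuous_on UNIV f"
| "k_times_cont_diff (Suc k) f \<longleftrightarrow> f differentiable_on UNIV \<and>
     (\<forall>v. k_times_cont_diff k (\<lambda>x. frechet_derivative f (at x) v))"

definition divergence :: "('a::euclidean_space \<Rightarrow> 'a) \<Rightarrow> 'a \<Rightarrow> real" where
  "divergence \<xi> x = (\<Sum>b\<in>Basis. frechet_derivative \<xi> (at x) b \<bullet> b)"

definition test_field :: "'a::euclidean_space set \<Rightarrow> ('a \<Rightarrow> 'a) \<Rightarrow> bool" where
  "test_field \<Omega> \<xi> \<longleftrightarrow> (\<forall>k. k_times_cont_diff k \<xi>) \<and>
     compact (closure {x. \<xi> x \<noteq> 0}) \<and> closure {x. \<xi> x \<noteq> 0} \<subseteq> \<Omega>"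

text \<open>\<open>f\<close> is a BV function on the open set \<open>\<Omega>\<close> whose distributional derivative is the finite
  vector measure \<open>D\<close> on the Borel sets of \<open>\<Omega>\<close>.\<close>

definition has_bv_derivative ::
    "('a::euclidean_space \<Rightarrow> real) \<Rightarrow> ('a set \<Rightarrow> 'a) \<Rightarrow> 'a set \<Rightarrow> bool" where
  "has_bv_derivative f D \<Omega> \<longleftrightarrow>
     integrable (restrict_space lborel \<Omega>) f \<and>
     vector_measure (restrict_space borel \<Omega>) D \<and>
     (\<forall>\<xi>. test_field \<Omega> \<xi> \<longrightarrow>
        vector_measure_integral (restrict_space borel \<Omega>) D \<xi> =
          - (LINT x|restrict_space lborel \<Omega>. f x * divergence \<xi> x))"


section \<open>Convex sets, normals and Gauss curvature\<close>

definition outer_unit_normals :: "'a::euclidean_space set \<Rightarrow> 'a \<Rightarrow> 'a set" where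
  "outer_unit_normals C x = {n. norm n = 1 \<and> (\<forall>y\<in>C. n \<bullet> (y - x) \<le> 0)}"

definition support_function :: "'a::euclidean_space set \<Rightarrow> 'a \<Rightarrow> real" where
  "support_function C \<theta> = (SUP x\<in>C. \<theta> \<bullet> x)"

text \<open>\<open>e 0, \<dots>, e (d - 2)\<close> is an orthonormal basis of the hyperplane orthogonal to \<open>n\<close>.\<close>

definition tangent_basis :: "'a::euclidean_space \<Rightarrow> (nat \<Rightarrow> 'a) \<Rightarrow> bool" where
  "tangent_basis n e \<longleftrightarrow>
     (\<forall>i<DIM('a) - 1. e i \<bullet> n = 0) \<and>
     (\<forall>i<DIM('a) - 1. \<forall>j<DIM('a) - 1. e i \<bullet> e j = (if i = j then 1 else 0))"

definition sphere_chart ::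
    "'a::euclidean_space \<Rightarrow> (nat \<Rightarrow> 'a) \<Rightarrow> real Matrix.vec \<Rightarrow> 'a" where
  "sphere_chart n e \<theta> =
     (\<Sum>i<DIM('a) - 1. (\<theta> $ i) *\<^sub>R e i) + sqrt (1 - scalar_prod \<theta> \<theta>) *\<^sub>R n"

text \<open>\<open>Q\<close> is the second Alexandrov derivative at \<open>n\<close> of a function on the unit sphere, in the
  coordinates given by \<open>e\<close>. The type of vectors of variable dimension carries no topology, so the
  remainder \<open>o(|\<theta>|\<^sup>2)\<close> is written out.\<close>

definition has_alexandrov_hessian ::
    "('a::euclidean_space \<Rightarrow> real) \<Rightarrow> 'a \<Rightarrow> (nat \<Rightarrow> 'a) \<Rightarrow> real mat \<Rightarrow> bool" where
  "has_alexandrov_hessian f n e Q \<longleftrightarrow>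
     Q \<in> carrier_mat (DIM('a) - 1) (DIM('a) - 1) \<and> transpose_mat Q = Q \<and>
     (\<exists>p \<in> carrier_vec (DIM('a) - 1). \<forall>\<epsilon>>0. \<exists>\<delta>>0. \<forall>\<theta> \<in> carrier_vec (DIM('a) - 1).
        sqrt (scalar_prod \<theta> \<theta>) < \<delta> \<longrightarrow>
        \<bar>f (sphere_chart n e \<theta>) - f n - scalar_prod p \<theta> - 1 / 2 * scalar_prod (Q *\<^sub>v \<theta>) \<theta>\<bar>
          \<le> \<epsilon> * scalar_prod \<theta> \<theta>)"

text \<open>The Gauss curvature at \<open>x\<close> of the boundary of \<open>C\<close> is defined and equals \<open>k\<close>. It is a relation
  because the curvature is left undefined where the outer normal is not unique or where the second
  derivative of the support function exists but gives a degenerate matrix. Changing \<open>e\<close> conjugates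
  \<open>Q\<close> by an orthogonal matrix, so \<open>k\<close> does not depend on \<open>e\<close>.\<close>

definition has_gauss_curvature :: "'a::euclidean_space set \<Rightarrow> 'a \<Rightarrow> real \<Rightarrow> bool" where
  "has_gauss_curvature C x k \<longleftrightarrow>
     compact C \<and> convex C \<and> interior C \<noteq> {} \<and> x \<in> frontier C \<and>
     (\<exists>n. outer_unit_normals C x = {n} \<and>
        ((\<exists>e Q. tangent_basis n e \<and> has_alexandrov_hessian (support_function C) n e Q \<and>
            det (support_function C n \<cdot>\<^sub>m 1\<^sub>m (DIM('a) - 1) + Q) \<noteq> 0 \<and>
            k = 1 / det (support_function C n \<cdot>\<^sub>m 1\<^sub>m (DIM('a) - 1) + Q)) \<or>
         ((\<nexists>e Q. tangent_basis n e \<and> has_alexandrov_hessian (support_function C) n e Q) \<and>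
            k = 0)))"


section \<open>Gauss mass transport\<close>

definition measure_with_density :: "'a::euclidean_space set \<Rightarrow> ('a \<Rightarrow> real) \<Rightarrow> 'a measure" where
  "measure_with_density X \<rho> = density (restrict_space lborel X) (\<lambda>x. ennreal (\<rho> x))"

text \<open>\<open>\<rho> dx\<close> is a probability measure on \<open>X\<close> equivalent to Lebesgue measure on \<open>X\<close>.\<close>

definition equivalent_prob_density :: "'a::euclidean_space set \<Rightarrow> ('a \<Rightarrow> real) \<Rightarrow> bool" where
  "equivalent_prob_density X \<rho> \<longleftrightarrow>
     \<rho> \<in> borel_measurable (restrict_space borel X) \<and> (\<forall>x\<in>X. 0 \<le> \<rho> x) \<and>
     emeasure (measure_with_density X \<rho>) X = 1 \<and>
     absolutely_continuous (restrict_space lborel X) (measure_with_density X \<rho>) \<and>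
     absolutely_continuous (measure_with_density X \<rho>) (restrict_space lborel X)"

definition sublevel :: "'a set \<Rightarrow> ('a \<Rightarrow> real) \<Rightarrow> real \<Rightarrow> 'a set" where
  "sublevel A \<phi> s = {x \<in> A. \<phi> x \<le> s}"

definition gauss_mass_transport ::
    "'a::euclidean_space set \<Rightarrow> real \<Rightarrow> ('a \<Rightarrow> real) \<Rightarrow> ('a \<Rightarrow> real) \<Rightarrow>
     ('a \<Rightarrow> 'a) \<Rightarrow> ('a \<Rightarrow> real) \<Rightarrow> bool" where
  "gauss_mass_transport A R \<rho>0 \<rho>1 T \<phi> \<longleftrightarrow>
     T \<in> restrict_space borel A \<rightarrow>\<^sub>M restrict_space borel (cball 0 R) \<and>
     continuous_on A \<phi> \<and> \<phi> \<in> A \<rightarrow> {0..R} \<and> (\<forall>s. convex (sublevel A \<phi> s)) \<and>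
     distr (measure_with_density A \<rho>0) (restrict_space borel (cball 0 R)) T =
       measure_with_density (cball 0 R) \<rho>1 \<and>
     (AE x in restrict_space lborel A. \<exists>n.
        outer_unit_normals (sublevel A \<phi> (\<phi> x)) x = {n} \<and> T x = \<phi> x *\<^sub>R n)"

end

theory Submission
  imports Defs
begin

text \<open>Let \<open>F t y\<close> be the support function of the sublevel set \<open>{\<phi> \<le> t}\<close>. It is convex in \<open>y\<close> and
  monotone in \<open>t\<close>, hence has at almost every \<open>(t, y)\<close> a parabolic Taylor expansion, of first order in
  \<open>t\<close> (coefficient \<open>c\<close>) and of second order in \<open>y\<close> (Hessian \<open>N\<close>): one-dimensional expansions along
  lines exist almost everywhere and are glued together at points of density. The map
  \<open>(x, s) \<mapsto> (\<phi> x, s n(x))\<close>, with \<open>1 < s < 2\<close>, is inverse to \<open>(t, y) \<mapsto> (\<nabla>F t y, |y|)\<close>. Comparing volumes of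
  small parabolic boxes with those of their preimages shows that its Jacobian at points of
  expansion is \<open>s / (c det N)\<close>, where the determinant is taken on \<open>y\<^sup>\<bottom>\<close>. On the other hand the transport
  equation and polar coordinates express this Jacobian through \<open>\<rho>0\<close> and \<open>\<rho>1\<close>; in particular \<open>c\<close> and
  \<open>N\<close> are nondegenerate almost everywhere along the image of \<open>A\<close>. At such points \<open>\<phi>\<close> is differentiable
  with \<open>|\<nabla>\<phi>| = s / c\<close>, the sublevel set has curvature \<open>1 / det (s N)\<close>, and \<open>D\<^sub>a\<phi> = |\<nabla>\<phi>|\<close> by testing
  the distributional derivative against bump functions shrinking to the point.\<close>

section \<open>Differentiation of measures\<close>

text \<open>The potential is only continuous and quasiconvex, so it cannot be differentiated
  directly; support functions trade this for convexity and monotonicity, to which one-dimensional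
  a.e. differentiability applies. The two variables scale differently: tilting the direction by
  \<open>d\<close> moves the support point by order \<open>d\<close> tangentially but by order
  \<open>d^2\<close> in height, and the height is what the level sees. Hence boxes of size
  \<open>d^2\<close> in \<open>t\<close> and \<open>d\<close> in \<open>y\<close>, and a
  differentiation theory general enough for them. Expansions at different points are chosen without
  measurability, so density arguments must work for arbitrary sets. A priori the expansion may be
  degenerate. The upper volume bound is therefore proved with perturbed coefficients
  \<open>c + k\<close> and \<open>q i + k\<close>; as \<open>k\<close> tends to 0 it forces
  nondegeneracy wherever the transported density is positive, and only then are
  \<open>\<phi>\<close> and its normals localized and the lower bound proved. The variable
  \<open>s\<close> makes the dimensions agree and replaces the sphere of directions by an open
  shell, so that no surface measure appears.\<close>

lemma null_set_if_small_open_cover: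
 fixes E :: "'b::euclidean_space set"
 assumes "!!e. 0 < e ==> \<exists>W. open W \<and> E \<subseteq> W \<and> emeasure lborel W <= ennreal e"
 shows "\<exists>N\<in>null_sets lborel. E \<subseteq> N"
proof -
 have "\<exists>W. open W \<and> E \<subseteq> W \<and> emeasure lborel W <= ennreal (1 / real (Suc k))" for k
  by (rule assms) simp
 then obtain W where W: "!!k. open (W k)" "!!k. E \<subseteq> W k"
  "!!k. emeasure lborel (W k) <= ennreal (1 / real (Suc k))" by metis
 have meas: "(\<Inter>k. W k) \<in> sets lborel" using W(1) by auto
 have "emeasure lborel (\<Inter>k. W k) <= 0"
 proof (rule LIMSEQ_le_const)
  show "(\<lambda>k. ennreal (1 / real (Suc k))) \<longlonglongrightarrow> 0"
   using tendsto_ennrealI[OF LIMSEQ_inverse_real_of_nat] by (simp add: inverse_eq_divide)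
  show "\<exists>N. \<forall>n\<ge>N. emeasure lborel (\<Inter>k. W k) <= ennreal (1 / real (Suc n))"
  proof (intro exI allI impI)
   fix n :: nat
   have "emeasure lborel (\<Inter>k. W k) <= emeasure lborel (W n)"
    using W(1) by (intro emeasure_mono) auto
   then show "emeasure lborel (\<Inter>k. W k) <= ennreal (1 / real (Suc n))" using W(3) order_trans by blast
  qed
 qed
 then have "(\<Inter>k. W k) \<in> null_sets lborel" using meas by auto
 moreover have "E \<subseteq> (\<Inter>k. W k)" using W(2) by auto
 ultimately show ?thesis by blast
qed

text \<open>The two facts behind Vitali covering, engulfing with factor 3 and doubling, are isolated
  so that one proof serves Euclidean balls (for monotone functions and the distributional
  derivative) and the anisotropic boxes \<open>pbox\<close>.\<close>

locale engulfing =
 fixes P :: "real => 'b::euclidean_space => 'b set" and K :: real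
 assumes open_P: "0 < \<delta> ==> open (P \<delta> z)"
  and center_in_P: "0 < \<delta> ==> z \<in> P \<delta> z"
  and shrinking: "open U ==> z \<in> U ==> \<exists>\<delta>0>0. \<forall>\<delta>. 0 < \<delta> --> \<delta> < \<delta>0 --> P \<delta> z \<subseteq> U"
  and engulf: "0 < \<delta> ==> \<delta> <= \<delta>' ==> P \<delta> z \<inter> P \<delta>' z' \<noteq> {} ==> P \<delta> z \<subseteq> P (3 * \<delta>') z'"
  and doubling: "0 < \<delta> ==> emeasure lborel (P (3 * \<delta>) z) <= ennreal K * emeasure lborel (P \<delta> z)"
  and K_pos: "0 < K"
  and finite_P: "0 < \<delta> ==> emeasure lborel (P \<delta> z) < \<infinity>"
begin

abbreviation sparse :: "'b measure => real => 'b => bool" where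
 "sparse m k z \<equiv> \<forall>\<^sub>F d in at_right 0. emeasure m (P d z) <= ennreal k * emeasure lborel (P d z)"

lemma P_borel [measurable]: "0 < d ==> P d z \<in> sets borel"
 by (intro borel_open open_P)

text \<open>Greedy selection: keep a set of largest radius, discard all that meet it (engulfing puts
  them into its tripled copy), and recurse on the rest.\<close>

lemma finite_vitali:
 assumes "finite I" "!!i. i \<in> I ==> 0 < fst i"
 shows "\<exists>J\<subseteq>I. disjoint_family_on (\<lambda>i. P (fst i) (snd i)) J \<and>
   (\<Union>i\<in>I. P (fst i) (snd i)) \<subseteq> (\<Union>i\<in>J. P (3 * fst i) (snd i))"
 using assms
proof (induction "card I" arbitrary: I rule: less_induct)
 case less
 show ?case
 proof (cases "I = {}")
  case True then show ?thesis by (auto simp: disjoint_family_on_def)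
 next
  case False
  have "Max (fst ` I) \<in> fst ` I" using False less.prems(1) by simp
  then obtain i where "i \<in> I" "fst i = Max (fst ` I)" by force
  then have i: "i \<in> I" "!!j. j \<in> I ==> fst j <= fst i"
   using less.prems(1) by auto
  define I' where "I' = {j\<in>I. P (fst j) (snd j) \<inter> P (fst i) (snd i) = {}}"
  have "i \<notin> I'" using center_in_P[of "fst i" "snd i"] less.prems(2) i unfolding I'_def by blast
  then have "I' \<subset> I" using i unfolding I'_def by blast
  then have "card I' < card I" using less.prems(1) by (simp add: psubset_card_mono)
  moreover have "finite I'" "!!j. j \<in> I' ==> 0 < fst j" using less.prems by (auto simp: I'_def)
  ultimately obtain J where J: "J \<subseteq> I'" "disjoint_family_on (\<lambda>i. P (fst i) (snd i)) J"
   "(\<Union>i\<in>I'. P (fst i) (snd i)) \<subseteq> (\<Union>i\<in>J. P (3 * fst i) (snd i))" using less.hyps by blast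
  have "disjoint_family_on (\<lambda>i. P (fst i) (snd i)) (insert i J)"
   using J(1,2) by (auto simp: disjoint_family_on_def I'_def)
  moreover have "(\<Union>i\<in>I. P (fst i) (snd i)) \<subseteq> (\<Union>i\<in>insert i J. P (3 * fst i) (snd i))"
  proof (rule UN_least)
   fix j assume j: "j \<in> I"
   show "P (fst j) (snd j) \<subseteq> (\<Union>i\<in>insert i J. P (3 * fst i) (snd i))"
   proof (cases "j \<in> I'")
    case True then show ?thesis using J(3) by blast
   next
    case False
    then have "P (fst j) (snd j) \<inter> P (fst i) (snd i) \<noteq> {}" using j by (auto simp: I'_def)
    then show ?thesis using engulf[OF less.prems(2)[OF j] i(2)[OF j]] by blast
   qed
  qed
  moreover have "insert i J \<subseteq> I" using J i \<open>I' \<subset> I\<close> by blast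
  ultimately show ?thesis by blast
 qed
qed

text \<open>The weak (1,1) bound for the maximal function of \<open>m\<close>, phrased through an
  open cover because \<open>E\<close> may be non-measurable. Doubling turns the tripled sets of the
  covering lemma into the factor \<open>K\<close>.\<close>

lemma weak_type:
 assumes m: "sets m = sets borel" and U: "open U"
  and E: "!!z. z \<in> E ==> \<exists>h>0. P h z \<subseteq> U \<and> b * emeasure lborel (P h z) <= emeasure m (P h z)"
 shows "\<exists>W. open W \<and> E \<subseteq> W \<and> b * emeasure lborel W <= ennreal K * emeasure m U"
proof -
 obtain d where d: "!!z. z \<in> E ==> 0 < d z \<and> P (d z) z \<subseteq> U \<and>
   b * emeasure lborel (P (d z) z) <= emeasure m (P (d z) z)"
  using E by metis
 define W where "W = (\<Union>z\<in>E. P (d z) z)"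
 have W: "open W" "E \<subseteq> W" using d open_P center_in_P by (auto simp: W_def)
 \<comment> \<open>Lindelof makes the cover countable, so that the Vitali selection can be applied
   to finite subfamilies and passed to the supremum.\<close>
 obtain C where C: "C \<subseteq> (\<lambda>z. P (d z) z) ` E" "countable C" "\<Union>C = W"
 proof (rule Lindelof[of "(\<lambda>z. P (d z) z) ` E"])
  show "open S" if "S \<in> (\<lambda>z. P (d z) z) ` E" for S using that d open_P by auto
 qed (auto simp: W_def)
 obtain E' where E': "E' \<subseteq> E" "countable E'" "C = (\<lambda>z. P (d z) z) ` E'"
  using C(1,2) by (meson countable_subset_image)
 have WE': "W = (\<Union>z\<in>E'. P (d z) z)" using C E' by blast
 have fin: "b * emeasure lborel (\<Union>z\<in>F. P (d z) z) <= ennreal K * emeasure m U"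
  if F: "finite F" "F \<subseteq> E'" for F
 proof -
  have "finite ((\<lambda>z. (d z, z)) ` F)" "!!i. i \<in> (\<lambda>z. (d z, z)) ` F ==> 0 < fst i"
   using F d E' by auto
  from finite_vitali[OF this] obtain J where J: "J \<subseteq> (\<lambda>z. (d z, z)) ` F"
   "disjoint_family_on (\<lambda>i. P (fst i) (snd i)) J"
   "(\<Union>i\<in>(\<lambda>z. (d z, z)) ` F. P (fst i) (snd i)) \<subseteq> (\<Union>i\<in>J. P (3 * fst i) (snd i))" by blast
  have finJ: "finite J" using J(1) F finite_subset by blast
  have Jd: "0 < fst i" "P (fst i) (snd i) \<subseteq> U"
   "b * emeasure lborel (P (fst i) (snd i)) <= emeasure m (P (fst i) (snd i))" if "i \<in> J" for i
   using that J(1) F(2) E'(1) d by fastforce+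
  have "emeasure lborel (\<Union>z\<in>F. P (d z) z) <= emeasure lborel (\<Union>i\<in>J. P (3 * fst i) (snd i))"
   using J(3) Jd by (intro emeasure_mono) (auto intro!: sets.finite_UN finJ P_borel)
  also have "... <= (\<Sum>i\<in>J. emeasure lborel (P (3 * fst i) (snd i)))"
   using Jd by (intro emeasure_subadditive_finite finJ) auto
  also have "... <= (\<Sum>i\<in>J. ennreal K * emeasure lborel (P (fst i) (snd i)))"
   using Jd by (intro sum_mono doubling) auto
  finally have "b * emeasure lborel (\<Union>z\<in>F. P (d z) z)
    <= b * (\<Sum>i\<in>J. ennreal K * emeasure lborel (P (fst i) (snd i)))" by (rule mult_left_mono) simp
  also have "... = ennreal K * (\<Sum>i\<in>J. b * emeasure lborel (P (fst i) (snd i)))"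
   by (simp add: sum_distrib_left mult.left_commute)
  also have "... <= ennreal K * (\<Sum>i\<in>J. emeasure m (P (fst i) (snd i)))"
   using Jd by (intro mult_left_mono sum_mono) auto
  also have "(\<Sum>i\<in>J. emeasure m (P (fst i) (snd i))) = emeasure m (\<Union>i\<in>J. P (fst i) (snd i))"
   using Jd m J(2) finJ by (intro sum_emeasure) auto
  also have "... <= emeasure m U" using Jd(2) m U by (intro emeasure_mono UN_least) auto
  finally show ?thesis by (simp add: mult_left_mono)
 qed
 have "b * emeasure lborel W <= ennreal K * emeasure m U"
 proof (cases "E' = {}")
  case True then show ?thesis using WE' by simp
 next
  case False
  define F where "F n = from_nat_into E' ` {..<n}" for n :: nat
  have F: "finite (F n)" "F n \<subseteq> E'" for n
   using from_nat_into[OF False] by (auto simp: F_def)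
  have "E' = range (from_nat_into E')" using False E' by (simp add: range_from_nat_into)
  then have UF: "E' = (\<Union>n. F n)" unfolding F_def by auto
  define G where "G n = (\<Union>z\<in>F n. P (d z) z)" for n
  have G: "G n \<in> sets lborel" for n
   unfolding G_def using F d E'(1) P_borel by (intro sets.finite_UN) (auto simp: subset_iff)
  have "incseq G" unfolding G_def F_def incseq_def by (auto intro: less_le_trans)
  then have "(SUP n. emeasure lborel (G n)) = emeasure lborel (\<Union>n. G n)"
   using G by (intro SUP_emeasure_incseq) auto
  moreover have "(\<Union>n. G n) = W" unfolding G_def WE' using UF by auto
  ultimately have "b * emeasure lborel W = (SUP n. b * emeasure lborel (G n))"
   by (metis SUP_mult_left_ennreal)
  also have "... <= ennreal K * emeasure m U" using fin[OF F] by (intro SUP_least) (simp add: G_def)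
  finally show ?thesis .
 qed
 with W show ?thesis by blast
qed


lemma P_pos: "0 < h ==> 0 < emeasure lborel (P h z)"
proof -
 assume d: "0 < h"
 obtain r where r: "0 < r" "ball z r \<subseteq> P h z"
  using open_P[OF d, of z] center_in_P[OF d, of z] by (meson open_contains_ball)
 have "0 < emeasure lborel (ball z r)" using r by (simp add: emeasure_ball ennreal_zero_less_mult_iff)
 also have "... <= emeasure lborel (P h z)" using r d by (intro emeasure_mono) auto
 finally show ?thesis .
qed

lemma eventually_P_subset:
 assumes "open U" "z \<in> U"
 shows "\<forall>\<^sub>F d in at_right 0. P d z \<subseteq> U"
proof -
 obtain d0 where "d0 > 0" "\<forall>d. 0 < d --> d < d0 --> P d z \<subseteq> U"
  using shrinking[OF assms] by blast
 then show ?thesis unfolding eventually_at_right_field by blast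
qed

text \<open>Since \<open>m\<close> vanishes on \<open>N\<close>, outer regularity encloses
  \<open>N\<close> in open sets of arbitrarily small \<open>m\<close>-mass; the weak-type bound
  inside such a set shows that the points of \<open>N\<close> with density bounded below form a null
  set. It is applied to singular parts, and also to Lebesgue densities that vanish on
  \<open>N\<close>.\<close>

lemma singular_density_zero:
 assumes m: "sets m = sets borel" "emeasure m UNIV < \<infinity>" and N: "N \<in> sets borel" "emeasure m N = 0"
 shows "AE z in lborel. z \<in> N -->
  (\<forall>k>0. sparse m k z)"
proof -
 define E where "E n = {z\<in>N. \<not> (sparse m (1 / real (Suc n)) z)}" for n
 have "\<exists>M\<in>null_sets lborel. E n \<subseteq> M" for n
 proof (rule null_set_if_small_open_cover)
  fix e :: real assume e: "0 < e"
  \<comment> \<open>Chosen so that the factor \<open>real (Suc n) * K\<close> lost in the weak-type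
    bound gives back exactly \<open>e\<close>.\<close>
  define e' where "e' = e / (real (Suc n) * K)"
  have e': "e' > 0" using e K_pos by (simp add: e'_def)
  have "emeasure m N = (INF U\<in>{U. N \<subseteq> U \<and> open U}. emeasure m U)"
   using m N by (intro outer_regular) (auto simp: sets_eq_imp_space_eq[OF m(1)])
  then have "(INF U\<in>{U. N \<subseteq> U \<and> open U}. emeasure m U) < ennreal e'" using N(2) e' by simp
  then obtain U where U: "N \<subseteq> U" "open U" "emeasure m U < ennreal e'"
   by (auto simp: INF_less_iff)
  have "\<exists>d>0. P d z \<subseteq> U \<and> ennreal (1 / real (Suc n)) * emeasure lborel (P d z) <= emeasure m (P d z)"
   if z: "z \<in> E n" for z
  proof -
   have A: "\<not> (sparse m (1 / real (Suc n)) z)"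
    using z by (simp add: E_def)
   have "\<forall>\<^sub>F d in at_right 0. P d z \<subseteq> U" using z U by (intro eventually_P_subset) (auto simp: E_def)
   moreover have "\<forall>\<^sub>F d::real in at_right 0. 0 < d" by (rule eventually_at_right_less)
   ultimately have B: "\<forall>\<^sub>F d in at_right 0. P d z \<subseteq> U \<and> 0 < d" by (rule eventually_conj)
   show ?thesis
   proof (rule ccontr)
    assume C: "\<not> ?thesis"
    have "sparse m (1 / real (Suc n)) z"
     using B by eventually_elim (use C linear in blast)
    with A show False by blast
   qed
  qed
  from weak_type[OF m(1) U(2) this] obtain W where W: "open W" "E n \<subseteq> W"
   "ennreal (1 / real (Suc n)) * emeasure lborel W <= ennreal K * emeasure m U" by blast
  have "ennreal (real (Suc n)) * (ennreal (1 / real (Suc n)) * emeasure lborel W) <= ennreal (real (Suc n)) * (ennreal K * ennreal e')"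
   using W(3) U(3) by (intro mult_left_mono order_trans[OF W(3)]) auto
  moreover have "ennreal (real (Suc n)) * (ennreal (1 / real (Suc n)) * emeasure lborel W) = emeasure lborel W"
   by (simp only: mult.assoc[symmetric] ennreal_mult[symmetric]) (simp flip: ennreal_mult add: field_simps del: of_nat_Suc)
  moreover have "ennreal (real (Suc n)) * (ennreal K * ennreal e') = ennreal e"
   using K_pos e by (simp flip: ennreal_mult add: e'_def del: of_nat_Suc)
  ultimately show "\<exists>W. open W \<and> E n \<subseteq> W \<and> emeasure lborel W <= ennreal e" using W by auto
 qed
 then obtain M where M: "!!n. M n \<in> null_sets lborel" "!!n. E n \<subseteq> M n" by metis
 have "(\<Union>n. M n) \<in> null_sets lborel" using M(1) by blast
 then show ?thesis
 proof (rule AE_I')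
  show "{z \<in> space lborel. \<not> (z \<in> N --> (\<forall>k>0. sparse m k z))} \<subseteq> (\<Union>n. M n)"
  proof (rule subsetI, rule ccontr)
   fix z assume z: "z \<in> {z \<in> space lborel. \<not> (z \<in> N --> (\<forall>k>0. sparse m k z))}" and nz: "z \<notin> (\<Union>n. M n)"
   have "sparse m k z" if "k > 0" for k
   proof -
    obtain n where n: "1 / real (Suc n) < k" using nat_approx_posE[OF \<open>k > 0\<close>] by metis
    have "z \<notin> E n" using nz M by auto
    then have "sparse m (1 / real (Suc n)) z"
     using z by (auto simp: E_def)
    then show ?thesis
    proof eventually_elim
     case (elim d)
     have "ennreal (1 / real (Suc n)) * emeasure lborel (P d z) <= ennreal k * emeasure lborel (P d z)"
      using n by (intro mult_right_mono ennreal_leI) auto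
     then show ?case using elim by (rule order_trans[rotated])
    qed
   qed
   then show False using z by auto
  qed
 qed
qed

text \<open>For rational \<open>q\<close> near \<open>f z\<close>, the part of
  \<open>|f - q|\<close> of size at least \<open>a\<close> is the density of a measure that vanishes
  on \<open>{|f - q| < a}\<close>, hence has zero density at almost every point of that set.
  Countably many \<open>q\<close>, \<open>a\<close> and truncation radii suffice.\<close>

lemma lebesgue_points:
 fixes f :: "'b => real"
 assumes f: "integrable lborel f"
 shows "AE z in lborel. \<forall>k>0. \<forall>\<^sub>F d in at_right 0.
   (\<integral>\<^sup>+x\<in>P d z. ennreal (abs (f x - f z)) \<partial>lborel) <= ennreal k * emeasure lborel (P d z)"
proof -
 have [measurable]: "f \<in> borel_measurable borel" using f by auto
 have [measurable]: "ball (0::'b) R \<in> sets borel" for R by auto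
 define h where "h q a R x = ennreal (abs (f x - q)) * indicator ({x. a <= abs (f x - q)} \<inter> ball 0 R) x" for q a R x
 have [measurable]: "h q a R \<in> borel_measurable borel" for q a R unfolding h_def by measurable
 have A: "AE z in lborel. z \<in> {x. abs (f x - q) < a} -->
  (\<forall>k>0. sparse (density lborel (h q a R)) k z)" for q a R
 proof (rule singular_density_zero)
  have "emeasure (density lborel (h q a R)) UNIV = (\<integral>\<^sup>+x. h q a R x \<partial>lborel)"
   by (simp add: emeasure_density)
  also have "... <= (\<integral>\<^sup>+x. ennreal (abs (f x)) + ennreal (abs q) * indicator (ball 0 R) x \<partial>lborel)"
   unfolding h_def by (intro nn_integral_mono) (auto simp: indicator_def simp flip: ennreal_plus intro!: ennreal_leI)
  also have "... = (\<integral>\<^sup>+x. ennreal (abs (f x)) \<partial>lborel) + ennreal (abs q) * emeasure lborel (ball (0::'b) R)"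
   by (subst nn_integral_add) (auto simp: nn_integral_cmult)
  also have "... < \<infinity>"
   using f emeasure_lborel_ball_finite[of "0::'b" R] by (auto simp: integrable_iff_bounded ennreal_mult_less_top)
  finally show "emeasure (density lborel (h q a R)) UNIV < \<infinity>" .
  show "emeasure (density lborel (h q a R)) {x. abs (f x - q) < a} = 0"
   by (subst emeasure_density) (auto simp: nn_integral_0_iff_AE h_def indicator_def)
 qed auto
 have "AE z in lborel. \<forall>q\<in>\<rat>. \<forall>n::nat. \<forall>R::nat. z \<in> {x. abs (f x - q) < 1 / real (Suc n)} -->
  (\<forall>k>0. sparse (density lborel (h q (1 / real (Suc n)) R)) k z)"
  by (intro AE_ball_countable[THEN iffD2] countable_rat ballI AE_all_countable[THEN iffD2] allI A)
 then show ?thesis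
 proof eventually_elim
  case (elim z)
  show ?case
  proof (intro allI impI)
   fix k :: real assume k: "k > 0"
   obtain n where n: "1 / real (Suc n) < k / 4" using nat_approx_posE[of "k/4"] k by auto
   define a where "a = 1 / real (Suc n)"
   have a: "0 < a" "a < k / 4" using n by (auto simp: a_def)
   obtain q where q: "q \<in> \<rat>" "f z - a < q" "q < f z + a"
    using Rats_dense_in_real[of "f z - a" "f z + a"] a by auto
   obtain R :: nat where R: "norm z < real R" using reals_Archimedean2 by blast
   have "sparse (density lborel (h q a R)) (k/2) z"
    using elim q k by (auto simp: a_def)
   moreover have "\<forall>\<^sub>F d in at_right 0. P d z \<subseteq> ball 0 R" using R by (intro eventually_P_subset) auto
   moreover have "\<forall>\<^sub>F d::real in at_right 0. 0 < d" by (rule eventually_at_right_less)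
   ultimately show "\<forall>\<^sub>F d in at_right 0. (\<integral>\<^sup>+x\<in>P d z. ennreal (abs (f x - f z)) \<partial>lborel) <= ennreal k * emeasure lborel (P d z)"
   proof eventually_elim
    case (elim d)
    have [measurable]: "P d z \<in> sets borel" using elim by simp
    have "(\<integral>\<^sup>+x\<in>P d z. ennreal (abs (f x - f z)) \<partial>lborel) <= (\<integral>\<^sup>+x. h q a R x * indicator (P d z) x + ennreal (2 * a) * indicator (P d z) x \<partial>lborel)"
    proof (intro nn_integral_mono)
     fix x
     \<comment> \<open>Where \<open>|f x - q| < a\<close>, both values lie within \<open>a\<close>
       of \<open>q\<close>, which costs \<open>2 * a\<close>; elsewhere \<open>h\<close> absorbs
       \<open>|f x - q|\<close>.\<close>
     have "ennreal (abs (f x - f z)) <= h q a R x + ennreal (2 * a)" if "x \<in> P d z"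
      using that elim q a unfolding h_def
      by (auto simp: indicator_def simp flip: ennreal_plus intro!: ennreal_leI)
     then show "ennreal (abs (f x - f z)) * indicator (P d z) x <= h q a R x * indicator (P d z) x + ennreal (2 * a) * indicator (P d z) x"
      by (auto simp: indicator_def)
    qed
    also have "... = emeasure (density lborel (h q a R)) (P d z) + ennreal (2 * a) * emeasure lborel (P d z)"
     by (subst nn_integral_add) (auto simp: emeasure_density nn_integral_cmult)
    also have "... <= ennreal (k/2) * emeasure lborel (P d z) + ennreal (k/2) * emeasure lborel (P d z)"
     using elim a by (intro add_mono mult_right_mono ennreal_leI) auto
    also have "... = ennreal k * emeasure lborel (P d z)"
     using k by (simp flip: distrib_right ennreal_plus)
    finally show ?case .
   qed
  qed
 qed
qed


text \<open>The closure of an arbitrary set \<open>G\<close> has density one at almost every point of \<open>G\<close>.\<close>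

lemma not_porous:
 assumes mono: "!!d d' z. 0 < d ==> d <= d' ==> P d z \<subseteq> P d' z"
  and sub: "!!d d' z z'. 0 < d ==> 0 < d' ==> d' <= d ==> z' \<in> P d z ==> P d' z' \<subseteq> P (3 * d) z"
  and vol: "!!u. 0 < u ==> \<exists>c>0. \<forall>d>0. \<forall>z z'. emeasure lborel (P (u * d) z') > ennreal c * emeasure lborel (P (3 * d) z)"
 shows "AE z in lborel. z \<in> G --> (\<forall>u>0. \<forall>\<^sub>F d in at_right 0. \<forall>z'\<in>P d z. P (u * d) z' \<inter> G \<noteq> {})"
proof -
 have "AE z in lborel. \<forall>n::nat. z \<in> (closure G \<union> - ball 0 n) -->
  (\<forall>k>0. sparse (density lborel (indicator (ball 0 n - closure G))) k z)"
 proof (intro AE_all_countable[THEN iffD2] allI singular_density_zero)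
  fix n :: nat
  have [measurable]: "ball (0::'b) n \<in> sets borel" "closure G \<in> sets borel" by auto
  show "sets (density lborel (indicator (ball 0 (real n) - closure G))) = sets borel" by simp
  have "emeasure lborel (ball 0 (real n) - closure G) <= emeasure lborel (ball (0::'b) n)"
   by (intro emeasure_mono) auto
  also have "... < \<infinity>" by (rule emeasure_lborel_ball_finite)
  finally show "emeasure (density lborel (indicator (ball 0 (real n) - closure G))) UNIV < \<infinity>"
   by (simp add: emeasure_density)
  show "closure G \<union> - ball 0 (real n) \<in> sets borel" by measurable
  show "emeasure (density lborel (indicator (ball 0 (real n) - closure G))) (closure G \<union> - ball 0 (real n)) = 0"
   by (subst emeasure_density) (auto simp: nn_integral_0_iff_AE indicator_def)
 qed
 then show ?thesis
 proof eventually_elim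
  case (elim z)
  show ?case
  proof (intro impI allI)
   fix u :: real assume zG: "z \<in> G" and u0: "0 < u"
   \<comment> \<open>Truncating at 1 makes \<open>sub\<close> applicable; monotonicity in the radius
     leads back to \<open>u\<close>.\<close>
   define u' where "u' = min u 1"
   have u: "0 < u'" "u' <= 1" "u' <= u" using u0 by (auto simp: u'_def)
   obtain c where c: "c > 0" "!!d z z'. d > 0 ==> emeasure lborel (P (u' * d) z') > ennreal c * emeasure lborel (P (3 * d) z)"
    using vol[OF u(1)] by blast
   obtain n :: nat where n: "norm z < real n" using reals_Archimedean2 by blast
   have "z \<in> closure G" using zG closure_subset by blast
   then have "sparse (density lborel (indicator (ball 0 n - closure G))) c z"
    using elim c by blast
   moreover have "\<forall>\<^sub>F d in at_right 0. P d z \<subseteq> ball 0 n" using n by (intro eventually_P_subset) auto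
   ultimately have "\<forall>\<^sub>F d in at_right 0. P d z \<subseteq> ball 0 n \<and> emeasure (density lborel (indicator (ball 0 n - closure G))) (P d z) <= ennreal c * emeasure lborel (P d z)"
    by eventually_elim auto
   then obtain b where b: "b > 0" "!!d. 0 < d ==> d < b ==> P d z \<subseteq> ball 0 n \<and> emeasure (density lborel (indicator (ball 0 n - closure G))) (P d z) <= ennreal c * emeasure lborel (P d z)"
    unfolding eventually_at_right_field by blast
   have "\<forall>d>0. d < b / 3 --> (\<forall>z'\<in>P d z. P (u * d) z' \<inter> G \<noteq> {})"
   proof (intro allI impI ballI notI)
    fix d z' assume d: "0 < d" "d < b / 3" and z': "z' \<in> P d z" and emp: "P (u * d) z' \<inter> G = {}"
    have ud: "0 < u * d" "0 < u' * d" "u' * d <= d" using u u0 d by (auto simp: mult_left_le_one_le)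
    have s1: "P (u' * d) z' \<subseteq> P (3 * d) z" using sub[OF d(1) ud(2,3) z'] .
    have "P (u' * d) z' \<inter> G = {}" using emp mono[OF ud(2), of "u * d" z'] u(3) d(1) by auto
    \<comment> \<open>An open box that misses \<open>G\<close> misses its closure; it would then
      fill a fixed proportion of \<open>P (3 * d) z\<close>, more than the density of the complement
      of the closure allows.\<close>
    then have "P (u' * d) z' \<inter> closure G = {}" using open_P[OF ud(2)] by (simp add: open_Int_closure_eq_empty)
    moreover have b3: "P (3 * d) z \<subseteq> ball 0 n" "emeasure (density lborel (indicator (ball 0 n - closure G))) (P (3 * d) z) <= ennreal c * emeasure lborel (P (3 * d) z)"
     using b(2)[of "3 * d"] d by auto
    ultimately have s2: "P (u' * d) z' \<subseteq> P (3 * d) z \<inter> (ball 0 n - closure G)" using s1 by auto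
    have [measurable]: "ball (0::'b) n \<in> sets borel" "closure G \<in> sets borel" "P (3 * d) z \<in> sets borel" using d by auto
    have "emeasure lborel (P (u' * d) z') <= emeasure lborel (P (3 * d) z \<inter> (ball 0 n - closure G))"
     using s2 by (rule emeasure_mono) measurable
    also have "... = emeasure (density lborel (indicator (ball 0 n - closure G))) (P (3 * d) z)"
     by (subst emeasure_density) (auto simp: indicator_inter_arith[symmetric] Int_commute)
    finally show False using b3(2) c(2)[OF d(1), of z z'] by (meson leD order_trans)
   qed
   then show "\<forall>\<^sub>F d in at_right 0. \<forall>z'\<in>P d z. P (u * d) z' \<inter> G \<noteq> {}"
    using b(1) unfolding eventually_at_right_field by (intro exI[of _ "b/3"]) auto
  qed
 qed
qed

end

interpretation balls: engulfing "\<lambda>\<delta> z::'b::euclidean_space. ball z \<delta>" "3 ^ DIM('b)"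
proof
 fix \<delta> \<delta>' :: real and z z' :: 'b and U :: "'b set"
 show "\<exists>\<delta>0>0. \<forall>\<delta>>0. \<delta> < \<delta>0 --> ball z \<delta> \<subseteq> U" if U: "open U" "z \<in> U"
 proof -
  obtain e where "e > 0" "ball z e \<subseteq> U" using U by (meson open_contains_ball)
  then show ?thesis by (intro exI[of _ e]) (auto simp: subset_iff)
 qed
 show "ball z \<delta> \<subseteq> ball z' (3 * \<delta>')" if "0 < \<delta>" "\<delta> <= \<delta>'" and ne: "ball z \<delta> \<inter> ball z' \<delta>' \<noteq> {}"
 proof
  fix x assume x: "x \<in> ball z \<delta>"
  obtain w where w: "dist z w < \<delta>" "dist z' w < \<delta>'" using ne by auto
  have "dist z' x <= dist z' w + dist z w + dist z x" by metric
  then show "x \<in> ball z' (3 * \<delta>')" using x w that by auto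
 qed
 show "emeasure lborel (ball z (3 * \<delta>)) <= ennreal (3 ^ DIM('b)) * emeasure lborel (ball z \<delta>)" if "0 < \<delta>"
  using that by (simp add: emeasure_ball power_mult_distrib mult_ac flip: ennreal_mult)
qed (auto simp: emeasure_lborel_ball_finite[unfolded infinity_ennreal_def])

section \<open>Parabolic boxes\<close>

definition pbox :: "real => real \<times> 'a::euclidean_space => (real \<times> 'a) set" where
 "pbox d z = {fst z - d\<^sup>2 <..< fst z + d\<^sup>2} \<times> ball (snd z) d"

lemma mem_pbox: "w \<in> pbox d z \<longleftrightarrow> abs (fst w - fst z) < d\<^sup>2 \<and> norm (snd w - snd z) < d"
 by (cases w; cases z) (auto simp: pbox_def dist_norm norm_minus_commute)

lemma emeasure_pbox:
 assumes "0 < d"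
 shows "emeasure lborel (pbox d (z :: real \<times> 'a::euclidean_space)) =
  ennreal (2 * unit_ball_vol (real DIM('a)) * d ^ (DIM('a) + 2))"
proof -
 have "emeasure lborel (pbox d z) = emeasure (lborel \<Otimes>\<^sub>M lborel) ({fst z - d\<^sup>2 <..< fst z + d\<^sup>2} \<times> ball (snd z) d)"
  by (simp add: lborel_prod pbox_def)
 also have "... = ennreal (2 * d\<^sup>2) * ennreal (unit_ball_vol (real DIM('a)) * d ^ DIM('a))"
  using assms by (subst lborel.emeasure_pair_measure_Times) (auto simp: emeasure_ball)
 also have "... = ennreal (2 * unit_ball_vol (real DIM('a)) * d ^ (DIM('a) + 2))"
  using assms by (subst ennreal_mult[symmetric]) (auto simp: power_add mult_ac power2_eq_square)
 finally show ?thesis .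
qed

interpretation parab: engulfing "pbox :: real => real \<times> 'a::euclidean_space => _" "3 ^ (DIM('a) + 2)"
proof
 fix \<delta> \<delta>' :: real and z z' :: "real \<times> 'a" and U :: "(real \<times> 'a) set"
 show "open (pbox \<delta> z)" unfolding pbox_def by (intro open_Times) auto
 show "z \<in> pbox \<delta> z" if "0 < \<delta>" using that by (simp add: mem_pbox)
 show "\<exists>\<delta>0>0. \<forall>\<delta>>0. \<delta> < \<delta>0 --> pbox \<delta> z \<subseteq> U" if U: "open U" "z \<in> U"
 proof -
  obtain A B where AB: "open A" "open B" "z \<in> A \<times> B" "A \<times> B \<subseteq> U" using open_prod_elim[OF U] by metis
  then obtain e1 e2 where e: "e1 > 0" "ball (fst z) e1 \<subseteq> A" "e2 > 0" "ball (snd z) e2 \<subseteq> B"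
   by (metis mem_Times_iff open_contains_ball)
  show ?thesis
  proof (intro exI[of _ "min 1 (min e1 e2)"] conjI allI impI subsetI)
   fix \<delta> w assume \<delta>: "0 < \<delta>" "\<delta> < min 1 (min e1 e2)" and w: "w \<in> pbox \<delta> z"
   have "\<delta>\<^sup>2 <= \<delta>" using \<delta> by (simp add: power2_eq_square mult_left_le)
   then have "fst w \<in> ball (fst z) e1" "snd w \<in> ball (snd z) e2"
    using w \<delta> by (auto simp: mem_pbox dist_norm norm_minus_commute)
   then show "w \<in> U" using e AB by (metis mem_Times_iff subset_iff)
  qed (use e in auto)
 qed
 show "pbox \<delta> z \<subseteq> pbox (3 * \<delta>') z'" if d: "0 < \<delta>" "\<delta> <= \<delta>'" and ne: "pbox \<delta> z \<inter> pbox \<delta>' z' \<noteq> {}"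
 proof
  fix x assume x: "x \<in> pbox \<delta> z"
  obtain w where w: "w \<in> pbox \<delta> z" "w \<in> pbox \<delta>' z'" using ne by auto
  have "\<delta>\<^sup>2 <= \<delta>'\<^sup>2" using d by (intro power_mono) auto
  then have "abs (fst x - fst z') < (3 * \<delta>')\<^sup>2" using x w by (auto simp: mem_pbox power_mult_distrib)
  moreover have "norm (snd x - snd z') <= norm (snd x - snd z) + norm (snd w - snd z) + norm (snd w - snd z')"
   by norm
  ultimately show "x \<in> pbox (3 * \<delta>') z'" using x w d by (auto simp: mem_pbox)
 qed
 show "emeasure lborel (pbox (3 * \<delta>) z) <= ennreal (3 ^ (DIM('a) + 2)) * emeasure lborel (pbox \<delta> z)" if "0 < \<delta>"
  using that by (simp add: emeasure_pbox power_mult_distrib mult_ac flip: ennreal_mult)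
 show "emeasure lborel (pbox \<delta> z) < \<infinity>" if "0 < \<delta>" using that by (simp add: emeasure_pbox)
qed auto

text \<open>Stands in for \<open>z\<close> being a density point of \<open>G\<close>. Unlike measure
  density it makes sense for arbitrary \<open>G\<close>, and it directly yields nets of points of
  \<open>G\<close> at any prescribed relative scale.\<close>

abbreviation filled :: "(real \<times> 'a::euclidean_space) set => real \<times> 'a => bool" where
 "filled G z \<equiv> \<forall>u>0. \<forall>\<^sub>F d in at_right 0. \<forall>z'\<in>pbox d z. pbox (u * d) z' \<inter> G \<noteq> {}"

lemma pbox_not_porous:
 fixes G :: "(real \<times> 'a::euclidean_space) set"
 shows "AE z in lborel. z \<in> G --> (filled G z)"
proof (rule parab.not_porous)
 fix h h' :: real and z z' :: "real \<times> 'a"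
 show "pbox h z \<subseteq> pbox h' z" if "0 < h" "h <= h'"
 proof -
  have "h\<^sup>2 <= h'\<^sup>2" using that by (intro power_mono) auto
  then show ?thesis using that unfolding subset_iff mem_pbox by (meson less_le_trans)
 qed
 show "pbox h' z' \<subseteq> pbox (3 * h) z" if d: "0 < h" "0 < h'" "h' <= h" and z': "z' \<in> pbox h z"
  using parab.engulf[OF d(2,3), of z' z] parab.center_in_P[OF d(2), of z'] z' by blast
next
 fix v :: real assume v: "0 < v"
 show "\<exists>c>0. \<forall>h>0. \<forall>z z'. emeasure lborel (pbox (v * h) (z' :: real \<times> 'a)) > ennreal c * emeasure lborel (pbox (3 * h) (z :: real \<times> 'a))"
 \<comment> \<open>Half of the exact volume ratio \<open>(v/3) ^ (DIM('a) + 2)\<close>, to make the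
   inequality strict.\<close>
 proof (intro exI[of _ "(v/3) ^ (DIM('a) + 2) / 2"] conjI allI impI)
  fix h :: real and z z' :: "real \<times> 'a" assume h: "0 < h"
  have u: "unit_ball_vol (real DIM('a)) > 0" by simp
  have "(v/3) ^ (DIM('a) + 2) / 2 * (2 * unit_ball_vol (real DIM('a)) * (3*h) ^ (DIM('a) + 2)) = unit_ball_vol (real DIM('a)) * (v * h) ^ (DIM('a) + 2)"
   by (simp add: power_mult_distrib power_divide field_simps del: power_Suc)
  also have "... < 2 * unit_ball_vol (real DIM('a)) * (v * h) ^ (DIM('a) + 2)" using u v h by simp
  finally show "ennreal ((v/3) ^ (DIM('a) + 2) / 2) * emeasure lborel (pbox (3 * h) z) < emeasure lborel (pbox (v * h) z')"
   using h v u by (simp only: emeasure_pbox mult_pos_pos zero_less_numeral)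
    (subst ennreal_mult[symmetric], auto intro!: ennreal_lessI mult_pos_pos)
 qed (use v in auto)
qed

section \<open>Lebesgue decomposition and derivatives of measures\<close>

lemma lebesgue_decomposition:
 fixes m :: "'b::euclidean_space measure"
 assumes m: "sets m = sets borel" "emeasure m UNIV < \<infinity>"
 obtains f :: "'b => real" and N where "integrable lborel f" "!!x. 0 <= f x" "N \<in> null_sets lborel"
  "density m (indicator (- N)) = density lborel (\<lambda>x. ennreal (f x))"
proof -
 have sm: "space m = UNIV" using sets_eq_imp_space_eq[OF m(1)] by simp
 interpret m: finite_measure m using m(2) by (intro finite_measureI) (simp add: sm)
 have [measurable_cong]: "sets m = sets borel" by fact
 \<comment> \<open>Exhaustion: a Lebesgue-null set \<open>M\<close> of largest \<open>m\<close>-mass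
   carries the singular part, since a null set with mass outside \<open>M\<close> could be added to
   it. What remains is absolutely continuous.\<close>
 define s where "s = (SUP N\<in>null_sets lborel. emeasure m N)"
 have ne: "null_sets (lborel::'b measure) \<noteq> {}" by blast
 obtain F where F: "range F \<subseteq> emeasure m ` null_sets lborel" "s = (SUP i::nat. F i)"
  using ennreal_SUP_countable_SUP[OF ne, of "emeasure m"] unfolding s_def by metis
 have "\<exists>N\<in>null_sets lborel. F i = emeasure m N" for i using F(1) by auto
 then obtain N where N': "!!i. N i \<in> null_sets lborel" "!!i. F i = emeasure m (N i)" by metis
 have N: "range N \<subseteq> null_sets lborel" "s = (SUP i::nat. emeasure m (N i))"
  using N'(1) unfolding F(2) N'(2) by auto
 define M where "M = (\<Union>i. N i)"
 have M: "M \<in> null_sets lborel" using N unfolding M_def by (intro null_sets_UN) auto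
 have Mb [measurable]: "M \<in> sets borel" using null_setsD2[OF M] by simp
 have Ms: "emeasure m M = s"
 proof (rule antisym)
  show "emeasure m M <= s" unfolding s_def using M by (intro SUP_upper)
  show "s <= emeasure m M" unfolding N(2) M_def using N(1) m(1)
   by (intro SUP_least emeasure_mono) (auto intro: Mb[unfolded M_def])
 qed
 have ac: "absolutely_continuous lborel (density m (indicator (- M)))"
  unfolding absolutely_continuous_def
 proof
  fix E assume E: "E \<in> null_sets (lborel::'b measure)"
  have Eb [measurable]: "E \<in> sets borel" using null_setsD2[OF E] by simp
  have "emeasure m (M \<union> E) <= s" unfolding s_def using M E by (intro SUP_upper) auto
  moreover have "emeasure m (M \<union> E) = emeasure m M + emeasure m (E - M)"
   by (subst plus_emeasure) (auto intro!: arg_cong[of _ _ "emeasure m"])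
  ultimately have "emeasure m M + emeasure m (E - M) <= emeasure m M" using Ms by simp
  then have "emeasure m (E - M) = 0" using m.emeasure_finite[of M]
   by (metis add.right_neutral ennreal_add_left_cancel_le le_zero_eq top.not_eq_extremum infinity_ennreal_def)
  then have "emeasure (density m (indicator (- M))) E = 0"
   by (subst emeasure_density) (auto simp: indicator_inter_arith[symmetric] Diff_eq Int_commute)
  then show "E \<in> null_sets (density m (indicator (- M)))" by (auto simp: null_sets_def)
 qed
 obtain F where F: "F \<in> borel_measurable lborel" "density lborel F = density m (indicator (- M))"
  using sigma_finite_measure.Radon_Nikodym[OF sigma_finite_lborel ac] by (auto simp: m(1))
 have [measurable]: "F \<in> borel_measurable borel" using F(1) by simp
 have "(\<integral>\<^sup>+x. F x \<partial>lborel) = emeasure (density m (indicator (- M))) UNIV"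
  unfolding F(2)[symmetric] by (simp add: emeasure_density)
 also have "... = emeasure m (- M)" by (simp add: emeasure_density m)
 also have "... < \<infinity>" using m.emeasure_finite[of "- M"] by (simp add: less_top[symmetric])
 finally have fin: "(\<integral>\<^sup>+x. F x \<partial>lborel) < \<infinity>" .
 then have AEfin: "AE x in lborel. F x \<noteq> \<infinity>" by (intro nn_integral_PInf_AE) auto
 define f where "f x = enn2real (F x)" for x
 have [measurable]: "f \<in> borel_measurable borel" unfolding f_def by simp
 have Ff: "AE x in lborel. F x = ennreal (f x)" using AEfin by eventually_elim (simp add: f_def less_top)
 have "integrable lborel f"
 proof (rule integrableI_nonneg)
  have "(\<integral>\<^sup>+x. ennreal (f x) \<partial>lborel) = (\<integral>\<^sup>+x. F x \<partial>lborel)" using Ff by (intro nn_integral_cong_AE) auto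
  then show "(\<integral>\<^sup>+x. ennreal (f x) \<partial>lborel) < \<infinity>" using fin by simp
 qed (auto simp: f_def)
 moreover have "density lborel F = density lborel (\<lambda>x. ennreal (f x))"
  by (rule density_cong) (use Ff in auto)
 ultimately show ?thesis using that[of f M] M F(2) by (auto simp: f_def)
qed

text \<open>Weights supported in \<open>P d z\<close> are allowed instead of its indicator alone,
  because the derivative is later tested on one-sided intervals and on smooth bumps.\<close>

abbreviation tests :: "(real => 'b::euclidean_space => 'b set) => 'b measure => real => real => 'b => bool" where
 "tests P m c k z \<equiv> \<forall>\<^sub>F d in at_right 0. \<forall>w\<in>borel_measurable borel.
   (\<forall>x. 0 <= w x \<and> w x <= indicat_real (P d z) x) --> abs ((LINT x|m. w x) - c * (LINT x|lborel. w x)) <= k * measure lborel (P d z)"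

context engulfing begin

text \<open>The singular part has zero density almost everywhere, and the absolutely continuous part
  is handled at Lebesgue points of \<open>f\<close>. Both estimates hold for the full indicator in
  absolute value, so weights below it satisfy them too.\<close>

lemma measure_derivative:
 fixes m :: "'b measure"
 assumes m: "sets m = sets borel" "emeasure m UNIV < \<infinity>"
  and f: "integrable lborel f" "!!x. 0 <= f x" and N: "N \<in> null_sets lborel"
  and dec: "density m (indicator (- N)) = density lborel (\<lambda>x. ennreal (f x))"
 shows "AE z in lborel. \<forall>k>0. tests P m (f z) k z"
proof -
 have sm: "space m = UNIV" using sets_eq_imp_space_eq[OF m(1)] by simp
 interpret m: finite_measure m using m(2) by (intro finite_measureI) (simp add: sm)
 have [measurable_cong]: "sets m = sets borel" by fact
 have [measurable]: "N \<in> sets borel" "f \<in> borel_measurable borel" using null_setsD2[OF N] f by auto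
 define ms where "ms = density m (indicator N)"
 have ms: "sets ms = sets borel" by (simp add: ms_def m)
 then have [measurable_cong]: "sets ms = sets borel" .
 have ems: "emeasure ms E = emeasure m (N \<inter> E)" if [measurable]: "E \<in> sets borel" for E
  unfolding ms_def by (subst emeasure_density) (simp_all add: indicator_inter_arith[symmetric] m)
 have "AE z in lborel. z \<in> - N --> (\<forall>k>0. \<forall>\<^sub>F d in at_right 0. emeasure ms (P d z) <= ennreal k * emeasure lborel (P d z))"
  by (rule singular_density_zero) (use m.emeasure_finite[of N] in \<open>auto simp: ms ems less_top[symmetric]\<close>)
 then show ?thesis using AE_not_in[OF N] lebesgue_points[OF f(1)]
 proof eventually_elim
  case (elim z)
  show ?case
  proof (intro allI impI)
   fix k :: real assume "k > 0"
   then have e: "k/2 > 0" by simp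
   have "\<forall>\<^sub>F d in at_right 0. emeasure ms (P d z) <= ennreal (k/2) * emeasure lborel (P d z)"
    "\<forall>\<^sub>F d in at_right 0. (\<integral>\<^sup>+x\<in>P d z. ennreal (abs (f x - f z)) \<partial>lborel) <= ennreal (k/2) * emeasure lborel (P d z)"
    using elim e by blast+
   then show "tests P m (f z) k z"
    using eventually_at_right_less[of "0::real"]
   proof eventually_elim
    case (elim d)
    show ?case
    proof (intro ballI impI)
     fix w :: "'b => real" assume [measurable]: "w \<in> borel_measurable borel" and w: "\<forall>x. 0 <= w x \<and> w x <= indicat_real (P d z) x"
     have [measurable]: "P d z \<in> sets borel" using elim by simp
     have b: "0 <= w x" "w x <= 1" "x \<notin> P d z ==> w x = 0" for x using w[rule_format, of x] by (cases "x \<in> P d z"; simp)+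
     have fin: "emeasure lborel (P d z) = ennreal (measure lborel (P d z))" using finite_P[of d z] elim by (simp add: emeasure_eq_ennreal_measure)
     have i: "integrable m w" by (rule m.integrable_const_bound[of _ 1]) (use b in auto)
     have i1: "integrable lborel (\<lambda>x. f x * w x)"
      by (rule Bochner_Integration.integrable_bound[OF f(1)]) (auto simp: abs_mult b intro!: mult_left_le)
     have "integrable lborel (indicat_real (P d z))" using finite_P[of d z] elim by (simp add: integrable_indicator_iff)
     then have i2: "integrable lborel w" by (rule Bochner_Integration.integrable_bound) (use w in auto)
     have "(LINT x|m. w x) = (LINT x|m. indicat_real (- N) x * w x + indicat_real N x * w x)"
      by (intro Bochner_Integration.integral_cong) (auto simp: indicator_def)
     also have "... = (LINT x|m. indicat_real (- N) x * w x) + (LINT x|m. indicat_real N x * w x)"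
      using integrable_mult_indicator[OF _ i, of "- N"] integrable_mult_indicator[OF _ i, of N]
      by (intro Bochner_Integration.integral_add) auto
     also have "(LINT x|m. indicat_real N x * w x) = (LINT x|ms. w x)"
      using integral_density[of w m "indicat_real N"] by (simp add: ms_def ennreal_indicator)
     also have "(LINT x|m. indicat_real (- N) x * w x) = (LINT x|density m (indicator (- N)). w x)"
      using integral_density[of w m "indicat_real (- N)"] by (simp add: ennreal_indicator)
     also have "... = (LINT x|lborel. f x * w x)" unfolding dec using f by (subst integral_density) auto
     finally have eq: "(LINT x|m. w x) - f z * (LINT x|lborel. w x) = (LINT x|lborel. (f x - f z) * w x) + (LINT x|ms. w x)"
      using i1 i2 by (simp add: left_diff_distrib)
     have le: "abs a <= k/2 * measure lborel (P d z)" if "ennreal (abs a) <= X" "X <= ennreal (k/2) * emeasure lborel (P d z)" for a X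
      using order_trans[OF that] e unfolding fin by (simp add: ennreal_mult[symmetric] ennreal_le_iff)
     have "integrable lborel (\<lambda>x. (f x - f z) * w x)" using i1 i2 by (simp add: left_diff_distrib)
     then have "ennreal (abs (LINT x|lborel. (f x - f z) * w x)) <= (\<integral>\<^sup>+x. ennreal (abs ((f x - f z) * w x)) \<partial>lborel)"
      using integral_norm_bound_ennreal[of lborel "\<lambda>x. (f x - f z) * w x"] by simp
     also have "... <= (\<integral>\<^sup>+x\<in>P d z. ennreal (abs (f x - f z)) \<partial>lborel)"
     proof (intro nn_integral_mono)
      fix x show "ennreal (abs ((f x - f z) * w x)) <= ennreal (abs (f x - f z)) * indicator (P d z) x"
       using b[of x] by (cases "x \<in> P d z") (auto simp: abs_mult intro!: ennreal_leI mult_left_le)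
     qed
     finally have 1: "abs (LINT x|lborel. (f x - f z) * w x) <= k/2 * measure lborel (P d z)" using elim(2) by (rule le)
     have "emeasure ms (P d z) \<noteq> \<infinity>" unfolding ems[OF \<open>P d z \<in> sets borel\<close>] by simp
     then have "integrable ms (indicat_real (P d z))" by (simp add: integrable_indicator_iff ms less_top[symmetric] sets.Int_space_eq2)
     then have "integrable ms w" by (rule Bochner_Integration.integrable_bound) (use w in auto)
     then have "ennreal (abs (LINT x|ms. w x)) <= (\<integral>\<^sup>+x. ennreal (abs (w x)) \<partial>ms)" using integral_norm_bound_ennreal[of ms w] by simp
     also have "... <= (\<integral>\<^sup>+x. indicator (P d z) x \<partial>ms)"
     proof (intro nn_integral_mono)
      fix x show "ennreal (abs (w x)) <= indicator (P d z) x" using b[of x] by (cases "x \<in> P d z") auto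
     qed
     also have "... = emeasure ms (P d z)" by (simp add: ms)
     finally have "abs (LINT x|ms. w x) <= k/2 * measure lborel (P d z)" using elim(1) by (rule le)
     with 1 show "abs ((LINT x|m. w x) - f z * (LINT x|lborel. w x)) <= k * measure lborel (P d z)" unfolding eq by linarith
    qed
   qed
  qed
 qed
qed

end

section \<open>Differentiability of monotone functions of one variable\<close>

lemma right_regularization:
 fixes g :: "real => real"
 assumes g: "mono g"
 defines "G \<equiv> \<lambda>x. Inf (g ` {x<..})"
 shows "mono G" "!!a. continuous (at_right a) G" "!!x. g x <= G x" "!!x y. x < y ==> G x <= g y"
proof -
 have bdd: "bdd_below (g ` {x<..})" for x using g by (intro bdd_belowI2[of _ "g x"]) (auto simp: mono_def)
 show up: "!!x y. x < y ==> G x <= g y" unfolding G_def using bdd by (auto intro: cInf_lower)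
 show low: "!!x. g x <= G x" unfolding G_def using g by (intro cInf_greatest) (auto simp: mono_def)
 show mono: "mono G"
 proof
  fix x y :: real assume "x <= y"
  then show "G x <= G y" unfolding G_def using bdd by (intro cInf_superset_mono) auto
 qed
 show "continuous (at_right a) G" for a
  unfolding continuous_within tendsto_iff
 proof (intro allI impI)
  fix e :: real assume e: "e > 0"
  have "Inf (g ` {a<..}) < G a + e" using e by (simp add: G_def)
  then obtain y where y: "a < y" "g y < G a + e" using cInf_lessD[of "g ` {a<..}"] by force
  have "dist (G x) (G a) < e" if "a < x" "x < y" for x
   using up[OF that(2)] y monoD[OF mono, of a x] that by (auto simp: dist_real_def)
  then show "\<forall>\<^sub>F x in at_right a. dist (G x) (G a) < e" using y(1) unfolding eventually_at_right_field by blast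
 qed
qed

text \<open>Differentiation of the Stieltjes measure of \<open>G\<close>: a difference quotient is
  an average over a half-open interval at \<open>x\<close> of length \<open>|h|\<close>. Radius
  \<open>2 * abs h\<close> makes the open ball contain its far endpoint; the ball has length
  \<open>4 * abs h\<close>, whence the tolerance \<open>e/8\<close>.\<close>

lemma right_continuous_mono_AE_differentiable:
 fixes G :: "real => real"
 assumes G: "mono G" "!!a. continuous (at_right a) G" and bd: "!!x. abs (G x) <= C"
 shows "AE x in lborel. \<exists>c. ((\<lambda>h. (G (x + h) - G x) / h) \<longlongrightarrow> c) (at 0)"
proof -
 define m where "m = interval_measure G"
 have Ioc: "emeasure m {a<..b} = ennreal (G b - G a)" if "a <= b" for a b
  unfolding m_def using that G by (intro emeasure_interval_measure_Ioc) (auto simp: mono_def)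
 have m: "sets m = sets borel" by (simp add: m_def)
 have U: "(\<Union>n::nat. {- real n<..real n}) = UNIV"
 proof -
  have "x \<in> (\<Union>n::nat. {- real n<..real n})" for x :: real
  proof -
   obtain n :: nat where "abs x < real n" using reals_Archimedean2 by blast
   then show ?thesis by (auto intro!: exI[of _ n])
  qed
  then show ?thesis by blast
 qed
 have "emeasure m UNIV = (SUP n::nat. emeasure m {- real n<..real n})"
  unfolding U[symmetric] by (intro SUP_emeasure_incseq[symmetric]) (auto simp: m incseq_def)
 also have "... <= ennreal (2 * C)"
 proof (rule SUP_least)
  fix n :: nat
  have "G (real n) - G (- real n) <= 2 * C" using bd[of "real n"] bd[of "- real n"] by auto
  then show "emeasure m {- real n<..real n} <= ennreal (2 * C)" by (subst Ioc) (auto intro: ennreal_leI)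
 qed
 finally have fin: "emeasure m UNIV < \<infinity>" using order_le_less_trans by fastforce
 have sm: "space m = UNIV" using sets_eq_imp_space_eq[OF m] by simp
 interpret m: finite_measure m using fin by (intro finite_measureI) (simp add: sm)
 obtain f N where f: "integrable lborel f" "!!x. 0 <= f x" "N \<in> null_sets lborel"
  "density m (indicator (- N)) = density lborel (\<lambda>x. ennreal (f x))" using lebesgue_decomposition[OF m fin] by metis
 have inc: "(LINT x|m. indicat_real {a<..b} x) = G b - G a" if "a <= b" for a b
  using Ioc[OF that] that G(1) by (simp add: m sm measure_def mono_def)
 from balls.measure_derivative[OF m fin f] show ?thesis
 proof eventually_elim
  case (elim x)
  have "((\<lambda>h. (G (x + h) - G x) / h) \<longlongrightarrow> f x) (at 0)"
   unfolding tendsto_iff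
  proof (intro allI impI)
   fix e :: real assume e: "e > 0"
   obtain d where d: "d > 0" "!!r w. 0 < r ==> r < d ==> w \<in> borel_measurable borel ==>
     (\<forall>y. 0 <= w y \<and> w y <= indicat_real (ball x r) y) ==>
     abs ((LINT x|m. w x) - f x * (LINT x|lborel. w x)) <= e/8 * measure lborel (ball x r)"
    using elim[rule_format, of "e/8"] e unfolding eventually_at_right_field by auto
   have meas: "measure lborel (ball x r) = 2 * r" if "0 < r" for r using that by (simp add: ball_eq_greaterThanLessThan)
   have "dist ((G (x + h) - G x) / h) (f x) < e" if h: "h \<noteq> 0" "abs h < d / 2" for h
   proof -
    define I where "I = (if h > 0 then {x<..x+h} else {x+h<..x})"
    have "I \<subseteq> ball x (2 * abs h)" using h by (auto simp: I_def dist_real_def)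
    then have "abs ((LINT x|m. indicat_real I x) - f x * (LINT x|lborel. indicat_real I x)) <= e/8 * measure lborel (ball x (2 * abs h))"
     using h by (intro d(2)) (auto simp: I_def indicator_def)
    also have "... = e / 2 * abs h" using h by (subst meas) auto
    also have "(LINT x|lborel. indicat_real I x) = abs h" by (auto simp: I_def)
    also have "(LINT x|m. indicat_real I x) = (G (x + h) - G x) / h * abs h"
     using h inc[of x "x+h"] inc[of "x+h" x] by (auto simp: I_def)
    finally have "abs ((G (x + h) - G x) / h - f x) * abs h <= e / 2 * abs h"
     by (simp only: left_diff_distrib[symmetric] abs_mult abs_abs)
    then show ?thesis using h e by (simp add: dist_real_def)
   qed
   then show "\<forall>\<^sub>F h in at 0. dist ((G (x + h) - G x) / h) (f x) < e"
    using d(1) unfolding eventually_at by (intro exI[of _ "d/2"]) (auto simp: dist_real_def)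
  qed
  then show ?case by blast
 qed
qed

text \<open>Truncation makes \<open>g\<close> bounded and right regularization makes it a
  distribution function \<open>G\<close>. Where \<open>G\<close> is differentiable, the original is
  trapped between \<open>G\<close> at \<open>x + h - h^2\<close> and at \<open>x + h\<close>, and
  \<open>h - h^2\<close> is asymptotic to \<open>h\<close>.\<close>

lemma mono_AE_differentiable:
 fixes g :: "real => real"
 assumes g: "mono g"
 shows "AE x in lborel. \<exists>c. ((\<lambda>h. (g (x + h) - g x) / h) \<longlongrightarrow> c) (at 0)"
proof -
 define gn where "gn n x = g (max (- real n) (min (real n) x))" for n :: nat and x
 have gn: "mono (gn n)" for n using g unfolding gn_def mono_def by (auto simp: max_def min_def)
 have bd: "abs (gn n x) <= abs (g (- real n)) + abs (g (real n))" for n x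
 proof -
  have "g (- real n) <= gn n x" "gn n x <= g (real n)" unfolding gn_def by (auto intro!: monoD[OF g])
  then show ?thesis by auto
 qed
 define G where "G n x = Inf (gn n ` {x<..})" for n x
 note G = right_regularization[OF gn, folded G_def]
 have "AE x in lborel. \<forall>n. \<exists>c. ((\<lambda>h. (G n (x + h) - G n x) / h) \<longlongrightarrow> c) (at 0)"
 proof (intro AE_all_countable[THEN iffD2] allI right_continuous_mono_AE_differentiable G)
  fix n x
  show "abs (G n x) <= abs (g (- real n)) + abs (g (real n))" using bd[of n x] bd[of n "x+1"] G(3)[of n x] G(4)[of x "x+1" n] by auto
 qed
 then show ?thesis
 proof eventually_elim
  case (elim x)
  obtain n :: nat where n: "abs x < real n" using reals_Archimedean2 by blast
  obtain c where c: "((\<lambda>h. (G n (x + h) - G n x) / h) \<longlongrightarrow> c) (at 0)" using elim by blast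
  have "isCont (G n) x"
   using c by (intro DERIV_isCont[of _ c]) (simp add: DERIV_def)
  \<comment> \<open>Continuity of \<open>G\<close> from the left excludes a jump of
    \<open>gn\<close> at \<open>x\<close>.\<close>
  have gx: "gn n x = G n x"
  proof (rule antisym[OF G(3)])
   have "((\<lambda>y. G n y) \<longlongrightarrow> G n x) (at_left x)"
    using \<open>isCont (G n) x\<close> by (simp add: isCont_def filterlim_at_split)
   moreover have "\<forall>\<^sub>F y in at_left x. G n y <= gn n x"
    using G(4)[of _ x n] by (auto simp: eventually_at_left_field intro!: exI[of _ "x - 1"])
   ultimately show "G n x <= gn n x" by (rule tendsto_upperbound) simp
  qed
  have lim1: "((\<lambda>h. (G n (x + (h - h\<^sup>2)) - G n x) / (h - h\<^sup>2) * ((h - h\<^sup>2) / h)) \<longlongrightarrow> c * 1) (at 0)"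
  proof (rule tendsto_mult)
   have f: "filterlim (\<lambda>h::real. h - h\<^sup>2) (at 0) (at 0)"
   proof (rule filterlim_atI)
    show "((\<lambda>h::real. h - h\<^sup>2) \<longlongrightarrow> 0) (at 0)" by (auto intro!: tendsto_eq_intros)
    show "\<forall>\<^sub>F h::real in at 0. h - h\<^sup>2 \<noteq> 0"
     unfolding eventually_at by (intro exI[of _ 1]) (auto simp: power2_eq_square)
   qed
   show "((\<lambda>h. (G n (x + (h - h\<^sup>2)) - G n x) / (h - h\<^sup>2)) \<longlongrightarrow> c) (at 0)"
    by (rule filterlim_compose[OF c f])
   have "((\<lambda>h::real. 1 - h) \<longlongrightarrow> 1) (at 0)" by (auto intro!: tendsto_eq_intros)
   then show "((\<lambda>h::real. (h - h\<^sup>2) / h) \<longlongrightarrow> 1) (at 0)"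
    by (rule Lim_transform_eventually)
     (auto simp: eventually_at power2_eq_square field_simps intro!: exI[of _ 1])
  qed
  have sq: "min a b <= q \<and> q <= max a b" if "(a::real) <= q \<and> q <= b \<or> b <= q \<and> q <= a" for a b q using that by auto
  have key: "(G n (x + (h - h\<^sup>2)) - G n x) / (h - h\<^sup>2) * ((h - h\<^sup>2) / h) <= (gn n (x + h) - gn n x) / h \<and> (gn n (x + h) - gn n x) / h <= (G n (x + h) - G n x) / h \<or>
     (G n (x + h) - G n x) / h <= (gn n (x + h) - gn n x) / h \<and> (gn n (x + h) - gn n x) / h <= (G n (x + (h - h\<^sup>2)) - G n x) / (h - h\<^sup>2) * ((h - h\<^sup>2) / h)" if h: "h \<noteq> 0" "abs h < 1" for h :: real
  proof -
   have h1: "0 < h\<^sup>2" using h by simp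
   have hh: "h - h\<^sup>2 \<noteq> 0" using h by (auto simp: power2_eq_square)
   have "G n (x + (h - h\<^sup>2)) <= gn n (x + h)" using h1 by (intro G(4)) auto
   moreover have "gn n (x + h) <= G n (x + h)" by (rule G(3))
   moreover have "(G n (x + (h - h\<^sup>2)) - G n x) / (h - h\<^sup>2) * ((h - h\<^sup>2) / h) = (G n (x + (h - h\<^sup>2)) - G n x) / h" using hh by simp
   ultimately show ?thesis
    using h unfolding gx by (cases "h > 0") (simp_all only: divide_right_mono divide_right_mono_neg diff_right_mono less_imp_le not_less simp_thms)
  qed
  have lim: "((\<lambda>h. (gn n (x + h) - gn n x) / h) \<longlongrightarrow> c) (at 0)"
  proof (rule tendsto_sandwich)
   have *: "\<forall>\<^sub>F h in at 0. min ((G n (x + (h - h\<^sup>2)) - G n x) / (h - h\<^sup>2) * ((h - h\<^sup>2) / h)) ((G n (x + h) - G n x) / h) <= (gn n (x + h) - gn n x) / h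
     \<and> (gn n (x + h) - gn n x) / h <= max ((G n (x + (h - h\<^sup>2)) - G n x) / (h - h\<^sup>2) * ((h - h\<^sup>2) / h)) ((G n (x + h) - G n x) / h)"
    using sq[OF key] unfolding eventually_at by (intro exI[of _ 1]) (simp add: dist_real_def)
   show "\<forall>\<^sub>F h in at 0. min ((G n (x + (h - h\<^sup>2)) - G n x) / (h - h\<^sup>2) * ((h - h\<^sup>2) / h)) ((G n (x + h) - G n x) / h) <= (gn n (x + h) - gn n x) / h"
    using * by eventually_elim auto
   show "\<forall>\<^sub>F h in at 0. (gn n (x + h) - gn n x) / h <= max ((G n (x + (h - h\<^sup>2)) - G n x) / (h - h\<^sup>2) * ((h - h\<^sup>2) / h)) ((G n (x + h) - G n x) / h)"
    using * by eventually_elim auto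
   show "((\<lambda>h. min ((G n (x + (h - h\<^sup>2)) - G n x) / (h - h\<^sup>2) * ((h - h\<^sup>2) / h)) ((G n (x + h) - G n x) / h)) \<longlongrightarrow> c) (at 0)"
    using tendsto_min[OF lim1 c] by simp
   show "((\<lambda>h. max ((G n (x + (h - h\<^sup>2)) - G n x) / (h - h\<^sup>2) * ((h - h\<^sup>2) / h)) ((G n (x + h) - G n x) / h)) \<longlongrightarrow> c) (at 0)"
    using tendsto_max[OF lim1 c] by simp
  qed
  have "\<forall>\<^sub>F h in at 0. (gn n (x + h) - gn n x) / h = (g (x + h) - g x) / h"
   unfolding eventually_at
  proof (intro exI[of _ "real n - abs x"] conjI ballI impI)
   fix h :: real assume "h \<noteq> 0 \<and> dist h 0 < real n - abs x"
   then have "abs h < real n - abs x" by (simp add: dist_real_def)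
   then have "- real n <= x + h" "x + h <= real n" "- real n <= x" "x <= real n" using n by linarith+
   then show "(gn n (x + h) - gn n x) / h = (g (x + h) - g x) / h" by (simp add: gn_def)
  qed (use n in auto)
  then have "((\<lambda>h. (g (x + h) - g x) / h) \<longlongrightarrow> c) (at 0)" by (rule Lim_transform_eventually[OF lim])
  then show ?case by blast
 qed
qed


text \<open>Convexity of \<open>f\<close> on the whole space is used only through the existence of subgradients.\<close>

definition subgradient :: "('a::real_inner => real) => 'a => 'a => bool" where
 "subgradient f y p \<longleftrightarrow> (\<forall>u. f u \<ge> f y + p \<bullet> (u - y))"

definition subdifferentiable :: "('a::real_inner => real) => bool" where
 "subdifferentiable f \<longleftrightarrow> (\<forall>y. \<exists>p. subgradient f y p)"

section \<open>Second-order expansions of convex functions on the line\<close>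

lemma subdifferentiable_expansion:
 fixes g k :: "real => real"
 assumes k: "!!x u. g u \<ge> g x + k x * (u - x)"
  and lim: "((\<lambda>h. (k (x + h) - k x) / h) \<longlongrightarrow> b) (at 0)"
 shows "((\<lambda>h. (g (x + h) - g x - h * k x) / h\<^sup>2) \<longlongrightarrow> b / 2) (at 0)"
 unfolding tendsto_iff
proof (intro allI impI)
 fix e :: real assume e: "e > 0"
 have "\<forall>\<^sub>F h in at 0. dist ((k (x + h) - k x) / h) b < e/2" using tendstoD[OF lim, of "e/2"] e by simp
 then obtain d where d: "d > 0" "!!h. h \<noteq> 0 ==> abs h < d ==> abs ((k (x + h) - k x) / h - b) < e/2"
  unfolding eventually_at by (auto simp: dist_real_def)
 have kh: "abs (k (x + h) - k x - b * h) <= e/2 * abs h" if "abs h < d" for h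
 proof (cases "h = 0")
  case False
  have "k (x + h) - k x - b * h = ((k (x + h) - k x) / h - b) * h" using False by (simp add: field_simps)
  then have "abs (k (x + h) - k x - b * h) = abs ((k (x + h) - k x) / h - b) * abs h" by (simp only: abs_mult)
  also have "... <= e/2 * abs h" using d(2)[OF False that] by (intro mult_right_mono) auto
  finally show ?thesis .
 qed auto
 have main: "abs (g (x + h) - g x - h * k x - b / 2 * h\<^sup>2) <= e/2 * h\<^sup>2" if h: "abs h < d" for h
 proof -
  \<comment> \<open>The increment of \<open>g\<close> is telescoped over \<open>N\<close> equal
    steps. Each step lies between the values of \<open>k\<close> at its two endpoints times its
    length, so \<open>S N\<close> is squeezed between Riemann sums of the linear approximation of
    \<open>k\<close>; this replaces integrating the subgradient.\<close>
  define S where "S N = (\<Sum>i<N. g (x + real (Suc i) * (h / real N)) - g (x + real i * (h / real N)))" for N :: nat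
  have S: "S N = g (x + h) - g x" if "N > 0" for N
   unfolding S_def using that by (subst sum_lessThan_telescope) auto
  have bound: "abs (g (x + h) - g x - h * k x - b / 2 * h\<^sup>2) <= e/2 * h\<^sup>2 + (abs b / 2 * h\<^sup>2) / real N" if N: "N > 0" for N :: nat
  proof -
   define q where "q = h / real N"
   have qN: "real N * q = h" using N by (simp add: q_def)
   have q2: "q * q * real N * real N = h\<^sup>2" using qN by (metis mult.assoc mult.commute power2_eq_square)
   have qd: "abs (real i * q) < d" if "i <= N" for i
   proof -
    have "abs (real i * q) = real i * abs h / real N" by (simp add: q_def abs_mult)
    also have "... <= real N * abs h / real N" using that by (intro divide_right_mono mult_right_mono) auto
    finally show ?thesis using h N by simp
   qed
   have K: "abs (k (x + real i * q) * q - k x * q - b * real i * (q * q)) <= e/2 * real N * (q * q)" if "i <= N" for i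
   proof -
    have "abs (k (x + real i * q) * q - k x * q - b * real i * (q * q)) = abs (k (x + real i * q) - k x - b * (real i * q)) * abs q"
     by (simp flip: abs_mult add: algebra_simps)
    also have "... <= (e/2 * abs (real i * q)) * abs q" using kh[OF qd[OF that]] by (intro mult_right_mono) auto
    also have "... = e/2 * real i * (q * q)" by (simp add: abs_mult)
    also have "... <= e/2 * real N * (q * q)" using that e by (intro mult_right_mono mult_left_mono) auto
    finally show ?thesis .
   qed
   have up: "g (x + real (Suc i) * q) - g (x + real i * q) <= k (x + real (Suc i) * q) * q" for i
    using k[of "x + real (Suc i) * q" "x + real i * q"] by (simp add: algebra_simps)
   have lo: "g (x + real (Suc i) * q) - g (x + real i * q) \<ge> k (x + real i * q) * q" for i
    using k[of "x + real i * q" "x + real (Suc i) * q"] by (simp add: algebra_simps)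
   have gauss: "(\<Sum>i<N. real i) = real N * (real N - 1) / 2" by (induction N) (auto simp: field_simps)
   have U: "S N <= (\<Sum>i<N. k x * q + b * real (Suc i) * (q * q) + e/2 * real N * (q * q))"
    unfolding S_def q_def[symmetric]
   proof (intro sum_mono)
    fix i assume "i \<in> {..<N}"
    then have "Suc i <= N" by simp
    from K[OF this] up[of i] show "g (x + real (Suc i) * q) - g (x + real i * q) <= k x * q + b * real (Suc i) * (q * q) + e/2 * real N * (q * q)"
     unfolding abs_le_iff by linarith
   qed
   have "(\<Sum>i<N. k x * q + b * real (Suc i) * (q * q) + e/2 * real N * (q * q)) = real N * q * k x + b * (q * q) * ((\<Sum>i<N. real i) + real N) + e/2 * (q * q * real N * real N)"
    by (simp add: sum.distrib sum_distrib_left sum_distrib_right algebra_simps)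
   also have "... = h * k x + b / 2 * h\<^sup>2 + b / 2 * h\<^sup>2 / real N + e/2 * h\<^sup>2"
    unfolding gauss qN using N by (simp add: q2[symmetric] field_simps)
   finally have U': "S N <= h * k x + b / 2 * h\<^sup>2 + b / 2 * h\<^sup>2 / real N + e/2 * h\<^sup>2" using U by simp
   have L: "S N \<ge> (\<Sum>i<N. k x * q + b * real i * (q * q) - e/2 * real N * (q * q))"
    unfolding S_def q_def[symmetric]
   proof (intro sum_mono)
    fix i assume "i \<in> {..<N}"
    then have "i <= N" by simp
    from K[OF this] lo[of i] show "k x * q + b * real i * (q * q) - e/2 * real N * (q * q) <= g (x + real (Suc i) * q) - g (x + real i * q)"
     unfolding abs_le_iff by linarith
   qed
   have "(\<Sum>i<N. k x * q + b * real i * (q * q) - e/2 * real N * (q * q)) = real N * q * k x + b * (q * q) * (\<Sum>i<N. real i) - e/2 * (q * q * real N * real N)"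
    by (simp add: sum.distrib sum_subtractf sum_distrib_left sum_distrib_right algebra_simps)
   also have "... = h * k x + b / 2 * h\<^sup>2 - b / 2 * h\<^sup>2 / real N - e/2 * h\<^sup>2"
    unfolding gauss qN using N by (simp add: q2[symmetric] field_simps)
   finally have L': "S N \<ge> h * k x + b / 2 * h\<^sup>2 - b / 2 * h\<^sup>2 / real N - e/2 * h\<^sup>2" using L by simp
   have "abs (b / 2 * h\<^sup>2 / real N) = (abs b / 2 * h\<^sup>2) / real N" by (simp add: abs_mult)
   then show ?thesis using U' L' S[OF N] by linarith
  qed
  have "(\<lambda>N. e/2 * h\<^sup>2 + (abs b / 2 * h\<^sup>2) / real N) \<longlonglongrightarrow> e/2 * h\<^sup>2 + 0"
   by (intro tendsto_add tendsto_const lim_const_over_n)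
  then show ?thesis using bound by (intro LIMSEQ_le_const[where x="e/2 * h\<^sup>2"]) (auto intro!: exI[of _ 1])
 qed
 have "dist ((g (x + h) - g x - h * k x) / h\<^sup>2) (b / 2) < e" if "h \<noteq> 0" "abs h < d" for h
 proof -
  have "((g (x + h) - g x - h * k x) / h\<^sup>2 - b / 2) * h\<^sup>2 = g (x + h) - g x - h * k x - b / 2 * h\<^sup>2"
   using that by (simp add: field_simps)
  then have "abs ((g (x + h) - g x - h * k x) / h\<^sup>2 - b / 2) * h\<^sup>2 = abs (g (x + h) - g x - h * k x - b / 2 * h\<^sup>2)"
   by (metis abs_mult abs_power2)
  also have "... <= e/2 * h\<^sup>2" using main that by blast
  finally have "abs ((g (x + h) - g x - h * k x) / h\<^sup>2 - b / 2) <= e/2" using that by simp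
  then show ?thesis using e by (simp add: dist_real_def)
 qed
 then show "\<forall>\<^sub>F h in at 0. dist ((g (x + h) - g x - h * k x) / h\<^sup>2) (b / 2) < e"
  using d(1) unfolding eventually_at by (intro exI[of _ d]) (auto simp: dist_real_def)
qed

text \<open>Any selection of subgradients is monotone, hence differentiable almost everywhere, and
  half its derivative is the second-order coefficient.\<close>

lemma subdifferentiable_AE_expansion:
 fixes g :: "real => real"
 assumes g: "subdifferentiable g"
 shows "AE x in lborel. \<exists>a b. ((\<lambda>h. (g (x + h) - g x - h * a) / h\<^sup>2) \<longlongrightarrow> b) (at 0)"
proof -
 obtain k where k: "!!x u. g u \<ge> g x + k x * (u - x)"
  using g unfolding subdifferentiable_def subgradient_def by (auto simp: inner_real_def) metis
 have "mono k"
 proof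
  fix x y :: real assume "x <= y"
  have "(k y - k x) * (y - x) \<ge> 0" using k[of x y] k[of y x] by (simp add: algebra_simps)
  then show "k x <= k y" using \<open>x <= y\<close> by (cases "x = y") (auto simp: zero_le_mult_iff)
 qed
 from mono_AE_differentiable[OF this] show ?thesis
  by eventually_elim (use subdifferentiable_expansion[OF k] in blast)
qed

text \<open>Convergence as \<open>h \<rightarrow> 0\<close> through the rationals, written so that measurability in a parameter is evident.\<close>

definition rat_cauchy :: "(real => real) => bool" where
 "rat_cauchy f \<longleftrightarrow> (\<forall>n::nat. \<exists>m::nat. \<forall>h\<in>\<rat>. \<forall>k\<in>\<rat>. h \<noteq> 0 --> k \<noteq> 0 -->
   abs h < 1 / real (Suc m) --> abs k < 1 / real (Suc m) --> abs (f h - f k) <= 1 / real (Suc n))"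

lemma measurable_rat_cauchy:
 assumes [measurable]: "!!h. (\<lambda>z. f z h) \<in> borel_measurable M"
 shows "{z \<in> space M. rat_cauchy (f z)} \<in> sets M"
proof -
 have eq: "(\<forall>h\<in>\<rat>. P h) \<longleftrightarrow> (\<forall>q::rat. P (real_of_rat q))" for P :: "real => bool"
  by (auto simp: Rats_def)
 show ?thesis unfolding rat_cauchy_def eq by measurable
qed

lemma tendsto_imp_rat_cauchy:
 assumes "(f \<longlongrightarrow> l) (at 0)"
 shows "rat_cauchy f"
 unfolding rat_cauchy_def
proof
 fix n :: nat
 have "\<forall>\<^sub>F h in at 0. dist (f h) l < 1 / real (Suc n) / 2"
  using tendstoD[OF assms, of "1 / real (Suc n) / 2"] by simp
 then obtain d where d: "d > 0" "!!h. h \<noteq> 0 ==> abs h < d ==> abs (f h - l) < 1 / real (Suc n) / 2"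
  unfolding eventually_at by (auto simp: dist_real_def)
 obtain m where m: "1 / real (Suc m) < d" using nat_approx_posE[OF d(1)] by metis
 have "abs (f h - f k) <= 1 / real (Suc n)" if "h \<noteq> 0" "k \<noteq> 0" "abs h < 1 / real (Suc m)" "abs k < 1 / real (Suc m)" for h k
 proof -
  have tri: "abs (a - b) <= E" if "abs (a - l) < E / 2" "abs (b - l) < E / 2" for a b E :: real using that by linarith
  show ?thesis by (rule tri) (use d(2) less_trans[OF that(3) m] less_trans[OF that(4) m] that in blast)+
 qed
 then show "\<exists>m::nat. \<forall>h\<in>\<rat>. \<forall>k\<in>\<rat>. h \<noteq> 0 --> k \<noteq> 0 -->
   abs h < 1 / real (Suc m) --> abs k < 1 / real (Suc m) --> abs (f h - f k) <= 1 / real (Suc n)" by blast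
qed

lemma rat_cauchy_limit:
 assumes f: "rat_cauchy f"
 obtains l where "!!e. 0 < e ==> \<exists>d>0. \<forall>h\<in>\<rat>. h \<noteq> 0 --> abs h < d --> abs (f h - l) <= e"
proof -
 define x where "x j = f (1 / real (Suc j))" for j :: nat
 have C: "\<exists>m::nat. \<forall>h\<in>\<rat>. \<forall>k\<in>\<rat>. h \<noteq> 0 --> k \<noteq> 0 --> abs h < 1 / real (Suc m) --> abs k < 1 / real (Suc m) --> abs (f h - f k) <= e"
  if e: "e > 0" for e
 proof -
  obtain n where n: "1 / real (Suc n) < e" using nat_approx_posE[OF e] by metis
  then show ?thesis using f unfolding rat_cauchy_def by (meson less_imp_le order_trans)
 qed
 have rat: "1 / real (Suc j) \<in> \<rat>" "1 / real (Suc j) \<noteq> 0" for j by (auto simp del: of_nat_Suc)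
 have small: "abs (1 / real (Suc j)) < 1 / real (Suc m)" if "m < j" for j m :: nat using that by (simp add: field_simps)
 have "Cauchy x"
 proof (rule CauchyI)
  fix e :: real assume e: "0 < e"
  obtain m where m: "!!h k. h \<in> \<rat> ==> k \<in> \<rat> ==> h \<noteq> 0 ==> k \<noteq> 0 ==> abs h < 1 / real (Suc m) ==> abs k < 1 / real (Suc m) ==> abs (f h - f k) <= e/2"
   using C[of "e/2"] e by (auto; blast)
  have "abs (x i - x j) <= e/2" if "m < i" "m < j" for i j
   unfolding x_def by (rule m[OF rat(1) rat(1) rat(2) rat(2) small[OF that(1)] small[OF that(2)]])
  then have "abs (x i - x j) < e" if "m < i" "m < j" for i j using that e by fastforce
  then show "\<exists>M. \<forall>m\<ge>M. \<forall>n\<ge>M. norm (x m - x n) < e" by (intro exI[of _ "Suc m"]) (auto simp: Suc_le_eq)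
 qed
 then obtain l where l: "x \<longlonglongrightarrow> l" using Cauchy_convergent_iff convergent_def by blast
 show ?thesis
 proof
  fix e :: real assume "0 < e"
  then obtain m where m: "!!h k. h \<in> \<rat> ==> k \<in> \<rat> ==> h \<noteq> 0 ==> k \<noteq> 0 ==> abs h < 1 / real (Suc m) ==> abs k < 1 / real (Suc m) ==> abs (f h - f k) <= e"
   using C[of e] by (auto; blast)
  have "abs (f h - l) <= e" if h: "h \<in> \<rat>" "h \<noteq> 0" "abs h < 1 / real (Suc m)" for h
  proof (rule LIMSEQ_le_const2)
   show "(\<lambda>j. abs (f h - x j)) \<longlonglongrightarrow> abs (f h - l)" by (intro tendsto_intros l)
   show "\<exists>N. \<forall>j\<ge>N. abs (f h - x j) <= e"
    using m[OF h(1) rat(1) h(2) rat(2) h(3) small] unfolding x_def by (intro exI[of _ "Suc m"]) (auto simp: Suc_le_eq)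
  qed
  then show "\<exists>d>0. \<forall>h\<in>\<rat>. h \<noteq> 0 --> abs h < d --> abs (f h - l) <= e"
   by (intro exI[of _ "1 / real (Suc m)"]) auto
 qed
qed

text \<open>Monotonicity sandwiches \<open>g (t + h)\<close> between the values at rationals within
  \<open>u * |h|\<close> of \<open>h\<close>; \<open>u\<close> is so small that this changes
  \<open>c * h\<close> by at most \<open>e/2 * |h|\<close>.\<close>

lemma mono_derivative_from_rats:
 fixes g :: "real => real"
 assumes g: "mono g"
  and lim: "!!e. 0 < e ==> \<exists>d>0. \<forall>h\<in>\<rat>. h \<noteq> 0 --> abs h < d --> abs ((g (t + h) - g t) / h - c) <= e"
  and e: "0 < e"
 shows "\<exists>d>0. \<forall>h. abs h < d --> abs (g (t + h) - g t - c * h) <= e * abs h"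
proof -
 obtain d where d: "d > 0" "!!h. h \<in> \<rat> ==> h \<noteq> 0 ==> abs h < d ==> abs ((g (t + h) - g t) / h - c) <= e/4"
  using lim[of "e/4"] e by auto
 have dd: "abs (g (t + h) - g t - c * h) <= e/4 * abs h" if "h \<in> \<rat>" "h \<noteq> 0" "abs h < d" for h
 proof -
  have "g (t + h) - g t - c * h = ((g (t + h) - g t) / h - c) * h" using that by (simp add: field_simps)
  then have "abs (g (t + h) - g t - c * h) = abs ((g (t + h) - g t) / h - c) * abs h" by (simp only: abs_mult)
  then show ?thesis using mult_right_mono[OF d(2)[OF that], of "abs h"] by simp
 qed
 define u where "u = min (1/2) (e / (2 * (abs c + 1)))"
 have u: "0 < u" "u <= 1/2" "abs c * u <= e/2"
 proof -
  show "0 < u" using e unfolding u_def by (auto intro: add_nonneg_pos)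
  show "u <= 1/2" unfolding u_def by (rule min.cobounded1)
  have "abs c * u <= (abs c + 1) * (e / (2 * (abs c + 1)))" using e by (intro mult_mono) (auto simp: u_def)
  also have "... = e/2" by (simp add: field_simps)
  finally show "abs c * u <= e/2" .
 qed
 have "abs (g (t + h) - g t - c * h) <= e * abs h" if h: "abs h < d/2" for h
 proof (cases "h = 0")
  case False
  have step: "abs (g (t + k) - g t - c * h) <= e * abs h" if k: "k \<in> \<rat>" "abs (k - h) < u * abs h" for k
  proof -
   have "u * abs h <= 1/2 * abs h" using u by (intro mult_right_mono) auto
   then have "abs (k - h) < abs h" using k False by linarith
   then have k': "k \<noteq> 0" "abs k < d" "abs k <= 2 * abs h" using h by linarith+
   have "abs (c * k - c * h) = abs c * abs (k - h)" by (simp flip: abs_mult add: right_diff_distrib)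
   also have "... <= abs c * (u * abs h)" using k by (intro mult_left_mono) auto
   also have "... <= e/2 * abs h" unfolding mult.assoc[symmetric] using u by (intro mult_right_mono) auto
   finally have 1: "abs (c * k - c * h) <= e/2 * abs h" .
   have "e/4 * abs k <= e/4 * (2 * abs h)" using k' e by (intro mult_left_mono) auto
   then show ?thesis using dd[OF k(1) k'(1,2)] 1 by linarith
  qed
  have pos: "0 < u * abs h" using u False by simp
  obtain k1 where k1: "k1 \<in> \<rat>" "h - u * abs h < k1" "k1 < h" using Rats_dense_in_real[of "h - u * abs h" h] pos by auto
  obtain k2 where k2: "k2 \<in> \<rat>" "h < k2" "k2 < h + u * abs h" using Rats_dense_in_real[of h "h + u * abs h"] pos by auto
  have "g (t + k1) <= g (t + h)" "g (t + h) <= g (t + k2)" using k1 k2 by (auto intro!: monoD[OF g])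
  moreover have "abs (k1 - h) < u * abs h" "abs (k2 - h) < u * abs h" using k1 k2 by auto
  ultimately show ?thesis using step[OF k1(1)] step[OF k2(1)] by linarith
 qed auto
 then show ?thesis using d(1) by (intro exI[of _ "d/2"]) auto
qed

text \<open>Fubini for the pair (point, parameter along the line) yields one parameter
  \<open>s\<close> that is good for almost every \<open>y\<close>; translation invariance then
  removes \<open>s\<close>. No coordinates adapted to \<open>v\<close> enter.\<close>

lemma AE_lines:
 fixes v :: "'a::euclidean_space"
 assumes P: "{y. P y} \<in> sets borel" and lines: "!!y. AE s in lborel. P (y + s *\<^sub>R v)"
 shows "AE y in lborel. P y"
proof -
 have [measurable]: "Measurable.pred borel P" using P by (simp add: pred_def)
 have "AE y in (lborel :: 'a measure). AE s in (lborel :: real measure). P (y + s *\<^sub>R v)" using lines by simp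
 moreover have "{x \<in> space (lborel \<Otimes>\<^sub>M lborel). P (fst x + snd x *\<^sub>R v)} \<in> sets ((lborel :: 'a measure) \<Otimes>\<^sub>M (lborel :: real measure))"
  by measurable
 ultimately have ae: "AE s in (lborel :: real measure). AE y in (lborel :: 'a measure). P (y + s *\<^sub>R v)"
  by (simp add: lborel_pair.AE_commute)
 have "ae_filter (lborel :: real measure) \<noteq> bot" by (simp add: ae_filter_eq_bot_iff)
 from eventually_happens'[OF this ae] obtain s :: real where s: "AE y in lborel. P (y + s *\<^sub>R v)" by blast
 have "AE y in distr lborel borel ((+) (s *\<^sub>R v)). P y"
  by (subst AE_distr_iff) (use s in \<open>auto simp: add.commute\<close>)
 then show ?thesis unfolding lborel_distr_plus .
qed

section \<open>Convex functions of several variables\<close>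

lemma subdifferentiable_convex_on:
 fixes f :: "'a::real_inner => real"
 shows "subdifferentiable f ==> convex_on UNIV f"
proof (rule convex_onI)
 fix t :: real and x y :: 'a assume f: "subdifferentiable f" and t: "0 < t" "t < 1"
 define z where "z = (1 - t) *\<^sub>R x + t *\<^sub>R y"
 obtain p where p: "!!u. f u \<ge> f z + p \<bullet> (u - z)" using f unfolding subdifferentiable_def subgradient_def by blast
 have "(1 - t) * f x + t * f y \<ge> (1 - t) * (f z + p \<bullet> (x - z)) + t * (f z + p \<bullet> (y - z))"
  using p t by (intro add_mono mult_left_mono) auto
 also have "(1 - t) * (f z + p \<bullet> (x - z)) + t * (f z + p \<bullet> (y - z)) = f z + p \<bullet> ((1 - t) *\<^sub>R (x - z) + t *\<^sub>R (y - z))"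
  by (simp add: inner_add_right algebra_simps)
 also have "(1 - t) *\<^sub>R (x - z) + t *\<^sub>R (y - z) = 0" by (simp add: z_def algebra_simps)
 finally show "f ((1 - t) *\<^sub>R x + t *\<^sub>R y) <= (1 - t) * f x + t * f y" by (simp add: z_def)
qed auto

lemma subdifferentiable_continuous:
 fixes f :: "'a::euclidean_space => real"
 shows "subdifferentiable f ==> continuous_on UNIV f"
 using convex_on_continuous[OF open_UNIV subdifferentiable_convex_on] by blast

lemma subdifferentiable_affine:
 assumes f: "subdifferentiable f" and h: "h > 0"
 shows "subdifferentiable (\<lambda>u. (f (y + h *\<^sub>R u) - a - p \<bullet> u) / h\<^sup>2)"
 unfolding subdifferentiable_def
proof
 fix u
 obtain q where q: "!!w. f w \<ge> f (y + h *\<^sub>R u) + q \<bullet> (w - (y + h *\<^sub>R u))"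
  using f unfolding subdifferentiable_def subgradient_def by blast
 have "subgradient (\<lambda>u. (f (y + h *\<^sub>R u) - a - p \<bullet> u) / h\<^sup>2) u ((1 / h\<^sup>2) *\<^sub>R (h *\<^sub>R q - p))"
  unfolding subgradient_def
 proof
  fix w
  have "f (y + h *\<^sub>R u) - a - p \<bullet> u + (h *\<^sub>R q - p) \<bullet> (w - u) <= f (y + h *\<^sub>R w) - a - p \<bullet> w"
   using q[of "y + h *\<^sub>R w"] by (simp add: inner_diff_left inner_diff_right algebra_simps)
  then have "(f (y + h *\<^sub>R u) - a - p \<bullet> u + (h *\<^sub>R q - p) \<bullet> (w - u)) / h\<^sup>2 <= (f (y + h *\<^sub>R w) - a - p \<bullet> w) / h\<^sup>2"
   by (intro divide_right_mono) auto
  then show "(f (y + h *\<^sub>R u) - a - p \<bullet> u) / h\<^sup>2 + ((1 / h\<^sup>2) *\<^sub>R (h *\<^sub>R q - p)) \<bullet> (w - u) <= (f (y + h *\<^sub>R w) - a - p \<bullet> w) / h\<^sup>2"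
   by (simp add: add_divide_distrib)
 qed
 then show "\<exists>q. subgradient (\<lambda>u. (f (y + h *\<^sub>R u) - a - p \<bullet> u) / h\<^sup>2) u q" by blast
qed

lemma subdifferentiable_line:
 assumes f: "subdifferentiable f"
 shows "subdifferentiable (\<lambda>s::real. f (y + s *\<^sub>R v))"
 unfolding subdifferentiable_def
proof
 fix s :: real
 obtain q where q: "!!w. f w \<ge> f (y + s *\<^sub>R v) + q \<bullet> (w - (y + s *\<^sub>R v))"
  using f unfolding subdifferentiable_def subgradient_def by blast
 have "subgradient (\<lambda>s. f (y + s *\<^sub>R v)) s (q \<bullet> v)"
  unfolding subgradient_def
 proof
  fix u :: real
  show "f (y + s *\<^sub>R v) + (q \<bullet> v) \<bullet> (u - s) <= f (y + u *\<^sub>R v)"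
   using q[of "y + u *\<^sub>R v"] by (simp add: inner_real_def inner_diff_right inner_add_right algebra_simps)
 qed
 then show "\<exists>q. subgradient (\<lambda>s. f (y + s *\<^sub>R v)) s q" by blast
qed


lemma inner_sgn_self: "p \<bullet> sgn p = norm (p::'a::real_inner)"
 by (cases "p = 0") (simp_all add: sgn_div_norm dot_square_norm power2_eq_square)

lemma norm_sgn_le_1: "norm (sgn (p::'a::real_normed_vector)) <= 1"
 by (simp add: norm_sgn)

text \<open>For convex \<open>f\<close>, closeness to \<open>q\<close> on an \<open>h\<close>-net is
  enough. From above: step \<open>2 * h\<close> along the subgradient \<open>p\<close> at
  \<open>u\<close>; a net point \<open>v\<close> near there still has
  \<open>p \<bullet> (v - u) \<ge> 0\<close>, so \<open>f u <= f v\<close>. From below: reflect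
  \<open>u\<close> in a nearby net point \<open>v\<close> and combine midpoint convexity with the
  upper bound at \<open>2 *\<^sub>R v - u\<close>.\<close>

lemma subdifferentiable_near:
 fixes f q :: "'a::euclidean_space => real"
 assumes f: "subdifferentiable f"
  and q: "!!u u'. norm u <= 3 ==> norm u' <= 3 ==> abs (q u - q u') <= L * norm (u - u')"
  and D: "!!u. norm u <= 5/2 ==> \<exists>v\<in>D. norm (v - u) <= h"
  and fq: "!!v. v \<in> D ==> norm v <= 3 ==> abs (f v - q v) <= k"
  and h: "0 < h" "h <= 1/8" and L: "0 <= L" and u: "norm u <= 1"
 shows "abs (f u - q u) <= 3 * k + 10 * L * h"
proof -
 have up: "f u <= q u + k + 3 * L * h" if u: "norm u <= 2" for u
 proof -
  obtain p where p: "!!w. f w \<ge> f u + p \<bullet> (w - u)" using f unfolding subdifferentiable_def subgradient_def by blast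
  have ns: "norm ((2 * h) *\<^sub>R sgn p) <= 2 * h" using h norm_sgn_le_1[of p] by (simp add: mult_left_le)
  have nw: "norm (u + (2 * h) *\<^sub>R sgn p) <= 2 + 2 * h"
   using norm_triangle_ineq[of u "(2 * h) *\<^sub>R sgn p"] u ns by linarith
  then obtain v where v: "v \<in> D" "norm (v - (u + (2 * h) *\<^sub>R sgn p)) <= h" using D[of "u + (2 * h) *\<^sub>R sgn p"] h by auto
  have "p \<bullet> (v - u) = p \<bullet> (v - (u + (2 * h) *\<^sub>R sgn p)) + 2 * h * norm p"
   by (simp add: inner_diff_right inner_add_right inner_sgn_self)
  moreover have "abs (p \<bullet> (v - (u + (2 * h) *\<^sub>R sgn p))) <= norm p * h"
   using Cauchy_Schwarz_ineq2[of p "v - (u + (2 * h) *\<^sub>R sgn p)"] mult_left_mono[OF v(2), of "norm p"] by auto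
  moreover have "0 <= h * norm p" using h by simp
  moreover have "norm p * h = h * norm p" by simp
  ultimately have "p \<bullet> (v - u) \<ge> 0" unfolding abs_le_iff by linarith
  then have "f u <= f v" using p[of v] by simp
  have "norm (v - u) <= norm (v - (u + (2 * h) *\<^sub>R sgn p)) + norm ((2 * h) *\<^sub>R sgn p)"
   using norm_triangle_ineq[of "v - (u + (2 * h) *\<^sub>R sgn p)" "(2 * h) *\<^sub>R sgn p"] by simp
  also have "... <= 3 * h" using v(2) ns by linarith
  finally have vu: "norm (v - u) <= 3 * h" .
  have nv: "norm v <= 3" using norm_triangle_ineq[of "v - u" u] vu u h by simp
  have "f u <= q v + k" using \<open>f u <= f v\<close> fq[OF v(1) nv] by simp
  also have "q v <= q u + L * (3 * h)"
   using q[OF nv, of u] u mult_left_mono[OF vu L] by linarith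
  finally show ?thesis by simp
 qed
 obtain v where v: "v \<in> D" "norm (v - u) <= h" using D[of u] u by auto
 have nv: "norm v <= 3" using norm_triangle_ineq[of "v - u" u] v u h by simp
 have "norm (2 *\<^sub>R v - u) = norm (2 *\<^sub>R (v - u) + u)" by (simp add: algebra_simps scaleR_2)
 also have "... <= 2 * norm (v - u) + norm u" using norm_triangle_ineq[of "2 *\<^sub>R (v - u)" u] by simp
 finally have n2: "norm (2 *\<^sub>R v - u) <= 2" using v u h by simp
 obtain p where p: "!!w. f w \<ge> f v + p \<bullet> (w - v)" using f unfolding subdifferentiable_def subgradient_def by blast
 have "f u + f (2 *\<^sub>R v - u) \<ge> 2 * f v"
  using p[of u] p[of "2 *\<^sub>R v - u"] by (simp add: inner_diff_right algebra_simps)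
 moreover have "f (2 *\<^sub>R v - u) <= q (2 *\<^sub>R v - u) + k + 3 * L * h" by (rule up[OF n2])
 moreover have "abs (q (2 *\<^sub>R v - u) - q u) <= 2 * (L * h)"
 proof -
  have "2 *\<^sub>R v - u - u = 2 *\<^sub>R (v - u)" by (simp add: algebra_simps scaleR_2)
  then have "abs (q (2 *\<^sub>R v - u) - q u) <= L * (2 * norm (v - u))" using q[of "2 *\<^sub>R v - u" u] n2 u by simp
  then show ?thesis using mult_left_mono[OF v(2) L] by simp
 qed
 moreover have "abs (q v - q u) <= L * h" using q[OF nv, of u] u mult_left_mono[OF v(2) L] by simp
 moreover have "abs (f v - q v) <= k" by (rule fq[OF v(1) nv])
 moreover have "f u <= q u + k + 3 * L * h" using u by (intro up) simp
 moreover have "0 <= L * h" using L h by simp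
 ultimately show ?thesis by (simp only: abs_le_iff mult.assoc) linarith
qed

text \<open>Pointwise convergence of convex difference quotients on a dense set is uniform.\<close>

lemma second_order_expansion:
 fixes f :: "'a::euclidean_space => real"
 assumes f: "subdifferentiable f" and p: "subgradient f y p"
  and V: "!!S. open S ==> S \<noteq> {} ==> \<exists>v\<in>V. v \<in> S"
  and lim: "!!v. v \<in> V ==> \<exists>b. ((\<lambda>h. (f (y + h *\<^sub>R v) - f y - h * (p \<bullet> v)) / h\<^sup>2) \<longlongrightarrow> b) (at 0)"
 obtains g L where "!!u u'. norm u <= 3 ==> norm u' <= 3 ==> abs (g u - g u') <= L * norm (u - u')" "0 <= L"
  "!!c u. 0 <= c ==> g (c *\<^sub>R u) = c\<^sup>2 * g u" "!!u. 0 <= g u"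
  "!!e. 0 < e ==> \<exists>d>0. \<forall>w. norm w < d --> abs (f (y + w) - f y - p \<bullet> w - g w) <= e * (norm w)\<^sup>2"
proof -
 define F where "F h u = (f (y + h *\<^sub>R u) - f y - (h *\<^sub>R p) \<bullet> u) / h\<^sup>2" for h u
 have Fsub: "subdifferentiable (F h)" if "h > 0" for h
  unfolding F_def by (rule subdifferentiable_affine[OF f that])
 have F0: "0 <= F h u" for h u using p unfolding F_def subgradient_def by (auto intro!: divide_nonneg_nonneg) (metis add_diff_cancel_left' inner_scaleR_right le_diff_eq add.commute)
 have Fscale: "F h (c *\<^sub>R u) = c\<^sup>2 * F (h * c) u" for h c u by (simp add: F_def power_mult_distrib)
 have Flim: "\<exists>b. ((\<lambda>h. F h v) \<longlongrightarrow> b) (at_right 0)" if "v \<in> V" for v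
  using lim[OF that] unfolding F_def filterlim_at_split by auto
 have net: "\<exists>N. finite N \<and> N \<subseteq> V \<and> (\<forall>u. norm u <= R --> (\<exists>v\<in>N. norm (v - u) <= r))" if r: "r > 0" for r R
 proof -
  have cov: "cball 0 R \<subseteq> (\<Union>v\<in>V. ball v r)"
  proof
   fix u :: 'a
   obtain v where "v \<in> V" "v \<in> ball u r" using V[of "ball u r"] r by auto
   then show "u \<in> (\<Union>v\<in>V. ball v r)" by (auto simp: dist_commute)
  qed
  obtain N where N: "N \<subseteq> V" "finite N" "cball 0 R \<subseteq> (\<Union>v\<in>N. ball v r)"
   using compactE_image[OF compact_cball[of 0 R] _ cov] by auto
  have "\<exists>v\<in>N. norm (v - u) <= r" if "norm u <= R" for u
  proof -
   have "u \<in> cball 0 R" using that by simp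
   then obtain v where "v \<in> N" "u \<in> ball v r" using N(3) by blast
   then show ?thesis by (auto simp: dist_norm intro!: bexI[of _ v])
  qed
  then show ?thesis using N by blast
 qed
 obtain N0 where N0: "finite N0" "N0 \<subseteq> V" "!!u. norm u <= 6 ==> \<exists>v\<in>N0. norm (v - u) <= 1" using net[of 1 6] by auto
 obtain b where b: "!!v. v \<in> V ==> ((\<lambda>h. F h v) \<longlongrightarrow> b v) (at_right 0)" using Flim by metis
 define M where "M = (\<Sum>v\<in>N0. abs (b v) + 1)"
 have M0: "M \<ge> 0" unfolding M_def by (intro sum_nonneg) auto
 have "\<forall>\<^sub>F h in at_right 0. \<forall>v\<in>N0. F h v <= M"
 proof (intro eventually_ball_finite N0(1) ballI)
  fix v assume v: "v \<in> N0"
  have "b v < M"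
  proof -
   have "abs (b v) + 1 <= M" unfolding M_def by (rule member_le_sum[OF v _ N0(1)]) auto
   then show ?thesis by linarith
  qed
  then have "\<forall>\<^sub>F h in at_right 0. F h v < M" using b v N0(2) order_tendstoD(2) by blast
  then show "\<forall>\<^sub>F h in at_right 0. F h v <= M" by eventually_elim simp
 qed
 then obtain h0 where h0: "h0 > 0" "!!h v. 0 < h ==> h < h0 ==> v \<in> N0 ==> F h v <= M"
  unfolding eventually_at_right_field by blast
 \<comment> \<open>A unit step along the subgradient leads near a net point where \<open>F h\<close>
   is at least as large; the net covers radius 6, so radius 4 is controlled.\<close>
 have FM: "F h u <= M" if h: "0 < h" "h < h0" and u: "norm u <= 4" for h u
 proof -
  obtain q where q: "!!w. F h w \<ge> F h u + q \<bullet> (w - u)" using Fsub[OF h(1)] unfolding subdifferentiable_def subgradient_def by blast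
  have "norm (u + sgn q) <= 6" using norm_triangle_ineq[of u "sgn q"] u by (simp add: norm_sgn split: if_splits)
  then obtain v where v: "v \<in> N0" "norm (v - (u + sgn q)) <= 1" using N0(3) by blast
  have "q \<bullet> (v - u) = q \<bullet> (v - (u + sgn q)) + norm q"
   by (simp add: inner_diff_right inner_add_right inner_sgn_self)
  moreover have "abs (q \<bullet> (v - (u + sgn q))) <= norm q"
   using Cauchy_Schwarz_ineq2[of q "v - (u + sgn q)"] mult_left_mono[OF v(2), of "norm q"] by simp
  ultimately have "F h u <= F h v" using q[of v] by linarith
  then show ?thesis using h0(2)[OF h v(1)] by simp
 qed
 \<comment> \<open>As \<open>F h\<close> is nonnegative and at most \<open>M\<close>, a unit step
   along a subgradient \<open>q\<close> shows \<open>norm q <= M\<close>.\<close>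
 have FL: "abs (F h u - F h u') <= M * norm (u - u')" if h: "0 < h" "h < h0" and u: "norm u <= 3" "norm u' <= 3" for h u u'
 proof -
  have *: "F h u - F h u' <= M * norm (u - u')" if u: "norm u <= 3" for u u'
  proof -
   obtain q where q: "!!w. F h w \<ge> F h u + q \<bullet> (w - u)" using Fsub[OF h(1)] unfolding subdifferentiable_def subgradient_def by blast
   have "norm (u + sgn q) <= 4" using norm_triangle_ineq[of u "sgn q"] u by (simp add: norm_sgn split: if_splits)
   then have "F h u + norm q <= M"
    using q[of "u + sgn q"] FM[OF h, of "u + sgn q"] by (simp add: inner_sgn_self)
   then have "norm q <= M" using F0[of h u] by simp
   have "F h u - F h u' <= q \<bullet> (u - u')" using q[of u'] by (simp add: inner_diff_right)
   also have "... <= norm q * norm (u - u')" by (rule norm_cauchy_schwarz)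
   also have "... <= M * norm (u - u')" using \<open>norm q <= M\<close> by (intro mult_right_mono) auto
   finally show ?thesis .
  qed
  from *[OF u(1), of u'] *[OF u(2), of u] show ?thesis by (simp add: abs_le_iff norm_minus_commute)
 qed
 have cau: "\<exists>h1>0. \<forall>h h' u. 0 < h --> h < h1 --> 0 < h' --> h' < h1 --> norm u <= 1 --> abs (F h u - F h' u) <= e" if e: "e > 0" for e
 proof -
  define \<eta> where "\<eta> = min (1/8) (e / (20 * (M + 1)))"
  have \<eta>: "0 < \<eta>" "\<eta> <= 1/8" "10 * M * \<eta> <= e/2"
  proof -
   show "0 < \<eta>" using e M0 by (auto simp: \<eta>_def)
   show "\<eta> <= 1/8" unfolding \<eta>_def by (rule min.cobounded1)
   have "10 * M * \<eta> <= 10 * (M + 1) * (e / (20 * (M + 1)))" using e M0 by (intro mult_mono) (auto simp: \<eta>_def)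
   also have "... = e/2" using M0 by (simp add: field_simps)
   finally show "10 * M * \<eta> <= e/2" .
  qed
  obtain N1 where N1: "finite N1" "N1 \<subseteq> V" "!!u. norm u <= 3 ==> \<exists>v\<in>N1. norm (v - u) <= \<eta>" using net[OF \<eta>(1), of 3] by auto
  have "\<forall>\<^sub>F h in at_right 0. \<forall>v\<in>N1. abs (F h v - b v) <= e/12"
  proof (intro eventually_ball_finite N1(1) ballI)
   fix v assume "v \<in> N1"
   then have "\<forall>\<^sub>F h in at_right 0. dist (F h v) (b v) < e/12" using b N1(2) e by (intro tendstoD) auto
   then show "\<forall>\<^sub>F h in at_right 0. abs (F h v - b v) <= e/12" by eventually_elim (simp add: dist_real_def)
  qed
  then obtain h1 where h1: "h1 > 0" "!!h v. 0 < h ==> h < h1 ==> v \<in> N1 ==> abs (F h v - b v) <= e/12"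
   unfolding eventually_at_right_field by blast
  have "abs (F h u - F h' u) <= e" if h: "0 < h" "h < min h0 h1" "0 < h'" "h' < min h0 h1" and u: "norm u <= 1" for h h' u
  proof -
   have "abs (F h u - F h' u) <= 3 * (e/6) + 10 * M * \<eta>"
   proof (rule subdifferentiable_near[OF Fsub[OF h(1)] _ _ _ \<eta>(1,2) M0 u, of "F h'" N1])
    show "abs (F h' u - F h' u') <= M * norm (u - u')" if "norm u <= 3" "norm u' <= 3" for u u'
     using FL[of h' u u'] h that by simp
    show "\<exists>v\<in>N1. norm (v - u) <= \<eta>" if "norm u <= 5/2" for u using N1(3)[of u] that by simp
    show "abs (F h v - F h' v) <= e/6" if "v \<in> N1" for v 
    proof -
     have "abs (F h v - b v) <= e/12" "abs (F h' v - b v) <= e/12" using h1(2)[of h v] h1(2)[of h' v] h that by auto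
     then show ?thesis by linarith
    qed
   qed
   then show ?thesis using \<eta>(3) by simp
  qed
  then show ?thesis using h0(1) h1(1) by (intro exI[of _ "min h0 h1"]) auto
 qed
 define \<gamma> where "\<gamma> u = lim (\<lambda>n. F (1 / real (Suc n)) u)" for u
 have inv0: "(\<lambda>n. 1 / real (Suc n)) \<longlonglongrightarrow> 0" using LIMSEQ_inverse_real_of_nat by (simp add: inverse_eq_divide)
 have lim\<gamma>: "(\<lambda>n. F (1 / real (Suc n)) u) \<longlonglongrightarrow> \<gamma> u" if u: "norm u <= 1" for u
 proof -
  have "Cauchy (\<lambda>n. F (1 / real (Suc n)) u)"
  proof (rule CauchyI)
   fix e :: real assume e: "0 < e"
   obtain h1 where h1: "h1 > 0" "!!h h'. 0 < h ==> h < h1 ==> 0 < h' ==> h' < h1 ==> abs (F h u - F h' u) <= e/2"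
    using cau[of "e/2"] e u by (auto; blast)
   obtain n0 where "!!n. n \<ge> n0 ==> 1 / real (Suc n) < h1"
    using order_tendstoD(2)[OF inv0 h1(1)] unfolding eventually_sequentially by blast
   then have "norm (F (1 / real (Suc m)) u - F (1 / real (Suc n)) u) < e" if "m \<ge> n0" "n \<ge> n0" for m n
    using h1(2)[of "1 / real (Suc m)" "1 / real (Suc n)"] that e by (auto simp del: of_nat_Suc)
   then show "\<exists>M. \<forall>m\<ge>M. \<forall>n\<ge>M. norm (F (1 / real (Suc m)) u - F (1 / real (Suc n)) u) < e" by blast
  qed
  then show ?thesis unfolding \<gamma>_def using Cauchy_convergent convergent_LIMSEQ_iff by blast
 qed
 have unif: "\<exists>h1>0. \<forall>h u. 0 < h --> h < h1 --> norm u <= 1 --> abs (F h u - \<gamma> u) <= e" if e: "e > 0" for e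
 proof -
  obtain h1 where h1: "h1 > 0" "!!h h' u. 0 < h ==> h < h1 ==> 0 < h' ==> h' < h1 ==> norm u <= 1 ==> abs (F h u - F h' u) <= e"
   using cau[OF e] by blast
  have "abs (F h u - \<gamma> u) <= e" if h: "0 < h" "h < h1" and u: "norm u <= 1" for h u
  proof (rule LIMSEQ_le_const2)
   show "(\<lambda>n. abs (F h u - F (1 / real (Suc n)) u)) \<longlonglongrightarrow> abs (F h u - \<gamma> u)" by (intro tendsto_intros lim\<gamma> u)
   obtain n0 where "!!n. n \<ge> n0 ==> 1 / real (Suc n) < h1"
    using order_tendstoD(2)[OF inv0 h1(1)] unfolding eventually_sequentially by blast
   then show "\<exists>N. \<forall>n\<ge>N. abs (F h u - F (1 / real (Suc n)) u) <= e"
    using h1(2)[OF h _ _ u] by (intro exI[of _ n0]) (auto simp del: of_nat_Suc)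
  qed
  then show ?thesis using h1(1) by blast
 qed
 \<comment> \<open>The limit is constructed on the unit ball and extended by the 2-homogeneity of
   the quotients. Limits at a single point do not make \<open>g\<close> a quadratic form; that comes
   later from comparing expansions at nearby points.\<close>
 define g where "g u = (norm u)\<^sup>2 * \<gamma> (sgn u)" for u
 have Fg: "((\<lambda>h. F h u) \<longlongrightarrow> g u) (at_right 0)" for u
 proof (cases "u = 0")
  case True then show ?thesis by (simp add: g_def F_def)
 next
  case False
  have "((\<lambda>h. F h (sgn u)) \<longlongrightarrow> \<gamma> (sgn u)) (at_right 0)"
   unfolding tendsto_iff
  proof (intro allI impI)
   fix e :: real assume "e > 0"
   then obtain h1 where h1: "h1 > 0" "!!h u. 0 < h ==> h < h1 ==> norm u <= 1 ==> abs (F h u - \<gamma> u) <= e/2" using unif[of "e/2"] by auto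
   have "dist (F h (sgn u)) (\<gamma> (sgn u)) < e" if "0 < h" "h < h1" for h
    using h1(2)[OF that norm_sgn_le_1, of u] \<open>e > 0\<close> unfolding dist_real_def by linarith
   then show "\<forall>\<^sub>F h in at_right 0. dist (F h (sgn u)) (\<gamma> (sgn u)) < e" using h1(1) unfolding eventually_at_right_field by blast
  qed
  moreover have "filterlim (\<lambda>h. h * norm u) (at_right 0) (at_right 0)"
  proof (rule filterlim_at_withinI)
   show "((\<lambda>h. h * norm u) \<longlongrightarrow> 0) (at_right 0)" by (auto intro!: tendsto_eq_intros)
   show "\<forall>\<^sub>F h in at_right 0. h * norm u \<in> {0<..} - {0}"
    using False eventually_at_right_less[of "0::real"] by (auto elim!: eventually_mono)
  qed
  ultimately have "((\<lambda>h. F (h * norm u) (sgn u)) \<longlongrightarrow> \<gamma> (sgn u)) (at_right 0)" by (rule filterlim_compose)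
  then have "((\<lambda>h. (norm u)\<^sup>2 * F (h * norm u) (sgn u)) \<longlongrightarrow> g u) (at_right 0)" unfolding g_def by (intro tendsto_mult tendsto_const)
  moreover have "(norm u)\<^sup>2 * F (h * norm u) (sgn u) = F h u" for h
   using Fscale[of h "norm u" "sgn u"] False by (simp add: sgn_div_norm)
  ultimately show ?thesis by simp
 qed
 show ?thesis
 proof (rule that[of g M])
  show "abs (g u - g u') <= M * norm (u - u')" if "norm u <= 3" "norm u' <= 3" for u u'
  proof (rule tendsto_upperbound)
   show "((\<lambda>h. abs (F h u - F h u')) \<longlongrightarrow> abs (g u - g u')) (at_right 0)" by (intro tendsto_intros Fg)
   show "\<forall>\<^sub>F h in at_right 0. abs (F h u - F h u') <= M * norm (u - u')"
    using FL that h0(1) unfolding eventually_at_right_field by blast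
  qed simp
  show "0 <= M" by fact
  show "g (c *\<^sub>R u) = c\<^sup>2 * g u" if "0 <= c" for c u
   using that by (cases "c = 0") (auto simp: g_def sgn_scaleR power_mult_distrib)
  show "0 <= g u" for u by (rule tendsto_lowerbound[OF Fg]) (auto simp: F0)
  show "\<exists>d>0. \<forall>w. norm w < d --> abs (f (y + w) - f y - p \<bullet> w - g w) <= e * (norm w)\<^sup>2" if e: "0 < e" for e
  proof -
   obtain h1 where h1: "h1 > 0" "!!h u. 0 < h ==> h < h1 ==> norm u <= 1 ==> abs (F h u - \<gamma> u) <= e" using unif[OF e] by auto
   have "abs (f (y + w) - f y - p \<bullet> w - g w) <= e * (norm w)\<^sup>2" if w: "norm w < h1" for w
   proof (cases "w = 0")
    case True then show ?thesis by (simp add: g_def)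
   next
    case False
    have nw: "norm w *\<^sub>R sgn w = w" using False by (simp add: sgn_div_norm)
    have "f (y + w) - f y - p \<bullet> w = (norm w)\<^sup>2 * F (norm w) (sgn w)"
     using False nw by (simp add: F_def) (metis inner_scaleR_right)
    then have "f (y + w) - f y - p \<bullet> w - g w = (norm w)\<^sup>2 * (F (norm w) (sgn w) - \<gamma> (sgn w))"
     by (simp add: g_def right_diff_distrib)
    then have "abs (f (y + w) - f y - p \<bullet> w - g w) = (norm w)\<^sup>2 * abs (F (norm w) (sgn w) - \<gamma> (sgn w))"
     by (simp add: abs_mult)
    also have "... <= (norm w)\<^sup>2 * e" using h1(2)[of "norm w" "sgn w"] False w by (intro mult_left_mono) (auto simp: norm_sgn)
    finally show ?thesis by (simp add: mult.commute)
   qed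
   then show ?thesis using h1(1) by blast
  qed
 qed
qed

section \<open>Parabolic second-order expansions\<close>

lemma measurable_fst_snd_borel [measurable]:
 "fst \<in> borel_measurable (borel :: ('a::second_countable_topology \<times> 'b::second_countable_topology) measure)"
 "snd \<in> borel_measurable (borel :: ('a::second_countable_topology \<times> 'b::second_countable_topology) measure)"
 by (auto intro!: borel_measurable_continuous_onI continuous_intros)

lemma AE_lborel_pair:
 fixes P :: "real \<times> 'a::euclidean_space => bool"
 assumes P: "{z. P z} \<in> sets borel" and ae: "!!t. AE y in lborel. P (t, y)"
 shows "AE z in lborel. P z"
proof -
 have "{z \<in> space (lborel \<Otimes>\<^sub>M lborel). P z} \<in> sets (lborel \<Otimes>\<^sub>M lborel)" unfolding lborel_prod using P by simp
 then have "AE z in (lborel \<Otimes>\<^sub>M lborel). P z"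
  by (rule lborel_pair.AE_pair_measure) (use ae in auto)
 then show ?thesis unfolding lborel_prod .
qed

lemma AE_lborel_pair':
 fixes P :: "real \<times> 'a::euclidean_space => bool"
 assumes P: "{z. P z} \<in> sets borel" and ae: "!!y. AE t in lborel. P (t, y)"
 shows "AE z in lborel. P z"
proof -
 have [measurable]: "Measurable.pred borel P" using P by (simp add: pred_def)
 have P': "{z \<in> space (lborel \<Otimes>\<^sub>M lborel). P z} \<in> sets (lborel \<Otimes>\<^sub>M lborel)" unfolding lborel_prod using P by simp
 have "Measurable.pred borel (\<lambda>x :: 'a \<times> real. P (snd x, fst x))"
  by (rule measurable_compose[OF borel_measurable_Pair]) measurable
 then have *: "{x \<in> space (lborel \<Otimes>\<^sub>M lborel). P (snd x, fst x)} \<in> sets ((lborel :: 'a measure) \<Otimes>\<^sub>M (lborel :: real measure))"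
  unfolding lborel_prod by (simp add: pred_def)
 have "AE y in (lborel :: 'a measure). AE t in lborel. P (t, y)" using ae by simp
 with lborel_pair.AE_commute[OF *] have ae': "AE t in lborel. AE y in (lborel :: 'a measure). P (t, y)" by simp
 have "AE z in (lborel \<Otimes>\<^sub>M lborel). P z"
  by (rule lborel_pair.AE_pair_measure[OF P' ae'])
 then show ?thesis unfolding lborel_prod .
qed

lemma abs_scale: "abs x <= e ==> abs (d\<^sup>2 * x) <= e * d\<^sup>2" for x :: real
 using mult_left_mono[of "abs x" e "d\<^sup>2"] by (simp add: abs_mult mult.commute)

lemma abs_unscale: "abs (d\<^sup>2 * x) <= e * d\<^sup>2 ==> 0 < d ==> abs x <= e" for x :: real
 by (simp add: abs_mult mult.commute)

locale convex_monotone =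
 fixes F :: "real => 'a::euclidean_space => real"
 assumes subdiff: "subdifferentiable (F t)"
  and mono: "mono (\<lambda>t. F t y)"
  and meas: "(\<lambda>z. F (fst z) (snd z)) \<in> borel_measurable borel"
begin

lemma meas_comp [measurable (raw)]:
 assumes "f \<in> borel_measurable M" "g \<in> borel_measurable M"
 shows "(\<lambda>z. F (f z) (g z)) \<in> borel_measurable M"
proof -
 have "(\<lambda>z. (f z, g z)) \<in> M \<rightarrow>\<^sub>M borel" using assms by (intro borel_measurable_Pair)
 from measurable_compose[OF this meas] show ?thesis by simp
qed

definition t_expansion :: "real \<times> 'a => real => bool" where
 "t_expansion z c \<longleftrightarrow> (\<forall>e>0. \<exists>d>0. \<forall>h. abs h < d -->
   abs (F (fst z + h) (snd z) - F (fst z) (snd z) - c * h) <= e * abs h)"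

lemma AE_t_expansion: "AE z in lborel. \<exists>c. t_expansion z c"
proof -
 have "AE z in lborel. rat_cauchy (\<lambda>h. (F (fst z + h) (snd z) - F (fst z) (snd z)) / h)"
 proof (rule AE_lborel_pair')
  have "{z \<in> space borel. rat_cauchy (\<lambda>h. (F (fst z + h) (snd z) - F (fst z) (snd z)) / h)} \<in> sets borel"
   by (intro measurable_rat_cauchy) measurable
  then show "{z. rat_cauchy (\<lambda>h. (F (fst z + h) (snd z) - F (fst z) (snd z)) / h)} \<in> sets borel" by simp
  fix y
  show "AE t in lborel. rat_cauchy (\<lambda>h. (F (fst (t, y) + h) (snd (t, y)) - F (fst (t, y)) (snd (t, y))) / h)"
   using mono_AE_differentiable[OF mono[of y]] by eventually_elim (auto intro: tendsto_imp_rat_cauchy)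
 qed
 then show ?thesis
 proof eventually_elim
  case (elim z)
  then obtain c where c: "!!e. 0 < e ==> \<exists>d>0. \<forall>h\<in>\<rat>. h \<noteq> 0 --> abs h < d -->
    abs ((F (fst z + h) (snd z) - F (fst z) (snd z)) / h - c) <= e"
   by (rule rat_cauchy_limit) blast
  from mono_derivative_from_rats[OF mono c] show ?case unfolding t_expansion_def by blast
 qed
qed

abbreviation dq2 :: "'a => real \<times> 'a => real => real => real" where
 "dq2 v z a h \<equiv> (F (fst z) (snd z + h *\<^sub>R v) - F (fst z) (snd z) - h * a) / h\<^sup>2"

text \<open>Fubini requires the exceptional set to be measurable, so the slope \<open>a\<close> is
  recovered as a limit of difference quotients, which is a Borel function of \<open>z\<close>,
  rather than from a chosen subgradient.\<close>

lemma AE_directional: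
 "AE z in lborel. \<exists>a b. ((\<lambda>h. dq2 v z a h) \<longlongrightarrow> b) (at 0)"
proof -
 define a where "a z = lim (\<lambda>n. (F (fst z) (snd z + (1 / real (Suc n)) *\<^sub>R v) - F (fst z) (snd z)) * real (Suc n))" for z
 have [measurable]: "a \<in> borel_measurable borel" unfolding a_def by (rule borel_measurable_lim_metric) measurable
 have aeq: "a z = a'" if "((\<lambda>h. dq2 v z a' h) \<longlongrightarrow> b) (at 0)" for a' b z
 proof -
  have 1: "((\<lambda>h. h * (dq2 v z a' h) + a') \<longlongrightarrow> 0 * b + a') (at 0)"
   by (intro tendsto_add tendsto_mult that tendsto_ident_at tendsto_const)
  have eq: "1 / R * ((X - Y - 1 / R * a') / (1 / R)\<^sup>2) + a' = (X - Y) * R" if "0 < R" for X Y R :: real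
   using that by (simp add: power2_eq_square field_simps)
  have "filterlim (\<lambda>n. 1 / real (Suc n)) (at 0) sequentially"
   by (rule filterlim_atI) (use LIMSEQ_inverse_real_of_nat in \<open>auto simp: inverse_eq_divide simp del: of_nat_Suc\<close>)
  from filterlim_compose[OF 1 this]
  have "(\<lambda>n. (F (fst z) (snd z + (1 / real (Suc n)) *\<^sub>R v) - F (fst z) (snd z)) * real (Suc n)) \<longlonglongrightarrow> a'"
   unfolding eq[OF of_nat_0_less_iff[THEN iffD2, OF zero_less_Suc]] by simp
  then show ?thesis unfolding a_def by (rule limI)
 qed
 have "AE z in lborel. rat_cauchy (\<lambda>h. dq2 v z (a z) h)"
 proof (rule AE_lborel_pair)
  have "{z \<in> space borel. rat_cauchy (\<lambda>h. dq2 v z (a z) h)} \<in> sets borel"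
   by (intro measurable_rat_cauchy) measurable
  then show *: "{z. rat_cauchy (\<lambda>h. dq2 v z (a z) h)} \<in> sets borel" by simp
  fix t :: real
  show "AE y in lborel. rat_cauchy (\<lambda>h. dq2 v (t, y) (a (t, y)) h)"
  proof (rule AE_lines)
   have "(\<lambda>y. (t, y)) -` {z. rat_cauchy (\<lambda>h. dq2 v z (a z) h)} \<inter> space borel \<in> sets borel"
    by (rule measurable_sets[OF _ *]) measurable
   then show "{y. rat_cauchy (\<lambda>h. dq2 v (t, y) (a (t, y)) h)} \<in> sets borel"
    by (simp add: vimage_def)
   fix y
   show "AE s in lborel. rat_cauchy (\<lambda>h. dq2 v (t, y + s *\<^sub>R v) (a (t, y + s *\<^sub>R v)) h)"
    using subdifferentiable_AE_expansion[OF subdifferentiable_line[OF subdiff[of t], of y v]]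
   proof eventually_elim
    case (elim s)
    then obtain a' b where "((\<lambda>h. dq2 v (t, y + s *\<^sub>R v) a' h) \<longlongrightarrow> b) (at 0)"
     by (auto simp: algebra_simps)
    with aeq[OF this] show ?case by (auto intro: tendsto_imp_rat_cauchy)
   qed
  qed
 qed
 then show ?thesis
 proof eventually_elim
  case (elim z)
  obtain b where b: "!!e. 0 < e ==> \<exists>d>0. \<forall>h\<in>\<rat>. h \<noteq> 0 --> abs h < d --> abs (dq2 v z (a z) h - b) <= e"
   using elim by (rule rat_cauchy_limit) blast
  \<comment> \<open>Continuity of the convex slice transfers the limit from rational to real
    increments.\<close>
  have cont: "continuous_on UNIV (F (fst z))" by (rule subdifferentiable_continuous[OF subdiff])
  have "((\<lambda>h. dq2 v z (a z) h) \<longlongrightarrow> b) (at 0)"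
   unfolding tendsto_iff
  proof (intro allI impI)
   fix e :: real assume e: "e > 0"
   define \<Phi> where "\<Phi> h = dq2 v z (a z) h" for h
   obtain d where d: "d > 0" "!!h. h \<in> \<rat> ==> h \<noteq> 0 ==> abs h < d ==> abs (\<Phi> h - b) <= e/2"
    using b[of "e/2"] e unfolding \<Phi>_def by auto
   have "dist (\<Phi> h) b < e" if h: "h \<noteq> 0" "abs h < d" for h
   proof -
    have c: "isCont \<Phi> h"
     unfolding \<Phi>_def using h(1)
     by (intro continuous_intros isCont_o2[OF _ continuous_on_interior[OF cont]]) auto
    have "open {k. k \<noteq> 0 \<and> abs k < d}"
     by (intro open_Collect_conj open_Collect_neq open_Collect_less continuous_intros)
    then have "\<forall>\<^sub>F k in nhds h. k \<noteq> 0 \<and> abs k < d" using h by (auto simp: eventually_nhds)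
    moreover have "\<forall>\<^sub>F k in nhds h. dist (\<Phi> k) (\<Phi> h) < e/2"
     using c e tendstoD[of \<Phi> "\<Phi> h" "nhds h" "e/2"] by (simp add: continuous_at_imp_continuous_at_within isCont_def tendsto_at_iff_tendsto_nhds)
    ultimately have "\<forall>\<^sub>F k in nhds h. k \<noteq> 0 \<and> abs k < d \<and> dist (\<Phi> k) (\<Phi> h) < e/2" by eventually_elim auto
    then obtain r where r: "r > 0" "!!k. abs (k - h) < r ==> k \<noteq> 0 \<and> abs k < d \<and> dist (\<Phi> k) (\<Phi> h) < e/2"
     unfolding eventually_nhds_metric by (auto simp: dist_real_def)
    obtain k where "k \<in> \<rat>" "h < k" "k < h + r" using Rats_dense_in_real[of h "h + r"] r(1) by auto
    then have "abs (\<Phi> k - b) <= e/2" "dist (\<Phi> k) (\<Phi> h) < e/2" using d(2) r(2)[of k] by auto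
    then show ?thesis unfolding dist_real_def by linarith
   qed
   then show "\<forall>\<^sub>F h in at 0. dist (dq2 v z (a z) h) b < e"
    using d(1) unfolding eventually_at \<Phi>_def by (intro exI[of _ d]) (auto simp: dist_real_def)
  qed
  then show ?case by blast
 qed
qed

text \<open>\<open>g\<close> is the second-order part before it is known to be quadratic. Radius 3
  in the Lipschitz clause leaves room for the displaced points of the gluing arguments.\<close>

definition y_expansion :: "real \<times> 'a => 'a => ('a => real) => real => bool" where
 "y_expansion z p g L \<longleftrightarrow> subgradient (F (fst z)) (snd z) p \<and> 0 <= L \<and>
   (\<forall>u u'. norm u <= 3 --> norm u' <= 3 --> abs (g u - g u') <= L * norm (u - u')) \<and>
   (\<forall>c u. 0 <= c --> g (c *\<^sub>R u) = c\<^sup>2 * g u) \<and> (\<forall>u. 0 <= g u) \<and>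
   (\<forall>e>0. \<exists>d>0. \<forall>w. norm w < d -->
    abs (F (fst z) (snd z + w) - F (fst z) (snd z) - p \<bullet> w - g w) <= e * (norm w)\<^sup>2)"

lemma AE_y_expansion: "AE z in lborel. \<exists>p g L. y_expansion z p g L"
proof -
 obtain V :: "'a set" where V: "countable V" "!!S. open S ==> S \<noteq> {} ==> \<exists>v\<in>V. v \<in> S"
  using countable_dense_setE by blast
 have "AE z in lborel. \<forall>v\<in>V. \<exists>a b. ((\<lambda>h. dq2 v z a h) \<longlongrightarrow> b) (at 0)"
  using AE_directional V(1) by (intro AE_ball_countable[THEN iffD2] ballI)
 then show ?thesis
 proof eventually_elim
  case (elim z)
  obtain p where p: "subgradient (F (fst z)) (snd z) p" using subdiff unfolding subdifferentiable_def by blast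
  have "\<exists>b. ((\<lambda>h. dq2 v z (p \<bullet> v) h) \<longlongrightarrow> b) (at 0)" if v: "v \<in> V" for v
  proof -
   obtain a b where ab: "((\<lambda>h. dq2 v z a h) \<longlongrightarrow> b) (at 0)" using elim v by blast
   have 1: "((\<lambda>h. h * (dq2 v z a h) + a) \<longlongrightarrow> 0 * b + a) (at 0)"
    by (intro tendsto_add tendsto_mult ab tendsto_ident_at tendsto_const)
   have eq: "h * (dq2 v z a h) + a = (F (fst z) (snd z + h *\<^sub>R v) - F (fst z) (snd z)) / h" if "h \<noteq> 0" for h
    using that by (simp add: power2_eq_square field_simps)
   have sg: "F (fst z) (snd z + h *\<^sub>R v) - F (fst z) (snd z) \<ge> h * (p \<bullet> v)" for h
    using p unfolding subgradient_def by (metis add_diff_cancel_left' inner_scaleR_right le_diff_eq add.commute)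
   \<comment> \<open>The subgradient inequality for positive and for negative \<open>h\<close>
     bounds the common one-sided slope from both sides, so any subgradient reproduces
     \<open>a\<close>.\<close>
   have "p \<bullet> v <= 0 * b + a"
   proof (rule tendsto_lowerbound)
    show "((\<lambda>h. h * (dq2 v z a h) + a) \<longlongrightarrow> 0 * b + a) (at_right 0)"
     using 1 by (simp add: filterlim_at_split)
    show "\<forall>\<^sub>F h in at_right 0. p \<bullet> v <= h * (dq2 v z a h) + a"
     unfolding eventually_at_right_field using eq sg by (intro exI[of _ 1]) (auto simp: pos_le_divide_eq mult.commute)
   qed simp
   moreover have "0 * b + a <= p \<bullet> v"
   proof (rule tendsto_upperbound)
    show "((\<lambda>h. h * (dq2 v z a h) + a) \<longlongrightarrow> 0 * b + a) (at_left 0)"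
     using 1 by (simp add: filterlim_at_split)
    show "\<forall>\<^sub>F h in at_left 0. h * (dq2 v z a h) + a <= p \<bullet> v"
     unfolding eventually_at_left_field using eq sg by (intro exI[of _ "-1"]) (auto simp: neg_divide_le_eq mult.commute)
   qed simp
   ultimately have "a = p \<bullet> v" by simp
   then show ?thesis using ab by blast
  qed
  then obtain g L where "!!u u'. norm u <= 3 ==> norm u' <= 3 ==> abs (g u - g u') <= L * norm (u - u')" "0 <= L"
  "!!c u. 0 <= c ==> g (c *\<^sub>R u) = c\<^sup>2 * g u" "!!u. 0 <= g u"
  "!!e. 0 < e ==> \<exists>d>0. \<forall>w. norm w < d --> abs (F (fst z) (snd z + w) - F (fst z) (snd z) - p \<bullet> w - g w) <= e * (norm w)\<^sup>2"
   using second_order_expansion[OF subdiff p V(2)] by blast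
  then show ?case unfolding y_expansion_def using p by blast
 qed
qed

definition accurate :: "real => real => real \<times> 'a => real => 'a => ('a => real) => bool" where
 "accurate e d z c p g \<longleftrightarrow>
   (\<forall>h. abs h < d --> abs (F (fst z + h) (snd z) - F (fst z) (snd z) - c * h) <= e * abs h) \<and>
   (\<forall>w. norm w < d --> abs (F (fst z) (snd z + w) - F (fst z) (snd z) - p \<bullet> w - g w) <= e * (norm w)\<^sup>2)"

text \<open>Near a density point of the set of points with uniformly accurate expansions the separate
 expansions in \<open>t\<close> and \<open>y\<close> combine into a joint one.\<close>

lemma joint_expansion:
 assumes g: "y_expansion z p g L"
  and G: "!!z'. z' \<in> G ==> \<exists>c' p' g'. accurate e d z' c' p' g' \<and> abs (c' - c) <= e" and d: "0 < d"
  and acc: "accurate e d z c p g"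
  and por: "!!\<eta>. 0 < \<eta> ==> \<forall>\<^sub>F h in at_right 0. \<forall>z'\<in>pbox h z. pbox (\<eta> * h) z' \<inter> G \<noteq> {}"
  and e: "0 < e"
 shows "\<exists>h0>0. \<forall>h l u. 0 < h --> h < h0 --> abs l <= h\<^sup>2 --> norm u <= h -->
  abs (F (fst z + l) (snd z + u) - F (fst z) (snd z) - c * l - p \<bullet> u - g u) <= 49 * e * h\<^sup>2"
proof -
 have L: "0 <= L" using g by (simp add: y_expansion_def)
 define \<eta> where "\<eta> = min (1/8) (e / (L + 1))"
 have \<eta>: "0 < \<eta>" "\<eta> <= 1/8" "L * \<eta> <= e"
 proof -
  show "0 < \<eta>" using e L by (auto simp: \<eta>_def)
  show "\<eta> <= 1/8" unfolding \<eta>_def by (rule min.cobounded1)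
  have "L * \<eta> <= (L + 1) * (e / (L + 1))" using e L by (intro mult_mono) (auto simp: \<eta>_def)
  also have "... = e" using L by (simp add: field_simps)
  finally show "L * \<eta> <= e" .
 qed
 obtain r where r: "r > 0" "!!h. 0 < h ==> h < r ==> \<forall>z'\<in>pbox h z. pbox (\<eta>/4 * h) z' \<inter> G \<noteq> {}"
  using por[of "\<eta>/4"] \<eta>(1) unfolding eventually_at_right_field by auto
 define h0 where "h0 = min (r/4) (min 1 (d/4))"
 have h0: "h0 > 0" using r d by (simp add: h0_def)
 have "abs (F (fst z + l) (snd z + u) - F (fst z) (snd z) - c * l - p \<bullet> u - g u) <= 49 * e * h\<^sup>2"
  if h: "0 < h" "h < h0" and l: "abs l <= h\<^sup>2" and u: "norm u <= h" for h l u
 proof -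
  have h': "4 * h < r" "4 * h < d" "h < 1" using h by (auto simp: h0_def)
  have h2: "h\<^sup>2 <= h" using h h' by (simp add: power2_eq_square mult_left_le)
  \<comment> \<open>The slice at time \<open>fst z + l\<close>, rescaled to unit size. It is convex,
    so it is compared with \<open>g\<close> on the net \<open>D\<close> of rescaled positions of
    points of \<open>G\<close>.\<close>
  define f where "f v = (F (fst z + l) (snd z + h *\<^sub>R v) - (F (fst z) (snd z) + c * l) - (h *\<^sub>R p) \<bullet> v) / h\<^sup>2" for v
  have fs: "subdifferentiable f" unfolding f_def by (rule subdifferentiable_affine[OF subdiff h(1)])
  define D where "D = {v. \<exists>t1. (t1, snd z + h *\<^sub>R v) \<in> G \<and> abs (t1 - fst z) < h\<^sup>2}"
  have "abs (f ((1/h) *\<^sub>R u) - g ((1/h) *\<^sub>R u)) <= 3 * (13 * e) + 10 * L * \<eta>"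
  proof (rule subdifferentiable_near[OF fs _ _ _ \<eta>(1,2) L])
   show "abs (g u - g u') <= L * norm (u - u')" if "norm u <= 3" "norm u' <= 3" for u u'
    using g that by (simp add: y_expansion_def)
   show "norm ((1/h) *\<^sub>R u) <= 1" using u h by simp
   show "\<exists>v'\<in>D. norm (v' - v) <= \<eta>" if v: "norm v <= 5/2" for v
   proof -
    have "(fst z, snd z + h *\<^sub>R v) \<in> pbox (4 * h) z" using v h by (simp add: mem_pbox)
    then obtain w where w: "w \<in> G" "w \<in> pbox (\<eta>/4 * (4 * h)) (fst z, snd z + h *\<^sub>R v)"
     using r(2)[of "4 * h"] h(1) h'(1) by (meson Int_emptyI mult_pos_pos zero_less_numeral)
    have w': "abs (fst w - fst z) < (\<eta> * h)\<^sup>2" "norm (snd w - (snd z + h *\<^sub>R v)) < \<eta> * h"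
     using w(2) by (auto simp: mem_pbox)
    have "(\<eta> * h)\<^sup>2 <= h\<^sup>2" using \<eta> h by (intro power_mono) (auto simp: mult_left_le_one_le)
    define v' where "v' = (1/h) *\<^sub>R (snd w - snd z)"
    have v': "snd z + h *\<^sub>R v' = snd w" using h by (simp add: v'_def)
    have "(fst w, snd z + h *\<^sub>R v') \<in> G" using v' w(1) by simp
    then have "v' \<in> D" unfolding D_def using w'(1) \<open>(\<eta> * h)\<^sup>2 <= h\<^sup>2\<close> by (auto intro!: exI[of _ "fst w"])
    moreover have "v' - v = (1/h) *\<^sub>R (snd w - (snd z + h *\<^sub>R v))" using h by (simp add: v'_def algebra_simps)
    then have "norm (v' - v) = (1/h) * norm (snd w - (snd z + h *\<^sub>R v))" using h by simp
    then have "norm (v' - v) <= \<eta>" using w'(2) h(1) by (simp add: pos_divide_le_eq less_imp_le)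
    ultimately show ?thesis by blast
   qed
   show "abs (f v - g v) <= 13 * e" if v: "v \<in> D" "norm v <= 3" for v
   proof -
    define y1 where "y1 = snd z + h *\<^sub>R v"
    obtain t1 where t1: "(t1, y1) \<in> G" "abs (t1 - fst z) < h\<^sup>2" using v(1) unfolding D_def y1_def by blast
    obtain c1 p1 g1 where c1: "accurate e d (t1, y1) c1 p1 g1" "abs (c1 - c) <= e" using G[OF t1(1)] by blast
    \<comment> \<open>From the good point \<open>(t1, y1)\<close> its \<open>t\<close>-expansion
      reaches both times \<open>fst z + l\<close> and \<open>fst z\<close>, with difference
      \<open>c1 * l\<close>; the \<open>y\<close>-expansion at \<open>z\<close> covers the rest. The
      errors \<open>2 + 1 + 1 + 9\<close> add up to 13 units of \<open>e * h^2\<close>.\<close>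
    define s1 where "s1 = fst z + l - t1"
    define s2 where "s2 = fst z - t1"
    have s: "abs s1 <= 2 * h\<^sup>2" "abs s2 <= h\<^sup>2" "s1 - s2 = l" using t1(2) l by (auto simp: s1_def s2_def)
    have sd: "abs s1 < d" "abs s2 < d" using s h2 h' h by linarith+
    have A: "abs (F (fst z + l) y1 - F t1 y1 - c1 * s1) <= e * (2 * h\<^sup>2)"
    proof -
     have "abs (F (t1 + s1) y1 - F t1 y1 - c1 * s1) <= e * abs s1" using c1(1) sd(1) unfolding accurate_def by simp
     also have "... <= e * (2 * h\<^sup>2)" using s(1) e by (intro mult_left_mono) auto
     finally show ?thesis by (simp add: s1_def)
    qed
    have B: "abs (F (fst z) y1 - F t1 y1 - c1 * s2) <= e * h\<^sup>2"
    proof -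
     have "abs (F (t1 + s2) y1 - F t1 y1 - c1 * s2) <= e * abs s2" using c1(1) sd(2) unfolding accurate_def by simp
     also have "... <= e * h\<^sup>2" using s(2) e by (intro mult_left_mono) auto
     finally show ?thesis by (simp add: s2_def)
    qed
    have C: "abs (c1 * l - c * l) <= e * h\<^sup>2"
    proof -
     have "abs (c1 * l - c * l) = abs (c1 - c) * abs l" by (simp flip: abs_mult add: left_diff_distrib)
     also have "... <= e * h\<^sup>2" using c1(2) l e by (intro mult_mono) auto
     finally show ?thesis .
    qed
    have nw: "norm (h *\<^sub>R v) <= 3 * h" using v(2) h by (simp add: mult.commute)
    have E: "abs (F (fst z) y1 - F (fst z) (snd z) - p \<bullet> (h *\<^sub>R v) - g (h *\<^sub>R v)) <= e * (9 * h\<^sup>2)"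
    proof -
     have "norm (h *\<^sub>R v) < d" using nw h' h by linarith
     then have "abs (F (fst z) (snd z + h *\<^sub>R v) - F (fst z) (snd z) - p \<bullet> (h *\<^sub>R v) - g (h *\<^sub>R v)) <= e * (norm (h *\<^sub>R v))\<^sup>2"
      using acc unfolding accurate_def by blast
     also have "... <= e * (3 * h)\<^sup>2" using nw e by (intro mult_left_mono power_mono) auto
     finally show ?thesis by (simp add: y1_def power_mult_distrib)
    qed
    have gs: "g (h *\<^sub>R v) = h\<^sup>2 * g v" using g h(1) by (simp add: y_expansion_def)
    have "c1 * s1 - c1 * s2 = c1 * l" using s(3) by (simp flip: right_diff_distrib)
    then have "abs (F (fst z + l) y1 - (F (fst z) (snd z) + c * l) - (h *\<^sub>R p) \<bullet> v - h\<^sup>2 * g v) <= 13 * (e * h\<^sup>2)"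
     using A B C E unfolding gs inner_scaleR_left inner_scaleR_right by (simp only: abs_le_iff) linarith
    moreover have "f v - g v = (F (fst z + l) y1 - (F (fst z) (snd z) + c * l) - (h *\<^sub>R p) \<bullet> v - h\<^sup>2 * g v) / h\<^sup>2"
     using h by (simp add: f_def y1_def diff_divide_distrib)
    ultimately show ?thesis using h by (simp add: abs_divide divide_le_eq mult.assoc)
   qed
  qed
  also have "... <= 49 * e" using \<eta>(3) by simp
  finally have fin: "abs (f ((1/h) *\<^sub>R u) - g ((1/h) *\<^sub>R u)) <= 49 * e" .
  have "g ((1/h) *\<^sub>R u) = (1/h)\<^sup>2 * g u" using g h(1) by (simp add: y_expansion_def)
  then have "(f ((1/h) *\<^sub>R u) - g ((1/h) *\<^sub>R u)) * h\<^sup>2 = F (fst z + l) (snd z + u) - F (fst z) (snd z) - c * l - p \<bullet> u - g u"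
   using h(1) by (simp add: f_def power_divide field_simps)
  then have "abs (F (fst z + l) (snd z + u) - F (fst z) (snd z) - c * l - p \<bullet> u - g u) = abs (f ((1/h) *\<^sub>R u) - g ((1/h) *\<^sub>R u)) * h\<^sup>2"
   by (metis abs_mult abs_power2)
  also have "... <= 49 * e * h\<^sup>2" using fin by (intro mult_right_mono) auto
  finally show ?thesis .
 qed
 then show ?thesis using h0 by blast
qed

text \<open>Comparing the expansions at two nearby points shows that the second difference of \<open>g\<close> is linear.\<close>

lemma second_difference_affine:
 assumes g: "y_expansion z p g L"
  and J: "!!e. 0 < e ==> \<exists>h0>0. \<forall>h \<tau> u. 0 < h --> h < h0 --> abs \<tau> <= h\<^sup>2 --> norm u <= h -->
   abs (F (fst z + \<tau>) (snd z + u) - F (fst z) (snd z) - c * \<tau> - p \<bullet> u - g u) <= e * h\<^sup>2"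
  and G: "!!e. 0 < e ==> \<exists>G d. 0 < d \<and>
    (\<forall>z'\<in>G. \<exists>c' p' g' L'. y_expansion z' p' g' L' \<and> accurate e d z' c' p' g' \<and> (\<forall>w\<in>W. abs (g' w - g w) <= e)) \<and>
    (filled G z)"
  and W: "!!w. w \<in> W ==> norm w <= 1" and x: "norm x <= 1" and e: "0 < e"
 shows "\<exists>a l. \<forall>w\<in>W. abs (g (x + w) - a - l \<bullet> w - g w) <= e"
proof -
 have L: "0 <= L" using g by (simp add: y_expansion_def)
 have lip: "abs (g u - g u') <= L * norm (u - u')" if "norm u <= 3" "norm u' <= 3" for u u'
  using g that unfolding y_expansion_def by blast
 define e' where "e' = e / 20"
 have e': "0 < e'" "e = 20 * e'" using e by (auto simp: e'_def)
 from assms(3)[OF e'(1)] obtain G d where G0: "0 < d" "\<forall>z'\<in>G. \<exists>c' p' g' L'. y_expansion z' p' g' L' \<and> accurate e' d z' c' p' g' \<and> (\<forall>w\<in>W. abs (g' w - g w) <= e')"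
  "filled G z"
  by (elim exE conjE) (rule that)
 note G = G0(1) G0(2,3)[rule_format]
 obtain h0 where h0: "h0 > 0" "!!h \<tau> u. 0 < h ==> h < h0 ==> abs \<tau> <= h\<^sup>2 ==> norm u <= h ==>
   abs (F (fst z + \<tau>) (snd z + u) - F (fst z) (snd z) - c * \<tau> - p \<bullet> u - g u) <= e' * h\<^sup>2"
  using J[OF e'(1)] by blast
 define \<eta> where "\<eta> = min (1/2) (e' / (L + 1))"
 have \<eta>: "0 < \<eta>" "\<eta> <= 1/2" "L * \<eta> <= e'"
 proof -
  show "0 < \<eta>" using e' L by (auto simp: \<eta>_def)
  show "\<eta> <= 1/2" unfolding \<eta>_def by (rule min.cobounded1)
  have "L * \<eta> <= (L + 1) * (e' / (L + 1))" using e' L by (intro mult_mono) (auto simp: \<eta>_def)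
  also have "... = e'" using L by (simp add: field_simps)
  finally show "L * \<eta> <= e'" .
 qed
 obtain r where r: "r > 0" "!!h. 0 < h ==> h < r ==> \<forall>z'\<in>pbox h z. pbox (\<eta>/2 * h) z' \<inter> G \<noteq> {}"
  using G(3)[of "\<eta>/2"] \<eta>(1) unfolding eventually_at_right_field by auto
 define h where "h = min (r/4) (min (h0/4) (d/4))"
 have h: "0 < h" "2 * h < r" "3 * h < h0" "2 * h < d" using r(1) h0(1) G(1) by (auto simp: h_def)
 have "norm (h *\<^sub>R x) <= h" using x h(1) by (simp add: mult_left_le)
 then have "(fst z, snd z + h *\<^sub>R x) \<in> pbox (2 * h) z" using h(1) unfolding mem_pbox by simp
 \<comment> \<open>A good point near the one displaced by \<open>h *\<^sub>R x\<close>. Its own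
   expansion and the joint expansion at \<open>z\<close> describe the same values of
   \<open>F\<close> around it, so \<open>g (x + w) - g w\<close> agrees with an affine function of
   \<open>w\<close> up to the errors.\<close>
 then obtain z1 where z1: "z1 \<in> G" "z1 \<in> pbox (\<eta>/2 * (2 * h)) (fst z, snd z + h *\<^sub>R x)"
  using r(2)[of "2 * h"] h(1,2) by (meson Int_emptyI mult_pos_pos zero_less_numeral)
 have z1': "abs (fst z1 - fst z) < (\<eta> * h)\<^sup>2" "norm (snd z1 - (snd z + h *\<^sub>R x)) < \<eta> * h" using z1(2) by (auto simp: mem_pbox)
 obtain c1 p1 g1 L1 where y1: "y_expansion z1 p1 g1 L1" and c1: "accurate e' d z1 c1 p1 g1" "!!w. w \<in> W ==> abs (g1 w - g w) <= e'" using G(2)[OF z1(1)] by blast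
 define x' where "x' = (1/h) *\<^sub>R (snd z1 - snd z)"
 have x'z: "snd z1 = snd z + h *\<^sub>R x'" using h by (simp add: x'_def)
 have "x' - x = (1/h) *\<^sub>R (snd z1 - (snd z + h *\<^sub>R x))" using h by (simp add: x'_def algebra_simps)
 then have "norm (x' - x) = (1/h) * norm (snd z1 - (snd z + h *\<^sub>R x))" using h by simp
 then have x'x: "norm (x' - x) <= \<eta>" using z1'(2) h(1) by (simp add: pos_divide_le_eq less_imp_le)
 have nx': "norm x' <= 3/2" using norm_triangle_ineq[of "x' - x" x] x'x x \<eta> by simp
 have "(\<eta> * h)\<^sup>2 <= (3 * h)\<^sup>2" using \<eta> h by (intro power_mono mult_right_mono) auto
 then have \<tau>: "abs (fst z1 - fst z) <= (3 * h)\<^sup>2" using z1'(1) by linarith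
 define a where "a = (F (fst z1) (snd z1) - F (fst z) (snd z) - c * (fst z1 - fst z) - p \<bullet> (h *\<^sub>R x')) / h\<^sup>2"
 define l where "l = (1/h) *\<^sub>R (p1 - p)"
 have "abs (g (x + w) - a - l \<bullet> w - g w) <= e" if w: "w \<in> W" for w
 proof -
  have nw: "norm w <= 1" by (rule W[OF w])
  have hom: "g (h *\<^sub>R v) = h\<^sup>2 * g v" for v using g h(1) by (simp add: y_expansion_def)
  have nxw: "norm (x' + w) <= 5/2" using norm_triangle_ineq[of x' w] nx' nw by simp
  have "norm (h *\<^sub>R (x' + w)) <= 3 * h" using nxw h(1) by (simp add: mult.commute)
  then have A: "abs (F (fst z + (fst z1 - fst z)) (snd z + h *\<^sub>R (x' + w)) - F (fst z) (snd z) - c * (fst z1 - fst z) - p \<bullet> (h *\<^sub>R (x' + w)) - g (h *\<^sub>R (x' + w))) <= e' * (3 * h)\<^sup>2"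
   using h \<tau> by (intro h0(2)) auto
  have nw': "norm (h *\<^sub>R w) <= h" using nw h(1) by (simp add: mult_left_le)
  then have "norm (h *\<^sub>R w) < d" using h by linarith
  then have "abs (F (fst z1) (snd z1 + h *\<^sub>R w) - F (fst z1) (snd z1) - p1 \<bullet> (h *\<^sub>R w) - g1 (h *\<^sub>R w)) <= e' * (norm (h *\<^sub>R w))\<^sup>2"
   using c1(1) unfolding accurate_def by blast
  also have "... <= e' * h\<^sup>2" using nw' e' by (intro mult_left_mono power_mono) auto
  finally have B: "abs (F (fst z1) (snd z1 + h *\<^sub>R w) - F (fst z1) (snd z1) - p1 \<bullet> (h *\<^sub>R w) - g1 (h *\<^sub>R w)) <= e' * h\<^sup>2" .
  have hom1: "g1 (h *\<^sub>R w) = h\<^sup>2 * g1 w" using y1 h(1) by (simp add: y_expansion_def)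
  have "norm (x + w) <= 3" using norm_triangle_ineq[of x w] x nw by simp
  then have "abs (g (x' + w) - g (x + w)) <= L * norm ((x' + w) - (x + w))" using nxw by (intro lip) auto
  also have "... <= L * \<eta>" using x'x L by (intro mult_left_mono) auto
  finally have "abs (g (x' + w) - g (x + w)) <= e'" using \<eta>(3) by simp
  from abs_scale[OF this] have D: "abs (h\<^sup>2 * g (x' + w) - h\<^sup>2 * g (x + w)) <= e' * h\<^sup>2"
   by (simp only: right_diff_distrib)
  from abs_scale[OF c1(2)[OF w]] have C: "abs (h\<^sup>2 * g1 w - h\<^sup>2 * g w) <= e' * h\<^sup>2"
   by (simp only: right_diff_distrib)
  have E: "h\<^sup>2 * a = F (fst z1) (snd z1) - F (fst z) (snd z) - c * (fst z1 - fst z) - p \<bullet> (h *\<^sub>R x')"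
   "h\<^sup>2 * (l \<bullet> w) = p1 \<bullet> (h *\<^sub>R w) - p \<bullet> (h *\<^sub>R w)"
   using h(1) by (simp_all add: a_def l_def inner_diff_left power2_eq_square) (simp add: right_diff_distrib)
  have pos: "snd z + h *\<^sub>R (x' + w) = snd z1 + h *\<^sub>R w" by (simp add: x'z algebra_simps)
  have "e' * (3 * h)\<^sup>2 = 9 * (e' * h\<^sup>2)" by (simp add: power_mult_distrib)
  then have A': "abs (F (fst z1) (snd z1 + h *\<^sub>R w) - F (fst z) (snd z) - c * (fst z1 - fst z) - (p \<bullet> (h *\<^sub>R x') + p \<bullet> (h *\<^sub>R w)) - h\<^sup>2 * g (x' + w)) <= 9 * (e' * h\<^sup>2)"
   using A unfolding pos hom by (simp add: scaleR_add_right inner_add_right)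
  have pos': "0 <= e' * h\<^sup>2" using e' by simp
  have "abs (h\<^sup>2 * g (x + w) - h\<^sup>2 * a - h\<^sup>2 * (l \<bullet> w) - h\<^sup>2 * g w) <= 20 * (e' * h\<^sup>2)"
   using A' B C D pos' unfolding E hom1 abs_le_iff by linarith
  then have "abs (h\<^sup>2 * (g (x + w) - a - l \<bullet> w - g w)) <= e * h\<^sup>2"
   unfolding e'(2) by (simp only: right_diff_distrib mult.assoc)
  then show ?thesis using abs_unscale h(1) by blast
 qed
 then show ?thesis by blast
qed

definition parabolic_expansion :: "real \<times> 'a => real => 'a => ('a => 'a) => bool" where
 "parabolic_expansion z c p N \<longleftrightarrow> subgradient (F (fst z)) (snd z) p \<and> linear N \<and> (\<forall>u v. N u \<bullet> v = u \<bullet> N v) \<and> (\<forall>u. 0 <= N u \<bullet> u) \<and>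
   (\<forall>e>0. \<exists>d0>0. \<forall>d r u. 0 < d --> d < d0 --> abs r <= d\<^sup>2 --> norm u <= d -->
   abs (F (fst z + r) (snd z + u) - F (fst z) (snd z) - c * r - p \<bullet> u - N u \<bullet> u / 2) <= e * d\<^sup>2)"

text \<open>The approximating functional may change with the precision; comparing its values at
  \<open>w\<close> and at the basis vectors eliminates it.\<close>

lemma linear_from_approx:
 fixes h :: "'a => real"
 assumes "!!e. 0 < e ==> \<exists>l. \<forall>v\<in>insert w Basis. abs (h v - l \<bullet> v) <= e"
 shows "h w = (\<Sum>b\<in>Basis. (w \<bullet> b) * h b)"
proof (rule ccontr)
 define S where "S = 1 + (\<Sum>b\<in>Basis. abs (w \<bullet> b))"
 have S: "0 < S" unfolding S_def by (intro add_pos_nonneg sum_nonneg) auto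
 assume "\<not> ?thesis"
 then have d: "0 < abs (h w - (\<Sum>b\<in>Basis. (w \<bullet> b) * h b)) / (2 * S)" using S by simp
 obtain l where l: "!!v. v \<in> insert w Basis ==> abs (h v - l \<bullet> v) <= abs (h w - (\<Sum>b\<in>Basis. (w \<bullet> b) * h b)) / (2 * S)"
  using assms[OF d] by blast
 have lw: "l \<bullet> w = (\<Sum>b\<in>Basis. (w \<bullet> b) * (l \<bullet> b))" by (subst euclidean_inner) (simp add: mult.commute)
 have "h w - (\<Sum>b\<in>Basis. (w \<bullet> b) * h b) = (h w - l \<bullet> w) - (\<Sum>b\<in>Basis. (w \<bullet> b) * (h b - l \<bullet> b))"
  unfolding lw by (simp add: right_diff_distrib sum_subtractf)
 also have "abs (...) <= abs (h w - l \<bullet> w) + (\<Sum>b\<in>Basis. abs (w \<bullet> b) * abs (h b - l \<bullet> b))"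
  by (rule order_trans[OF abs_triangle_ineq4 add_left_mono]) (simp only: abs_mult[symmetric] sum_abs)
 also have "... <= abs (h w - (\<Sum>b\<in>Basis. (w \<bullet> b) * h b)) / (2 * S) + (\<Sum>b\<in>Basis. abs (w \<bullet> b) * (abs (h w - (\<Sum>b\<in>Basis. (w \<bullet> b) * h b)) / (2 * S)))"
  using l by (intro add_mono sum_mono mult_left_mono) auto
 also have "... = S * (abs (h w - (\<Sum>b\<in>Basis. (w \<bullet> b) * h b)) / (2 * S))"
  unfolding S_def sum_distrib_right[symmetric] by (simp only: distrib_right mult_1)
 also have "... = abs (h w - (\<Sum>b\<in>Basis. (w \<bullet> b) * h b)) / 2" using S by simp
 finally show False using d S by (simp add: zero_less_divide_iff)
qed

text \<open>At every precision the polarization \<open>B\<close> is close to a linear function of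
  \<open>w\<close>. Exact linearity follows for \<open>w\<close> in the dense set, by Lipschitz
  continuity inside the unit ball, and by homogeneity everywhere. Symmetry makes \<open>B\<close>
  bilinear, and \<open>g (2 *\<^sub>R u) = 4 * g u\<close> recovers \<open>g\<close> from
  it.\<close>

lemma quadratic_form:
 fixes g :: "'a => real"
 assumes V: "!!S. open S ==> S \<noteq> {} ==> \<exists>v\<in>V. v \<in> S"
  and hom: "!!c u. 0 <= c ==> g (c *\<^sub>R u) = c\<^sup>2 * g u"
  and lip: "!!u u'. norm u <= 3 ==> norm u' <= 3 ==> abs (g u - g u') <= L * norm (u - u')" and L: "0 <= L"
  and app: "!!w x e. w \<in> V ==> norm w <= 1 ==> norm x <= 1 ==> 0 < e ==>
    \<exists>a l. \<forall>v\<in>insert 0 (insert w Basis). abs (g (x + v) - a - l \<bullet> v - g v) <= e"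
 obtains N where "linear N" "!!u v. N u \<bullet> v = u \<bullet> N v" "!!u. g u = N u \<bullet> u / 2"
proof -
 define B where "B x w = g (x + w) - g x - g w" for x w
 have g0: "g 0 = 0" using hom[of 0 0] by simp
 have lin1: "B x w = (\<Sum>b\<in>Basis. (w \<bullet> b) * B x b)" if w: "w \<in> V" "norm w <= 1" and x: "norm x <= 1" for x w
 proof (rule linear_from_approx)
  fix e :: real assume "0 < e"
  then have "0 < e/2" by simp
  from app[OF w x this] obtain a l where al: "\<forall>v\<in>insert 0 (insert w Basis). abs (g (x + v) - a - l \<bullet> v - g v) <= e/2"
   by (elim exE)
  have "abs (B x v - l \<bullet> v) <= e" if "v \<in> insert w Basis" for v
  proof -
   have "abs (g (x + v) - a - l \<bullet> v - g v) <= e/2" using al that by blast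
   \<comment> \<open>Evaluation at \<open>v = 0\<close> identifies the affine constant with
     \<open>g x\<close>.\<close>
   moreover have "abs (g x - a) <= e/2" using al g0 by simp
   ultimately show ?thesis unfolding B_def by linarith
  qed
  then show "\<exists>l. \<forall>v\<in>insert w Basis. abs (B x v - l \<bullet> v) <= e" by blast
 qed
 have glim: "(\<lambda>n. g (s n)) \<longlonglongrightarrow> g u" if s: "s \<longlonglongrightarrow> u" and u: "norm u < 3" for s u
 proof -
  have "(\<lambda>n. L * norm (s n - u)) \<longlonglongrightarrow> L * norm (u - u)" by (intro tendsto_intros s)
  then have 0: "(\<lambda>n. L * norm (s n - u)) \<longlonglongrightarrow> 0" by simp
  have "\<forall>\<^sub>F n in sequentially. norm (s n) < 3" using order_tendstoD(2)[OF tendsto_norm[OF s] u] .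
  then have "\<forall>\<^sub>F n in sequentially. norm (g (s n) - g u) <= L * norm (s n - u)"
   by eventually_elim (use lip[of _ u] u in auto)
  then have "(\<lambda>n. g (s n) - g u) \<longlonglongrightarrow> 0" by (rule Lim_null_comparison[OF _ 0])
  then show ?thesis by (simp add: LIM_zero_iff)
 qed
 have lin2: "B x w = (\<Sum>b\<in>Basis. (w \<bullet> b) * B x b)" if w: "norm w < 1" and x: "norm x <= 1" for x w
 proof -
  have "\<exists>v\<in>V. norm (v - w) < min (1 / real (Suc n)) (1 - norm w)" for n
  proof -
   have "0 < min (1 / real (Suc n)) (1 - norm w)" using w by simp
   then have "ball w (min (1 / real (Suc n)) (1 - norm w)) \<noteq> {}" by (metis ball_eq_empty not_le)
   then obtain v where "v \<in> V" "v \<in> ball w (min (1 / real (Suc n)) (1 - norm w))" using V open_ball by blast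
   then show ?thesis by (auto simp: dist_norm norm_minus_commute intro!: bexI[of _ v])
  qed
  then obtain s where s: "!!n. s n \<in> V" "!!n. norm (s n - w) < min (1 / real (Suc n)) (1 - norm w)" by metis
  have "(\<lambda>n. s n - w) \<longlonglongrightarrow> 0"
  proof (rule Lim_null_comparison)
   show "(\<lambda>n. 1 / real (Suc n)) \<longlonglongrightarrow> 0" using LIMSEQ_inverse_real_of_nat by (simp add: inverse_eq_divide)
   show "\<forall>\<^sub>F n in sequentially. norm (s n - w) <= 1 / real (Suc n)" using s(2) by (simp add: less_imp_le)
  qed
  then have sw: "s \<longlonglongrightarrow> w" by (simp add: LIM_zero_iff)
  have ns: "norm (s n) <= 1" for n using norm_triangle_ineq[of "s n - w" w] s(2)[of n] by simp
  have "(\<lambda>n. B x (s n)) \<longlonglongrightarrow> B x w" unfolding B_def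
   using norm_triangle_ineq[of x w] w x by (intro tendsto_diff tendsto_const glim tendsto_add sw) auto
  moreover have "(\<lambda>n. \<Sum>b\<in>Basis. (s n \<bullet> b) * B x b) \<longlonglongrightarrow> (\<Sum>b\<in>Basis. (w \<bullet> b) * B x b)" by (intro tendsto_intros sw)
  ultimately show ?thesis using lin1[OF s(1) ns x] LIMSEQ_unique by simp
 qed
 have Bhom: "B (c *\<^sub>R x) (c *\<^sub>R w) = c\<^sup>2 * B x w" if "0 <= c" for c x w
  unfolding B_def scaleR_add_right[symmetric] using hom[OF that] by (simp add: right_diff_distrib)
 have lin: "B x w = (\<Sum>b\<in>Basis. (w \<bullet> b) * B x b)" for x w
 proof -
  define c where "c = 1 / (2 + norm x + norm w)"
  have n: "0 <= norm x" "0 <= norm w" by auto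
  have c: "0 < c" "norm (c *\<^sub>R w) < 1" "norm (c *\<^sub>R x) <= 1" "c < 1" 
  proof -
   have D: "0 < 2 + norm x + norm w" using n by linarith
   then show "0 < c" by (simp add: c_def)
   have "norm (c *\<^sub>R w) = norm w / (2 + norm x + norm w)" "norm (c *\<^sub>R x) = norm x / (2 + norm x + norm w)"
    using D by (simp_all add: c_def)
   then show "norm (c *\<^sub>R w) < 1" "norm (c *\<^sub>R x) <= 1" using n D by (simp_all only: divide_less_eq_1_pos divide_le_eq_1_pos)
   show "c < 1" unfolding c_def using n D by (simp only: divide_less_eq_1_pos)
  qed
  have e1: "B (c *\<^sub>R x) (c *\<^sub>R w) = (\<Sum>b\<in>Basis. (w \<bullet> b) * (c * B (c *\<^sub>R x) b))"
   using lin2[OF c(2,3)] by (simp add: mult.left_commute mult.assoc)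
  have "c * B (c *\<^sub>R x) b = B (c *\<^sub>R x) (c *\<^sub>R b)" if b: "b \<in> Basis" for b
  proof -
   have "norm (c *\<^sub>R b) < 1" using b c by simp
   have "B (c *\<^sub>R x) (c *\<^sub>R b) = (\<Sum>b'\<in>Basis. if b' = b then c * B (c *\<^sub>R x) b else 0)"
    unfolding lin2[OF \<open>norm (c *\<^sub>R b) < 1\<close> c(3)] using b by (intro sum.cong) (auto simp: inner_Basis)
   then show ?thesis using b by simp
  qed
  then have "B (c *\<^sub>R x) (c *\<^sub>R w) = (\<Sum>b\<in>Basis. (w \<bullet> b) * B (c *\<^sub>R x) (c *\<^sub>R b))" unfolding e1 by simp
  then have "c\<^sup>2 * B x w = c\<^sup>2 * (\<Sum>b\<in>Basis. (w \<bullet> b) * B x b)"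
   using Bhom c by (simp add: sum_distrib_left mult.left_commute)
  then show ?thesis using c by simp
 qed
 have Bsym: "B x w = B w x" for x w by (simp add: B_def add.commute)
 define N where "N x = (\<Sum>b\<in>Basis. B x b *\<^sub>R b)" for x
 have Nw: "N x \<bullet> w = B x w" for x w
 proof -
  have "N x \<bullet> w = (\<Sum>b\<in>Basis. (w \<bullet> b) * B x b)" unfolding N_def inner_sum_left inner_scaleR_left by (intro sum.cong) (simp_all add: inner_commute[of w])
  then show ?thesis by (simp add: lin[of x w])
 qed
 have "linear N"
 proof (rule linearI)
  show "N (x + y) = N x + N y" for x y
  proof (rule euclidean_eqI)
   fix b :: 'a assume "b \<in> Basis"
   show "N (x + y) \<bullet> b = (N x + N y) \<bullet> b"
    unfolding inner_add_left Nw Bsym[of _ b] by (subst (1 2 3) lin) (simp add: inner_add_left distrib_right sum.distrib)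
  qed
  show "N (r *\<^sub>R x) = r *\<^sub>R N x" for r x
  proof (rule euclidean_eqI)
   fix b :: 'a assume "b \<in> Basis"
   show "N (r *\<^sub>R x) \<bullet> b = (r *\<^sub>R N x) \<bullet> b"
    unfolding inner_scaleR_left Nw Bsym[of _ b] by (subst (1 2) lin) (simp add: sum_distrib_left mult.assoc)
  qed
 qed
 moreover have "N u \<bullet> v = u \<bullet> N v" for u v using Nw Bsym by (simp add: inner_commute)
 moreover have "g u = N u \<bullet> u / 2" for u
  using hom[of 2 u] unfolding Nw B_def by (simp add: scaleR_2)
 ultimately show ?thesis by (rule that)
qed

text \<open>Points are sorted into countably many classes by accuracy, radius of validity, rounded
  \<open>c\<close> and rounded values of \<open>g\<close> on a finite set. The classes may be
  non-measurable, but almost every point is \<open>filled\<close> for each class containing it, so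
  it has good points with nearly the same coefficients at every relative scale.\<close>

theorem AE_parabolic_expansion: "AE z in lborel. \<exists>c p N. parabolic_expansion z c p N"
proof -
 obtain V :: "'a set" where V: "countable V" "!!S. open S ==> S \<noteq> {} ==> \<exists>v\<in>V. v \<in> S"
  using countable_dense_setE by blast
 define good where "good z \<longleftrightarrow> (\<exists>c. t_expansion z c) \<and> (\<exists>p g L. y_expansion z p g L)" for z
 have "\<exists>c p g L. good z --> t_expansion z c \<and> y_expansion z p g L" for z unfolding good_def by blast
 then obtain c p g L where cpg: "!!z. good z ==> t_expansion z (c z)" "!!z. good z ==> y_expansion z (p z) (g z) (L z)" by metis
 define W where "W w = insert 0 (insert w (Basis :: 'a set))" for w
 define G where "G n k w j r = {z. good z \<and> accurate (1 / real (Suc n)) (1 / real (Suc k)) z (c z) (p z) (g z) \<and>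
   \<lfloor>c z * real (Suc n)\<rfloor> = j \<and> restrict (\<lambda>v. \<lfloor>g z v * real (Suc n)\<rfloor>) (W w) = r}" for n k :: nat and w :: 'a and j :: int and r
 have "AE z in lborel. \<forall>n k. \<forall>w\<in>V. \<forall>j. \<forall>r\<in>PiE (W w) (\<lambda>_. UNIV). z \<in> G n k w j r -->
   (filled (G n k w j r) z)"
  by (intro AE_all_countable[THEN iffD2] allI AE_ball_countable[THEN iffD2] ballI V countable_PiE pbox_not_porous)
   (auto simp: W_def)
 moreover have "AE z in lborel. good z" using AE_t_expansion AE_y_expansion by eventually_elim (auto simp: good_def)
 ultimately show ?thesis
 proof eventually_elim
  case (elim z)
  note y = cpg(2)[OF elim(2)]
  have floor: "abs (a - b) <= 1 / real (Suc n)" if "\<lfloor>a * real (Suc n)\<rfloor> = \<lfloor>b * real (Suc n)\<rfloor>" for a b :: real and n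
  proof -
   have "abs (a * real (Suc n) - b * real (Suc n)) <= 1" using that by linarith
   then have "abs (a - b) * real (Suc n) <= 1" by (simp only: left_diff_distrib[symmetric] abs_mult abs_of_nat)
   then show ?thesis by (simp add: pos_le_divide_eq)
  qed
  have key: "\<exists>G d. 0 < d \<and> accurate e d z (c z) (p z) (g z) \<and>
    (\<forall>z'\<in>G. \<exists>c' p' g' L'. y_expansion z' p' g' L' \<and> accurate e d z' c' p' g' \<and> abs (c' - c z) <= e \<and> (\<forall>v\<in>W w. abs (g' v - g z v) <= e)) \<and>
    (filled G z)" if e: "0 < e" and w: "w \<in> V" for e w
  proof -
   obtain n where n: "1 / real (Suc n) < e" using nat_approx_posE[OF e] by metis
   have n0: "0 < 1 / real (Suc n)" by simp
   obtain d1 where d1: "d1 > 0" "!!h. abs h < d1 ==> abs (F (fst z + h) (snd z) - F (fst z) (snd z) - c z * h) <= 1 / real (Suc n) * abs h"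
    using cpg(1)[OF elim(2)] n0 unfolding t_expansion_def by meson
   obtain d2 where d2: "d2 > 0" "!!w. norm w < d2 ==> abs (F (fst z) (snd z + w) - F (fst z) (snd z) - p z \<bullet> w - g z w) <= 1 / real (Suc n) * (norm w)\<^sup>2"
    using y n0 unfolding y_expansion_def by meson
   obtain k where k: "1 / real (Suc k) < min d1 d2" using nat_approx_posE[of "min d1 d2"] d1 d2 by auto
   have weaken: "accurate e d z' c' p' g'" if "accurate (1 / real (Suc n)) d z' c' p' g'" for d z' c' p' g'
    using that n unfolding accurate_def by (meson abs_ge_zero less_imp_le mult_right_mono order_trans zero_le_power2)
   have acc: "accurate (1 / real (Suc n)) (1 / real (Suc k)) z (c z) (p z) (g z)"
    unfolding accurate_def using d1(2) d2(2) k by auto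
   define j where "j = \<lfloor>c z * real (Suc n)\<rfloor>"
   define r where "r = restrict (\<lambda>v. \<lfloor>g z v * real (Suc n)\<rfloor>) (W w)"
   have zG: "z \<in> G n k w j r" unfolding G_def j_def r_def using acc elim(2) by simp
   have "r \<in> PiE (W w) (\<lambda>_. UNIV)" by (simp add: r_def)
   then have por: "filled (G n k w j r) z"
    using elim(1) w zG by blast
   have "\<exists>c' p' g' L'. y_expansion z' p' g' L' \<and> accurate e (1 / real (Suc k)) z' c' p' g' \<and> abs (c' - c z) <= e \<and> (\<forall>v\<in>W w. abs (g' v - g z v) <= e)"
    if z': "z' \<in> G n k w j r" for z'
   proof (intro exI conjI ballI)
    show "y_expansion z' (p z') (g z') (L z')" using z' cpg(2) by (simp add: G_def)
    show "accurate e (1 / real (Suc k)) z' (c z') (p z') (g z')" using z' weaken by (simp add: G_def)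
    have "abs (c z' - c z) <= 1 / real (Suc n)" using z' floor unfolding G_def j_def by blast
    then show "abs (c z' - c z) <= e" using n by linarith
    fix v assume v: "v \<in> W w"
    have "restrict (\<lambda>v. \<lfloor>g z' v * real (Suc n)\<rfloor>) (W w) v = restrict (\<lambda>v. \<lfloor>g z v * real (Suc n)\<rfloor>) (W w) v"
     using z' unfolding G_def r_def by simp
    then have "abs (g z' v - g z v) <= 1 / real (Suc n)" using v floor by simp
    then show "abs (g z' v - g z v) <= e" using n by linarith
   qed
   then show ?thesis using por weaken[OF acc] by (intro exI[of _ "G n k w j r"] exI[of _ "1 / real (Suc k)"]) auto
  qed
  obtain w0 where w0: "w0 \<in> V" using V(2)[of UNIV] by auto
  have J: "\<exists>\<delta>0>0. \<forall>\<delta> \<tau> u. 0 < \<delta> --> \<delta> < \<delta>0 --> abs \<tau> <= \<delta>\<^sup>2 --> norm u <= \<delta> -->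
   abs (F (fst z + \<tau>) (snd z + u) - F (fst z) (snd z) - c z * \<tau> - p z \<bullet> u - g z u) <= e * \<delta>\<^sup>2" if e: "0 < e" for e
  proof -
   have "0 < e / 49" using e by simp
   from key[OF this w0] obtain G d where G: "0 < d" "accurate (e/49) d z (c z) (p z) (g z)"
    "\<forall>z'\<in>G. \<exists>c' p' g' L'. y_expansion z' p' g' L' \<and> accurate (e/49) d z' c' p' g' \<and> abs (c' - c z) <= e/49 \<and> (\<forall>v\<in>W w0. abs (g' v - g z v) <= e/49)"
    "filled G z"
    by (elim exE conjE) (rule that)
   have "!!z'. z' \<in> G ==> \<exists>c' p' g'. accurate (e/49) d z' c' p' g' \<and> abs (c' - c z) <= e/49" using G(3) by blast
   from joint_expansion[OF y this G(1,2)] G(4) e show ?thesis by simp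
  qed
  have app: "\<exists>a l. \<forall>v\<in>W w. abs (g z (x + v) - a - l \<bullet> v - g z v) <= e" if w: "w \<in> V" "norm w <= 1" and x: "norm x <= 1" and e: "0 < e" for w x e
  proof (rule second_difference_affine[OF y J _ _ x e])
   show "norm v <= 1" if "v \<in> W w" for v using that w by (auto simp: W_def)
   fix e :: real assume e: "0 < e"
   from key[OF e w(1)] obtain G d where G: "0 < d" "accurate e d z (c z) (p z) (g z)"
    "\<forall>z'\<in>G. \<exists>c' p' g' L'. y_expansion z' p' g' L' \<and> accurate e d z' c' p' g' \<and> abs (c' - c z) <= e \<and> (\<forall>v\<in>W w. abs (g' v - g z v) <= e)"
    "filled G z"
    by (elim exE conjE) (rule that)
   have "\<forall>z'\<in>G. \<exists>c' p' g' L'. y_expansion z' p' g' L' \<and> accurate e d z' c' p' g' \<and> (\<forall>w\<in>W w. abs (g' w - g z w) <= e)"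
    using G(3) by meson
   then show "\<exists>G d. 0 < d \<and> (\<forall>z'\<in>G. \<exists>c' p' g' L'. y_expansion z' p' g' L' \<and> accurate e d z' c' p' g' \<and> (\<forall>w\<in>W w. abs (g' w - g z w) <= e)) \<and>
     (filled G z)"
    using G(1,4) by (intro exI conjI)
  qed
  obtain N where N: "linear N" "!!u v. N u \<bullet> v = u \<bullet> N v" "!!u. g z u = N u \<bullet> u / 2"
  proof (rule quadratic_form[OF V(2), of "g z" "L z"])
   show "g z (c *\<^sub>R u) = c\<^sup>2 * g z u" if "0 <= c" for c u using y that unfolding y_expansion_def by blast
   show "abs (g z u - g z u') <= L z * norm (u - u')" if "norm u <= 3" "norm u' <= 3" for u u' using y that unfolding y_expansion_def by blast
   show "0 <= L z" using y unfolding y_expansion_def by blast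
   show "\<exists>a l. \<forall>v\<in>insert 0 (insert w Basis). abs (g z (x + v) - a - l \<bullet> v - g z v) <= e"
    if "w \<in> V" "norm w <= 1" "norm x <= 1" "0 < e" for w x e using app[OF that] unfolding W_def .
  qed (assumption | rule that)+
  have "0 <= g z u" for u using y unfolding y_expansion_def by blast
  then have "0 <= N u \<bullet> u" for u using N(3)[of u] by (metis zero_le_divide_iff not_numeral_le_zero)
  moreover have "subgradient (F (fst z)) (snd z) (p z)" using y unfolding y_expansion_def by blast
  ultimately have "parabolic_expansion z (c z) (p z) N"
   unfolding parabolic_expansion_def N(3)[symmetric] using N(1,2) J by blast
  then show ?case by blast
 qed
qed

end

section \<open>Linear changes of variables\<close>

lemma nn_integral_swap:
 fixes f :: "'a::euclidean_space => 'b::euclidean_space => ennreal"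
 assumes "(\<lambda>z. f (fst z) (snd z)) \<in> borel_measurable borel"
 shows "(\<integral>\<^sup>+x. \<integral>\<^sup>+y. f x y \<partial>lborel \<partial>lborel) = (\<integral>\<^sup>+y. \<integral>\<^sup>+x. f x y \<partial>lborel \<partial>lborel)"
proof -
 have "(\<lambda>z. f (fst z) (snd z)) \<in> borel_measurable (lborel \<Otimes>\<^sub>M lborel)" unfolding lborel_prod using assms by simp
 from lborel_pair.Fubini'[OF this[unfolded split_beta'[symmetric]]] show ?thesis by simp
qed

lemma nn_integral_lborel_translate:
 fixes f :: "'a::euclidean_space => ennreal"
 assumes [measurable]: "f \<in> borel_measurable borel"
 shows "(\<integral>\<^sup>+x. f (x + b) \<partial>lborel) = (\<integral>\<^sup>+x. f x \<partial>lborel)"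
 by (subst (2) lborel_distr_plus[of b, symmetric]) (simp add: nn_integral_distr add.commute)

lemma nn_integral_lborel_affine:
 fixes f :: "real => ennreal"
 assumes "f \<in> borel_measurable borel" "0 < c"
 shows "(\<integral>\<^sup>+x. f (t + c * x) \<partial>lborel) = ennreal (1 / c) * (\<integral>\<^sup>+x. f x \<partial>lborel)"
proof -
 have "ennreal (1 / c) * (\<integral>\<^sup>+x. f x \<partial>lborel) = ennreal (1 / c) * (ennreal c * (\<integral>\<^sup>+x. f (t + c * x) \<partial>lborel))"
  using nn_integral_real_affine[OF assms(1), of c t] assms(2) by simp
 also have "... = (\<integral>\<^sup>+x. f (t + c * x) \<partial>lborel)"
  using assms(2) by (simp flip: mult.assoc ennreal_mult)
 finally show ?thesis by simp
qed

text \<open>An auxiliary real variable turns a stretch along \<open>n\<close> into translations, so that no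
 coordinates adapted to \<open>n\<close> are needed.\<close>

lemma nn_integral_stretch:
 fixes f :: "'a::euclidean_space => ennreal"
 assumes f [measurable]: "f \<in> borel_measurable borel" and n: "norm n = 1" and q: "0 < q"
 shows "(\<integral>\<^sup>+w. f (w + ((q - 1) * (w \<bullet> n)) *\<^sub>R n) \<partial>lborel) = ennreal (1 / q) * (\<integral>\<^sup>+w. f w \<partial>lborel)"
proof -
 define h :: "real => ennreal" where "h = indicator {0..1}"
 have [measurable]: "h \<in> borel_measurable borel" by (simp add: h_def)
 have h1: "(\<integral>\<^sup>+a. h a \<partial>lborel) = 1" by (simp add: h_def)
 have nn: "n \<bullet> n = 1" using n by (simp add: dot_square_norm)
 have "(\<integral>\<^sup>+w. f (w + ((q - 1) * (w \<bullet> n)) *\<^sub>R n) \<partial>lborel) = (\<integral>\<^sup>+a. h a * (\<integral>\<^sup>+w. f (w + ((q - 1) * (w \<bullet> n)) *\<^sub>R n) \<partial>lborel) \<partial>lborel)"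
  by (simp add: nn_integral_multc h1)
 also have "... = (\<integral>\<^sup>+a. (\<integral>\<^sup>+w. h a * f (w + ((q - 1) * (w \<bullet> n) + q * a) *\<^sub>R n) \<partial>lborel) \<partial>lborel)"
 proof (rule nn_integral_cong)
  fix a :: real
  have "(\<integral>\<^sup>+w. f (w + ((q - 1) * (w \<bullet> n)) *\<^sub>R n) \<partial>lborel) = (\<integral>\<^sup>+w. f ((w + a *\<^sub>R n) + ((q - 1) * ((w + a *\<^sub>R n) \<bullet> n)) *\<^sub>R n) \<partial>lborel)"
   by (rule nn_integral_lborel_translate[symmetric]) measurable
  also have "... = (\<integral>\<^sup>+w. f (w + ((q - 1) * (w \<bullet> n) + q * a) *\<^sub>R n) \<partial>lborel)"
   by (intro nn_integral_cong arg_cong[of _ _ f]) (simp add: inner_add_left nn algebra_simps)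
  finally show "h a * (\<integral>\<^sup>+w. f (w + ((q - 1) * (w \<bullet> n)) *\<^sub>R n) \<partial>lborel) = (\<integral>\<^sup>+w. h a * f (w + ((q - 1) * (w \<bullet> n) + q * a) *\<^sub>R n) \<partial>lborel)"
   by (simp add: nn_integral_cmult)
 qed
 also have "... = (\<integral>\<^sup>+w. (\<integral>\<^sup>+a. h a * f (w + ((q - 1) * (w \<bullet> n) + q * a) *\<^sub>R n) \<partial>lborel) \<partial>lborel)"
  by (rule nn_integral_swap) measurable
 also have "... = (\<integral>\<^sup>+w. ennreal (1 / q) * (\<integral>\<^sup>+a. h ((a - (q - 1) * (w \<bullet> n)) / q) * f (w + a *\<^sub>R n) \<partial>lborel) \<partial>lborel)"
 proof (rule nn_integral_cong)
  fix w :: 'a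
  show "(\<integral>\<^sup>+a. h a * f (w + ((q - 1) * (w \<bullet> n) + q * a) *\<^sub>R n) \<partial>lborel) = ennreal (1 / q) * (\<integral>\<^sup>+a. h ((a - (q - 1) * (w \<bullet> n)) / q) * f (w + a *\<^sub>R n) \<partial>lborel)"
   using q by (subst nn_integral_lborel_affine[OF _ q, of _ "(q - 1) * (w \<bullet> n)", symmetric]) auto
 qed
 also have "... = ennreal (1 / q) * (\<integral>\<^sup>+w. (\<integral>\<^sup>+a. h ((a - (q - 1) * (w \<bullet> n)) / q) * f (w + a *\<^sub>R n) \<partial>lborel) \<partial>lborel)"
  by (intro nn_integral_cmult) measurable
 also have "(\<integral>\<^sup>+w. (\<integral>\<^sup>+a. h ((a - (q - 1) * (w \<bullet> n)) / q) * f (w + a *\<^sub>R n) \<partial>lborel) \<partial>lborel) = (\<integral>\<^sup>+a. (\<integral>\<^sup>+w. h ((a - (q - 1) * (w \<bullet> n)) / q) * f (w + a *\<^sub>R n) \<partial>lborel) \<partial>lborel)"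
  by (rule nn_integral_swap) measurable
 also have "... = (\<integral>\<^sup>+a. (\<integral>\<^sup>+w. h (a - (q - 1) * (w \<bullet> n) / q) * f w \<partial>lborel) \<partial>lborel)"
 proof (rule nn_integral_cong)
  fix a :: real
  have "(\<integral>\<^sup>+w. h (a - (q - 1) * (w \<bullet> n) / q) * f w \<partial>lborel) = (\<integral>\<^sup>+w. h (a - (q - 1) * ((w + a *\<^sub>R n) \<bullet> n) / q) * f (w + a *\<^sub>R n) \<partial>lborel)"
   by (rule nn_integral_lborel_translate[symmetric]) measurable
  moreover have "a - (q - 1) * ((w + a *\<^sub>R n) \<bullet> n) / q = (a - (q - 1) * (w \<bullet> n)) / q" for w
   using q by (simp add: inner_add_left nn field_simps)
  ultimately show "(\<integral>\<^sup>+w. h ((a - (q - 1) * (w \<bullet> n)) / q) * f (w + a *\<^sub>R n) \<partial>lborel) = (\<integral>\<^sup>+w. h (a - (q - 1) * (w \<bullet> n) / q) * f w \<partial>lborel)" by simp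
 qed
 also have "... = (\<integral>\<^sup>+w. (\<integral>\<^sup>+a. h (a - (q - 1) * (w \<bullet> n) / q) * f w \<partial>lborel) \<partial>lborel)"
  by (rule nn_integral_swap) measurable
 also have "... = (\<integral>\<^sup>+w. f w \<partial>lborel)"
 proof (rule nn_integral_cong)
  fix w :: 'a
  have "(\<integral>\<^sup>+a. h (a + - ((q - 1) * (w \<bullet> n) / q)) \<partial>lborel) = 1"
   unfolding nn_integral_lborel_translate[OF \<open>h \<in> borel_measurable borel\<close>] by (rule h1)
  then show "(\<integral>\<^sup>+a. h (a - (q - 1) * (w \<bullet> n) / q) * f w \<partial>lborel) = f w"
   unfolding diff_conv_add_uminus by (simp add: nn_integral_multc del: add_uminus_conv_diff)
 qed
 finally show ?thesis .
qed

lemma nn_integral_stretches: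
 fixes f :: "'a::euclidean_space => ennreal" and k :: nat
 assumes f: "f \<in> borel_measurable borel"
  and e: "!!i j. i < k ==> j < k ==> e i \<bullet> e j = (if i = j then 1 else 0)" and q: "!!i. i < k ==> 0 < q i"
 shows "(\<integral>\<^sup>+w. f (w + (\<Sum>i<k. ((q i - 1) * (w \<bullet> e i)) *\<^sub>R e i)) \<partial>lborel) = ennreal (1 / (\<Prod>i<k. q i)) * (\<integral>\<^sup>+w. f w \<partial>lborel)"
 using assms
proof (induction k arbitrary: f)
 case 0 then show ?case by simp
next
 case (Suc k)
 have [measurable]: "f \<in> borel_measurable borel" by fact
 have ek: "e i \<bullet> e k = 0" "e k \<bullet> e i = 0" if "i < k" for i using Suc.prems(2)[of i k] Suc.prems(2)[of k i] that by auto
 have nk: "e k \<bullet> e k = 1" using Suc.prems(2)[of k k] by simp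
 then have nk': "norm (e k) = 1" by (simp add: norm_eq_sqrt_inner)
 define g where "g w = f (w + (\<Sum>i<k. ((q i - 1) * (w \<bullet> e i)) *\<^sub>R e i))" for w
 have [measurable]: "g \<in> borel_measurable borel" unfolding g_def by measurable
 have eq: "w + (\<Sum>i<Suc k. ((q i - 1) * (w \<bullet> e i)) *\<^sub>R e i) = (w + ((q k - 1) * (w \<bullet> e k)) *\<^sub>R e k) + (\<Sum>i<k. ((q i - 1) * ((w + ((q k - 1) * (w \<bullet> e k)) *\<^sub>R e k) \<bullet> e i)) *\<^sub>R e i)" for w
  by (simp add: inner_add_left ek)
 have "(\<integral>\<^sup>+w. f (w + (\<Sum>i<Suc k. ((q i - 1) * (w \<bullet> e i)) *\<^sub>R e i)) \<partial>lborel) = (\<integral>\<^sup>+w. g (w + ((q k - 1) * (w \<bullet> e k)) *\<^sub>R e k) \<partial>lborel)"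
  unfolding g_def by (simp only: eq)
 also have "... = ennreal (1 / q k) * (\<integral>\<^sup>+w. g w \<partial>lborel)" using Suc.prems(3) nk' by (intro nn_integral_stretch) auto
 also have "(\<integral>\<^sup>+w. g w \<partial>lborel) = ennreal (1 / (\<Prod>i<k. q i)) * (\<integral>\<^sup>+w. f w \<partial>lborel)"
  unfolding g_def using Suc.prems by (intro Suc.IH) auto
 also have "ennreal (1 / q k) * (ennreal (1 / (\<Prod>i<k. q i)) * (\<integral>\<^sup>+w. f w \<partial>lborel)) = ennreal (1 / (\<Prod>i<Suc k. q i)) * (\<integral>\<^sup>+w. f w \<partial>lborel)"
 proof -
  have "0 < q k" "0 < (\<Prod>i<k. q i)" using Suc.prems(3) by (auto intro!: prod_pos)
  then have "ennreal (1 / q k) * ennreal (1 / (\<Prod>i<k. q i)) = ennreal (1 / (\<Prod>i<Suc k. q i))"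
   by (subst ennreal_mult[symmetric]) (auto simp: mult.commute)
  then show ?thesis by (simp only: mult.assoc[symmetric])
 qed
 finally show ?case .
qed

text \<open>The map turns \<open>(u, s)\<close> into a level, affine in the normal component of
  \<open>u\<close>, and a vector whose normal component is replaced by \<open>s\<close>. A
  translation in \<open>s\<close> and one of \<open>u\<close> along \<open>n\<close> decouple the
  variables and leave a one-dimensional substitution with factor \<open>k\<close>;
  \<open>inv\<close> makes the shear \<open>w\<close> insensitive to the translation.\<close>

lemma nn_integral_swap_shear:
 fixes f :: "real \<times> 'a::euclidean_space => ennreal"
 assumes f [measurable]: "f \<in> borel_measurable borel" and w [measurable]: "w \<in> borel_measurable borel"
  and n: "norm n = 1" and inv: "!!u a. w (u + a *\<^sub>R n) = w u" and k: "0 < k"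
 shows "(\<integral>\<^sup>+u. \<integral>\<^sup>+s. f (k * (u \<bullet> n) + w u, u - (u \<bullet> n) *\<^sub>R n + s *\<^sub>R n) \<partial>lborel \<partial>lborel) =
  ennreal (1 / k) * (\<integral>\<^sup>+z. f z \<partial>lborel)"
proof -
 have nn: "n \<bullet> n = 1" using n by (simp add: dot_square_norm)
 have "(\<integral>\<^sup>+u. \<integral>\<^sup>+s. f (k * (u \<bullet> n) + w u, u - (u \<bullet> n) *\<^sub>R n + s *\<^sub>R n) \<partial>lborel \<partial>lborel)
   = (\<integral>\<^sup>+u. \<integral>\<^sup>+r. f (k * (u \<bullet> n) + w u, u + r *\<^sub>R n) \<partial>lborel \<partial>lborel)"
 proof (rule nn_integral_cong)
  fix u :: 'a
  have "(\<integral>\<^sup>+s. f (k * (u \<bullet> n) + w u, u - (u \<bullet> n) *\<^sub>R n + s *\<^sub>R n) \<partial>lborel) = (\<integral>\<^sup>+s. f (k * (u \<bullet> n) + w u, u - (u \<bullet> n) *\<^sub>R n + (s + u \<bullet> n) *\<^sub>R n) \<partial>lborel)"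
   by (rule nn_integral_lborel_translate[symmetric]) measurable
  then show "(\<integral>\<^sup>+s. f (k * (u \<bullet> n) + w u, u - (u \<bullet> n) *\<^sub>R n + s *\<^sub>R n) \<partial>lborel) = (\<integral>\<^sup>+r. f (k * (u \<bullet> n) + w u, u + r *\<^sub>R n) \<partial>lborel)"
   by (simp add: algebra_simps)
 qed
 also have "... = (\<integral>\<^sup>+r. \<integral>\<^sup>+u. f (k * (u \<bullet> n) + w u, u + r *\<^sub>R n) \<partial>lborel \<partial>lborel)" by (rule nn_integral_swap) measurable
 also have "... = (\<integral>\<^sup>+r. \<integral>\<^sup>+u. f (k * (u \<bullet> n) - k * r + w u, u) \<partial>lborel \<partial>lborel)"
 proof (rule nn_integral_cong)
  fix r :: real
  have "(\<integral>\<^sup>+u. f (k * (u \<bullet> n) - k * r + w u, u) \<partial>lborel) = (\<integral>\<^sup>+u. f (k * ((u + r *\<^sub>R n) \<bullet> n) - k * r + w (u + r *\<^sub>R n), u + r *\<^sub>R n) \<partial>lborel)"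
   by (rule nn_integral_lborel_translate[symmetric]) measurable
  then show "(\<integral>\<^sup>+u. f (k * (u \<bullet> n) + w u, u + r *\<^sub>R n) \<partial>lborel) = (\<integral>\<^sup>+u. f (k * (u \<bullet> n) - k * r + w u, u) \<partial>lborel)"
   by (simp add: inner_add_left nn inv distrib_left)
 qed
 also have "... = (\<integral>\<^sup>+u. \<integral>\<^sup>+r. f (k * (u \<bullet> n) - k * r + w u, u) \<partial>lborel \<partial>lborel)" by (rule nn_integral_swap) measurable
 also have "... = (\<integral>\<^sup>+u. ennreal (1 / k) * (\<integral>\<^sup>+t. f (t, u) \<partial>lborel) \<partial>lborel)"
 proof (rule nn_integral_cong)
  fix u :: 'a
  have "(\<integral>\<^sup>+t. f (t, u) \<partial>lborel) = ennreal k * (\<integral>\<^sup>+r. f ((k * (u \<bullet> n) + w u) + - k * r, u) \<partial>lborel)"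
   using nn_integral_real_affine[of "\<lambda>t. f (t, u)" "- k" "k * (u \<bullet> n) + w u"] k by simp
  then show "(\<integral>\<^sup>+r. f (k * (u \<bullet> n) - k * r + w u, u) \<partial>lborel) = ennreal (1 / k) * (\<integral>\<^sup>+t. f (t, u) \<partial>lborel)"
   using k by (simp add: algebra_simps flip: mult.assoc ennreal_mult)
 qed
 also have "... = ennreal (1 / k) * (\<integral>\<^sup>+u. (\<integral>\<^sup>+t. f (t, u) \<partial>lborel) \<partial>lborel)" by (intro nn_integral_cmult) measurable
 also have "(\<integral>\<^sup>+u. (\<integral>\<^sup>+t. f (t, u) \<partial>lborel) \<partial>lborel) = (\<integral>\<^sup>+z. f z \<partial>(lborel \<Otimes>\<^sub>M lborel))"
  by (rule lborel_pair.nn_integral_snd) (simp add: lborel_prod)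
 finally show ?thesis unfolding lborel_prod .
qed

section \<open>Eigenbases of symmetric maps\<close>

lemma symmetric_eigenbasis:
 fixes N :: "'a::euclidean_space => 'a"
 assumes N: "linear N" "!!u v. N u \<bullet> v = u \<bullet> N v" and S: "subspace S" "!!x. x \<in> S ==> N x \<in> S"
 shows "\<exists>B\<subseteq>S. finite B \<and> (\<forall>u\<in>B. norm u = 1 \<and> (\<exists>q. N u = q *\<^sub>R u)) \<and> pairwise (\<lambda>u v. u \<bullet> v = 0) B \<and> span B = S"
 using S
proof (induction "dim S" arbitrary: S rule: less_induct)
 case less
 show ?case
 proof (cases "S = {0}")
  case True then show ?thesis by (intro exI[of _ "{}"]) auto
 next
  case False
  interpret linear N by (rule N(1))
  have "compact (S \<inter> sphere 0 1)" using closed_subspace[OF less.prems(1)] by (simp add: closed_Int_compact)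
  moreover have "S \<inter> sphere 0 1 \<noteq> {}"
  proof -
   obtain x where "x \<in> S" "x \<noteq> 0" using False subspace_0[OF less.prems(1)] by auto
   then have "sgn x \<in> S \<inter> sphere 0 1" using less.prems(1) by (auto simp: sgn_div_norm subspace_scale)
   then show ?thesis by blast
  qed
  moreover have "continuous_on (S \<inter> sphere 0 1) (\<lambda>u. N u \<bullet> u)"
   using N(1) by (intro continuous_intros linear_continuous_on) (simp add: linear_conv_bounded_linear)
  ultimately obtain u where u: "u \<in> S" "norm u = 1" "!!w. w \<in> S ==> norm w = 1 ==> N w \<bullet> w <= N u \<bullet> u"
   using continuous_attains_sup[of "S \<inter> sphere 0 1" "\<lambda>u. N u \<bullet> u"] by (metis IntE IntI mem_sphere_0)
  define q where "q = N u \<bullet> u"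
  have uu: "u \<bullet> u = 1" using u(2) by (simp add: dot_square_norm)
  have qmax: "N w \<bullet> w <= q * (w \<bullet> w)" if "w \<in> S" for w
  proof (cases "w = 0")
   case False
   have "N (sgn w) \<bullet> sgn w <= q" unfolding q_def using that False less.prems(1)
    by (intro u(3)) (auto simp: sgn_div_norm subspace_scale)
   moreover have "N (sgn w) \<bullet> sgn w = (N w \<bullet> w) / (norm w)\<^sup>2" by (simp add: sgn_div_norm scale power2_eq_square divide_inverse)
   ultimately show ?thesis using False by (simp add: divide_le_eq dot_square_norm)
  qed (simp add: zero)
  \<comment> \<open>First-order optimality of the maximizer along \<open>u + r *\<^sub>R w\<close>:
    a nonzero linear term in \<open>r\<close> would beat the quadratic ones, and
    \<open>r = (N u \<bullet> w) / C\<close> exhibits this.\<close>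
  have orth: "N u \<bullet> w = 0" if w: "w \<in> S" "u \<bullet> w = 0" for w
  proof (rule ccontr)
   assume ne: "N u \<bullet> w \<noteq> 0"
   have ineq: "2 * r * (N u \<bullet> w) + r\<^sup>2 * (N w \<bullet> w) <= q * r\<^sup>2 * (w \<bullet> w)" for r
   proof -
    have "N (u + r *\<^sub>R w) \<bullet> (u + r *\<^sub>R w) <= q * ((u + r *\<^sub>R w) \<bullet> (u + r *\<^sub>R w))"
     using u(1) w(1) less.prems(1) by (intro qmax) (auto intro: subspace_add subspace_scale)
    moreover have "N w \<bullet> u = N u \<bullet> w" using N(2)[of w u] by (simp add: inner_commute)
    ultimately show ?thesis using w(2) uu by (simp add: add scale inner_add_left inner_add_right inner_commute[of w u] q_def power2_eq_square algebra_simps)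
   qed
   define C where "C = abs (q * (w \<bullet> w)) + abs (N w \<bullet> w) + 1"
   have C: "C > 0" by (simp add: C_def add_nonneg_pos)
   define r where "r = (N u \<bullet> w) / C"
   have r: "2 * (r * (N u \<bullet> w)) <= r\<^sup>2 * C"
   proof -
    have "2 * (r * (N u \<bullet> w)) <= r\<^sup>2 * (q * (w \<bullet> w) - N w \<bullet> w)" using ineq[of r] by (simp add: algebra_simps)
    also have "... <= r\<^sup>2 * C" by (intro mult_left_mono) (auto simp: C_def)
    finally show ?thesis .
   qed
   have "r * (N u \<bullet> w) = (N u \<bullet> w)\<^sup>2 / C" "r\<^sup>2 * C = (N u \<bullet> w)\<^sup>2 / C" using C by (auto simp: r_def power2_eq_square)
   moreover have "(N u \<bullet> w)\<^sup>2 / C > 0" using ne C by simp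
   ultimately show False using r by linarith
  qed
  have Nu: "N u = q *\<^sub>R u"
  proof -
   define v where "v = N u - q *\<^sub>R u"
   have "v \<in> S" unfolding v_def using u(1) less.prems by (intro subspace_diff subspace_scale) auto
   moreover have "u \<bullet> v = 0" unfolding v_def q_def by (simp add: inner_diff_right uu inner_commute)
   ultimately have "N u \<bullet> v = 0" by (rule orth)
   then have "v \<bullet> v = 0" using \<open>u \<bullet> v = 0\<close> unfolding v_def by (simp add: inner_diff_left)
   then show ?thesis by (simp add: v_def)
  qed
  define S' where "S' = S \<inter> {x. u \<bullet> x = 0}"
  have S': "subspace S'" unfolding S'_def using less.prems(1) by (intro subspace_inter subspace_hyperplane)
  have "u \<notin> S'" using uu by (simp add: S'_def)
  then have "S' \<subset> S" using u(1) unfolding S'_def by blast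
  then have "dim S' < dim S" using less.prems(1) S' by (metis dim_psubset span_eq_iff)
  moreover have "N x \<in> S'" if "x \<in> S'" for x
   using that less.prems(2) N(2)[of u x] unfolding S'_def Nu by auto
  ultimately obtain B where B: "B \<subseteq> S'" "finite B" "\<forall>u\<in>B. norm u = 1 \<and> (\<exists>q. N u = q *\<^sub>R u)" "pairwise (\<lambda>u v. u \<bullet> v = 0) B" "span B = S'"
   using less.hyps[of S'] S' by blast
  have "pairwise (\<lambda>u v. u \<bullet> v = 0) (insert u B)"
   using B(1,4) unfolding pairwise_insert S'_def by (auto simp: inner_commute)
  moreover have "span (insert u B) = S"
  proof
   show "span (insert u B) \<subseteq> S" using B(1) u(1) less.prems(1) unfolding S'_def by (intro span_minimal) auto
   show "S \<subseteq> span (insert u B)"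
   proof
    fix x assume "x \<in> S"
    then have "x - (u \<bullet> x) *\<^sub>R u \<in> S'"
     using u(1) less.prems(1) uu unfolding S'_def by (auto simp: inner_diff_right subspace_diff subspace_scale)
    then have "x - (u \<bullet> x) *\<^sub>R u \<in> span (insert u B)" using B(5) span_mono[of B "insert u B"] by auto
    then show "x \<in> span (insert u B)" by (metis insertI1 span_base span_breakdown_eq span_insert_0 diff_add_cancel span_add span_scale)
   qed
  qed
  ultimately show ?thesis using B u Nu \<open>S' \<subset> S\<close> by (intro exI[of _ "insert u B"]) auto
 qed
qed

lemma tangent_eigenbasis:
 fixes N :: "'a::euclidean_space => 'a"
 assumes N: "linear N" "!!u v. N u \<bullet> v = u \<bullet> N v" and n: "norm n = 1" "N n = 0"
 obtains e q where "tangent_basis n e" "!!i. i < DIM('a) - 1 ==> N (e i) = q i *\<^sub>R e i"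
  "!!u. u = (\<Sum>i<DIM('a) - 1. (u \<bullet> e i) *\<^sub>R e i) + (u \<bullet> n) *\<^sub>R n"
proof -
 define S where "S = {x. n \<bullet> x = 0}"
 have S: "subspace S" unfolding S_def by (rule subspace_hyperplane)
 have NS: "N x \<in> S" if "x \<in> S" for x using N(2)[of n x] n(2) unfolding S_def by simp
 obtain B where B: "B \<subseteq> S" "finite B" "!!u. u \<in> B ==> norm u = 1" "!!u. u \<in> B ==> \<exists>q. N u = q *\<^sub>R u" "pairwise (\<lambda>u v. u \<bullet> v = 0) B" "span B = S"
  using symmetric_eigenbasis[OF N S NS] by blast
 have "0 \<notin> B" using B(3) by force
 moreover have "pairwise Linear_Algebra.orthogonal B"
  using B(5) unfolding pairwise_def Linear_Algebra.orthogonal_def by blast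
 ultimately have indep: "independent B" using pairwise_orthogonal_independent by blast
 have "card B = dim S" using dim_span_eq_card_independent[OF indep] B(6) by simp
 also have "... = DIM('a) - 1" unfolding S_def by (rule dim_hyperplane) (use n in auto)
 finally have card: "card B = DIM('a) - 1" .
 obtain e where e: "bij_betw e {0..<card B} B" using ex_bij_betw_nat_finite[OF B(2)] by blast
 have eB: "e i \<in> B" if "i < DIM('a) - 1" for i using e that card by (auto simp: bij_betw_def)
 define q where "q i = (SOME r. N (e i) = r *\<^sub>R e i)" for i
 have q: "N (e i) = q i *\<^sub>R e i" if "i < DIM('a) - 1" for i
  unfolding q_def by (rule someI_ex) (rule B(4)[OF eB[OF that]])
 have en: "e i \<bullet> n = 0" if "i < DIM('a) - 1" for i
  using subsetD[OF B(1) eB[OF that]] by (simp add: S_def inner_commute)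
 have ee: "e i \<bullet> e j = (if i = j then 1 else 0)" if "i < DIM('a) - 1" "j < DIM('a) - 1" for i j
 proof (cases "i = j")
  case True then show ?thesis using B(3)[OF eB[OF that(1)]] by (simp add: dot_square_norm)
 next
  case False
  then have "e i \<noteq> e j" using e that card by (auto simp: bij_betw_def inj_on_def)
  then show ?thesis using False B(5) eB[OF that(1)] eB[OF that(2)] unfolding pairwise_def by simp
 qed
 have tb: "tangent_basis n e" using en ee by (simp add: tangent_basis_def)
 have nn: "n \<bullet> n = 1" using n by (simp add: dot_square_norm)
 have rep: "u = (\<Sum>i<DIM('a) - 1. (u \<bullet> e i) *\<^sub>R e i) + (u \<bullet> n) *\<^sub>R n" for u
 proof -
  define v where "v = u - (\<Sum>i<DIM('a) - 1. (u \<bullet> e i) *\<^sub>R e i) - (u \<bullet> n) *\<^sub>R n"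
  have "v \<bullet> n = 0" unfolding v_def by (simp add: inner_diff_left inner_sum_left en nn)
  then have "v \<in> S" by (simp add: S_def inner_commute)
  moreover have "v \<bullet> b = 0" if "b \<in> B" for b
  proof -
   have "b \<in> e ` {0..<card B}" using e that by (simp add: bij_betw_def)
   then obtain j where j: "j < DIM('a) - 1" "b = e j" unfolding card by auto
   have "(\<Sum>i<DIM('a) - 1. (u \<bullet> e i) * (e i \<bullet> e j)) = (\<Sum>i<DIM('a) - 1. if i = j then u \<bullet> e j else 0)"
    using j ee by (intro sum.cong) auto
   then show ?thesis using j en[OF j(1)] unfolding v_def
    by (simp add: inner_diff_left inner_sum_left inner_commute[of n])
  qed
  then have "span B \<subseteq> {x. v \<bullet> x = 0}" by (intro span_minimal subspace_hyperplane) auto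
  ultimately have "v \<bullet> v = 0" using B(6) by blast
  then have "v = 0" by simp
  then show ?thesis unfolding v_def by (simp add: diff_diff_eq)
 qed
 show ?thesis by (rule that[OF tb q rep])
qed

section \<open>Support functions of sublevel sets\<close>

locale quasiconvex_potential =
 fixes A :: "'a::euclidean_space set" and \<phi> :: "'a => real"
 assumes compact_A: "compact A" and convex_A: "convex A" and interior_A: "interior A \<noteq> {}"
  and cont: "continuous_on A \<phi>" and quasiconvex: "convex (sublevel A \<phi> s)"
begin

definition m0 :: real where "m0 = Inf (\<phi> ` A)"

text \<open>Levels below the minimum \<open>m0\<close> are raised to \<open>m0\<close>, so that
  every \<open>SL t\<close> is nonempty and \<open>F\<close> is finite and monotone on the whole
  line.\<close>

definition SL :: "real => 'a set" where "SL t = sublevel A \<phi> (max m0 t)"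

definition F :: "real => 'a => real" where "F t = support_function (SL t)"

lemma m0_attained: "\<exists>a\<in>A. \<phi> a = m0"
 and m0_le: "x \<in> A ==> m0 <= \<phi> x"
proof -
 have ne: "A \<noteq> {}" using interior_A by auto
 obtain a where a: "a \<in> A" "!!x. x \<in> A ==> \<phi> a <= \<phi> x"
  using continuous_attains_inf[OF compact_A ne cont] by blast
 have "\<phi> a = m0" unfolding m0_def using a by (intro cInf_eq_minimum[symmetric]) auto
 then show "\<exists>a\<in>A. \<phi> a = m0" "x \<in> A ==> m0 <= \<phi> x" using a by auto
qed

lemma SL_eq: "m0 <= t ==> SL t = sublevel A \<phi> t" by (simp add: SL_def)

lemma SL_phi: "x \<in> A ==> SL (\<phi> x) = sublevel A \<phi> (\<phi> x)" using m0_le by (intro SL_eq)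

lemma mem_SL: "x \<in> SL t \<longleftrightarrow> x \<in> A \<and> \<phi> x <= max m0 t" by (simp add: SL_def sublevel_def)

lemma SL_subset: "SL t \<subseteq> A" by (auto simp: mem_SL)

lemma SL_mono: "t <= t' ==> SL t \<subseteq> SL t'" by (auto simp: mem_SL)

lemma compact_SL: "compact (SL t)"
proof -
 have "SL t = A \<inter> \<phi> -` {..max m0 t}" by (auto simp: mem_SL)
 moreover have "closed (A \<inter> \<phi> -` {..max m0 t})"
  by (rule continuous_closed_preimage[OF cont compact_imp_closed[OF compact_A] closed_atMost])
 ultimately show ?thesis using compact_A by (metis compact_Int_closed inf.absorb_iff2 inf_le1)
qed

lemma convex_SL: "convex (SL t)" unfolding SL_def by (rule quasiconvex)

lemma SL_ne: "SL t \<noteq> {}"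
proof -
 obtain a where "a \<in> A" "\<phi> a = m0" using m0_attained by blast
 then have "a \<in> SL t" by (simp add: mem_SL)
 then show ?thesis by blast
qed

lemma F_bdd: "bdd_above ((\<lambda>x. y \<bullet> x) ` SL t)"
 by (intro bounded_imp_bdd_above compact_imp_bounded compact_continuous_image compact_SL continuous_intros)

lemma F_upper: "x \<in> SL t ==> y \<bullet> x <= F t y"
 unfolding F_def support_function_def by (intro cSUP_upper F_bdd)

lemma F_attained: "\<exists>x\<in>SL t. y \<bullet> x = F t y"
proof -
 have "continuous_on (SL t) (\<lambda>x. y \<bullet> x)" by (intro continuous_intros)
 from continuous_attains_sup[OF compact_SL SL_ne this]
 obtain x where x: "x \<in> SL t" "!!z. z \<in> SL t ==> y \<bullet> z <= y \<bullet> x" by blast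
 have "F t y <= y \<bullet> x" unfolding F_def support_function_def using x by (intro cSUP_least SL_ne) auto
 then show ?thesis using F_upper[OF x(1), of y] x(1) by (intro bexI[of _ x]) auto
qed

lemma not_in_SL:
 assumes "x \<notin> SL t"
 obtains y where "y \<noteq> 0" "F t y < y \<bullet> x"
proof -
 obtain a b where ab: "a \<bullet> x < b" "!!z. z \<in> SL t ==> a \<bullet> z > b"
  using separating_hyperplane_closed_point[OF convex_SL compact_imp_closed[OF compact_SL] assms] by blast
 obtain z where z: "z \<in> SL t" "(- a) \<bullet> z = F t (- a)" using F_attained by blast
 have "F t (- a) < (- a) \<bullet> x" using ab(1) ab(2)[OF z(1)] z(2) by simp
 moreover have "a \<noteq> 0" using ab SL_ne by force
 ultimately show ?thesis using that[of "- a"] by simp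
qed

lemma F_hom: "0 <= r ==> F t (r *\<^sub>R y) = r * F t y"
proof (rule antisym)
 assume r: "0 <= r"
 obtain x where x: "x \<in> SL t" "(r *\<^sub>R y) \<bullet> x = F t (r *\<^sub>R y)" using F_attained by blast
 show "F t (r *\<^sub>R y) <= r * F t y" using x(2) mult_left_mono[OF F_upper[OF x(1), of y] r] by simp
 obtain x where x: "x \<in> SL t" "y \<bullet> x = F t y" using F_attained by blast
 show "r * F t y <= F t (r *\<^sub>R y)" using F_upper[OF x(1), of "r *\<^sub>R y"] x(2) by simp
qed

lemma normals_support:
 assumes x: "x \<in> A" and n: "n \<in> outer_unit_normals (sublevel A \<phi> (\<phi> x)) x"
 shows "n \<bullet> x = F (\<phi> x) n"
proof (rule antisym)
 have xS: "x \<in> SL (\<phi> x)" using x by (simp add: mem_SL)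
 then show "n \<bullet> x <= F (\<phi> x) n" by (rule F_upper)
 obtain z where z: "z \<in> SL (\<phi> x)" "n \<bullet> z = F (\<phi> x) n" using F_attained by blast
 then have "z \<in> sublevel A \<phi> (\<phi> x)" using SL_phi[OF x] by simp
 then show "F (\<phi> x) n <= n \<bullet> x" using n z(2) by (auto simp: outer_unit_normals_def inner_diff_right)
qed

lemma support_subgradient: "x \<in> SL t ==> y \<bullet> x = F t y ==> subgradient (F t) y x"
 unfolding subgradient_def using F_upper by (auto simp: inner_diff_right inner_commute[of x])

text \<open>Homogeneity, tested at \<open>2 *\<^sub>R y\<close> and at 0, gives the value; a point
  outside the closed convex set would be separated from it by a direction that violates the
  subgradient inequality. With \<open>support_subgradient\<close>, subgradients of
  \<open>F t\<close> are exactly the support points.\<close>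

lemma subgradient_support:
 assumes p: "subgradient (F t) y p"
 shows "y \<bullet> p = F t y" "p \<in> SL t"
proof -
 have "F t (2 *\<^sub>R y) \<ge> F t y + p \<bullet> (2 *\<^sub>R y - y)" "F t (0 *\<^sub>R y) \<ge> F t y + p \<bullet> (0 *\<^sub>R y - y)"
  using p unfolding subgradient_def by blast+
 moreover have "F t (2 *\<^sub>R y) = 2 * F t y" "F t (0 *\<^sub>R y) = 0" using F_hom[of 2 t y] F_hom[of 0 t y] by auto
 ultimately show eq: "y \<bullet> p = F t y" by (simp add: scaleR_2 inner_commute)
 show "p \<in> SL t"
 proof (rule ccontr)
  assume "p \<notin> SL t"
  then obtain u where u: "F t u < u \<bullet> p" by (rule not_in_SL)
  have "F t u \<ge> F t y + p \<bullet> (u - y)" using p unfolding subgradient_def by blast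
  then show False using u eq by (simp add: inner_diff_right inner_commute)
 qed
qed

lemma F_mono: "t <= t' ==> F t y <= F t' y"
 using F_attained[of t y] F_upper SL_mono by (metis subsetD)

text \<open>Upper semicontinuity in both variables together, from compactness of \<open>A\<close>
  and continuity of \<open>\<phi>\<close>; it supplies the Borel measurability of
  \<open>F\<close>.\<close>

lemma closed_F_ge: "closed {z. r <= F (fst z) (snd z)}"
 unfolding closed_sequential_limits
proof (intro allI impI, elim conjE)
 fix z :: "nat => real \<times> 'a" and l assume z: "\<forall>n. z n \<in> {z. r <= F (fst z) (snd z)}" and l: "z \<longlonglongrightarrow> l"
 have "\<exists>x\<in>SL (fst (z n)). snd (z n) \<bullet> x = F (fst (z n)) (snd (z n))" for n using F_attained by blast
 then obtain x where x: "!!n. x n \<in> SL (fst (z n))" "!!n. snd (z n) \<bullet> x n = F (fst (z n)) (snd (z n))" by metis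
 have "!!n. x n \<in> A" using x(1) SL_subset by blast
 then obtain a \<sigma> where a: "a \<in> A" "strict_mono \<sigma>" "(x \<circ> \<sigma>) \<longlonglongrightarrow> a" using compact_A unfolding compact_def by metis
 have z\<sigma>: "(\<lambda>n. z (\<sigma> n)) \<longlonglongrightarrow> l" using LIMSEQ_subseq_LIMSEQ[OF l a(2)] by (simp add: comp_def)
 have x\<sigma>: "(\<lambda>n. x (\<sigma> n)) \<longlonglongrightarrow> a" using a(3) by (simp add: comp_def)
 have "(\<lambda>n. \<phi> (x (\<sigma> n))) \<longlonglongrightarrow> \<phi> a"
  by (rule continuous_on_tendsto_compose[OF cont x\<sigma> a(1)]) (use \<open>!!n. x n \<in> A\<close> in auto)
 moreover have "(\<lambda>n. max m0 (fst (z (\<sigma> n)))) \<longlonglongrightarrow> max m0 (fst l)" by (intro tendsto_intros z\<sigma>)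
 ultimately have "\<phi> a <= max m0 (fst l)" by (rule LIMSEQ_le) (use x(1) in \<open>auto simp: mem_SL\<close>)
 then have "a \<in> SL (fst l)" using a(1) by (simp add: mem_SL)
 moreover have "r <= snd l \<bullet> a"
 proof (rule LIMSEQ_le_const)
  show "(\<lambda>n. snd (z (\<sigma> n)) \<bullet> x (\<sigma> n)) \<longlonglongrightarrow> snd l \<bullet> a" by (intro tendsto_intros z\<sigma> x\<sigma>)
  show "\<exists>N. \<forall>n\<ge>N. r <= snd (z (\<sigma> n)) \<bullet> x (\<sigma> n)" using z x(2) by auto
 qed
 ultimately show "l \<in> {z. r <= F (fst z) (snd z)}" using F_upper order_trans by blast
qed

sublocale convex_monotone F
proof
 show "subdifferentiable (F t)" for t
  unfolding subdifferentiable_def using F_attained support_subgradient by blast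
 show "mono (\<lambda>t. F t y)" for y by (intro monoI F_mono)
 show "(\<lambda>z. F (fst z) (snd z)) \<in> borel_measurable borel"
  unfolding borel_measurable_iff_ge using closed_F_ge by auto
qed

text \<open>A minimum point of \<open>\<phi>\<close> is a limit of interior points of
  \<open>A\<close>, and near it \<open>\<phi>\<close> stays below \<open>t\<close>.\<close>

lemma interior_SL: "m0 < t ==> interior (SL t) \<noteq> {}"
proof -
 assume t: "m0 < t"
 obtain a where a: "a \<in> A" "\<phi> a = m0" using m0_attained by blast
 obtain d where d: "d > 0" "!!x. x \<in> A ==> dist x a < d ==> dist (\<phi> x) (\<phi> a) < t - m0"
  using cont a(1) t unfolding continuous_on_iff by (metis diff_gt_0_iff_gt)
 have "a \<in> closure (interior A)" using convex_closure_interior[OF convex_A interior_A] a(1) closure_subset by auto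
 then obtain b where b: "b \<in> interior A" "dist b a < d" using d(1) by (meson closure_approachable)
 have "open (interior A \<inter> ball a d)" by auto
 moreover have "interior A \<inter> ball a d \<subseteq> SL t"
 proof
  fix x assume x: "x \<in> interior A \<inter> ball a d"
  then have "x \<in> A" using interior_subset by blast
  moreover have "dist (\<phi> x) (\<phi> a) < t - m0" using d(2)[OF \<open>x \<in> A\<close>] x by (simp add: dist_commute)
  ultimately show "x \<in> SL t" using a(2) by (simp add: mem_SL dist_real_def)
 qed
 moreover have "b \<in> interior A \<inter> ball a d" using b by (simp add: dist_commute)
 ultimately show ?thesis by (metis interior_maximal subsetD empty_iff)
qed

end

text \<open>Compares the radial coordinate \<open>norm y\<close> with the linear coordinate along
  \<open>sgn y\<close>; the difference is of second order, negligible against the width of a small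
  box.\<close>

lemma norm_expansion:
 fixes y u :: "'a::real_inner"
 assumes y: "y \<noteq> 0"
 shows "0 <= norm (y + u) - norm y - sgn y \<bullet> u" "norm (y + u) - norm y - sgn y \<bullet> u <= (norm u)\<^sup>2 / norm y"
proof -
 have ny: "0 < norm y" using y by simp
 have yu: "y \<bullet> u = norm y * (sgn y \<bullet> u)" using ny by (simp add: sgn_div_norm)
 have "norm y + sgn y \<bullet> u = sgn y \<bullet> (y + u)" by (simp add: inner_add_right inner_commute[of _ y] inner_sgn_self)
 also have "... <= norm (sgn y) * norm (y + u)" by (rule norm_cauchy_schwarz)
 finally show "0 <= norm (y + u) - norm y - sgn y \<bullet> u" using y by (simp add: norm_sgn)
 have su: "abs (sgn y \<bullet> u) <= norm u" using Cauchy_Schwarz_ineq2[of "sgn y" u] y by (simp add: norm_sgn)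
 define r where "r = norm u / norm y"
 have r: "norm u = r * norm y" "0 <= r" using ny by (auto simp: r_def)
 have rr: "(norm u)\<^sup>2 / norm y = r * r * norm y" using ny by (simp add: r(1) power2_eq_square)
 have "norm (y + u) <= norm y + sgn y \<bullet> u + r * r * norm y"
 proof (rule power2_le_imp_le)
  have "0 <= (1 - r + r * r) * norm y"
  proof (intro mult_nonneg_nonneg)
   have "0 <= (1 - r / 2)\<^sup>2 + 3 / 4 * r * r" by (intro add_nonneg_nonneg) auto
   also have "... = 1 - r + r * r" by (simp add: power2_eq_square algebra_simps)
   finally show "0 <= 1 - r + r * r" .
  qed auto
  then have "0 <= norm y - norm u + r * r * norm y" unfolding r(1) by (simp add: algebra_simps)
  then show "0 <= norm y + sgn y \<bullet> u + r * r * norm y" using su by linarith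
  have "(norm (y + u))\<^sup>2 = (norm y)\<^sup>2 + 2 * norm y * (sgn y \<bullet> u) + (norm u)\<^sup>2"
   by (simp add: power2_norm_eq_inner inner_add_left inner_add_right inner_commute[of u y] yu)
  also have "(norm u)\<^sup>2 = norm y * (r * r * norm y)" by (simp add: r(1) power2_eq_square)
  also have "(norm y)\<^sup>2 + 2 * norm y * (sgn y \<bullet> u) + norm y * (r * r * norm y) <= (norm y)\<^sup>2 + 2 * norm y * (sgn y \<bullet> u) + (norm y * (r * r * norm y) + (norm y * (r * r * norm y) + 2 * (sgn y \<bullet> u) * (r * r * norm y) + (sgn y \<bullet> u)\<^sup>2 + (r * r * norm y)\<^sup>2))"
  proof -
   have "abs (2 * (sgn y \<bullet> u) * (r * r * norm y)) <= 2 * norm u * (r * r * norm y)"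
    using su r(2) ny by (simp add: abs_mult mult_right_mono)
   also have "... = 2 * (r * (r * r * (norm y * norm y)))" by (simp add: r(1))
   finally have 1: "- (2 * (r * (r * r * (norm y * norm y)))) <= 2 * (sgn y \<bullet> u) * (r * r * norm y)" by linarith
   have "0 <= (r * norm y - r * r * norm y)\<^sup>2" by simp
   then have "0 <= r * r * (norm y * norm y) - 2 * (r * (r * r * (norm y * norm y))) + (r * r * norm y)\<^sup>2" by (simp add: power2_eq_square algebra_simps)
   moreover have "norm y * (r * r * norm y) = r * r * (norm y * norm y)" by simp
   ultimately show ?thesis using 1 zero_le_power2[of "sgn y \<bullet> u"] by linarith
  qed
  also have "... = (norm y + sgn y \<bullet> u + r * r * norm y)\<^sup>2" by (simp add: power2_eq_square algebra_simps)
  finally show "(norm (y + u))\<^sup>2 <= (norm y + sgn y \<bullet> u + r * r * norm y)\<^sup>2" .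
 qed
 then show "norm (y + u) - norm y - sgn y \<bullet> u <= (norm u)\<^sup>2 / norm y" unfolding rr by linarith
qed

section \<open>Support points near a point of expansion\<close>

locale support_expansion = quasiconvex_potential A \<phi> for A :: "'a::euclidean_space set" and \<phi> +
 fixes t0 c :: real and y0 x0 :: 'a and N :: "'a => 'a"
 assumes expansion: "parabolic_expansion (t0, y0) c x0 N" and y0: "y0 \<noteq> 0" and t0: "m0 < t0"
begin

definition s0 :: real where "s0 = norm y0"
definition n0 :: 'a where "n0 = sgn y0"

lemma s0: "0 < s0" and n0: "norm n0 = 1" "n0 \<bullet> n0 = 1" and y0_eq: "y0 = s0 *\<^sub>R n0"
 using y0 by (auto simp: s0_def n0_def norm_sgn sgn_div_norm dot_square_norm power2_eq_square)

lemma y0_inner: "y0 \<bullet> x = s0 * (n0 \<bullet> x)"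
 by (subst y0_eq) simp

lemma linear_N: "linear N" and N_sym: "N u \<bullet> v = u \<bullet> N v" and N_psd: "0 <= N u \<bullet> u"
 using expansion by (auto simp: parabolic_expansion_def)

abbreviation tay :: "real => 'a => real" where
 "tay r u \<equiv> F (t0 + r) (y0 + u) - F t0 y0 - c * r - x0 \<bullet> u - N u \<bullet> u / 2"

text \<open>The predicted position of a support point \<open>x\<close> of \<open>SL (t0 + r)\<close>
  in direction \<open>y0 + u\<close>: tangentially \<open>N u\<close> up to \<open>k * d\<close>, in
  height \<open>c * r - N u \<bullet> u / 2\<close> up to the finer error
  \<open>k * d^2\<close>.\<close>

abbreviation foot :: "real => real => real => 'a => 'a => bool" where
 "foot k d r u x \<equiv> norm (x - x0 - N u) <= k * d \<and> abs (y0 \<bullet> (x - x0) - c * r + N u \<bullet> u / 2) <= k * d\<^sup>2"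

lemma expand:
 assumes "0 < k"
 shows "\<exists>d0>0. \<forall>d r u. 0 < d --> d < d0 --> abs r <= d\<^sup>2 --> norm u <= d -->
   abs (tay r u) <= k * d\<^sup>2"
 using expansion assms unfolding parabolic_expansion_def fst_conv snd_conv by blast

lemma x0: "y0 \<bullet> x0 = F t0 y0" "x0 \<in> SL t0"
 using subgradient_support expansion by (auto simp: parabolic_expansion_def)

lemma N_bound: "\<exists>M>0. \<forall>u. norm (N u) <= M * norm u"
 by (rule linear_bounded_pos[OF linear_N]) blast

text \<open>A support point is a subgradient of the slice, so \<open>x \<bullet> u\<close> is at
  most the increment of \<open>F\<close> from \<open>y0 + h\<close> to \<open>y0 + h + u\<close>.
  Inserting the expansion, with \<open>u\<close> taken along the deviation \<open>v\<close>, bounds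
  \<open>v\<close>; the value of the expansion and \<open>h \<bullet> v\<close> then give the
  height.\<close>

lemma forward:
 assumes b: "0 < b"
 shows "\<exists>d0>0. \<forall>d r h x. 0 < d --> d < d0 --> abs r <= d\<^sup>2 --> norm h <= d --> x \<in> SL (t0 + r) -->
   (y0 + h) \<bullet> x = F (t0 + r) (y0 + h) -->
   foot b d r h x"
proof -
 obtain M where M: "0 < M" "!!u. norm (N u) <= M * norm u" using N_bound by blast
 \<comment> \<open>Relative length of the test displacement. With this \<open>l\<close> and
   \<open>e'\<close>, the quadratic term and the expansion errors each contribute at most a quarter
   of \<open>b * l * d^2\<close>.\<close>
 define l where "l = min 1 (b / (2 * M))"
 have l: "0 < l" "l <= 1" "M * l <= b / 2"
 proof -
  show "0 < l" "l <= 1" using b M by (auto simp: l_def)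
  have "M * l <= M * (b / (2 * M))" using M by (intro mult_left_mono) (auto simp: l_def)
  then show "M * l <= b / 2" using M by simp
 qed
 define e' where "e' = min (b / 16) (b * l / 32)"
 have e': "0 < e'" "e' <= b / 16" "e' <= b * l / 32" using b l by (auto simp: e'_def)
 obtain d1 where d1: "d1 > 0" "!!d r u. 0 < d ==> d < d1 ==> abs r <= d\<^sup>2 ==> norm u <= d ==>
   abs (tay r u) <= e' * d\<^sup>2"
  using expand[OF e'(1)] by blast
 have fw: "norm (x - x0 - N h) <= 3 / 4 * b * d \<and> abs (y0 \<bullet> (x - x0) - c * r + N h \<bullet> h / 2) <= b * d\<^sup>2"
  if d: "0 < d" "d < d1 / 2" and r: "abs r <= d\<^sup>2" and h: "norm h <= d" and x: "x \<in> SL (t0 + r)"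
   "(y0 + h) \<bullet> x = F (t0 + r) (y0 + h)" for d r h x
 proof -
  interpret linear N by (rule linear_N)
  have "d\<^sup>2 <= (2 * d)\<^sup>2" using d by (intro power_mono) auto
  then have r': "abs r <= (2 * d)\<^sup>2" using r by linarith
  have "e' * (2 * d)\<^sup>2 = 4 * (e' * d\<^sup>2)" by (simp add: power_mult_distrib)
  then have ex: "abs (tay r u) <= 4 * (e' * d\<^sup>2)" if "norm u <= 2 * d" for u
   using d1(2)[of "2 * d" r u] d r' that by simp
  define v where "v = x - x0 - N h"
  define u where "u = (l * d) *\<^sub>R sgn v"
  have nu: "norm u <= l * d" using l d norm_sgn_le_1[of v] by (simp add: u_def mult_left_le)
  have "l * d <= d" using l d by simp
  then have "norm (h + u) <= 2 * d" using norm_triangle_ineq[of h u] h nu by linarith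
  note A = ex[OF this]
  have B: "abs (tay r h) <= 4 * (e' * d\<^sup>2)" using h d by (intro ex) auto
  have C: "F (t0 + r) (y0 + (h + u)) \<ge> F (t0 + r) (y0 + h) + x \<bullet> u"
   using F_upper[OF x(1), of "y0 + (h + u)"] x(2) by (simp add: inner_add_left inner_commute[of x u])
  have D: "N (h + u) \<bullet> (h + u) = N h \<bullet> h + 2 * (N h \<bullet> u) + N u \<bullet> u"
   using N_sym[of u h] by (simp add: add inner_add_left inner_add_right inner_commute)
  have vu1: "v \<bullet> u = x \<bullet> u - x0 \<bullet> u - N h \<bullet> u" by (simp add: v_def inner_diff_left)
  have vu2: "v \<bullet> u = l * d * norm v" by (simp add: u_def inner_sgn_self)
  have Nu: "N u \<bullet> u <= M * (l * d)\<^sup>2"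
  proof -
   have "N u \<bullet> u <= norm (N u) * norm u" by (rule norm_cauchy_schwarz)
   also have "... <= M * norm u * norm u" using M(2) by (intro mult_right_mono) auto
   also have "... <= M * (l * d) * (l * d)" using nu M(1) l d by (intro mult_mono) auto
   finally show ?thesis by (simp add: power2_eq_square mult.assoc)
  qed
  have "l * d * norm v <= M * (l * d)\<^sup>2 / 2 + 8 * (e' * d\<^sup>2)"
  proof -
   have arith: "k <= Q / 2 + 8 * E" if "w = xu - xu0 - nu" "w = k" "nuu <= Q"
    "F2 - F0 - ct - (xe + xu0) - (nee + 2 * nu + nuu) / 2 <= 4 * E" "- (F1 - F0 - ct - xe - nee / 2) <= 4 * E" "F1 + xu <= F2"
    for w xu xu0 nu k nuu Q F2 F0 ct xe nee E F1 :: real using that by (simp add: field_simps)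
   show ?thesis by (rule arith[OF vu1 vu2 Nu
      abs_le_D1[OF A, unfolded D inner_add_right[of x0]] abs_le_D2[OF B] C])
  qed
  also have "... <= l * d * (3 / 4 * b * d)"
  proof -
   have "M * (l * d)\<^sup>2 / 2 = (M * l) * (l * d\<^sup>2) / 2" by (simp add: power2_eq_square)
   also have "... <= b / 2 * (l * d\<^sup>2) / 2" using l by (intro divide_right_mono mult_right_mono) auto
   finally have 1: "M * (l * d)\<^sup>2 / 2 <= b * l * d\<^sup>2 / 4" by simp
   have "8 * (e' * d\<^sup>2) <= 8 * (b * l / 32 * d\<^sup>2)" using e' by (intro mult_left_mono mult_right_mono) auto
   then have 2: "8 * (e' * d\<^sup>2) <= b * l * d\<^sup>2 / 4" by simp
   have "l * d * (3 / 4 * b * d) = 3 / 4 * (b * l * d\<^sup>2)" unfolding power2_eq_square by (simp add: mult_ac)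
   moreover have "0 <= b * l * d\<^sup>2" using b l by simp
   ultimately show ?thesis using 1 2 by linarith
  qed
  finally have v: "norm v <= 3 / 4 * b * d" using l d by simp
  have xv: "x = x0 + N h + v" by (simp add: v_def)
  have "abs (h \<bullet> v) <= norm h * norm v" by (rule Cauchy_Schwarz_ineq2)
  also have "... <= d * (3 / 4 * b * d)" using h v d by (intro mult_mono) auto
  also have "... = 3 / 4 * (b * d\<^sup>2)" unfolding power2_eq_square by (simp add: mult_ac)
  finally have hv: "abs (h \<bullet> v) <= 3 / 4 * (b * d\<^sup>2)" .
  have "y0 \<bullet> (x - x0) = F (t0 + r) (y0 + h) - F t0 y0 - h \<bullet> x0 - N h \<bullet> h - h \<bullet> v"
   using x(2) x0(1) unfolding xv by (simp add: inner_add_left inner_add_right inner_diff_right inner_commute[of "N h"])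
  moreover have "4 * (e' * d\<^sup>2) <= 4 * (b / 16 * d\<^sup>2)" using e' by (intro mult_left_mono mult_right_mono) auto
  ultimately have "abs (y0 \<bullet> (x - x0) - c * r + N h \<bullet> h / 2) <= b * d\<^sup>2"
   using B hv unfolding abs_le_iff inner_commute[of x0 h] by (simp add: inner_commute[of x0 h])
  then show ?thesis using v by (simp add: v_def)
 qed
 have le: "3 / 4 * b * d <= b * d" if "0 < d" for d using b that by simp
 show ?thesis using fw le d1(1) by (intro exI[of _ "d1 / 2"]) (meson half_gt_zero order_trans)
qed

lemma forward_K:
 assumes K: "0 < K" and b: "0 < b"
 shows "\<exists>d0>0. \<forall>d r u x. 0 < d --> d < d0 --> abs r <= K * d\<^sup>2 --> norm u <= K * d --> x \<in> SL (t0 + r) -->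
   (y0 + u) \<bullet> x = F (t0 + r) (y0 + u) -->
   foot b d r u x"
proof -
 define k where "k = max K 1"
 have k: "1 <= k" "K <= k" "k <= k\<^sup>2" using self_le_power[of k 2] by (auto simp: k_def)
 have "0 < b / k\<^sup>2" using b k by simp
 from forward[OF this] obtain d0 where d0: "d0 > 0" "!!d r u x. 0 < d ==> d < d0 ==> abs r <= d\<^sup>2 ==> norm u <= d ==> x \<in> SL (t0 + r) ==>
   (y0 + u) \<bullet> x = F (t0 + r) (y0 + u) ==>
   foot (b / k\<^sup>2) d r u x" by blast
 show ?thesis
 proof (intro exI[of _ "d0 / k"] conjI allI impI)
  show "0 < d0 / k" using d0(1) k by simp
  fix d r u x assume H: "0 < d" "d < d0 / k" "abs r <= K * d\<^sup>2" "norm u <= K * d" "x \<in> SL (t0 + r)" "(y0 + u) \<bullet> x = F (t0 + r) (y0 + u)"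
  have "K * d\<^sup>2 <= k\<^sup>2 * d\<^sup>2" "K * d <= k * d" using k H(1) by (auto intro!: mult_right_mono)
  then have "abs r <= (k * d)\<^sup>2" "norm u <= k * d" using H(3,4) unfolding power_mult_distrib by linarith+
  then have "norm (x - x0 - N u) <= b / k\<^sup>2 * (k * d) \<and> abs (y0 \<bullet> (x - x0) - c * r + N u \<bullet> u / 2) <= b / k\<^sup>2 * (k * d)\<^sup>2"
   using H k by (intro d0(2)) (auto simp: power_mult_distrib pos_less_divide_eq mult.commute)
  moreover have "b / k\<^sup>2 * (k * d)\<^sup>2 = b * d\<^sup>2" using k by (simp add: power_mult_distrib)
  moreover have "b / k\<^sup>2 * (k * d) <= b * d"
  proof -
   have "b / k\<^sup>2 * (k * d) = b * d / k" using k by (simp add: power2_eq_square)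
   also have "... <= b * d" using k b H(1) by (simp add: divide_le_eq)
   finally show ?thesis .
  qed
  ultimately show "norm (x - x0 - N u) <= b * d" "abs (y0 \<bullet> (x - x0) - c * r + N u \<bullet> u / 2) <= b * d\<^sup>2" by linarith+
 qed
qed

text \<open>\<open>xi\<close> is the centre of a ball inside a strictly lower sublevel set, hence
  lies at depth \<open>\<rho>\<close> below the supporting hyperplane at \<open>x0\<close> and stays
  inside for nearby levels. It serves to exclude separating vectors that point inwards.\<close>

lemma interior_point:
 obtains xi \<rho> where "0 < \<rho>" "\<forall>\<^sub>F l in at 0. xi \<in> SL (t0 + l)" "xi \<in> SL t0" "n0 \<bullet> (x0 - xi) \<ge> \<rho>"
proof -
 define t' where "t' = (m0 + t0) / 2"
 have t': "m0 < t'" "t' < t0" using t0 by (auto simp: t'_def)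
 obtain xi where "xi \<in> interior (SL t')" using interior_SL[OF t'(1)] by blast
 then obtain r where r: "r > 0" "ball xi r \<subseteq> SL t'" by (meson mem_interior)
 have xi: "xi \<in> SL t" if "t' <= t" for t using subsetD[OF r(2), of xi] r(1) SL_mono[OF that] by auto
 have "xi + (r/2) *\<^sub>R n0 \<in> ball xi r" using r(1) n0 by (simp add: dist_norm)
 then have "xi + (r/2) *\<^sub>R n0 \<in> SL t0" using r(2) SL_mono[of t' t0] t' by auto
 from F_upper[OF this, of y0] have "y0 \<bullet> (xi + (r/2) *\<^sub>R n0) <= y0 \<bullet> x0" by (simp add: x0)
 then have "s0 * (r/2) <= s0 * (n0 \<bullet> (x0 - xi))" unfolding y0_inner
  by (simp add: inner_add_right inner_diff_right n0(2) algebra_simps)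
 then have *: "r/2 <= n0 \<bullet> (x0 - xi)" using s0 by simp
 have ev: "\<forall>\<^sub>F l in at 0. xi \<in> SL (t0 + l)"
  unfolding eventually_at using t' xi by (intro exI[of _ "t0 - t'"]) (auto simp: dist_real_def)
 have "xi \<in> SL t0" using xi t' by simp
 with ev * show ?thesis using r(1) by (intro that[of "r/2" xi]) auto
qed

text \<open>\<open>F t0\<close> is linear along rays, so the quadratic form vanishes at
  \<open>n0\<close>; for a positive semidefinite form this puts \<open>n0\<close> into the
  kernel.\<close>

lemma N_y0: "N n0 = 0"
proof -
 interpret linear N by (rule linear_N)
 have "N n0 \<bullet> n0 = 0"
 proof (rule ccontr)
  assume "N n0 \<bullet> n0 \<noteq> 0"
  then have pos: "0 < N n0 \<bullet> n0 / 4" using N_psd[of n0] by simp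
  from expand[OF this] obtain d0 where d0: "d0 > 0" "!!d l u. 0 < d ==> d < d0 ==> abs l <= d\<^sup>2 ==> norm u <= d ==>
   abs (tay l u) <= N n0 \<bullet> n0 / 4 * d\<^sup>2" by blast
  define d where "d = d0 / 2"
  have d: "0 < d" "d < d0" using d0(1) by (auto simp: d_def)
  have "y0 + d *\<^sub>R n0 = (1 + d / s0) *\<^sub>R y0" using s0 by (subst (1 2) y0_eq) (simp add: algebra_simps)
  then have "F t0 (y0 + d *\<^sub>R n0) = (1 + d / s0) * F t0 y0" using F_hom d(1) s0 by simp
  also have "... = F t0 y0 + x0 \<bullet> (d *\<^sub>R n0)"
   unfolding x0(1)[symmetric] y0_inner using s0 by (simp add: field_simps inner_commute)
  finally have "abs (d\<^sup>2 * (N n0 \<bullet> n0) / 2) <= N n0 \<bullet> n0 / 4 * d\<^sup>2"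
   using d0(2)[OF d, of 0 "d *\<^sub>R n0"] d(1) n0 by (simp add: scale power2_eq_square)
  then show False using pos d(1) by (simp add: zero_less_mult_iff)
 qed
 then have nn: "N n0 \<bullet> n0 = 0" .
 have "N n0 \<bullet> v = 0" for v
 proof (rule ccontr)
  assume ne: "N n0 \<bullet> v \<noteq> 0"
  have sym: "N v \<bullet> n0 = N n0 \<bullet> v" using N_sym[of v n0] by (simp add: inner_commute)
  have ineq: "0 <= 2 * r * (N n0 \<bullet> v) + r\<^sup>2 * (N v \<bullet> v)" for r
   using N_psd[of "n0 + r *\<^sub>R v"] nn sym
   by (simp add: add scale inner_add_left inner_add_right power2_eq_square algebra_simps)
  define C where "C = N v \<bullet> v + 1"
  have C: "C > 0" using N_psd[of v] by (simp add: C_def)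
  define r where "r = - (N n0 \<bullet> v) / C"
  have "r\<^sup>2 * (N v \<bullet> v) <= r\<^sup>2 * C" by (intro mult_left_mono) (auto simp: C_def)
  then have "0 <= 2 * r * (N n0 \<bullet> v) + r\<^sup>2 * C" using ineq[of r] by linarith
  moreover have "2 * r * (N n0 \<bullet> v) + r\<^sup>2 * C = - (N n0 \<bullet> v)\<^sup>2 / C" using C by (simp add: r_def power2_eq_square field_simps)
  moreover have "(N n0 \<bullet> v)\<^sup>2 / C > 0" using ne C by simp
  ultimately show False by simp
 qed
 then show ?thesis using inner_eq_zero_iff by blast
qed

end

locale expansion_point = support_expansion A \<phi> t0 c y0 x0 N
 for A :: "'a::euclidean_space set" and \<phi> t0 c y0 x0 N +
 fixes e :: "nat => 'a" and q :: "nat => real"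
 assumes tangent: "tangent_basis (sgn y0) e" and eigen: "i < DIM('a) - 1 ==> N (e i) = q i *\<^sub>R e i"
  and frame: "u = (\<Sum>i<DIM('a) - 1. (u \<bullet> e i) *\<^sub>R e i) + (u \<bullet> sgn y0) *\<^sub>R sgn y0"
begin

lemma e_n0: "i < DIM('a) - 1 ==> e i \<bullet> n0 = 0" "i < DIM('a) - 1 ==> n0 \<bullet> e i = 0"
 and e_e: "i < DIM('a) - 1 ==> j < DIM('a) - 1 ==> e i \<bullet> e j = (if i = j then 1 else 0)"
 using tangent by (auto simp: tangent_basis_def n0_def inner_commute)

lemma tangential: "w \<bullet> n0 = 0 ==> (\<Sum>i<DIM('a) - 1. (w \<bullet> e i) *\<^sub>R e i) = w"
 using frame[of w] by (simp add: n0_def)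

lemma inner_frame_sum: "i < DIM('a) - 1 ==> (\<Sum>j<DIM('a) - 1. a j *\<^sub>R e j) \<bullet> e i = a i"
proof -
 assume i: "i < DIM('a) - 1"
 have "(\<Sum>j<DIM('a) - 1. a j *\<^sub>R e j) \<bullet> e i = (\<Sum>j<DIM('a) - 1. if j = i then a i else 0)"
  unfolding inner_sum_left using i e_e by (intro sum.cong) auto
 then show ?thesis using i by simp
qed

lemma inner_frame_sum_n0: "(\<Sum>j<DIM('a) - 1. a j *\<^sub>R e j) \<bullet> n0 = 0"
 by (simp add: inner_sum_left e_n0)

lemma N_frame: "N u = (\<Sum>i<DIM('a) - 1. (q i * (u \<bullet> e i)) *\<^sub>R e i)"
proof -
 interpret linear N by (rule linear_N)
 have "N u = N ((\<Sum>i<DIM('a) - 1. (u \<bullet> e i) *\<^sub>R e i) + (u \<bullet> n0) *\<^sub>R n0)" using frame[of u] by (simp add: n0_def)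
 also have "... = (\<Sum>i<DIM('a) - 1. (u \<bullet> e i) *\<^sub>R N (e i))" by (simp add: add scale sum N_y0)
 also have "... = (\<Sum>i<DIM('a) - 1. (q i * (u \<bullet> e i)) *\<^sub>R e i)" by (intro sum.cong) (auto simp: eigen)
 finally show ?thesis .
qed

lemma N_inner: "N u \<bullet> u = (\<Sum>i<DIM('a) - 1. q i * (u \<bullet> e i)\<^sup>2)"
 unfolding N_frame[of u] inner_sum_left by (simp add: power2_eq_square inner_commute mult.assoc)

lemma norm_frame: "(norm u)\<^sup>2 = (\<Sum>i<DIM('a) - 1. (u \<bullet> e i)\<^sup>2) + (u \<bullet> n0)\<^sup>2"
proof -
 define v where "v = (\<Sum>i<DIM('a) - 1. (u \<bullet> e i) *\<^sub>R e i) + (u \<bullet> n0) *\<^sub>R n0"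
 have "u = v" unfolding v_def n0_def by (rule frame)
 then have "u \<bullet> u = v \<bullet> u" by simp
 also have "... = (\<Sum>i<DIM('a) - 1. (u \<bullet> e i) * (e i \<bullet> u)) + (u \<bullet> n0) * (n0 \<bullet> u)"
  unfolding v_def by (simp only: inner_add_left inner_sum_left inner_scaleR_left)
 finally show ?thesis unfolding power2_norm_eq_inner by (simp add: power2_eq_square inner_commute)
qed

lemma q_nonneg: "i < DIM('a) - 1 ==> 0 <= q i"
 using N_psd[of "e i"] e_e[of i i] by (simp add: eigen)

lemma c_nonneg: "0 <= c"
proof (rule ccontr)
 assume "\<not> 0 <= c"
 then have "0 < - c / 2" by simp
 from expand[OF this] obtain d0 where d0: "d0 > 0" "!!d r u. 0 < d ==> d < d0 ==> abs r <= d\<^sup>2 ==> norm u <= d ==>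
   abs (tay r u) <= - c / 2 * d\<^sup>2" by blast
 define d where "d = d0 / 2"
 have d: "0 < d" "d < d0" using d0(1) by (auto simp: d_def)
 have "abs (F (t0 + d\<^sup>2) y0 - F t0 y0 - c * d\<^sup>2) <= - c / 2 * d\<^sup>2"
  using d0(2)[OF d, of "d\<^sup>2" 0] d(1) linear_0[OF linear_N] by simp
 moreover have "F t0 y0 <= F (t0 + d\<^sup>2) y0" by (rule F_mono) simp
 moreover have "c * d\<^sup>2 < 0" using \<open>\<not> 0 <= c\<close> d(1) by (simp add: mult_neg_pos)
 ultimately show False by linarith
qed

end

section \<open>Localization of points and normals at nondegenerate expansions\<close>

context expansion_point begin

text \<open>\<open>y1\<close> weakly separates \<open>x0 + w\<close> from
  \<open>SL (t0 + r)\<close>. The estimate says that \<open>y1\<close> is nearly parallel to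
  \<open>n0\<close> and that the level is not too high for the height of \<open>w\<close>.
  \<open>K\<close> bounds the position and \<open>K1\<close> the level; \<open>K5\<close> must not
  depend on \<open>K1\<close>, because \<open>localization\<close> chooses \<open>K1\<close> in
  terms of \<open>K5\<close>.\<close>

abbreviation sep_est :: "real => real => real => real => real => bool" where
 "sep_est K K1 K4 K5 d0 \<equiv> \<forall>d r w y1. 0 < d --> d < d0 --> abs r <= K1 * d\<^sup>2 -->
   norm w <= K * d --> abs (y0 \<bullet> w) <= K * d\<^sup>2 --> y1 \<noteq> 0 --> (\<forall>z\<in>SL (t0 + r). 0 <= y1 \<bullet> (x0 + w - z)) -->
   0 < y1 \<bullet> n0 \<and> norm (y1 - (y1 \<bullet> n0) *\<^sub>R n0) <= K4 * d * (y1 \<bullet> n0) \<and> 0 <= y0 \<bullet> w - c * r + K5 * d\<^sup>2"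

abbreviation loc_est :: "real => real => real => bool" where
 "loc_est K K' d0 \<equiv> \<forall>d w. 0 < d --> d < d0 --> norm w <= K * d --> abs (y0 \<bullet> w) <= K * d\<^sup>2 -->
   x0 + w \<in> A \<and> abs (\<phi> (x0 + w) - t0) <= K' * d\<^sup>2 \<and>
   (\<forall>n\<in>outer_unit_normals (sublevel A \<phi> (\<phi> (x0 + w))) (x0 + w). norm (n - n0) <= K' * d)"

lemma expand_K:
 assumes K: "0 < K" and b: "0 < b"
 shows "\<exists>d0>0. \<forall>d r u. 0 < d --> d < d0 --> abs r <= K * d\<^sup>2 --> norm u <= K * d -->
   abs (tay r u) <= b * d\<^sup>2"
proof -
 define k where "k = max K 1"
 have k: "1 <= k" "K <= k" "k <= k\<^sup>2" using self_le_power[of k 2] by (auto simp: k_def)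
 have "0 < b / k\<^sup>2" using b k by simp
 from expand[OF this] obtain d0 where d0: "d0 > 0" "!!d r u. 0 < d ==> d < d0 ==> abs r <= d\<^sup>2 ==> norm u <= d ==>
   abs (tay r u) <= b / k\<^sup>2 * d\<^sup>2" by blast
 show ?thesis
 proof (intro exI[of _ "d0 / k"] conjI allI impI)
  show "0 < d0 / k" using d0(1) k by simp
  fix d r :: real and u :: 'a assume H: "0 < d" "d < d0 / k" "abs r <= K * d\<^sup>2" "norm u <= K * d"
  have "K * d\<^sup>2 <= k\<^sup>2 * d\<^sup>2" "K * d <= k * d" using k H(1) by (auto intro!: mult_right_mono)
  then have "abs r <= (k * d)\<^sup>2" "norm u <= k * d" using H(3,4) unfolding power_mult_distrib by linarith+
  then have "abs (tay r u) <= b / k\<^sup>2 * (k * d)\<^sup>2"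
   using H k by (intro d0(2)) (auto simp: pos_less_divide_eq mult.commute)
  moreover have "b / k\<^sup>2 * (k * d)\<^sup>2 = b * d\<^sup>2" using k by (simp add: power_mult_distrib)
  ultimately show "abs (tay r u) <= b * d\<^sup>2" by simp
 qed
qed

lemma tangential_inverse:
 assumes q: "!!i. i < DIM('a) - 1 ==> 0 < q i"
 shows "\<exists>C>0. \<forall>v. v \<bullet> n0 = 0 --> (\<exists>u. N u = v \<and> norm u <= C * norm v)"
proof -
 define I where "I v = (\<Sum>i<DIM('a) - 1. ((v \<bullet> e i) / q i) *\<^sub>R e i)" for v
 have "linear I" unfolding I_def
  by (rule linearI) (simp_all add: inner_add_left add_divide_distrib scaleR_add_left sum.distrib scaleR_sum_right)
 from linear_bounded_pos[OF this] obtain C where C: "C > 0" "!!v. norm (I v) <= C * norm v" by blast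
 have "N (I v) = v" if "v \<bullet> n0 = 0" for v
 proof -
  have "N (I v) = (\<Sum>i<DIM('a) - 1. (v \<bullet> e i) *\<^sub>R e i)"
   unfolding N_frame[of "I v"]
  proof (intro sum.cong refl)
   fix i assume "i \<in> {..<DIM('a) - 1}"
   then have "I v \<bullet> e i = (v \<bullet> e i) / q i" "q i \<noteq> 0" using inner_frame_sum[of i "\<lambda>i. (v \<bullet> e i) / q i"] q[of i] by (auto simp: I_def)
   then show "(q i * (I v \<bullet> e i)) *\<^sub>R e i = (v \<bullet> e i) *\<^sub>R e i" by simp
  qed
  then show ?thesis using tangential[OF that] by simp
 qed
 then show ?thesis using C by blast
qed

text \<open>A vector that separates a point near \<open>x0\<close> from a sublevel set is almost parallel to \<open>n0\<close>: otherwise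
 it would fail to separate the point from the support point of the sublevel set in a direction
 \<open>y0 + \<eta>\<close> tilted towards it.\<close>

lemma separating_direction:
 assumes c: "0 < c" and q: "!!i. i < DIM('a) - 1 ==> 0 < q i" and K: "0 < K"
 shows "\<exists>K5>0. \<forall>K1>0. \<exists>K4>0. \<exists>l0>0. sep_est K K1 K4 K5 l0"
proof -
 obtain M where M: "0 < M" "!!u. norm (N u) <= M * norm u" using N_bound by blast
 obtain C where C: "C > 0" "!!v. v \<bullet> n0 = 0 ==> \<exists>\<eta>. N \<eta> = v \<and> norm \<eta> <= C * norm v" using tangential_inverse[OF q] by blast
 obtain xi \<rho> where xi: "0 < \<rho>" "\<forall>\<^sub>F \<tau> in at 0. xi \<in> SL (t0 + \<tau>)" "xi \<in> SL t0" "n0 \<bullet> (x0 - xi) \<ge> \<rho>" by (rule interior_point)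
 \<comment> \<open>One more than \<open>K\<close>: the tilted support point is pushed by
   \<open>k * l\<close> along \<open>v\<close>, which beats the displacement \<open>w\<close> of
   size \<open>K * l\<close> and leaves a margin of \<open>l\<close> for the error
   \<open>l / 4\<close>.\<close>
 define k where "k = K + 1"
 \<comment> \<open>Bounds the height \<open>N \<eta> \<bullet> \<eta> / 2\<close> lost by the tilted
   support point, plus the error 1/4 of its predicted height.\<close>
 define K5 where "K5 = M * (k * C)\<^sup>2 / 2 + 1 / 4"
 have k: "0 < k" using K by (simp add: k_def)
 have K5: "0 < K5" unfolding K5_def using M by (intro add_nonneg_pos) auto
 have "\<exists>K4>0. \<exists>l0>0. sep_est K K1 K4 K5 l0" if K1: "0 < K1" for K1
 proof -
  define K2 where "K2 = max K1 (k * C)"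
  have K2: "0 < K2" "K1 <= K2" "k * C <= K2" using K1 by (auto simp: K2_def)
  obtain l1 where l1: "l1 > 0" "!!l \<tau> \<eta> x. 0 < l ==> l < l1 ==> abs \<tau> <= K2 * l\<^sup>2 ==> norm \<eta> <= K2 * l ==> x \<in> SL (t0 + \<tau>) ==>
   (y0 + \<eta>) \<bullet> x = F (t0 + \<tau>) (y0 + \<eta>) ==>
   foot (1/4) l \<tau> \<eta> x"
   using forward_K[OF K2(1), of "1/4"] by auto
  define K3 where "K3 = (K + c * K1 + K5) / s0"
  have K3: "0 < K3" unfolding K3_def using K c K1 K5 s0 by (intro divide_pos_pos add_pos_pos mult_pos_pos)
  define K4 where "K4 = 4 / 3 * K3"
  define D where "D = norm (x0 - xi)"
  obtain l2 where l2: "l2 > 0" "!!\<tau>. abs \<tau> < l2 ==> xi \<in> SL (t0 + \<tau>)"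
  proof -
   obtain d where "d > 0" "!!\<tau>. \<tau> \<noteq> 0 ==> abs \<tau> < d ==> xi \<in> SL (t0 + \<tau>)" using xi(2) unfolding eventually_at by (auto simp: dist_real_def)
   then show ?thesis using xi(3) by (intro that[of d]) (auto, metis add.right_neutral)
  qed
  define l0 where "l0 = min l1 (min 1 (min (l2 / K1) (\<rho> / (K + K4 * (D + K)))))"
  have dpos: "0 < K + K4 * (D + K)" using K K3 by (intro add_pos_nonneg mult_nonneg_nonneg) (auto simp: K4_def D_def)
  have l0: "l0 > 0" using l1 l2 xi(1) K1 dpos by (simp add: l0_def)
  have main: "0 < y1 \<bullet> n0 \<and> norm (y1 - (y1 \<bullet> n0) *\<^sub>R n0) <= K4 * l * (y1 \<bullet> n0) \<and> 0 <= y0 \<bullet> w - c * \<tau> + K5 * l\<^sup>2"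
   if l: "0 < l" "l < l0" and \<tau>: "abs \<tau> <= K1 * l\<^sup>2" and w: "norm w <= K * l" "abs (y0 \<bullet> w) <= K * l\<^sup>2" and y1: "y1 \<noteq> 0"
    and sep: "\<forall>z\<in>SL (t0 + \<tau>). 0 <= y1 \<bullet> (x0 + w - z)" for l \<tau> w y1
  proof -
   have l': "l < l1" "l < 1" "l < l2 / K1" "l < \<rho> / (K + K4 * (D + K))" using l(2) by (auto simp: l0_def)
   define a where "a = y1 \<bullet> n0"
   define v where "v = y1 - a *\<^sub>R n0"
   have y1_eq: "y1 = a *\<^sub>R n0 + v" by (simp add: v_def)
   have vn: "v \<bullet> n0 = 0" by (simp add: v_def a_def inner_diff_left n0)
   have "((k * l) *\<^sub>R sgn v) \<bullet> n0 = 0" using vn by (simp add: sgn_div_norm)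
   from C(2)[OF this] obtain \<eta> where \<eta>: "N \<eta> = (k * l) *\<^sub>R sgn v" "norm \<eta> <= C * norm ((k * l) *\<^sub>R sgn v)" by blast
   have "norm ((k * l) *\<^sub>R sgn v) <= k * l" using norm_sgn_le_1[of v] k l by (simp add: mult_left_le)
   then have "norm \<eta> <= C * (k * l)" using \<eta>(2) mult_left_mono[of "norm ((k * l) *\<^sub>R sgn v)" "k * l" C] C(1) by linarith
   then have \<eta>n: "norm \<eta> <= k * C * l" by (simp add: mult_ac)
   obtain P where P: "P \<in> SL (t0 + \<tau>)" "(y0 + \<eta>) \<bullet> P = F (t0 + \<tau>) (y0 + \<eta>)" using F_attained by blast
   have "K1 * l\<^sup>2 <= K2 * l\<^sup>2" "k * C * l <= K2 * l" using K2 l by (auto intro!: mult_right_mono)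
   then have "abs \<tau> <= K2 * l\<^sup>2" "norm \<eta> <= K2 * l" using \<tau> \<eta>n by linarith+
   from l1(2)[OF l(1) l'(1) this P] have fw: "norm (P - x0 - N \<eta>) <= 1/4 * l" "abs (y0 \<bullet> (P - x0) - c * \<tau> + N \<eta> \<bullet> \<eta> / 2) <= 1/4 * l\<^sup>2" by auto
   define r where "r = P - x0 - N \<eta>"
   define h where "h = n0 \<bullet> (w - (P - x0))"
   have "y1 \<bullet> (x0 + w - P) = a * h + v \<bullet> (w - N \<eta> - r)"
    unfolding h_def r_def by (subst y1_eq) (simp add: inner_add_left inner_diff_right algebra_simps)
   moreover have "v \<bullet> w <= K * l * norm v"
    using norm_cauchy_schwarz[of v w] mult_left_mono[OF w(1), of "norm v"] by (simp add: mult.commute)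
   moreover have "- (v \<bullet> r) <= 1/4 * l * norm v"
   proof -
    have "abs (v \<bullet> r) <= norm v * (1/4 * l)"
     using Cauchy_Schwarz_ineq2[of v r] mult_left_mono[OF fw(1), of "norm v"] unfolding r_def by simp
    then show ?thesis by (simp add: mult.commute abs_le_iff)
   qed
   moreover have "v \<bullet> N \<eta> = K * l * norm v + l * norm v" unfolding \<eta>(1) by (simp add: inner_sgn_self k_def algebra_simps)
   moreover have "0 <= y1 \<bullet> (x0 + w - P)" using sep P(1) by blast
   ultimately have ah: "3/4 * (l * norm v) <= a * h" by (simp add: inner_diff_right)
   have s0h: "s0 * h = y0 \<bullet> w - y0 \<bullet> (P - x0)" unfolding h_def y0_inner by (simp add: inner_diff_right right_diff_distrib)
   have N\<eta>: "N \<eta> \<bullet> \<eta> / 2 <= M * (k * C)\<^sup>2 / 2 * l\<^sup>2"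
   proof -
    have "N \<eta> \<bullet> \<eta> <= norm (N \<eta>) * norm \<eta>" by (rule norm_cauchy_schwarz)
    also have "... <= M * norm \<eta> * norm \<eta>" using M(2) by (intro mult_right_mono) auto
    also have "... <= M * (k * C * l) * (k * C * l)" using \<eta>n M(1) C(1) k l by (intro mult_mono) auto
    also have "... = M * (k * C)\<^sup>2 * l\<^sup>2" unfolding power2_eq_square by (simp add: mult_ac)
    finally show ?thesis by simp
   qed
   have K5': "K5 * l\<^sup>2 = M * (k * C)\<^sup>2 / 2 * l\<^sup>2 + 1/4 * l\<^sup>2" by (simp add: K5_def distrib_right)
   have up: "s0 * h <= y0 \<bullet> w - c * \<tau> + K5 * l\<^sup>2" using s0h fw(2) N\<eta> K5' unfolding abs_le_iff by linarith
   have c\<tau>: "abs (c * \<tau>) <= c * K1 * l\<^sup>2" using mult_left_mono[OF \<tau>, of c] c by (simp add: abs_mult)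
   have lo: "- (s0 * h) <= K * l\<^sup>2 + c * K1 * l\<^sup>2 + K5 * l\<^sup>2"
   proof -
    have "0 <= M * (k * C)\<^sup>2 / 2 * l\<^sup>2" "0 <= N \<eta> \<bullet> \<eta> / 2" using M(1) N_psd[of \<eta>] by auto
    then show ?thesis using s0h fw(2) K5' c\<tau> w(2) unfolding abs_le_iff by linarith
   qed
   have "s0 * h <= K * l\<^sup>2 + c * K1 * l\<^sup>2 + K5 * l\<^sup>2" using up c\<tau> w(2) unfolding abs_le_iff by linarith
   then have "abs (s0 * h) <= (K + c * K1 + K5) * l\<^sup>2" using lo unfolding abs_le_iff distrib_right by linarith
   then have "s0 * abs h <= s0 * (K3 * l\<^sup>2)" unfolding K3_def using s0 by (simp add: abs_mult)
   then have h: "abs h <= K3 * l\<^sup>2" using s0 by simp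
   have "a * h <= abs a * abs h" by (simp flip: abs_mult)
   also have "... <= abs a * (K3 * l\<^sup>2)" using h by (intro mult_left_mono) auto
   also have "... = l * (K3 * l * abs a)" by (simp add: power2_eq_square)
   finally have "l * (3/4 * norm v) <= l * (K3 * l * abs a)" using ah by simp
   then have v: "norm v <= K4 * l * abs a" using l(1) by (simp add: K4_def)
   \<comment> \<open>If \<open>y1\<close> pointed inwards, \<open>xi\<close> would lie on the wrong
     side: its depth \<open>\<rho>\<close> dominates the other terms because
     \<open>l < \<rho> / (K + K4 * (D + K))\<close>.\<close>
   have a: "0 < a"
   proof (rule ccontr)
    assume na: "\<not> 0 < a"
    have "abs \<tau> < l2"
    proof -
     have "K1 * l\<^sup>2 <= K1 * l" using K1 l l' by (intro mult_left_mono) (auto simp: power2_eq_square mult_left_le)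
     also have "... < l2" using l'(3) K1 by (simp add: pos_less_divide_eq mult.commute)
     finally show ?thesis using \<tau> by linarith
    qed
    then have "0 <= y1 \<bullet> (x0 + w - xi)" using sep l2(2) by blast
    also have "y1 \<bullet> (x0 + w - xi) = a * (n0 \<bullet> (x0 - xi)) + a * (n0 \<bullet> w) + v \<bullet> (x0 + w - xi)"
     by (subst y1_eq) (simp add: inner_add_left inner_add_right inner_diff_right algebra_simps)
    also have "... <= - abs a * \<rho> + abs a * (K * l) + K4 * l * abs a * (D + K)"
    proof (intro add_mono)
     show "a * (n0 \<bullet> (x0 - xi)) <= - abs a * \<rho>" using mult_left_mono[OF xi(4), of "abs a"] na by simp
     have "abs (n0 \<bullet> w) <= K * l" using Cauchy_Schwarz_ineq2[of n0 w] w(1) n0 by simp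
     then have "abs a * abs (n0 \<bullet> w) <= abs a * (K * l)" by (intro mult_left_mono) auto
     then show "a * (n0 \<bullet> w) <= abs a * (K * l)" by (simp add: abs_mult[symmetric])
     have "norm (x0 + w - xi) <= D + norm w" using norm_triangle_ineq[of "x0 - xi" w] by (simp add: D_def algebra_simps)
     also have "... <= D + K" using w(1) K l' l by (simp add: mult_left_le order_trans[OF w(1)])
     finally have "norm v * norm (x0 + w - xi) <= (K4 * l * abs a) * (D + K)" using v by (intro mult_mono) (auto intro: order_trans[OF norm_ge_zero])
     then show "v \<bullet> (x0 + w - xi) <= K4 * l * abs a * (D + K)" using norm_cauchy_schwarz[of v "x0 + w - xi"] by linarith
    qed
    also have "... = abs a * (l * (K + K4 * (D + K)) - \<rho>)" by (simp add: algebra_simps)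
    finally have "0 <= abs a * (l * (K + K4 * (D + K)) - \<rho>)" .
    moreover have "l * (K + K4 * (D + K)) - \<rho> < 0" using l'(4) dpos by (simp add: pos_less_divide_eq)
    ultimately have "a = 0" by (simp add: zero_le_mult_iff)
    then have "y1 = 0" using v y1_eq by simp
    with y1 show False by simp
   qed
   have "0 <= 3/4 * (l * norm v)" using l(1) by simp
   then have "0 <= a * h" using ah by linarith
   then have "0 <= h" using a by (simp add: zero_le_mult_iff)
   then have "0 <= y0 \<bullet> w - c * \<tau> + K5 * l\<^sup>2" using up s0 mult_nonneg_nonneg[of s0 h] by linarith
   then show ?thesis using a v unfolding v_def a_def by simp
  qed
  have "0 < K4" using K3 by (simp add: K4_def)
  then show ?thesis using main l0 by blast
 qed
 then show ?thesis using K5 by blast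
qed

lemma norm_frame_pyth: "v \<bullet> n0 = 0 ==> (norm (v + a *\<^sub>R n0))\<^sup>2 = a\<^sup>2 + (norm v)\<^sup>2"
 unfolding power2_norm_eq_inner by (simp add: inner_add_left inner_add_right n0(2) inner_commute power2_eq_square)

text \<open>A vector separating \<open>x0 + w\<close> from the sublevel set at
  \<open>t0 + K1 * h^2\<close> would violate the height estimate, so the point lies in that set; a
  level below \<open>t0 - K1 * h^2\<close> is excluded by the direction \<open>y0\<close> itself. A
  normal separates the point from its own sublevel set, which bounds its tilt.\<close>

lemma localization:
 assumes c: "0 < c" and q: "!!i. i < DIM('a) - 1 ==> 0 < q i" and K: "0 < K"
 shows "\<exists>K'>0. \<exists>h0>0. loc_est K K' h0"
proof -
 obtain K5 where K5: "K5 > 0" "!!K1. K1 > 0 ==> \<exists>K4>0. \<exists>h0>0. sep_est K K1 K4 K5 h0"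
  using separating_direction[OF c q K] by blast
 \<comment> \<open>Makes \<open>c * K1\<close> exceed \<open>K + K5\<close>; the surplus 2 also
   covers the expansion error \<open>h^2\<close> in the lower bound.\<close>
 define K1 where "K1 = (K + K5 + 2) / c"
 have K1: "0 < K1" "c * K1 = K + K5 + 2" using K K5 c by (auto simp: K1_def)
 obtain K4 h1 where K4: "K4 > 0" "h1 > 0" "!!h r w y1. 0 < h ==> h < h1 ==> abs r <= K1 * h\<^sup>2 ==>
   norm w <= K * h ==> abs (y0 \<bullet> w) <= K * h\<^sup>2 ==> y1 \<noteq> 0 ==> (\<forall>z\<in>SL (t0 + r). 0 <= y1 \<bullet> (x0 + w - z)) ==> 0 < y1 \<bullet> n0 \<and> norm (y1 - (y1 \<bullet> n0) *\<^sub>R n0) <= K4 * h * (y1 \<bullet> n0) \<and> 0 <= y0 \<bullet> w - c * r + K5 * h\<^sup>2"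
  using K5(2)[OF K1(1)] by blast
 obtain h2 where h2: "h2 > 0" "!!h r u. 0 < h ==> h < h2 ==> abs r <= K1 * h\<^sup>2 ==> norm u <= K1 * h ==>
   abs (tay r u) <= 1 * h\<^sup>2"
  using expand_K[OF K1(1), of 1] by auto
 define h0 where "h0 = min (min h1 h2) (min 1 (min (1 / K4) ((t0 - m0) / K1)))"
 have h0: "h0 > 0" using K4 h2 K1 t0 by (simp add: h0_def)
 have "x0 + w \<in> A \<and> abs (\<phi> (x0 + w) - t0) <= max K1 (2 * K4) * h\<^sup>2 \<and>
   (\<forall>n\<in>outer_unit_normals (sublevel A \<phi> (\<phi> (x0 + w))) (x0 + w). norm (n - n0) <= max K1 (2 * K4) * h)"
  if h: "0 < h" "h < h0" and w: "norm w <= K * h" "abs (y0 \<bullet> w) <= K * h\<^sup>2" for h w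
 proof -
  have h': "h < h1" "h < h2" "h < 1" "h < 1 / K4" "h < (t0 - m0) / K1" using h(2) by (auto simp: h0_def)
  have d2: "0 < h\<^sup>2" using h(1) by simp
  have cK: "c * (K1 * h\<^sup>2) = K * h\<^sup>2 + K5 * h\<^sup>2 + 2 * h\<^sup>2" using K1(2) by (simp only: mult.assoc[symmetric] distrib_right)
  have K1d: "K1 * h\<^sup>2 < t0 - m0"
  proof -
   have "K1 * h\<^sup>2 <= K1 * h" using K1 h h' by (intro mult_left_mono) (auto simp: power2_eq_square mult_left_le)
   also have "... < t0 - m0" using h'(5) K1 by (simp add: pos_less_divide_eq mult.commute)
   finally show ?thesis .
  qed
  have in1: "x0 + w \<in> SL (t0 + K1 * h\<^sup>2)"
  proof (rule ccontr)
   assume "x0 + w \<notin> SL (t0 + K1 * h\<^sup>2)"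
   then obtain y where y: "y \<noteq> 0" "F (t0 + K1 * h\<^sup>2) y < y \<bullet> (x0 + w)" by (rule not_in_SL)
   have "\<forall>z\<in>SL (t0 + K1 * h\<^sup>2). 0 <= y \<bullet> (x0 + w - z)" using y(2) F_upper[of _ "t0 + K1 * h\<^sup>2" y] by (fastforce simp: inner_diff_right)
   then have "0 <= y0 \<bullet> w - c * (K1 * h\<^sup>2) + K5 * h\<^sup>2" using K4(3)[OF h(1) h'(1) _ w y(1)] K1(1) by simp
   then show False using w(2) d2 unfolding cK abs_le_iff by linarith
  qed
  then have inA: "x0 + w \<in> A" and up: "\<phi> (x0 + w) <= t0 + K1 * h\<^sup>2"
   using t0 mult_pos_pos[OF K1(1) d2] by (auto simp: mem_SL max_absorb2)
  have low: "t0 - K1 * h\<^sup>2 <= \<phi> (x0 + w)"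
  proof (rule ccontr)
   assume "\<not> ?thesis"
   then have "x0 + w \<in> SL (t0 + - (K1 * h\<^sup>2))" using inA by (simp add: mem_SL)
   from F_upper[OF this, of y0] have "y0 \<bullet> (x0 + w) <= F (t0 + - (K1 * h\<^sup>2)) y0" .
   moreover have "abs (tay (- (K1 * h\<^sup>2)) 0) <= 1 * h\<^sup>2"
    using K1(1) h(1) by (intro h2(2)[OF h(1) h'(2)]) auto
   ultimately have "y0 \<bullet> w <= - (c * (K1 * h\<^sup>2)) + h\<^sup>2" by (simp add: inner_add_right x0 abs_le_iff)
   moreover have "0 < K5 * h\<^sup>2" using K5(1) d2 by simp
   ultimately show False using w(2) d2 unfolding cK abs_le_iff by linarith
  qed
  have "norm (n - n0) <= max K1 (2 * K4) * h" if n: "n \<in> outer_unit_normals (sublevel A \<phi> (\<phi> (x0 + w))) (x0 + w)" for n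
  proof -
   have n1: "norm n = 1" "!!z. z \<in> sublevel A \<phi> (\<phi> (x0 + w)) ==> n \<bullet> (z - (x0 + w)) <= 0"
    using n by (auto simp: outer_unit_normals_def)
   have "\<forall>z\<in>SL (t0 + (\<phi> (x0 + w) - t0)). 0 <= n \<bullet> (x0 + w - z)"
    using n1(2) SL_phi[OF inA] by (fastforce simp: inner_diff_right)
   moreover have "abs (\<phi> (x0 + w) - t0) <= K1 * h\<^sup>2" using up low by (simp add: abs_le_iff)
   moreover have "n \<noteq> 0" using n1(1) by auto
   ultimately have *: "0 < n \<bullet> n0" "norm (n - (n \<bullet> n0) *\<^sub>R n0) <= K4 * h * (n \<bullet> n0)"
    using K4(3)[OF h(1) h'(1) _ w] by blast+
   define a where "a = n \<bullet> n0"
   define v where "v = n - a *\<^sub>R n0"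
   have a1: "a <= 1" using norm_cauchy_schwarz[of n n0] n1(1) n0(1) by (simp add: a_def)
   have a0: "0 < a" using *(1) by (simp add: a_def)
   have "norm v <= K4 * h * a" using *(2) by (simp add: v_def a_def)
   also have "... <= K4 * h" using a1 K4(1) h(1) by (simp add: mult_left_le)
   finally have nv: "norm v <= K4 * h" .
   have "K4 * h <= 1" using h'(4) K4(1) by (simp add: pos_less_divide_eq mult.commute less_imp_le)
   then have nv1: "norm v <= 1" using nv by linarith
   have "v \<bullet> n0 = 0" by (simp add: v_def a_def inner_diff_left n0)
   then have "(norm n)\<^sup>2 = a\<^sup>2 + (norm v)\<^sup>2"
    using norm_frame_pyth[of v a] by (simp add: v_def)
   then have "1 - a\<^sup>2 = norm v * norm v" using n1(1) by (simp add: power2_eq_square)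
   moreover have "1 - a <= 1 - a\<^sup>2" using a0 a1 by (simp add: power2_eq_square mult_left_le)
   moreover have "norm v * norm v <= norm v" using nv1 by (simp add: mult_left_le)
   ultimately have "1 - a <= norm v" by linarith
   have "n - n0 = v + (a - 1) *\<^sub>R n0" by (simp add: v_def algebra_simps)
   then have "norm (n - n0) <= norm v + (1 - a)" using norm_triangle_ineq[of v "(a - 1) *\<^sub>R n0"] n0(1) a1 by simp
   also have "... <= 2 * K4 * h" using \<open>1 - a <= norm v\<close> nv by simp
   also have "... <= max K1 (2 * K4) * h" using h(1) by (intro mult_right_mono) auto
   finally show ?thesis .
  qed
  moreover have "K1 * h\<^sup>2 <= max K1 (2 * K4) * h\<^sup>2" by (intro mult_right_mono) auto
  ultimately show ?thesis using inA up low unfolding abs_le_iff by (intro conjI ballI) auto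
 qed
 then show ?thesis using h0 K1(1) by (intro exI[of _ "max K1 (2 * K4)"] conjI exI[of _ h0]) auto
qed

text \<open>An increment \<open>w\<close> is treated at the scale \<open>h = sqrt (norm w)\<close>.
  Direction \<open>y0\<close> bounds the level from below. From above, a separating vector is
  normalized to \<open>y0 + v\<close> with \<open>v\<close> of order \<open>h\<close>:
  \<open>v \<bullet> w\<close> is then of order \<open>h^3\<close>, and
  \<open>N v \<bullet> v / 2\<close>, which is of the same order as \<open>norm w\<close>, has the
  favourable sign.\<close>

lemma differentiable_phi:
 assumes c: "0 < c" and q: "!!i. i < DIM('a) - 1 ==> 0 < q i"
 shows "\<phi> x0 = t0" "(\<phi> has_derivative (\<lambda>w. (y0 \<bullet> w) / c)) (at x0)"
proof -
 \<comment> \<open>With \<open>norm w = h^2 <= h\<close> and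
   \<open>abs (y0 \<bullet> w) <= s0 * h^2\<close>, this constant puts \<open>w\<close> into the
   range of \<open>localization\<close>.\<close>
 define K where "K = max 1 s0"
 have K: "0 < K" "1 <= K" "s0 <= K" by (auto simp: K_def)
 obtain K' h1 where L1: "K' > 0" "h1 > 0" "loc_est K K' h1"
  using localization[OF c _ K(1)] q by (elim meta_impE exE conjE) (rule q, assumption, rule that)
 have L: "K' > 0" "h1 > 0" "!!h w. 0 < h ==> h < h1 ==> norm w <= K * h ==> abs (y0 \<bullet> w) <= K * h\<^sup>2 ==>
   x0 + w \<in> A \<and> abs (\<phi> (x0 + w) - t0) <= K' * h\<^sup>2"
  using L1(1,2) L1(3)[rule_format] by blast+
 have "abs (\<phi> x0 - t0) <= 0"
 proof (rule field_le_epsilon)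
  fix k :: real assume k: "0 < k"
  define h where "h = min (h1 / 2) (sqrt (k / K'))"
  have h: "0 < h" "h < h1" using L k by (auto simp: h_def)
  have "h\<^sup>2 <= (sqrt (k / K'))\<^sup>2" using h(1) by (intro power_mono) (auto simp: h_def)
  then have "K' * h\<^sup>2 <= k" using L(1) k by (simp add: pos_le_divide_eq mult.commute)
  then show "abs (\<phi> x0 - t0) <= 0 + k" using L(3)[OF h, of 0] h(1) K by simp
 qed
 then show pt: "\<phi> x0 = t0" by simp
 have "\<exists>d>0. \<forall>w. norm w < d --> abs (\<phi> (x0 + w) - t0 - (y0 \<bullet> w) / c) <= k * norm w" if k: "0 < k" for k
 proof -
  define K1 where "K1 = max K' (s0 / c + k)"
  have K1: "0 < K1" "K' <= K1" "s0 / c + k <= K1" using L(1) by (auto simp: K1_def)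
  obtain K4 h2 where K4: "K4 > 0" "h2 > 0" "!!h r w y1. 0 < h ==> h < h2 ==> abs r <= K1 * h\<^sup>2 ==>
    norm w <= K * h ==> abs (y0 \<bullet> w) <= K * h\<^sup>2 ==> y1 \<noteq> 0 ==> (\<forall>z\<in>SL (t0 + r). 0 <= y1 \<bullet> (x0 + w - z)) ==> 0 < y1 \<bullet> n0 \<and> norm (y1 - (y1 \<bullet> n0) *\<^sub>R n0) <= K4 * h * (y1 \<bullet> n0)"
  proof -
   obtain K5 where "\<forall>K1>0. \<exists>K4>0. \<exists>h0>0. sep_est K K1 K4 K5 h0"
    using separating_direction[OF c q K(1)] by blast
   then show ?thesis using K1(1) that by metis
  qed
  define K2 where "K2 = max K1 (s0 * K4)"
  have K2: "0 < K2" "K1 <= K2" "s0 * K4 <= K2" using K1(1) by (auto simp: K2_def)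
  define k' where "k' = c * k / 2"
  have k': "0 < k'" "c * k = 2 * k'" using c k by (auto simp: k'_def)
  obtain h3 where h3: "h3 > 0" "!!h r u. 0 < h ==> h < h3 ==> abs r <= K2 * h\<^sup>2 ==> norm u <= K2 * h ==>
    abs (tay r u) <= k' * h\<^sup>2"
   using expand_K[OF K2(1) k'(1)] by blast
  define d' where "d' = min (min h1 h2) (min h3 (min 1 (min (k' / (s0 * K4)) ((t0 - m0) / K1))))"
  have "0 < k' / (s0 * K4)" "0 < (t0 - m0) / K1" using K4(1) k'(1) s0 t0 K1(1) by simp_all
  then have d': "0 < d'" unfolding d'_def using L(2) K4(2) h3(1) by (simp only: min_less_iff_conj) simp
  define d where "d = d'\<^sup>2"
  have d: "0 < d" unfolding d_def using d' by (rule zero_less_power)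
  have "abs (\<phi> (x0 + w) - t0 - (y0 \<bullet> w) / c) <= k * norm w" if w: "norm w < d" for w
  proof (cases "w = 0")
   case True then show ?thesis using pt by simp
  next
   case False
   define h where "h = sqrt (norm w)"
   have h: "0 < h" "h\<^sup>2 = norm w" using False by (auto simp: h_def)
   have "h < d'" using w d' unfolding h(2)[symmetric] d_def by (auto intro: power2_less_imp_less)
   then have h': "h < h1" "h < h2" "h < h3" "h < 1" "h < k' / (s0 * K4)" "h < (t0 - m0) / K1" unfolding d'_def by auto
   have "h\<^sup>2 <= h" unfolding power2_eq_square using h(1) h'(4) by (intro mult_left_le) auto
   have w1: "norm w <= K * h" using \<open>h\<^sup>2 <= h\<close> h K(2) mult_right_mono[of 1 K h] by linarith
   have yw: "abs (y0 \<bullet> w) <= s0 * h\<^sup>2" using Cauchy_Schwarz_ineq2[of y0 w] h(2) by (simp add: s0_def)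
   have w2: "abs (y0 \<bullet> w) <= K * h\<^sup>2" using yw mult_right_mono[OF K(3), of "h\<^sup>2"] by simp
   have inA: "x0 + w \<in> A" and r: "abs (\<phi> (x0 + w) - t0) <= K' * h\<^sup>2" using L(3)[OF h(1) h'(1) w1 w2] by auto
   define r where "r = \<phi> (x0 + w) - t0"
   have K1K2: "K' * h\<^sup>2 <= K2 * h\<^sup>2" "K1 * h\<^sup>2 <= K2 * h\<^sup>2" using K1 K2 by (auto intro!: mult_right_mono)
   have "x0 + w \<in> SL (t0 + r)" using inA by (simp add: mem_SL r_def)
   from F_upper[OF this, of y0] have "y0 \<bullet> (x0 + w) <= F (t0 + r) y0" .
   moreover have "abs (tay r 0) <= k' * h\<^sup>2"
    using order_trans[OF r K1K2(1)] K2(1) h(1) unfolding r_def by (intro h3(2)[OF h(1) h'(3)]) auto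
   ultimately have low: "y0 \<bullet> w - k' * h\<^sup>2 <= c * r" by (simp add: inner_add_right x0 abs_le_iff)
   \<comment> \<open>The predicted increment plus the tolerance; the upper bound amounts to
     membership of \<open>x0 + w\<close> in the sublevel set at \<open>t0 + r1\<close>.\<close>
   define r1 where "r1 = (y0 \<bullet> w) / c + k * h\<^sup>2"
   have cr1: "c * r1 = y0 \<bullet> w + 2 * (k' * h\<^sup>2)" using c by (simp add: r1_def distrib_left k'(2)[symmetric] mult.assoc[symmetric])
   have r1: "abs r1 <= K1 * h\<^sup>2"
   proof -
    have "abs r1 <= abs (y0 \<bullet> w) / c + k * h\<^sup>2" unfolding r1_def using c k by (simp add: order_trans[OF abs_triangle_ineq])
    also have "... <= s0 * h\<^sup>2 / c + k * h\<^sup>2" using yw c by (intro add_right_mono divide_right_mono) auto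
    also have "... = (s0 / c + k) * h\<^sup>2" by (simp add: distrib_right)
    also have "... <= K1 * h\<^sup>2" using K1(3) by (intro mult_right_mono) auto
    finally show ?thesis .
   qed
   have "x0 + w \<in> SL (t0 + r1)"
   proof (rule ccontr)
    assume "x0 + w \<notin> SL (t0 + r1)"
    then obtain y1 where y1: "y1 \<noteq> 0" "F (t0 + r1) y1 < y1 \<bullet> (x0 + w)" by (rule not_in_SL)
    have "\<forall>z\<in>SL (t0 + r1). 0 <= y1 \<bullet> (x0 + w - z)" using y1(2) F_upper[of _ "t0 + r1" y1] by (fastforce simp: inner_diff_right)
    from K4(3)[OF h(1) h'(2) r1 w1 w2 y1(1) this] have y1n: "0 < y1 \<bullet> n0" "norm (y1 - (y1 \<bullet> n0) *\<^sub>R n0) <= K4 * h * (y1 \<bullet> n0)" by auto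
    \<comment> \<open>Scales the separating vector to the same \<open>n0\<close>-component as
      \<open>y0\<close>, so that it differs from \<open>y0\<close> only tangentially.\<close>
    define b where "b = s0 / (y1 \<bullet> n0)"
    have b: "0 < b" "b * (y1 \<bullet> n0) = s0" using y1n(1) s0 by (auto simp: b_def)
    define v where "v = b *\<^sub>R (y1 - (y1 \<bullet> n0) *\<^sub>R n0)"
    have yv: "y0 + v = b *\<^sub>R y1" unfolding v_def scaleR_diff_right scaleR_scaleR b(2) by (simp add: y0_eq[symmetric])
    have "norm v <= b * (K4 * h * (y1 \<bullet> n0))" unfolding v_def norm_scaleR using b(1) y1n(2) by simp
    also have "... = s0 * K4 * h" using b(2) by (simp add: mult_ac)
    finally have v: "norm v <= s0 * K4 * h" .
    have "F (t0 + r1) (y0 + v) < (y0 + v) \<bullet> (x0 + w)"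
     unfolding yv F_hom[OF less_imp_le[OF b(1)]] using y1(2) b(1) by simp
    moreover have "abs (tay r1 v) <= k' * h\<^sup>2"
     using order_trans[OF r1 K1K2(2)] order_trans[OF v mult_right_mono[OF K2(3)]] h(1) by (intro h3(2)[OF h(1) h'(3)]) (simp_all only: less_imp_le)
    moreover have "(y0 + v) \<bullet> (x0 + w) = F t0 y0 + y0 \<bullet> w + x0 \<bullet> v + v \<bullet> w"
     by (simp add: inner_add_left inner_add_right x0 inner_commute[of x0])
    moreover have "v \<bullet> w < k' * h\<^sup>2"
    proof -
     have "v \<bullet> w <= norm v * norm w" by (rule norm_cauchy_schwarz)
     also have "... <= s0 * K4 * h * h\<^sup>2" unfolding h(2)[symmetric] using v by (intro mult_right_mono) auto
     also have "... < k' * h\<^sup>2" using h'(5) s0 K4(1) h(1) by (intro mult_strict_right_mono) (auto simp: pos_less_divide_eq mult.commute)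
     finally show ?thesis .
    qed
    ultimately show False using cr1 N_psd[of v] unfolding abs_le_iff by linarith
   qed
   moreover have "m0 <= t0 + r1"
   proof -
    have "K1 * h\<^sup>2 <= K1 * h" using K1 \<open>h\<^sup>2 <= h\<close> by (intro mult_left_mono) auto
    also have "... < t0 - m0" using h'(6) K1 by (simp add: pos_less_divide_eq mult.commute)
    finally show ?thesis using r1 by linarith
   qed
   ultimately have "r <= r1" by (simp add: mem_SL r_def)
   moreover have "(y0 \<bullet> w) / c - k * h\<^sup>2 <= r"
   proof -
    have "c * ((y0 \<bullet> w) / c - k * h\<^sup>2) = y0 \<bullet> w - 2 * (k' * h\<^sup>2)" using c by (simp add: right_diff_distrib k'(2)[symmetric] mult.assoc[symmetric])
    also have "... <= c * r" using low k' zero_le_power2[of h] mult_nonneg_nonneg[of k' "h\<^sup>2"] by linarith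
    finally show ?thesis using c by simp
   qed
   ultimately show ?thesis unfolding r1_def r_def h(2) abs_le_iff by linarith
  qed
  then show ?thesis using d by blast
 qed
 note est = this
 show "(\<phi> has_derivative (\<lambda>w. (y0 \<bullet> w) / c)) (at x0)"
  unfolding has_derivative_at_alt
 proof (intro conjI allI impI)
  show "bounded_linear (\<lambda>w. (y0 \<bullet> w) / c)" by (intro bounded_linear_divide bounded_linear_inner_right bounded_linear_compose[OF bounded_linear_divide])
  fix k :: real assume "0 < k"
  from est[OF this] obtain d where d: "d > 0" "!!w. norm w < d ==> abs (\<phi> (x0 + w) - t0 - (y0 \<bullet> w) / c) <= k * norm w" by blast
  show "\<exists>d>0. \<forall>y. norm (y - x0) < d --> norm (\<phi> y - \<phi> x0 - (y0 \<bullet> (y - x0)) / c) <= k * norm (y - x0)"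
   using d(2)[of "_ - x0"] d(1) pt by (intro exI[of _ d]) auto
 qed
qed

end

section \<open>Volumes of parabolic boxes and of their preimages\<close>

context expansion_point begin

text \<open>For \<open>c' = c\<close> and \<open>q' = q\<close> this is the second-order Taylor polynomial at \<open>(x0, s0)\<close> of the map
 \<open>(x, s) \<mapsto> (\<phi> x, s n(x))\<close>, whose Jacobian is to be determined.\<close>

definition Xi :: "real => (nat => real) => 'a => real => real \<times> 'a" where
 "Xi c' q' x s = (t0 + (y0 \<bullet> (x - x0) + (\<Sum>i<DIM('a) - 1. ((x - x0) \<bullet> e i)\<^sup>2 / q' i) / 2) / c',
   y0 + ((\<Sum>i<DIM('a) - 1. ((x - x0) \<bullet> e i / q' i) *\<^sub>R e i) + (s - s0) *\<^sub>R n0))"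

text \<open>\<open>Xi\<close> divides the tangential coordinates by \<open>q' i\<close> and
  multiplies the normal one by \<open>s0 / c'\<close>, so volumes of preimages carry the constant
  factor \<open>c' * (\<Prod>i<DIM('a) - 1. q' i) / s0\<close>. The quadratic part of the level
  depends on tangential coordinates alone and is a volume-preserving shear.\<close>

lemma volume_Xi:
 assumes B: "B \<in> sets borel" and c': "0 < c'" and q': "!!i. i < DIM('a) - 1 ==> 0 < q' i"
 shows "(\<integral>\<^sup>+x. \<integral>\<^sup>+s. indicator B (Xi c' q' x s) \<partial>lborel \<partial>lborel) =
  ennreal (c' * (\<Prod>i<DIM('a) - 1. q' i) / s0) * emeasure lborel B"
proof -
 have [measurable]: "B \<in> sets borel" by fact
 \<comment> \<open>The quadratic term in stretched coordinates: for
   \<open>w \<bullet> e i = q' i * (u \<bullet> e i)\<close>, the quotient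
   \<open>(w \<bullet> e i)^2 / q' i\<close> becomes
   \<open>q' i * (u \<bullet> e i)^2\<close>.\<close>
 define v where "v u = (\<Sum>i<DIM('a) - 1. q' i * (u \<bullet> e i)\<^sup>2) / (2 * c')" for u
 define f :: "real \<times> 'a => ennreal" where "f z = indicator B ((t0, y0) + z)" for z
 define g where "g u = (\<integral>\<^sup>+s. f (s0 / c' * (u \<bullet> n0) + v u, u - (u \<bullet> n0) *\<^sub>R n0 + s *\<^sub>R n0) \<partial>lborel)" for u
 have f [measurable]: "f \<in> borel_measurable borel" unfolding f_def by measurable
 have [measurable]: "v \<in> borel_measurable borel" unfolding v_def by measurable
 have g [measurable]: "g \<in> borel_measurable borel" unfolding g_def by measurable
 have "(\<integral>\<^sup>+s. indicator B (Xi c' q' (w + x0) s) \<partial>lborel) =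
   g (w + (\<Sum>i<DIM('a) - 1. ((1 / q' i - 1) * (w \<bullet> e i)) *\<^sub>R e i))" (is "?L = g ?u") for w
 proof -
  have ui: "?u \<bullet> e i = w \<bullet> e i / q' i" if "i < DIM('a) - 1" for i
   using inner_frame_sum[OF that] by (simp add: inner_add_left left_diff_distrib)
  have un: "?u \<bullet> n0 = w \<bullet> n0" by (simp only: inner_add_left inner_frame_sum_n0 add_0_right)
  have "?u - (?u \<bullet> n0) *\<^sub>R n0 = (\<Sum>i<DIM('a) - 1. (?u \<bullet> e i) *\<^sub>R e i)" unfolding n0_def by (subst (1) frame) (rule add_diff_cancel_right')
  also have "... = (\<Sum>i<DIM('a) - 1. (w \<bullet> e i / q' i) *\<^sub>R e i)" using ui by (intro sum.cong) auto
  finally have ut: "?u - (?u \<bullet> n0) *\<^sub>R n0 = (\<Sum>i<DIM('a) - 1. (w \<bullet> e i / q' i) *\<^sub>R e i)" .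
  have "(\<Sum>i<DIM('a) - 1. q' i * (?u \<bullet> e i)\<^sup>2) = (\<Sum>i<DIM('a) - 1. (w \<bullet> e i)\<^sup>2 / q' i)"
  proof (intro sum.cong refl)
   fix i assume i: "i \<in> {..<DIM('a) - 1}"
   then have "q' i \<noteq> 0" using q'[of i] by auto
   then show "q' i * (?u \<bullet> e i)\<^sup>2 = (w \<bullet> e i)\<^sup>2 / q' i" using ui[of i] i by (simp add: power2_eq_square)
  qed
  then have "s0 / c' * (?u \<bullet> n0) + v ?u = (y0 \<bullet> w + (\<Sum>i<DIM('a) - 1. (w \<bullet> e i)\<^sup>2 / q' i) / 2) / c'"
   unfolding v_def un y0_inner using c' by (simp add: add_divide_distrib inner_commute)
  then have "f (s0 / c' * (?u \<bullet> n0) + v ?u, ?u - (?u \<bullet> n0) *\<^sub>R n0 + (s + - s0) *\<^sub>R n0) = indicator B (Xi c' q' (w + x0) s)" for s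
   unfolding f_def Xi_def ut by (simp add: algebra_simps)
  moreover have "g ?u = (\<integral>\<^sup>+s. f (s0 / c' * (?u \<bullet> n0) + v ?u, ?u - (?u \<bullet> n0) *\<^sub>R n0 + (s + - s0) *\<^sub>R n0) \<partial>lborel)"
   unfolding g_def by (rule nn_integral_lborel_translate[symmetric]) measurable
  ultimately show ?thesis by simp
 qed
 note eq = this
 have "(\<integral>\<^sup>+x. \<integral>\<^sup>+s. indicator B (Xi c' q' x s) \<partial>lborel \<partial>lborel) = (\<integral>\<^sup>+w. \<integral>\<^sup>+s. indicator B (Xi c' q' (w + x0) s) \<partial>lborel \<partial>lborel)"
  by (rule nn_integral_lborel_translate[symmetric]) (unfold Xi_def, measurable)
 also have "... = ennreal (1 / (\<Prod>i<DIM('a) - 1. 1 / q' i)) * (\<integral>\<^sup>+u. g u \<partial>lborel)"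
  unfolding eq using q' e_e by (intro nn_integral_stretches g) auto
 also have "(\<integral>\<^sup>+u. g u \<partial>lborel) = ennreal (1 / (s0 / c')) * (\<integral>\<^sup>+z. f z \<partial>lborel)"
  unfolding g_def using s0 c' by (intro nn_integral_swap_shear f n0) (auto simp: v_def inner_add_left e_n0 simp del: One_nat_def intro!: arg_cong2[where f = "(/)"] sum.cong)
 also have "(\<integral>\<^sup>+z. f z \<partial>lborel) = emeasure lborel B"
  unfolding f_def by (subst add.commute, subst nn_integral_lborel_translate) auto
 also have "ennreal (1 / (\<Prod>i<DIM('a) - 1. 1 / q' i)) * (ennreal (1 / (s0 / c')) * emeasure lborel B) =
   ennreal (c' * (\<Prod>i<DIM('a) - 1. q' i) / s0) * emeasure lborel B"
 proof -
  have "0 <= (\<Prod>i<DIM('a) - 1. q' i)" using q' by (intro prod_nonneg) (simp add: less_imp_le)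
  then have "ennreal (1 / (\<Prod>i<DIM('a) - 1. 1 / q' i)) * ennreal (1 / (s0 / c')) = ennreal (c' * (\<Prod>i<DIM('a) - 1. q' i) / s0)"
   using s0 c' by (subst ennreal_mult[symmetric]) (auto simp: prod_dividef)
  then show ?thesis by (simp only: mult.assoc[symmetric])
 qed
 finally show ?thesis .
qed

text \<open>At this stage \<open>c\<close> and the \<open>q i\<close> may vanish, so
  \<open>Xi\<close> is taken with \<open>c + k1\<close> and \<open>q i + k1\<close>. Larger
  denominators only shrink the predicted coordinates, up to the errors of \<open>forward\<close>,
  which the enlarged box absorbs.\<close>

lemma upper_inclusion:
 assumes k1: "0 < k1" and k2: "0 < k2"
 shows "\<exists>d0>0. \<forall>d t y x. 0 < d --> d < d0 --> (t, y) \<in> pbox d (t0, y0) --> x \<in> SL t --> y \<bullet> x = F t y -->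
  Xi (c + k1) (\<lambda>i. q i + k1) x (norm y) \<in> pbox ((1 + k2) * d) (t0, y0)"
proof -
 define n :: real where "n = real (DIM('a) - 1)"
 \<comment> \<open>The precision required of \<open>forward\<close>: the errors of all
   \<open>n\<close> frame coordinates must fit into \<open>k1 / 2\<close> for the level and, after
   division by \<open>k1\<close>, into \<open>k2 / 2\<close> for the direction.\<close>
 define k where "k = min (k1 / (2 + 4 * n)) (k1 * k2 / (2 + 4 * n))"
 have n: "0 <= n" by (simp add: n_def)
 have k: "0 < k" "k * (2 + 4 * n) <= k1" "k * (2 + 4 * n) <= k1 * k2"
 proof -
  have "0 < 2 + 4 * n" using n by simp
  then show "0 < k" "k * (2 + 4 * n) <= k1" "k * (2 + 4 * n) <= k1 * k2"
   using k1 k2 unfolding pos_le_divide_eq[symmetric, OF \<open>0 < 2 + 4 * n\<close>] by (simp_all add: k_def)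
 qed
 have nk: "0 <= n * k" using n k by simp
 have kk1: "k <= k1" using k nk by (simp add: algebra_simps)
 obtain d1 where d1: "d1 > 0" "!!d l \<eta> x. 0 < d ==> d < d1 ==> abs l <= d\<^sup>2 ==> norm \<eta> <= d ==> x \<in> SL (t0 + l) ==>
   (y0 + \<eta>) \<bullet> x = F (t0 + l) (y0 + \<eta>) ==>
   foot k d l \<eta> x"
  using forward[OF k(1)] by blast
 define d0 where "d0 = min d1 (s0 * k2 / 2)"
 have "Xi (c + k1) (\<lambda>i. q i + k1) x (norm y) \<in> pbox ((1 + k2) * d) (t0, y0)"
  if d: "0 < d" "d < d0" and ty: "(t, y) \<in> pbox d (t0, y0)" and x: "x \<in> SL t" "y \<bullet> x = F t y" for d t y x
 proof -
  define l where "l = t - t0"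
  define \<eta> where "\<eta> = y - y0"
  define w where "w = x - x0"
  define r where "r = w - N \<eta>"
  have l\<eta>: "abs l < d\<^sup>2" "norm \<eta> < d" using ty by (auto simp: mem_pbox l_def \<eta>_def)
  have d2: "0 < d\<^sup>2" using d(1) by simp
  have fw: "norm r <= k * d" "abs (y0 \<bullet> w - c * l + N \<eta> \<bullet> \<eta> / 2) <= k * d\<^sup>2"
   using d1(2)[of d l \<eta> x] d l\<eta> x by (simp_all add: r_def w_def l_def \<eta>_def d0_def)
  define q' where "q' i = q i + k1" for i
  have q': "0 < q' i" "0 <= q i" "k1 <= q' i" "q i <= q' i" "q' i = q i + k1" if "i < DIM('a) - 1" for i
   using q_nonneg[OF that] k1 by (auto simp: q'_def)
  have wi: "w \<bullet> e i = q i * (\<eta> \<bullet> e i) + r \<bullet> e i" if "i < DIM('a) - 1" for i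
   using N_sym[of \<eta> "e i"] eigen[OF that] unfolding r_def by (simp add: inner_diff_left)
  have coord: "abs (u \<bullet> e i) <= norm u" if "i < DIM('a) - 1" for u i
   using Cauchy_Schwarz_ineq2[of u "e i"] e_e[OF that that] by (simp add: norm_eq_sqrt_inner)
  define E where "E = (\<Sum>i<DIM('a) - 1. (w \<bullet> e i)\<^sup>2 / q' i)"
  \<comment> \<open>Squaring the predicted coordinate and dividing by \<open>q' i\<close> yields the
    coefficient \<open>q i * (q i / q' i)\<close>, which differs from \<open>q i\<close> by at most
    \<open>k1\<close>.\<close>
  have rat: "0 <= q i / q' i" "q i / q' i <= 1" "q i * (q i / q' i) <= q i" "q i - k1 <= q i * (q i / q' i)" if "i < DIM('a) - 1" for i
  proof -
   note * = q'[OF that]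
   show "0 <= q i / q' i" "q i / q' i <= 1" using * by (auto simp: divide_le_eq)
   then show "q i * (q i / q' i) <= q i" using * by (intro mult_left_le)
   have "(q i - k1) * q' i <= q i * q i" unfolding *(5) using k1 by (simp add: algebra_simps)
   then show "q i - k1 <= q i * (q i / q' i)" using * by (simp add: pos_le_divide_eq)
  qed
  have coeff: "abs ((w \<bullet> e i)\<^sup>2 / q' i - q i * (q i / q' i) * (\<eta> \<bullet> e i)\<^sup>2) <= 3 * k * d\<^sup>2" if i: "i < DIM('a) - 1" for i
  proof -
   have eq: "(w \<bullet> e i)\<^sup>2 / q' i - q i * (q i / q' i) * (\<eta> \<bullet> e i)\<^sup>2 = 2 * (q i / q' i) * ((\<eta> \<bullet> e i) * (r \<bullet> e i)) + (r \<bullet> e i)\<^sup>2 / q' i"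
    unfolding wi[OF i] using q'[OF i] by (simp add: field_simps power2_eq_square)
   have "abs (\<eta> \<bullet> e i) <= d" "abs (r \<bullet> e i) <= k * d" using coord[OF i, of \<eta>] coord[OF i, of r] l\<eta> fw by linarith+
   then have 1: "abs ((\<eta> \<bullet> e i) * (r \<bullet> e i)) <= d * (k * d)" and 2: "abs (r \<bullet> e i) * abs (r \<bullet> e i) <= (k * d) * (k * d)"
    unfolding abs_mult using d(1) k(1) by (auto intro!: mult_mono simp del: abs_mult_self_eq abs_mult_self)
   have "abs (2 * (q i / q' i) * ((\<eta> \<bullet> e i) * (r \<bullet> e i))) <= 2 * (k * d\<^sup>2)"
   proof -
    have "abs ((q i / q' i) * ((\<eta> \<bullet> e i) * (r \<bullet> e i))) <= 1 * (d * (k * d))"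
     unfolding abs_mult[of "q i / q' i"] using rat[OF i] 1 by (intro mult_mono) auto
    also have "1 * (d * (k * d)) = k * d\<^sup>2" by (simp add: power2_eq_square)
    finally show ?thesis by (simp only: mult.assoc abs_mult[of 2] abs_numeral mult_le_cancel_left_pos zero_less_numeral)
   qed
   moreover have "(r \<bullet> e i)\<^sup>2 / q' i <= k * d\<^sup>2"
   proof -
    have "(r \<bullet> e i)\<^sup>2 <= k * k * d\<^sup>2" using 2 by (simp add: power2_eq_square mult_ac)
    also have "... <= k * q' i * d\<^sup>2" using k kk1 q'[OF i] by (intro mult_right_mono mult_left_mono) auto
    finally show ?thesis using q'[OF i] by (simp add: pos_divide_le_eq mult_ac)
   qed
   moreover have "0 <= (r \<bullet> e i)\<^sup>2 / q' i" using q'[OF i] by simp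
   ultimately show ?thesis unfolding eq abs_le_iff by linarith
  qed
  have E1: "E <= N \<eta> \<bullet> \<eta> + 3 * (n * k) * d\<^sup>2" and E2: "N \<eta> \<bullet> \<eta> - k1 * d\<^sup>2 - 3 * (n * k) * d\<^sup>2 <= E"
  proof -
   have "E <= (\<Sum>i<DIM('a) - 1. q i * (\<eta> \<bullet> e i)\<^sup>2 + 3 * k * d\<^sup>2)" unfolding E_def
   proof (intro sum_mono)
    fix i assume "i \<in> {..<DIM('a) - 1}"
    then have i: "i < DIM('a) - 1" by simp
    show "(w \<bullet> e i)\<^sup>2 / q' i <= q i * (\<eta> \<bullet> e i)\<^sup>2 + 3 * k * d\<^sup>2"
     using coeff[OF i] mult_right_mono[OF rat(3)[OF i], of "(\<eta> \<bullet> e i)\<^sup>2"] unfolding abs_le_iff by auto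
   qed
   also have "... = N \<eta> \<bullet> \<eta> + 3 * (n * k) * d\<^sup>2" by (simp add: sum.distrib N_inner n_def)
   finally show "E <= N \<eta> \<bullet> \<eta> + 3 * (n * k) * d\<^sup>2" .
   have "(\<Sum>i<DIM('a) - 1. (\<eta> \<bullet> e i)\<^sup>2) <= (norm \<eta>)\<^sup>2" unfolding norm_frame by simp
   also have "... <= d\<^sup>2" using l\<eta> by (intro power_mono) auto
   finally have "k1 * (\<Sum>i<DIM('a) - 1. (\<eta> \<bullet> e i)\<^sup>2) <= k1 * d\<^sup>2" using k1 by simp
   then have "N \<eta> \<bullet> \<eta> - k1 * d\<^sup>2 - 3 * (n * k) * d\<^sup>2 <= (\<Sum>i<DIM('a) - 1. q i * (\<eta> \<bullet> e i)\<^sup>2 - k1 * (\<eta> \<bullet> e i)\<^sup>2 - 3 * k * d\<^sup>2)"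
    by (simp add: sum_subtractf N_inner n_def sum_distrib_left)
   also have "... <= E" unfolding E_def
   proof (intro sum_mono)
    fix i assume "i \<in> {..<DIM('a) - 1}"
    then have i: "i < DIM('a) - 1" by simp
    show "q i * (\<eta> \<bullet> e i)\<^sup>2 - k1 * (\<eta> \<bullet> e i)\<^sup>2 - 3 * k * d\<^sup>2 <= (w \<bullet> e i)\<^sup>2 / q' i"
     using coeff[OF i] mult_right_mono[OF rat(4)[OF i], of "(\<eta> \<bullet> e i)\<^sup>2"] unfolding abs_le_iff left_diff_distrib by auto
   qed
   finally show "N \<eta> \<bullet> \<eta> - k1 * d\<^sup>2 - 3 * (n * k) * d\<^sup>2 <= E" .
  qed
  have small: "k * d\<^sup>2 + 3 * (n * k) * d\<^sup>2 / 2 <= k1 * d\<^sup>2 / 2"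
   using mult_right_mono[OF k(2), of "d\<^sup>2"] nk d2 mult_nonneg_nonneg[OF nk, of "d\<^sup>2"] by (simp add: algebra_simps)
  have cl: "abs (c * l) <= c * d\<^sup>2" using l\<eta> c_nonneg by (simp add: abs_mult mult_left_mono)
  have "abs (y0 \<bullet> w + E / 2) <= (c + k1) * d\<^sup>2"
   using fw(2) E1 E2 small cl mult_pos_pos[OF k1 d2] unfolding abs_le_iff distrib_right by linarith
  then have "abs ((y0 \<bullet> w + E / 2) / (c + k1)) <= d\<^sup>2" using c_nonneg k1 by (simp add: abs_divide pos_divide_le_eq mult.commute)
  also have "d\<^sup>2 < ((1 + k2) * d)\<^sup>2" using d(1) k2 by (intro power_strict_mono) auto
  finally have first: "abs ((y0 \<bullet> w + E / 2) / (c + k1)) < ((1 + k2) * d)\<^sup>2" .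
  \<comment> \<open>The tangential part of \<open>\<eta>\<close> shrunk by factors at most 1, hence
    no longer than \<open>\<eta>\<close>. What remains is the propagated error \<open>r1\<close> and
    the second-order discrepancy \<open>h\<close> between \<open>norm y\<close> and its linear
    part.\<close>
  define v where "v = (\<Sum>i<DIM('a) - 1. (q i / q' i * (\<eta> \<bullet> e i)) *\<^sub>R e i) + (\<eta> \<bullet> n0) *\<^sub>R n0"
  define r1 where "r1 = (\<Sum>i<DIM('a) - 1. (r \<bullet> e i / q' i) *\<^sub>R e i)"
  define h where "h = norm y - s0 - \<eta> \<bullet> n0"
  have dec: "(\<Sum>i<DIM('a) - 1. (w \<bullet> e i / q' i) *\<^sub>R e i) + (norm y - s0) *\<^sub>R n0 = v + (r1 + h *\<^sub>R n0)"
  proof -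
   have "(\<Sum>i<DIM('a) - 1. (w \<bullet> e i / q' i) *\<^sub>R e i) = (\<Sum>i<DIM('a) - 1. (q i / q' i * (\<eta> \<bullet> e i)) *\<^sub>R e i + (r \<bullet> e i / q' i) *\<^sub>R e i)"
    by (intro sum.cong) (auto simp: wi add_divide_distrib scaleR_add_left)
   then show ?thesis unfolding v_def r1_def h_def by (simp add: sum.distrib algebra_simps)
  qed
  have "norm v <= norm \<eta>"
  proof (rule power2_le_imp_le)
   have "v \<bullet> n0 = \<eta> \<bullet> n0" unfolding v_def inner_add_left inner_frame_sum_n0 by (simp add: n0)
   moreover have "v \<bullet> e i = q i / q' i * (\<eta> \<bullet> e i)" if "i < DIM('a) - 1" for i
    using inner_frame_sum[OF that] e_n0[OF that] by (simp add: v_def inner_add_left)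
   ultimately have "(norm v)\<^sup>2 = (\<Sum>i<DIM('a) - 1. (q i / q' i)\<^sup>2 * (\<eta> \<bullet> e i)\<^sup>2) + (\<eta> \<bullet> n0)\<^sup>2"
    unfolding norm_frame[of v] by (auto simp: power_mult_distrib power_divide intro!: sum.cong)
   also have "... <= (\<Sum>i<DIM('a) - 1. (\<eta> \<bullet> e i)\<^sup>2) + (\<eta> \<bullet> n0)\<^sup>2"
    using rat by (intro add_right_mono sum_mono mult_left_le_one_le) (auto simp: power_le_one)
   finally show "(norm v)\<^sup>2 <= (norm \<eta>)\<^sup>2" unfolding norm_frame[of \<eta>] .
  qed simp
  moreover have "norm r1 <= n * (k * d / k1)"
  proof -
   have "norm r1 <= (\<Sum>i<DIM('a) - 1. norm ((r \<bullet> e i / q' i) *\<^sub>R e i))" unfolding r1_def by (rule norm_sum)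
   also have "... <= (\<Sum>i<DIM('a) - 1. k * d / k1)"
   proof (intro sum_mono)
    fix i assume "i \<in> {..<DIM('a) - 1}"
    then have i: "i < DIM('a) - 1" by simp
    have "abs (r \<bullet> e i) / q' i <= k * d / k1" using coord[OF i, of r] fw q'[OF i] k1 by (intro frac_le) auto
    then show "norm ((r \<bullet> e i / q' i) *\<^sub>R e i) <= k * d / k1" using e_e[OF i i] q'[OF i] by (simp add: norm_eq_sqrt_inner[of "e i"] abs_divide)
   qed
   finally show ?thesis by (simp add: n_def)
  qed
  moreover have "abs h <= k2 * d / 2"
  proof -
   have "norm (y0 + \<eta>) - norm y0 - sgn y0 \<bullet> \<eta> = h" by (simp add: h_def \<eta>_def s0_def n0_def inner_commute)
   then have "0 <= h" "h <= (norm \<eta>)\<^sup>2 / s0" using norm_expansion[OF y0, of \<eta>] by (simp_all add: s0_def)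
   moreover have "(norm \<eta>)\<^sup>2 / s0 <= k2 * d / 2"
   proof -
    have "(norm \<eta>)\<^sup>2 <= d * d" unfolding power2_eq_square using l\<eta>(2) d(1) by (intro mult_mono) auto
    also have "... <= (s0 * k2 / 2) * d" using d by (intro mult_right_mono) (auto simp: d0_def)
    finally show ?thesis using s0 by (simp add: pos_divide_le_eq mult_ac)
   qed
   ultimately show ?thesis by linarith
  qed
  moreover have "n * (k * d / k1) <= k2 * d / 2"
  proof -
   have "n * k <= k1 * k2 / 2" using k(3) k(1) nk by (simp add: algebra_simps)
   then have "n * k * d <= k1 * k2 / 2 * d" using d(1) by (intro mult_right_mono) auto
   then show ?thesis using k1 by (simp add: pos_divide_le_eq mult_ac)
  qed
  moreover have "norm (v + (r1 + h *\<^sub>R n0)) <= norm v + (norm r1 + abs h)"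
   using norm_triangle_ineq[of v "r1 + h *\<^sub>R n0"] norm_triangle_ineq[of r1 "h *\<^sub>R n0"] by (simp add: n0)
  ultimately have "norm (v + (r1 + h *\<^sub>R n0)) < (1 + k2) * d" using l\<eta>(2) unfolding distrib_right by linarith
  then show ?thesis using first by (simp add: mem_pbox Xi_def dec[symmetric] E_def w_def q'_def)
 qed
 moreover have "0 < d0" using d1 s0 k2 by (simp add: d0_def)
 ultimately show ?thesis by blast
qed

lemma norm_le_frame: "norm u <= (\<Sum>i<DIM('a) - 1. abs (u \<bullet> e i)) + abs (u \<bullet> n0)"
proof -
 have "norm u <= norm (\<Sum>i<DIM('a) - 1. (u \<bullet> e i) *\<^sub>R e i) + norm ((u \<bullet> n0) *\<^sub>R n0)"
  unfolding n0_def by (subst (1) frame) (rule norm_triangle_ineq)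
 moreover have "norm (\<Sum>i<DIM('a) - 1. (u \<bullet> e i) *\<^sub>R e i) <= (\<Sum>i<DIM('a) - 1. norm ((u \<bullet> e i) *\<^sub>R e i))" by (rule norm_sum)
 moreover have "(\<Sum>i<DIM('a) - 1. norm ((u \<bullet> e i) *\<^sub>R e i)) = (\<Sum>i<DIM('a) - 1. abs (u \<bullet> e i))"
  using e_e by (intro sum.cong) (auto simp: norm_eq_sqrt_inner)
 ultimately show ?thesis by (simp add: n0)
qed

text \<open>A bootstrap: the bound on \<open>Xi\<close> gives crude bounds on \<open>w\<close>,
  \<open>localization\<close> turns them into bounds of order \<open>h^2\<close> for the level and
  \<open>h\<close> for the direction, and \<open>forward_K\<close> at that size identifies the true
  displacement \<open>\<eta>\<close> with the predicted \<open>\<eta>'\<close> up to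
  \<open>l * h\<close>. This fits into the gap between \<open>b * h\<close> and
  \<open>h\<close>.\<close>

lemma lower_inclusion:
 assumes c: "0 < c" and q: "!!i. i < DIM('a) - 1 ==> 0 < q i" and b: "0 < b" "b < 1"
 shows "\<exists>h0>0. \<forall>h x s. 0 < h --> h < h0 --> Xi c q x s \<in> pbox (b * h) (t0, y0) --> x \<in> A \<and> abs (s - s0) < h \<and>
  (\<forall>n\<in>outer_unit_normals (sublevel A \<phi> (\<phi> x)) x. (\<phi> x, s *\<^sub>R n) \<in> pbox h (t0, y0))"
proof -
 define m :: real where "m = real (DIM('a) - 1)"
 obtain M where M: "0 < M" "!!u. norm (N u) <= M * norm u" using N_bound by blast
 \<comment> \<open>Inserting 1 keeps the minimum defined in dimension one, where there are no
   tangential directions.\<close>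
 define Q where "Q = Min (insert 1 (q ` {..<DIM('a) - 1}))"
 have Q: "0 < Q" "!!i. i < DIM('a) - 1 ==> Q <= q i" using q by (auto simp: Q_def)
 define K where "K = (c + M) + (c + M) / s0"
 have K: "0 < K" unfolding K_def using c M s0 by (intro add_pos_pos divide_pos_pos)
 have KM: "M + (c + M) / s0 <= K" "c + M <= K" unfolding K_def using c M s0 by auto
 obtain K' h1 where L1: "K' > 0" "h1 > 0" "loc_est K K' h1"
  using localization[OF c _ K] q by (elim meta_impE exE conjE) (rule q, assumption, rule that)
 define K2 where "K2 = max K' (1 + s0 * K')"
 have K2: "0 < K2" "K' <= K2" "1 + s0 * K' <= K2" using L1(1) by (auto simp: K2_def)
 \<comment> \<open>The first bound fits \<open>norm d <= l * h\<close> into the gap for the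
   direction, the second fits the difference of the quadratic terms into the gap for the
   level.\<close>
 define l where "l = min ((1 - b) / 2) (c * (1 - b) / (4 * M))"
 have l: "0 < l" "l <= (1 - b) / 2" "M * l <= c * (1 - b) / 4"
 proof -
  show "0 < l" using b c M by (simp add: l_def)
  show "l <= (1 - b) / 2" unfolding l_def by (rule min.cobounded1)
  have "M * l <= M * (c * (1 - b) / (4 * M))" using M by (intro mult_left_mono) (auto simp: l_def)
  then show "M * l <= c * (1 - b) / 4" using M by simp
 qed
 define k where "k = min (l * Q / (2 * m + 1)) (c * (1 - b) / 4)"
 have m: "0 <= m" by (simp add: m_def)
 have k: "0 < k" "m * (k / Q) <= l / 2" "k <= c * (1 - b) / 4"
 proof -
  show e0: "0 < k" using m l Q c b by (simp add: k_def)
  show "k <= c * (1 - b) / 4" unfolding k_def by (rule min.cobounded2)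
  have "k <= l * Q / (2 * m + 1)" by (simp add: k_def)
  then have "k * (2 * m + 1) <= l * Q" using m by (simp add: pos_le_divide_eq)
  then have "(2 * m) * k <= l * Q" using e0 by (simp add: algebra_simps)
  then show "m * (k / Q) <= l / 2" using Q(1) by (simp add: pos_divide_le_eq mult_ac)
 qed
 obtain h2 where h2: "h2 > 0" "!!h r \<eta> x. 0 < h ==> h < h2 ==> abs r <= K2 * h\<^sup>2 ==> norm \<eta> <= K2 * h ==> x \<in> SL (t0 + r) ==>
   (y0 + \<eta>) \<bullet> x = F (t0 + r) (y0 + \<eta>) ==>
   foot k h r \<eta> x"
  using forward_K[OF K2(1) k(1)] by blast
 define h0 where "h0 = min (min h1 h2) (min (min 1 s0) (l * s0 / (2 * K2\<^sup>2)))"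
 have h0: "0 < h0" using L1(2) h2(1) s0 l(1) K2(1) by (simp add: h0_def)
 have "x \<in> A \<and> abs (s - s0) < h \<and> (\<forall>n\<in>outer_unit_normals (sublevel A \<phi> (\<phi> x)) x. (\<phi> x, s *\<^sub>R n) \<in> pbox h (t0, y0))"
  if h: "0 < h" "h < h0" and X: "Xi c q x s \<in> pbox (b * h) (t0, y0)" for h x s
 proof -
  have h': "h < h1" "h < h2" "h < 1" "h < s0" "h < l * s0 / (2 * K2\<^sup>2)" using h(2) by (auto simp: h0_def)
  have d2: "0 < h\<^sup>2" "h\<^sup>2 <= h" using h(1) h'(3) by (auto simp: power2_eq_square mult_left_le)
  define w where "w = x - x0"
  define \<eta>' where "\<eta>' = (\<Sum>i<DIM('a) - 1. (w \<bullet> e i / q i) *\<^sub>R e i) + (s - s0) *\<^sub>R n0"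
  define r' where "r' = (y0 \<bullet> w + (\<Sum>i<DIM('a) - 1. (w \<bullet> e i)\<^sup>2 / q i) / 2) / c"
  have r\<eta>': "abs r' < (b * h)\<^sup>2" "norm \<eta>' < b * h"
   using X by (auto simp: mem_pbox Xi_def r'_def \<eta>'_def w_def)
  have bh: "b * h < h" "(b * h)\<^sup>2 <= b * h\<^sup>2" "b * h\<^sup>2 < h\<^sup>2"
   using b h(1) by (auto simp: power_mult_distrib power2_eq_square mult_left_le)
  have \<eta>'n: "\<eta>' \<bullet> n0 = s - s0" unfolding \<eta>'_def inner_add_left inner_frame_sum_n0 by (simp add: n0)
  have \<eta>'i: "q i * (\<eta>' \<bullet> e i) = w \<bullet> e i" if "i < DIM('a) - 1" for i
   using inner_frame_sum[OF that] e_n0[OF that] q[OF that] by (simp add: \<eta>'_def inner_add_left)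
  have ss: "abs (s - s0) < h"
   using Cauchy_Schwarz_ineq2[of \<eta>' n0] r\<eta>'(2) bh(1) n0(1) unfolding \<eta>'n by simp
  have sp: "0 < s" using ss h'(4) by linarith
  have N\<eta>': "N \<eta>' = (\<Sum>i<DIM('a) - 1. (w \<bullet> e i) *\<^sub>R e i)" unfolding N_frame[of \<eta>'] using \<eta>'i by (intro sum.cong) auto
  have "N \<eta>' \<bullet> \<eta>' = (\<Sum>i<DIM('a) - 1. (w \<bullet> e i)\<^sup>2 / q i)" unfolding N_inner
  proof (intro sum.cong refl)
   fix i assume "i \<in> {..<DIM('a) - 1}"
   then show "q i * (\<eta>' \<bullet> e i)\<^sup>2 = (w \<bullet> e i)\<^sup>2 / q i" using \<eta>'i[of i] q[of i] by (simp add: power2_eq_square eq_divide_eq flip: \<eta>'i)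
  qed
  then have cr': "c * r' = y0 \<bullet> w + N \<eta>' \<bullet> \<eta>' / 2" using c by (simp add: r'_def)
  have Nb: "abs (N u \<bullet> v) <= M * (norm u * norm v)" for u v
   using Cauchy_Schwarz_ineq2[of "N u" v] mult_right_mono[OF M(2)[of u], of "norm v"] by (simp add: mult.assoc)
  have \<eta>'2: "norm \<eta>' * norm \<eta>' <= h\<^sup>2" unfolding power2_eq_square using order_trans[OF less_imp_le[OF r\<eta>'(2)] less_imp_le[OF bh(1)]] h(1) by (intro mult_mono) auto
  have yw: "abs (y0 \<bullet> w) <= (c + M) * h\<^sup>2"
  proof -
   have "abs (N \<eta>' \<bullet> \<eta>') <= M * h\<^sup>2" using Nb[of \<eta>' \<eta>'] mult_left_mono[OF \<eta>'2, of M] M(1) by linarith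
   moreover have "abs (c * r') <= c * h\<^sup>2" using r\<eta>'(1) bh c by (simp add: abs_mult mult_left_mono)
   moreover have "0 <= M * h\<^sup>2" using M by simp
   ultimately show ?thesis unfolding cr' abs_le_iff distrib_right by linarith
  qed
  have "w = N \<eta>' + (w \<bullet> n0) *\<^sub>R n0" unfolding N\<eta>' n0_def by (rule frame)
  then have "norm w <= norm (N \<eta>') + abs (w \<bullet> n0)" using norm_triangle_ineq[of "N \<eta>'" "(w \<bullet> n0) *\<^sub>R n0"] by (simp add: n0)
  also have "... <= M * h + (c + M) / s0 * h"
  proof (intro add_mono)
   show "norm (N \<eta>') <= M * h" using M(2)[of \<eta>'] mult_left_mono[of "norm \<eta>'" h M] M(1) r\<eta>'(2) bh(1) by linarith
   have "s0 * abs (w \<bullet> n0) = abs (y0 \<bullet> w)" using s0 by (simp add: y0_inner abs_mult inner_commute[of w n0])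
   also have "... <= (c + M) * h" using yw mult_left_mono[OF d2(2), of "c + M"] c M by linarith
   finally show "abs (w \<bullet> n0) <= (c + M) / s0 * h" using s0 by (simp add: pos_le_divide_eq mult.commute)
  qed
  also have "... <= K * h" using mult_right_mono[OF KM(1), of h] h(1) by (simp add: distrib_right)
  finally have wK: "norm w <= K * h" .
  have ywK: "abs (y0 \<bullet> w) <= K * h\<^sup>2" using yw mult_right_mono[OF KM(2), of "h\<^sup>2"] by simp
  have x: "x0 + w = x" by (simp add: w_def)
  have loc: "x \<in> A" "abs (\<phi> x - t0) <= K' * h\<^sup>2" "!!n. n \<in> outer_unit_normals (sublevel A \<phi> (\<phi> x)) x ==> norm (n - n0) <= K' * h"
   using L1(3)[rule_format, OF h(1) h'(1) wK ywK] unfolding x by auto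
  have "(\<phi> x, s *\<^sub>R n) \<in> pbox h (t0, y0)" if n: "n \<in> outer_unit_normals (sublevel A \<phi> (\<phi> x)) x" for n
  proof -
   have n1: "norm n = 1" using n by (simp add: outer_unit_normals_def)
   define r where "r = \<phi> x - t0"
   define \<eta> where "\<eta> = s *\<^sub>R n - y0"
   have "\<eta> = (s - s0) *\<^sub>R n + s0 *\<^sub>R (n - n0)" unfolding \<eta>_def by (subst y0_eq) (simp add: algebra_simps)
   then have "norm \<eta> <= abs (s - s0) + s0 * norm (n - n0)" using norm_triangle_ineq[of "(s - s0) *\<^sub>R n" "s0 *\<^sub>R (n - n0)"] n1 s0 by simp
   also have "... <= h + s0 * (K' * h)" using ss loc(3)[OF n] s0 by (intro add_mono mult_left_mono) auto
   also have "... <= K2 * h" using mult_right_mono[OF K2(3), of h] h(1) by (simp add: distrib_right)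
   finally have \<eta>K: "norm \<eta> <= K2 * h" .
   have rK: "abs r <= K2 * h\<^sup>2" using loc(2) mult_right_mono[OF K2(2), of "h\<^sup>2"] by (simp add: r_def)
   have "x \<in> SL (t0 + r)" using loc(1) by (simp add: mem_SL r_def)
   moreover have "(y0 + \<eta>) \<bullet> x = F (t0 + r) (y0 + \<eta>)"
    using normals_support[OF loc(1) n] F_hom[of s "\<phi> x" n] sp by (simp add: r_def \<eta>_def)
   ultimately have fw: "norm (w - N \<eta>) <= k * h" "abs (y0 \<bullet> w - c * r + N \<eta> \<bullet> \<eta> / 2) <= k * h\<^sup>2"
    using h2(2)[OF h(1) h'(2) rK \<eta>K] by (simp_all add: w_def)
   define d where "d = \<eta>' - \<eta>"
   have di: "abs (d \<bullet> e i) <= k / Q * h" if i: "i < DIM('a) - 1" for i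
   proof -
    have "q i * (d \<bullet> e i) = (w - N \<eta>) \<bullet> e i"
     using N_sym[of \<eta> "e i"] eigen[OF i] \<eta>'i[OF i] by (simp add: d_def inner_diff_left right_diff_distrib)
    then have "q i * abs (d \<bullet> e i) = abs ((w - N \<eta>) \<bullet> e i)" using q[OF i] by (simp add: abs_mult flip: \<open>q i * (d \<bullet> e i) = _\<close>)
    also have "... <= k * h" using Cauchy_Schwarz_ineq2[of "w - N \<eta>" "e i"] e_e[OF i i] fw(1) by (simp add: norm_eq_sqrt_inner[of "e i"])
    finally have "Q * abs (d \<bullet> e i) <= k * h" using mult_right_mono[OF Q(2)[OF i], of "abs (d \<bullet> e i)"] by linarith
    then show ?thesis using Q(1) by (simp add: pos_le_divide_eq mult.commute)
   qed
   have dn: "abs (d \<bullet> n0) <= l / 2 * h"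
   proof -
    have "norm (y0 + \<eta>) - norm y0 - sgn y0 \<bullet> \<eta> = d \<bullet> n0"
     using \<eta>'n n1 sp by (simp add: d_def inner_diff_left \<eta>_def s0_def[symmetric] n0_def[symmetric] inner_diff_right inner_commute)
    then have "0 <= d \<bullet> n0" "d \<bullet> n0 <= (norm \<eta>)\<^sup>2 / s0" using norm_expansion[OF y0, of \<eta>] by (simp_all add: s0_def)
    moreover have "(norm \<eta>)\<^sup>2 / s0 <= l / 2 * h"
    proof -
     have "(norm \<eta>)\<^sup>2 <= (K2 * h)\<^sup>2" using \<eta>K by (intro power_mono) auto
     also have "... = K2\<^sup>2 * h * h" by (simp add: power2_eq_square)
     also have "... <= (l * s0 / 2) * h"
      using h'(5) K2(1) h(1) by (intro mult_right_mono) (auto simp: pos_less_divide_eq mult_ac)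
     finally show ?thesis using s0 by (simp add: pos_divide_le_eq mult_ac)
    qed
    ultimately show ?thesis by linarith
   qed
   have "norm d <= (\<Sum>i<DIM('a) - 1. k / Q * h) + l / 2 * h"
    using norm_le_frame[of d] dn sum_mono[of "{..<DIM('a) - 1}" "\<lambda>i. abs (d \<bullet> e i)" "\<lambda>i. k / Q * h"] di by fastforce
   also have "... = (m * (k / Q)) * h + l / 2 * h" by (simp add: m_def)
   also have "... <= l / 2 * h + l / 2 * h" using k(2) h(1) by (intro add_right_mono mult_right_mono) auto
   finally have dk: "norm d <= l * h" by (simp add: mult.commute)
   have "norm \<eta> <= norm \<eta>' + norm d" using norm_triangle_ineq4[of \<eta>' d] by (simp add: d_def)
   also have "... < b * h + (1 - b) / 2 * h" using r\<eta>'(2) dk mult_right_mono[OF l(2), of h] h(1) by linarith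
   also have "... <= h" using b h(1) mult_right_mono[of b 1 h] by (simp add: field_simps)
   finally have \<eta>h: "norm \<eta> < h" .
   have "N \<eta>' \<bullet> \<eta>' - N \<eta> \<bullet> \<eta> = N d \<bullet> (\<eta>' + \<eta>)"
    using N_sym[of \<eta>' \<eta>] inner_commute[of \<eta>' "N \<eta>"] by (simp add: d_def linear_diff[OF linear_N] inner_diff_left inner_add_right)
   moreover have "abs (N d \<bullet> (\<eta>' + \<eta>)) <= 2 * (c * (1 - b) / 4 * h\<^sup>2)"
   proof -
    have "norm d * norm (\<eta>' + \<eta>) <= (l * h) * (2 * h)"
    proof (intro mult_mono dk)
     show "norm (\<eta>' + \<eta>) <= 2 * h" using norm_triangle_ineq[of \<eta>' \<eta>] r\<eta>'(2) bh(1) \<eta>h by linarith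
    qed (use l(1) h(1) in auto)
    then have "M * (norm d * norm (\<eta>' + \<eta>)) <= M * ((l * h) * (2 * h))" using M(1) by (intro mult_left_mono) auto
    also have "... = 2 * (M * l * h\<^sup>2)" by (simp add: power2_eq_square)
    also have "... <= 2 * (c * (1 - b) / 4 * h\<^sup>2)" using l(3) by (intro mult_left_mono mult_right_mono) auto
    finally show ?thesis using Nb[of d "\<eta>' + \<eta>"] by linarith
   qed
   moreover have "k * h\<^sup>2 <= c * (1 - b) / 4 * h\<^sup>2" using k(3) by (intro mult_right_mono) auto
   ultimately have "abs (c * r' - c * r) <= 2 * (c * (1 - b) / 4 * h\<^sup>2)" using fw(2) unfolding cr' abs_le_iff by linarith
   also have "... = c * ((1 - b) / 2 * h\<^sup>2)" by simp
   finally have "abs (r' - r) <= (1 - b) / 2 * h\<^sup>2"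
    using c unfolding right_diff_distrib[symmetric] abs_mult by (simp only: abs_of_pos mult_le_cancel_left_pos)
   moreover have "b * h\<^sup>2 + (1 - b) / 2 * h\<^sup>2 < h\<^sup>2" using bh(3) by (simp add: field_simps)
   ultimately have "abs r < h\<^sup>2" using r\<eta>'(1) bh(2) unfolding abs_le_iff abs_less_iff by linarith
   then show ?thesis using \<eta>h by (simp add: mem_pbox r_def \<eta>_def)
  qed
  then show ?thesis using loc(1) ss by blast
 qed
 then show ?thesis using h0 by blast
qed

end

section \<open>The push-forward of Lebesgue measure\<close>

lemma nn_integral_lborel_scaleR:
 fixes f :: "'a::euclidean_space => ennreal"
 assumes [measurable]: "f \<in> borel_measurable borel" and c: "0 < c"
 shows "(\<integral>\<^sup>+x. f x \<partial>lborel) = (\<integral>\<^sup>+x. ennreal (c ^ DIM('a)) * f (c *\<^sub>R x) \<partial>lborel)"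
 by (subst lborel_affine[of c 0]) (use c in \<open>simp_all add: nn_integral_density nn_integral_distr\<close>)

lemma nn_integral_haar_scale:
 assumes [measurable]: "g \<in> borel_measurable borel" and b: "0 < b"
 shows "(\<integral>\<^sup>+t. indicator {0<..} t * ennreal (1 / t) * g (t * b) \<partial>lborel) = (\<integral>\<^sup>+t. indicator {0<..} t * ennreal (1 / t) * g t \<partial>lborel)"
proof -
 have "(\<integral>\<^sup>+t. indicator {0<..} t * ennreal (1 / t) * g t \<partial>lborel) =
   (\<integral>\<^sup>+t. ennreal b * (indicator {0<..} (b * t) * ennreal (1 / (b * t)) * g (b * t)) \<partial>lborel)"
  by (subst nn_integral_lborel_scaleR[OF _ b]) simp_all
 also have "... = (\<integral>\<^sup>+t. indicator {0<..} t * ennreal (1 / t) * g (t * b) \<partial>lborel)"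
 proof (rule nn_integral_cong)
  fix t :: real
  show "ennreal b * (indicator {0<..} (b * t) * ennreal (1 / (b * t)) * g (b * t)) = indicator {0<..} t * ennreal (1 / t) * g (t * b)"
  proof (cases "0 < t")
   case True
   then have "ennreal b * ennreal (1 / (b * t)) = ennreal (1 / t)" using b by (simp flip: ennreal_mult)
   then show ?thesis using True b by (simp add: mult.assoc[symmetric] mult.commute[of t b])
  qed (use b in \<open>simp add: zero_less_mult_iff\<close>)
 qed
 finally show ?thesis by simp
qed

text \<open>Invariance of \<open>dt / t\<close> under inversion, from scale invariance alone: insert
  a function of unit mass, exchange the integrals and rescale, as for the Haar measure of any
  commutative group.\<close>

lemma nn_integral_haar_inverse:
 assumes g [measurable]: "g \<in> borel_measurable borel" and r: "0 < r"
 shows "(\<integral>\<^sup>+a. indicator {0<..} a * ennreal (1 / a) * g (r / a) \<partial>lborel) = (\<integral>\<^sup>+t. indicator {0<..} t * ennreal (1 / t) * g t \<partial>lborel)"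
proof -
 define m :: "real => ennreal" where "m t = indicator {0<..} t * ennreal (1 / t)" for t
 have [measurable]: "m \<in> borel_measurable borel" unfolding m_def by measurable
 \<comment> \<open>The factor \<open>t\<close> cancels the weight, so \<open>h\<close> has mass 1
   with respect to \<open>dt / t\<close>.\<close>
 define h :: "real => ennreal" where "h t = ennreal t * indicator {1..2} t" for t
 have [measurable]: "h \<in> borel_measurable borel" unfolding h_def by measurable
 have "(\<integral>\<^sup>+t. m t * h t \<partial>lborel) = (\<integral>\<^sup>+t. indicator {1..2::real} t \<partial>lborel)"
  by (intro nn_integral_cong) (auto simp: m_def h_def indicator_def simp flip: ennreal_mult)
 then have h1: "(\<integral>\<^sup>+t. m t * h t \<partial>lborel) = 1" by simp
 have "(\<integral>\<^sup>+a. m a * g (r / a) \<partial>lborel) = (\<integral>\<^sup>+a. \<integral>\<^sup>+t. m a * g (r / a) * (m t * h (t * a)) \<partial>lborel \<partial>lborel)"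
 proof (rule nn_integral_cong)
  fix a :: real
  show "m a * g (r / a) = (\<integral>\<^sup>+t. m a * g (r / a) * (m t * h (t * a)) \<partial>lborel)"
  proof (cases "0 < a")
   case True
   have "(\<integral>\<^sup>+t. m t * h (t * a) \<partial>lborel) = 1" using nn_integral_haar_scale[OF _ True, of h] h1 unfolding m_def by simp
   then show ?thesis by (simp add: nn_integral_cmult)
  qed (simp add: m_def)
 qed
 also have "... = (\<integral>\<^sup>+t. \<integral>\<^sup>+a. m a * g (r / a) * (m t * h (t * a)) \<partial>lborel \<partial>lborel)" by (rule nn_integral_swap) measurable
 also have "... = (\<integral>\<^sup>+t. \<integral>\<^sup>+b. m b * (g (r * t / b) * (m t * h b)) \<partial>lborel \<partial>lborel)"
 proof (rule nn_integral_cong)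
  fix t :: real
  show "(\<integral>\<^sup>+a. m a * g (r / a) * (m t * h (t * a)) \<partial>lborel) = (\<integral>\<^sup>+b. m b * (g (r * t / b) * (m t * h b)) \<partial>lborel)"
  proof (cases "0 < t")
   case True
   have "(\<integral>\<^sup>+a. m a * (g (r * t / (a * t)) * (m t * h (a * t))) \<partial>lborel) = (\<integral>\<^sup>+b. m b * (g (r * t / b) * (m t * h b)) \<partial>lborel)"
    using nn_integral_haar_scale[OF _ True, of "\<lambda>b. g (r * t / b) * (m t * h b)"] unfolding m_def by simp
   then show ?thesis using True by (simp add: mult_ac)
  qed (simp add: m_def)
 qed
 also have "... = (\<integral>\<^sup>+b. \<integral>\<^sup>+t. m b * (g (r * t / b) * (m t * h b)) \<partial>lborel \<partial>lborel)" by (rule nn_integral_swap) measurable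
 also have "... = (\<integral>\<^sup>+b. (\<integral>\<^sup>+t. m t * g t \<partial>lborel) * (m b * h b) \<partial>lborel)"
 proof (rule nn_integral_cong)
  fix b :: real
  show "(\<integral>\<^sup>+t. m b * (g (r * t / b) * (m t * h b)) \<partial>lborel) = (\<integral>\<^sup>+t. m t * g t \<partial>lborel) * (m b * h b)"
  proof (cases "0 < b")
   case True
   have "(\<integral>\<^sup>+t. m b * (g (r * t / b) * (m t * h b)) \<partial>lborel) = (\<integral>\<^sup>+t. m t * g (t * (r / b)) * (m b * h b) \<partial>lborel)"
    by (intro nn_integral_cong) (simp add: mult_ac)
   also have "... = (\<integral>\<^sup>+t. m t * g (t * (r / b)) \<partial>lborel) * (m b * h b)" by (intro nn_integral_multc) measurable
   also have "(\<integral>\<^sup>+t. m t * g (t * (r / b)) \<partial>lborel) = (\<integral>\<^sup>+t. m t * g t \<partial>lborel)"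
    unfolding m_def using r True by (intro nn_integral_haar_scale g) simp
   finally show ?thesis .
  qed (simp add: m_def)
 qed
 also have "(\<integral>\<^sup>+b. (\<integral>\<^sup>+t. m t * g t \<partial>lborel) * (m b * h b) \<partial>lborel) = (\<integral>\<^sup>+t. m t * g t \<partial>lborel)" by (simp add: nn_integral_cmult h1)
 finally show ?thesis unfolding m_def .
qed

text \<open>Polar coordinates on both sides, without mentioning the surface measure of the sphere.\<close>

lemma nn_integral_radius_swap:
 fixes f :: "real \<times> 'a::euclidean_space => ennreal" and g :: "'a => ennreal"
 assumes [measurable]: "f \<in> borel_measurable borel" "g \<in> borel_measurable borel"
 shows "(\<integral>\<^sup>+z. (\<integral>\<^sup>+s. indicator {1<..<2} s * f (norm z, s *\<^sub>R sgn z) \<partial>lborel) * g z \<partial>lborel) =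
  (\<integral>\<^sup>+w. indicator {0<..} (fst w) * indicator {1<..<2} (norm (snd w)) *
    ennreal ((fst w / norm (snd w)) ^ (DIM('a) - 1)) * g (fst w *\<^sub>R sgn (snd w)) * f w \<partial>lborel)"
proof -
 have [measurable]: "(\<lambda>y::'a. sgn y) \<in> borel_measurable borel" by (intro borel_measurable_sgn)
 \<comment> \<open>The substitution \<open>s = a * norm z\<close>, followed by
   \<open>y = a *\<^sub>R z\<close>, links the two descriptions of a radius and a direction through
   the scalar \<open>a\<close>; \<open>t = norm y / a\<close> restores the radius of
   \<open>z\<close>.\<close>
 define H where "H z a = indicator {1<..<2} (a * norm z) * ennreal (norm z) * f (norm z, a *\<^sub>R z) * g z" for z a
 define G where "G y t = indicator {1<..<2} (norm y) * ennreal (norm y * (t / norm y) ^ DIM('a)) * f (t, y) * g (t *\<^sub>R sgn y)" for y t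
 have [measurable]: "(\<lambda>x. H (fst x) (snd x)) \<in> borel_measurable borel" "(\<lambda>x. G (fst x) (snd x)) \<in> borel_measurable borel"
  unfolding H_def G_def by measurable
 have [measurable]: "G y \<in> borel_measurable borel" for y unfolding G_def by measurable
 have "(\<integral>\<^sup>+z. (\<integral>\<^sup>+s. indicator {1<..<2} s * f (norm z, s *\<^sub>R sgn z) \<partial>lborel) * g z \<partial>lborel) = (\<integral>\<^sup>+z. \<integral>\<^sup>+a. H z a \<partial>lborel \<partial>lborel)"
 proof (rule nn_integral_cong_AE)
  have "AE z::'a in lborel. z \<noteq> 0" by (rule AE_lborel_singleton)
  then show "AE z in lborel. (\<integral>\<^sup>+s. indicator {1<..<2} s * f (norm z, s *\<^sub>R sgn z) \<partial>lborel) * g z = (\<integral>\<^sup>+a. H z a \<partial>lborel)"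
  proof eventually_elim
   case (elim z)
   have "(\<integral>\<^sup>+s. indicator {1<..<2} s * f (norm z, s *\<^sub>R sgn z) \<partial>lborel) * g z = (\<integral>\<^sup>+s. indicator {1<..<2} s * f (norm z, s *\<^sub>R sgn z) * g z \<partial>lborel)"
    by (intro nn_integral_multc[symmetric]) measurable
   also have "... = (\<integral>\<^sup>+a. ennreal (norm z ^ DIM(real)) * (indicator {1<..<2} (norm z *\<^sub>R a) * f (norm z, (norm z *\<^sub>R a) *\<^sub>R sgn z) * g z) \<partial>lborel)"
    using elim by (intro nn_integral_lborel_scaleR) simp_all
   also have "... = (\<integral>\<^sup>+a. H z a \<partial>lborel)"
    using elim by (intro nn_integral_cong) (simp add: H_def sgn_div_norm mult_ac)
   finally show ?case .
  qed
 qed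
 also have "... = (\<integral>\<^sup>+a. \<integral>\<^sup>+z. H z a \<partial>lborel \<partial>lborel)" by (rule nn_integral_swap) measurable
 also have "... = (\<integral>\<^sup>+a. \<integral>\<^sup>+y. indicator {0<..} a * ennreal (1 / a) * G y (norm y / a) \<partial>lborel \<partial>lborel)"
 proof (rule nn_integral_cong)
  fix a :: real
  show "(\<integral>\<^sup>+z. H z a \<partial>lborel) = (\<integral>\<^sup>+y. indicator {0<..} a * ennreal (1 / a) * G y (norm y / a) \<partial>lborel)"
  proof (cases "0 < a")
   case True
   have "(\<integral>\<^sup>+z. H z a \<partial>lborel) = (\<integral>\<^sup>+y. ennreal ((1 / a) ^ DIM('a)) * H ((1 / a) *\<^sub>R y) a \<partial>lborel)"
    unfolding H_def using True by (intro nn_integral_lborel_scaleR) simp_all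
   also have "... = (\<integral>\<^sup>+y. indicator {0<..} a * ennreal (1 / a) * G y (norm y / a) \<partial>lborel)"
   proof (rule nn_integral_cong)
    fix y :: 'a
    show "ennreal ((1 / a) ^ DIM('a)) * H ((1 / a) *\<^sub>R y) a = indicator {0<..} a * ennreal (1 / a) * G y (norm y / a)"
    proof (cases "y = 0")
     case False
     have "ennreal ((1 / a) ^ DIM('a)) * ennreal (norm y / a) = ennreal (1 / a) * ennreal (norm y * (norm y / a / norm y) ^ DIM('a))"
      using True False by (simp add: field_simps flip: ennreal_mult)
     moreover have "(norm y / a) *\<^sub>R sgn y = (1 / a) *\<^sub>R y" using False by (simp add: sgn_div_norm)
     moreover have "ennreal ((1 / a) ^ DIM('a)) * H ((1 / a) *\<^sub>R y) a =
       ennreal ((1 / a) ^ DIM('a)) * ennreal (norm y / a) * (indicator {1<..<2} (norm y) * f (norm y / a, y) * g ((1 / a) *\<^sub>R y))"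
      using True unfolding H_def by (simp add: mult_ac)
     ultimately show ?thesis using True unfolding G_def by (simp only: mult_ac indicator_simps greaterThan_iff mult_1_left)
    qed (simp add: H_def G_def)
   qed
   finally show ?thesis .
  next
   case False
   then have "a * norm z <= 0" for z :: 'a by (simp add: mult_nonpos_nonneg)
   then have "indicator {1<..<2} (a * norm z) = (0 :: ennreal)" for z :: 'a using order_trans[of "a * norm z" 0 1] by (simp add: indicator_def not_less)
   then have "H z a = 0" for z by (simp add: H_def)
   then show ?thesis using False by simp
  qed
 qed
 also have "... = (\<integral>\<^sup>+y. \<integral>\<^sup>+a. indicator {0<..} a * ennreal (1 / a) * G y (norm y / a) \<partial>lborel \<partial>lborel)"
  unfolding G_def by (rule nn_integral_swap) measurable
 also have "... = (\<integral>\<^sup>+y. \<integral>\<^sup>+t. indicator {0<..} t * ennreal (1 / t) * G y t \<partial>lborel \<partial>lborel)"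
 proof (rule nn_integral_cong)
  fix y :: 'a
  show "(\<integral>\<^sup>+a. indicator {0<..} a * ennreal (1 / a) * G y (norm y / a) \<partial>lborel) = (\<integral>\<^sup>+t. indicator {0<..} t * ennreal (1 / t) * G y t \<partial>lborel)"
   by (cases "y = 0") (simp_all add: nn_integral_haar_inverse, simp add: G_def)
 qed
 also have "... = (\<integral>\<^sup>+y. \<integral>\<^sup>+t. indicator {0<..} t * indicator {1<..<2} (norm y) *
    ennreal ((t / norm y) ^ (DIM('a) - 1)) * g (t *\<^sub>R sgn y) * f (t, y) \<partial>lborel \<partial>lborel)"
 proof (intro nn_integral_cong)
  fix y :: 'a and t :: real
  show "indicator {0<..} t * ennreal (1 / t) * G y t = indicator {0<..} t * indicator {1<..<2} (norm y) *
    ennreal ((t / norm y) ^ (DIM('a) - 1)) * g (t *\<^sub>R sgn y) * f (t, y)"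
  proof (cases "0 < t \<and> y \<noteq> 0")
   case True
   have "DIM('a) = Suc (DIM('a) - 1)" using DIM_positive[where 'a='a] by simp
   then have "(t / norm y) ^ DIM('a) = (t / norm y) * (t / norm y) ^ (DIM('a) - 1)" by (metis power_Suc)
   then have "ennreal (1 / t) * ennreal (norm y * (t / norm y) ^ DIM('a)) = ennreal ((t / norm y) ^ (DIM('a) - 1))"
    using True by (simp flip: ennreal_mult)
   moreover have "ennreal (1 / t) * G y t = ennreal (1 / t) * ennreal (norm y * (t / norm y) ^ DIM('a)) * (indicator {1<..<2} (norm y) * f (t, y) * g (t *\<^sub>R sgn y))"
    unfolding G_def by (simp only: mult_ac)
   ultimately show ?thesis using True by (simp only: mult_ac indicator_simps greaterThan_iff mult_1_left)
  qed (auto simp: G_def)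
 qed
 also have "... = (\<integral>\<^sup>+w. indicator {0<..} (fst w) * indicator {1<..<2} (norm (snd w)) *
    ennreal ((fst w / norm (snd w)) ^ (DIM('a) - 1)) * g (fst w *\<^sub>R sgn (snd w)) * f w \<partial>(lborel \<Otimes>\<^sub>M lborel))"
 proof -
  have "(\<lambda>w. indicator {0<..} (fst w) * indicator {1<..<2} (norm (snd w)) *
    ennreal ((fst w / norm (snd w)) ^ (DIM('a) - 1)) * g (fst w *\<^sub>R sgn (snd w)) * f w) \<in> borel_measurable (lborel \<Otimes>\<^sub>M lborel)"
   unfolding lborel_prod by measurable
  from lborel_pair.nn_integral_snd[OF this] show ?thesis by simp
 qed
 finally show ?thesis unfolding lborel_prod .
qed

section \<open>The transport equation lifted by a radial variable\<close>

locale gauss_transport = quasiconvex_potential A \<phi> for A :: "'a::euclidean_space set" and \<phi> +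
 fixes R :: real and \<rho>0 \<rho>1 :: "'a => real" and T :: "'a => 'a"
 assumes \<rho>0: "equivalent_prob_density A \<rho>0" and \<rho>1: "equivalent_prob_density (cball 0 R) \<rho>1"
  and transport: "gauss_mass_transport A R \<rho>0 \<rho>1 T \<phi>"
begin

definition r0 :: "'a => ennreal" where "r0 x = ennreal (\<rho>0 x) * indicator A x"
definition r1 :: "'a => ennreal" where "r1 z = ennreal (\<rho>1 z) * indicator (cball 0 R) z"
definition T' :: "'a => 'a" where "T' x = (if x \<in> A then T x else 0)"

lemma A_borel [measurable]: "A \<in> sets borel"
 using compact_A by (simp add: compact_imp_closed borel_closed)

lemma r0_borel [measurable]: "r0 \<in> borel_measurable borel" and r1_borel [measurable]: "r1 \<in> borel_measurable borel"
 and T'_borel [measurable]: "T' \<in> borel_measurable borel"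
proof -
 have "\<rho>0 \<in> borel_measurable (restrict_space borel A)" using \<rho>0 by (simp add: equivalent_prob_density_def)
 then have "(\<lambda>x. ennreal (\<rho>0 x)) \<in> borel_measurable (restrict_space borel A)" by measurable
 then show "r0 \<in> borel_measurable borel" unfolding r0_def by (subst (asm) borel_measurable_restrict_space_iff_ennreal) auto
 have "\<rho>1 \<in> borel_measurable (restrict_space borel (cball 0 R))" using \<rho>1 by (simp add: equivalent_prob_density_def)
 then have "(\<lambda>x. ennreal (\<rho>1 x)) \<in> borel_measurable (restrict_space borel (cball 0 R))" by measurable
 then show "r1 \<in> borel_measurable borel" unfolding r1_def by (subst (asm) borel_measurable_restrict_space_iff_ennreal) auto
 have "T \<in> restrict_space borel A \<rightarrow>\<^sub>M restrict_space borel (cball 0 R)" using transport by (simp add: gauss_mass_transport_def)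
 then have "T \<in> restrict_space borel A \<rightarrow>\<^sub>M borel" by (rule measurable_restrict_space2_iff[THEN iffD1, THEN conjunct1])
 then show "T' \<in> borel_measurable borel" unfolding T'_def by (intro measurable_If_restrict_space_iff[THEN iffD2]) (auto simp: A_borel)
qed

lemma nn_integral_mwd:
 assumes "X \<in> sets borel" "\<rho> \<in> borel_measurable (restrict_space borel X)" "f \<in> borel_measurable (restrict_space borel X)"
 shows "(\<integral>\<^sup>+x. f x \<partial>measure_with_density X \<rho>) = (\<integral>\<^sup>+x. f x * (ennreal (\<rho> x) * indicator X x) \<partial>lborel)"
proof -
 have m: "sets (restrict_space lborel X) = sets (restrict_space borel X)" by (intro sets_restrict_space_cong) simp
 have "(\<integral>\<^sup>+x. f x \<partial>measure_with_density X \<rho>) = (\<integral>\<^sup>+x. ennreal (\<rho> x) * f x \<partial>restrict_space lborel X)"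
  unfolding measure_with_density_def using assms by (intro nn_integral_density) (auto simp: measurable_cong_sets[OF m refl])
 also have "... = (\<integral>\<^sup>+x. ennreal (\<rho> x) * f x * indicator X x \<partial>lborel)"
  using assms(1) by (intro nn_integral_restrict_space) simp
 finally show ?thesis by (simp add: mult_ac)
qed

lemma push:
 assumes f [measurable]: "f \<in> borel_measurable borel"
 shows "(\<integral>\<^sup>+x. f (T' x) * r0 x \<partial>lborel) = (\<integral>\<^sup>+z. f z * r1 z \<partial>lborel)"
proof -
 have T: "T \<in> restrict_space borel A \<rightarrow>\<^sub>M restrict_space borel (cball 0 R)"
  and d: "distr (measure_with_density A \<rho>0) (restrict_space borel (cball 0 R)) T = measure_with_density (cball 0 R) \<rho>1"
  using transport by (auto simp: gauss_mass_transport_def)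
 have m: "sets (measure_with_density A \<rho>0) = sets (restrict_space borel A)"
  unfolding measure_with_density_def sets_density by (intro sets_restrict_space_cong) simp
 have fm: "f \<in> borel_measurable (restrict_space borel X)" for X by (rule measurable_restrict_space1) fact
 have "(\<integral>\<^sup>+z. f z * r1 z \<partial>lborel) = (\<integral>\<^sup>+z. f z \<partial>measure_with_density (cball 0 R) \<rho>1)"
  unfolding r1_def using \<rho>1 fm by (intro nn_integral_mwd[symmetric]) (auto simp: equivalent_prob_density_def)
 also have "... = (\<integral>\<^sup>+x. f (T x) \<partial>measure_with_density A \<rho>0)"
  unfolding d[symmetric] using T fm by (intro nn_integral_distr) (auto simp: measurable_cong_sets[OF m refl])
 also have "... = (\<integral>\<^sup>+x. f (T x) * r0 x \<partial>lborel)"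
  unfolding r0_def using \<rho>0 T measurable_compose[OF T fm] by (intro nn_integral_mwd) (auto simp: equivalent_prob_density_def)
 also have "... = (\<integral>\<^sup>+x. f (T' x) * r0 x \<partial>lborel)" by (intro nn_integral_cong) (auto simp: T'_def r0_def indicator_def)
 finally show ?thesis by simp
qed

lemma density_pos:
 assumes X: "X \<in> sets borel" and \<rho>: "equivalent_prob_density X \<rho>"
 shows "AE x in lborel. x \<in> X --> 0 < \<rho> x"
proof -
 have m: "sets (restrict_space lborel X) = sets (restrict_space borel X)" by (intro sets_restrict_space_cong) simp
 have ac: "absolutely_continuous (measure_with_density X \<rho>) (restrict_space lborel X)"
  and [measurable]: "\<rho> \<in> borel_measurable (restrict_space lborel X)" and nn: "!!x. x \<in> X ==> 0 <= \<rho> x"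
  using \<rho> by (auto simp: equivalent_prob_density_def measurable_cong_sets[OF m refl])
 have "AE x in measure_with_density X \<rho>. 0 < \<rho> x"
  unfolding measure_with_density_def by (subst AE_density) auto
 then have "AE x in restrict_space lborel X. 0 < \<rho> x"
  by (rule absolutely_continuous_AE[OF _ ac, rotated]) (simp add: measure_with_density_def)
 then show ?thesis using X by (subst (asm) AE_restrict_space_iff) auto
qed

lemma AE_r0_pos: "AE x in lborel. x \<in> A --> 0 < \<rho>0 x"
 by (rule density_pos[OF _ \<rho>0]) simp

lemma AE_r1_pos: "AE z in lborel. z \<in> cball 0 R --> 0 < \<rho>1 z"
 by (rule density_pos[OF _ \<rho>1]) simp

text \<open>The image of \<open>\<rho>0 dx\<close> under \<open>T\<close> has a Lebesgue density, so
  preimages of null sets have \<open>\<rho>0\<close>-mass zero; they are Lebesgue-null because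
  \<open>\<rho>0\<close> is positive almost everywhere on \<open>A\<close>.\<close>

lemma AE_pull:
 assumes "AE z in lborel. z \<in> cball 0 R --> Q z"
 shows "AE x in lborel. x \<in> A --> Q (T x)"
proof -
 obtain N where N: "N \<in> null_sets lborel" "!!z. z \<in> cball 0 R ==> z \<notin> N ==> Q z"
  using assms by (auto elim!: AE_E3)
 have [measurable]: "N \<in> sets borel" using null_setsD2[OF N(1)] by simp
 have "(\<integral>\<^sup>+x. indicator N (T' x) * r0 x \<partial>lborel) = (\<integral>\<^sup>+z. indicator N z * r1 z \<partial>lborel)" by (rule push) measurable
 also have "... = 0"
 proof (subst nn_integral_0_iff_AE)
  show "AE z in lborel. indicator N z * r1 z = 0" using AE_not_in[OF N(1)] by eventually_elim simp
 qed measurable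
 finally have "AE x in lborel. indicator N (T' x) * r0 x = (0::ennreal)" by (subst (asm) nn_integral_0_iff_AE) measurable
 then show ?thesis using AE_r0_pos
 proof eventually_elim
  case (elim x)
  show ?case
  proof
   assume x: "x \<in> A"
   have "T x \<in> cball 0 R" using transport x unfolding gauss_mass_transport_def
    by (auto dest!: measurable_space[where x = x] simp: space_restrict_space)
   moreover have "T x \<notin> N" using elim x by (auto simp: T'_def r0_def indicator_def ennreal_eq_0_iff split: if_splits)
   ultimately show "Q (T x)" by (intro N(2))
  qed
 qed
qed

definition gauss_point :: "'a => bool" where
 "gauss_point x \<longleftrightarrow> m0 < \<phi> x \<and> 0 < \<phi> x \<and> norm (T x) = \<phi> x \<and>
   outer_unit_normals (sublevel A \<phi> (\<phi> x)) x = {sgn (T x)} \<and> 0 < \<rho>0 x \<and> 0 < \<rho>1 (T x) \<and> norm (T x) <= R"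

text \<open>\<open>\<phi> x\<close> equals \<open>norm (T x)\<close> almost everywhere, and the
  sphere of radius \<open>m0\<close> and the origin are null in the target. This gives
  \<open>\<phi> x > m0\<close>, so the sublevel set has interior, and \<open>\<phi> x > 0\<close>,
  so \<open>T x\<close> determines the normal.\<close>

lemma AE_gauss_point: "AE x in lborel. x \<in> A --> gauss_point x"
proof -
 have \<phi>0: "\<phi> \<in> A \<rightarrow> {0..R}" and n: "AE x in restrict_space lborel A. \<exists>n. outer_unit_normals (sublevel A \<phi> (\<phi> x)) x = {n} \<and> T x = \<phi> x *\<^sub>R n"
  using transport by (auto simp: gauss_mass_transport_def)
 have n': "AE x in lborel. x \<in> A --> (\<exists>n. outer_unit_normals (sublevel A \<phi> (\<phi> x)) x = {n} \<and> T x = \<phi> x *\<^sub>R n)"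
  using n by (subst (asm) AE_restrict_space_iff) auto
 have "sphere (0::'a) m0 \<in> null_sets lborel" using negligible_sphere[of "0::'a" m0] by (simp add: negligible_iff_null_sets null_sets_completion_iff)
 from AE_not_in[OF this] have "AE z in lborel. z \<in> cball (0::'a) R --> norm z \<noteq> m0" by eventually_elim simp
 from AE_pull[OF this] have "AE x in lborel. x \<in> A --> norm (T x) \<noteq> m0" .
 moreover have "AE z in lborel. z \<in> cball (0::'a) R --> z \<noteq> 0" using AE_lborel_singleton[of "0::'a"] by eventually_elim simp
 from AE_pull[OF this] have "AE x in lborel. x \<in> A --> T x \<noteq> 0" .
 moreover have "AE z in lborel. z \<in> cball 0 R --> 0 < \<rho>1 z \<and> norm z <= R" using AE_r1_pos by eventually_elim simp
 from AE_pull[OF this] have "AE x in lborel. x \<in> A --> 0 < \<rho>1 (T x) \<and> norm (T x) <= R" .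
 ultimately show ?thesis using n' AE_r0_pos
 proof eventually_elim
  case (elim x)
  show ?case
  proof
   assume x: "x \<in> A"
   with elim obtain n where n: "outer_unit_normals (sublevel A \<phi> (\<phi> x)) x = {n}" "T x = \<phi> x *\<^sub>R n" by blast
   then have "norm n = 1" by (auto simp: outer_unit_normals_def)
   moreover have "0 <= \<phi> x" using \<phi>0 x by auto
   ultimately have "norm (T x) = \<phi> x" "0 < \<phi> x" "sgn (T x) = n" using n(2) elim x by (auto simp: sgn_div_norm)
   then show "gauss_point x" using elim x n m0_le[OF x] by (auto simp: gauss_point_def)
  qed
 qed
qed

text \<open>The extra radial variable \<open>s\<close> turns \<open>T\<close> into a map between spaces of equal dimension for which the
 1-homogeneous extension of the support function is the generating potential.\<close>

definition lift :: "'a => real => real \<times> 'a" where "lift x s = (norm (T' x), s *\<^sub>R sgn (T' x))"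

text \<open>The density of the image of \<open>\<rho>0 dx ds\<close>, with \<open>1 < s < 2\<close>,
  under \<open>lift\<close>. The target radius is \<open>fst w\<close> and the auxiliary one
  \<open>norm (snd w)\<close>; the power of their quotient compares the areas of the two
  spheres.\<close>

definition \<kappa> :: "real \<times> 'a => ennreal" where
 "\<kappa> w = indicator {0<..} (fst w) * indicator {1<..<2} (norm (snd w)) *
   ennreal ((fst w / norm (snd w)) ^ (DIM('a) - 1)) * r1 (fst w *\<^sub>R sgn (snd w))"

lemma \<kappa>_borel [measurable]: "\<kappa> \<in> borel_measurable borel" unfolding \<kappa>_def by measurable

lemma lift_borel [measurable (raw)]:
 assumes [measurable]: "f \<in> borel_measurable M" "g \<in> borel_measurable M"
 shows "(\<lambda>x. lift (f x) (g x)) \<in> borel_measurable M"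
 unfolding lift_def by measurable

lemma push_lift:
 assumes f [measurable]: "f \<in> borel_measurable borel"
 shows "(\<integral>\<^sup>+x. (\<integral>\<^sup>+s. indicator {1<..<2} s * f (lift x s) \<partial>lborel) * r0 x \<partial>lborel) = (\<integral>\<^sup>+w. \<kappa> w * f w \<partial>lborel)"
 unfolding \<kappa>_def nn_integral_radius_swap[OF f r1_borel, symmetric] lift_def
 by (rule push) measurable

text \<open>The gradient of \<open>F\<close> in \<open>y\<close>, written as limits of difference
  quotients so that it is Borel everywhere. Where an expansion exists it is the support point, and
  thus it inverts \<open>lift\<close>.\<close>

definition S :: "real \<times> 'a => 'a" where
 "S z = (\<Sum>b\<in>Basis. lim (\<lambda>n. real (Suc n) * (F (fst z) (snd z + (1 / real (Suc n)) *\<^sub>R b) - F (fst z) (snd z))) *\<^sub>R b)"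

lemma S_borel [measurable]: "S \<in> borel_measurable borel"
proof -
 have "(\<lambda>z. lim (\<lambda>n. real (Suc n) * (F (fst z) (snd z + (1 / real (Suc n)) *\<^sub>R b) - F (fst z) (snd z)))) \<in> borel_measurable borel" for b :: 'a
  by (rule borel_measurable_lim_metric) measurable
 then show ?thesis unfolding S_def by (intro borel_measurable_sum borel_measurable_scaleR) auto
qed

lemma S_expansion:
 assumes "parabolic_expansion z c p N"
 shows "S z = p"
proof -
 have N: "linear N" and ex: "!!e. 0 < e ==> \<exists>d0>0. \<forall>d r u. 0 < d --> d < d0 --> abs r <= d\<^sup>2 --> norm u <= d -->
   abs (F (fst z + r) (snd z + u) - F (fst z) (snd z) - c * r - p \<bullet> u - N u \<bullet> u / 2) <= e * d\<^sup>2"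
  using assms unfolding parabolic_expansion_def by auto
 obtain d0 where d0: "d0 > 0" "!!d r u. 0 < d ==> d < d0 ==> abs r <= d\<^sup>2 ==> norm u <= d ==>
   abs (F (fst z + r) (snd z + u) - F (fst z) (snd z) - c * r - p \<bullet> u - N u \<bullet> u / 2) <= 1 * d\<^sup>2" using ex[of 1] by auto
 have "lim (\<lambda>n. real (Suc n) * (F (fst z) (snd z + (1 / real (Suc n)) *\<^sub>R b) - F (fst z) (snd z))) = p \<bullet> b" if b: "b \<in> Basis" for b
 proof (rule limI)
  define M where "M = 1 + abs (N b \<bullet> b) / 2"
  have h0: "(\<lambda>n. 1 / real (Suc n)) \<longlonglongrightarrow> 0" using LIMSEQ_Suc[OF lim_1_over_n] by simp
  show "(\<lambda>n. real (Suc n) * (F (fst z) (snd z + (1 / real (Suc n)) *\<^sub>R b) - F (fst z) (snd z))) \<longlonglongrightarrow> p \<bullet> b"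
  proof (rule Lim_transform2[OF tendsto_const])
   have "(\<lambda>n. M * (1 / real (Suc n))) \<longlonglongrightarrow> 0" using tendsto_mult_right_zero[OF h0, of M] by simp
   then show "(\<lambda>n. p \<bullet> b - real (Suc n) * (F (fst z) (snd z + (1 / real (Suc n)) *\<^sub>R b) - F (fst z) (snd z))) \<longlonglongrightarrow> 0"
   proof (rule Lim_null_comparison[rotated])
    have "\<forall>\<^sub>F n in sequentially. 1 / real (Suc n) < d0" using order_tendstoD(2)[OF h0 d0(1)] .
    then show "\<forall>\<^sub>F n in sequentially. norm (p \<bullet> b - real (Suc n) * (F (fst z) (snd z + (1 / real (Suc n)) *\<^sub>R b) - F (fst z) (snd z))) <= M * (1 / real (Suc n))"
    proof eventually_elim
     case (elim n)
     define h where "h = 1 / real (Suc n)"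
     have h: "0 < h" "real (Suc n) * h = 1" by (auto simp: h_def)
     define D where "D = F (fst z) (snd z + h *\<^sub>R b) - F (fst z) (snd z)"
     have "abs (F (fst z + 0) (snd z + h *\<^sub>R b) - F (fst z) (snd z) - c * 0 - p \<bullet> (h *\<^sub>R b) - N (h *\<^sub>R b) \<bullet> (h *\<^sub>R b) / 2) <= 1 * h\<^sup>2"
      using h elim b by (intro d0(2)) (auto simp: h_def)
     then have "abs (D - h * (p \<bullet> b) - h\<^sup>2 * (N b \<bullet> b / 2)) <= h\<^sup>2" by (simp add: D_def linear_scale[OF N] power2_eq_square mult.assoc)
     moreover have "abs (h\<^sup>2 * (N b \<bullet> b / 2)) = h\<^sup>2 * (abs (N b \<bullet> b) / 2)" by (simp add: abs_mult)
     ultimately have "abs (h * (p \<bullet> b) - D) <= h\<^sup>2 * M" unfolding M_def distrib_left by linarith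
     then have "real (Suc n) * abs (h * (p \<bullet> b) - D) <= real (Suc n) * (h\<^sup>2 * M)" by (intro mult_left_mono) auto
     also have "... = (real (Suc n) * h) * (h * M)" by (simp only: power2_eq_square mult_ac)
     also have "real (Suc n) * abs (h * (p \<bullet> b) - D) = abs ((real (Suc n) * h) * (p \<bullet> b) - real (Suc n) * D)"
      by (subst abs_of_nonneg[of "real (Suc n)", symmetric], simp, simp only: abs_mult[symmetric] right_diff_distrib mult.assoc)
     finally show ?case unfolding h(2) by (simp only: real_norm_def D_def h_def mult_1_left mult.commute[of M])
    qed
   qed
  qed
 qed
 then show ?thesis unfolding S_def by (simp add: euclidean_representation)
qed

text \<open>By \<open>push_lift\<close> the lifted measure has density \<open>\<kappa>\<close>, so a
  null set of pairs pulls back to a null set of \<open>s\<close> for almost every \<open>x\<close>;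
  positivity of \<open>\<rho>0\<close> removes the weight.\<close>

lemma AE_lift:
 assumes "AE z in lborel. Q z"
 shows "AE x in lborel. x \<in> A --> (AE s in lborel. s \<in> {1<..<2} --> Q (lift x s))"
proof -
 obtain N where N: "N \<in> null_sets lborel" "!!z. z \<notin> N ==> Q z" using assms by (auto elim!: AE_E3)
 have [measurable]: "N \<in> sets borel" using null_setsD2[OF N(1)] by simp
 have "(\<integral>\<^sup>+x. (\<integral>\<^sup>+s. indicator {1<..<2} s * indicator N (lift x s) \<partial>lborel) * r0 x \<partial>lborel) = (\<integral>\<^sup>+w. \<kappa> w * indicator N w \<partial>lborel)"
  by (rule push_lift) measurable
 also have "... = 0"
 proof (subst nn_integral_0_iff_AE)
  show "AE z in lborel. \<kappa> z * indicator N z = 0" using AE_not_in[OF N(1)] by eventually_elim simp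
 qed measurable
 finally have "AE x in lborel. (\<integral>\<^sup>+s. indicator {1<..<2} s * indicator N (lift x s) \<partial>lborel) * r0 x = 0"
  by (subst (asm) nn_integral_0_iff_AE) measurable
 then show ?thesis using AE_r0_pos
 proof eventually_elim
  case (elim x)
  show ?case
  proof
   assume "x \<in> A"
   with elim have "(\<integral>\<^sup>+s. indicator {1<..<2} s * indicator N (lift x s) \<partial>lborel) = 0" by (auto simp: r0_def ennreal_eq_0_iff)
   then have "AE s in lborel. indicator {1<..<2} s * indicator N (lift x s) = (0::ennreal)" by (subst (asm) nn_integral_0_iff_AE) measurable
   then show "AE s in lborel. s \<in> {1<..<2} --> Q (lift x s)" by eventually_elim (use N(2) in \<open>auto simp: indicator_def split: if_splits\<close>)
  qed
 qed
qed

end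

context quasiconvex_potential begin

lemma expansion_pointI:
 assumes "parabolic_expansion (t, y) c p N" "y \<noteq> 0" "m0 < t"
 obtains e q where "expansion_point A \<phi> t c y p N e q"
proof -
 interpret support_expansion A \<phi> t c y p N by unfold_locales fact+
 obtain e q where "tangent_basis (sgn y) e" "!!i. i < DIM('a) - 1 ==> N (e i) = q i *\<^sub>R e i"
  "!!u. u = (\<Sum>i<DIM('a) - 1. (u \<bullet> e i) *\<^sub>R e i) + (u \<bullet> sgn y) *\<^sub>R sgn y"
  using tangent_eigenbasis[OF linear_N N_sym, of n0] n0(1) N_y0 unfolding n0_def by blast
 then have "expansion_point A \<phi> t c y p N e q" by unfold_locales
 then show thesis by (rule that)
qed

text \<open>\<open>forward\<close> without any change of level or direction forces every support
  point to coincide with \<open>p\<close>.\<close>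

lemma expansion_unique_support:
 assumes ex: "parabolic_expansion (t, y) c p N" and y: "y \<noteq> 0" "m0 < t" and x: "x \<in> SL t" "y \<bullet> x = F t y"
 shows "p = x"
proof -
 interpret support_expansion A \<phi> t c y p N by unfold_locales fact+
 have "norm (x - p) <= 0"
 proof (rule field_le_epsilon)
  fix k :: real assume k: "0 < k"
  obtain d0 where "d0 > 0" "!!d r u x. 0 < d ==> d < d0 ==> abs r <= d\<^sup>2 ==> norm u <= d ==> x \<in> SL (t + r) ==>
   (y + u) \<bullet> x = F (t + r) (y + u) ==> norm (x - p - N u) <= k * d" using forward[OF k] by blast
  from this(1) this(2)[of "min 1 (d0 / 2)" 0 0 x] have "norm (x - p) <= k * min 1 (d0 / 2)"
   using x linear_0[OF linear_N] by (simp add: min_def split: if_splits)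
  also have "... <= k * 1" using k by (intro mult_left_mono) auto
  finally show "norm (x - p) <= 0 + k" by simp
 qed
 then show ?thesis by simp
qed

end

section \<open>The Jacobian of the lifted map\<close>

context gauss_transport begin

text \<open>The density of the image under \<open>lift\<close> of Lebesgue measure on
  \<open>A\<close> times \<open>(1, 2)\<close>: since \<open>S\<close> recovers \<open>x\<close>,
  dividing \<open>\<kappa>\<close> by \<open>r0 (S w)\<close> removes the weight
  \<open>\<rho>0\<close>. It is the reciprocal Jacobian determinant that the volume comparison
  computes.\<close>

definition lam :: "real \<times> 'a => real" where "lam w = enn2real (\<kappa> w * inverse (r0 (S w)))"

definition mass :: "(real \<times> 'a) set => ennreal" where
 "mass B = (\<integral>\<^sup>+x. (\<integral>\<^sup>+s. indicator {1<..<2} s * indicator B (lift x s) \<partial>lborel) * indicator A x \<partial>lborel)"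

lemma lift_eq: "x \<in> A ==> gauss_point x ==> lift x s = (\<phi> x, s *\<^sub>R sgn (T x))"
 by (simp add: lift_def T'_def gauss_point_def)

lemma lift_support:
 assumes x: "x \<in> A" "gauss_point x" and s: "0 < s"
 shows "x \<in> SL (\<phi> x)" "(s *\<^sub>R sgn (T x)) \<bullet> x = F (\<phi> x) (s *\<^sub>R sgn (T x))" "norm (s *\<^sub>R sgn (T x)) = s"
proof -
 show "x \<in> SL (\<phi> x)" using x by (simp add: mem_SL)
 have n: "outer_unit_normals (sublevel A \<phi> (\<phi> x)) x = {sgn (T x)}" using x by (simp add: gauss_point_def)
 show "(s *\<^sub>R sgn (T x)) \<bullet> x = F (\<phi> x) (s *\<^sub>R sgn (T x))"
  using normals_support[OF x(1), of "sgn (T x)"] n s by (simp add: F_hom)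
 show "norm (s *\<^sub>R sgn (T x)) = s" using x s by (auto simp: gauss_point_def norm_sgn)
qed

lemma AE_S_lift: "AE x in lborel. x \<in> A --> (AE s in lborel. s \<in> {1<..<2} --> S (lift x s) = x)"
 using AE_lift[OF AE_parabolic_expansion] AE_gauss_point
proof eventually_elim
 case (elim x)
 show ?case
 proof
  assume x: "x \<in> A"
  with elim have g: "gauss_point x" and "AE s in lborel. s \<in> {1<..<2} --> (\<exists>c p N. parabolic_expansion (lift x s) c p N)" by auto
  from this(2) show "AE s in lborel. s \<in> {1<..<2} --> S (lift x s) = x"
  proof eventually_elim
   case (elim s)
   show ?case
   proof
    assume s: "s \<in> {1<..<2}"
    with elim obtain c p N where ex: "parabolic_expansion (\<phi> x, s *\<^sub>R sgn (T x)) c p N" unfolding lift_eq[OF x g] by blast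
    have "s *\<^sub>R sgn (T x) \<noteq> 0" "m0 < \<phi> x" using g s lift_support(3)[OF x g, of s] by (auto simp: gauss_point_def)
    then have "p = x" by (rule expansion_unique_support[OF ex]) (use lift_support[OF x g, of s] s in auto)
    then show "S (lift x s) = x" using S_expansion[OF ex] by (simp add: lift_eq[OF x g])
   qed
  qed
 qed
qed

lemma push_lebesgue:
 assumes [measurable]: "B \<in> sets borel"
 shows "mass B = (\<integral>\<^sup>+w. \<kappa> w * inverse (r0 (S w)) * indicator B w \<partial>lborel)"
proof -
 have "(\<integral>\<^sup>+w. \<kappa> w * (inverse (r0 (S w)) * indicator B w) \<partial>lborel) =
   (\<integral>\<^sup>+x. (\<integral>\<^sup>+s. indicator {1<..<2} s * (inverse (r0 (S (lift x s))) * indicator B (lift x s)) \<partial>lborel) * r0 x \<partial>lborel)"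
  by (rule push_lift[symmetric]) measurable
 also have "... = mass B" unfolding mass_def
 proof (rule nn_integral_cong_AE, use AE_S_lift AE_r0_pos in eventually_elim)
  case (elim x)
  show ?case
  proof (cases "x \<in> A")
   case True
   have r: "inverse (r0 x) * r0 x = 1" using elim True by (simp add: r0_def mult.commute ennreal_mult_divide_eq[symmetric] divide_ennreal_def[symmetric])
   have "(\<integral>\<^sup>+s. indicator {1<..<2} s * (inverse (r0 (S (lift x s))) * indicator B (lift x s)) \<partial>lborel) * r0 x =
     (\<integral>\<^sup>+s. indicator {1<..<2} s * (inverse (r0 (S (lift x s))) * indicator B (lift x s)) * r0 x \<partial>lborel)"
    by (intro nn_integral_multc[symmetric]) measurable
   also have "... = (\<integral>\<^sup>+s. indicator {1<..<2} s * indicator B (lift x s) \<partial>lborel)"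
   proof (rule nn_integral_cong_AE)
    have "AE s in lborel. s \<in> {1<..<2} --> S (lift x s) = x" using elim True by blast
    then show "AE s in lborel. indicator {1<..<2} s * (inverse (r0 (S (lift x s))) * indicator B (lift x s)) * r0 x =
      indicator {1<..<2} s * indicator B (lift x s)"
    proof eventually_elim
     case (elim s)
     have "a * (inverse (r0 x) * b) * r0 x = inverse (r0 x) * r0 x * (a * b)" for a b by (simp only: mult_ac)
     from this[of 1] show ?case using elim unfolding r by (cases "s \<in> {1<..<2}") simp_all
    qed
   qed
   finally show ?thesis using True by simp
  qed (simp add: r0_def)
 qed
 finally show ?thesis by (simp add: mult_ac)
qed

lemma lam_nonneg: "0 <= lam w" by (simp add: lam_def)

lemma lam_mass: "integrable lborel lam" "B \<in> sets borel ==> mass B = (\<integral>\<^sup>+w. ennreal (lam w) * indicator B w \<partial>lborel)"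
proof -
 have [measurable]: "lam \<in> borel_measurable borel" unfolding lam_def by measurable
 have "mass UNIV = emeasure lborel A" unfolding mass_def by simp
 moreover have "emeasure lborel A < \<infinity>" by (rule emeasure_bounded_finite[OF compact_imp_bounded[OF compact_A]])
 ultimately have fin: "(\<integral>\<^sup>+w. \<kappa> w * inverse (r0 (S w)) \<partial>lborel) < \<infinity>" using push_lebesgue[of UNIV] by simp
 then have "AE w in lborel. \<kappa> w * inverse (r0 (S w)) \<noteq> \<infinity>" by (intro nn_integral_PInf_AE) auto
 then have eq: "AE w in lborel. ennreal (lam w) = \<kappa> w * inverse (r0 (S w))"
  by eventually_elim (simp add: lam_def less_top)
 then have "(\<integral>\<^sup>+w. ennreal (lam w) \<partial>lborel) = (\<integral>\<^sup>+w. \<kappa> w * inverse (r0 (S w)) \<partial>lborel)" by (rule nn_integral_cong_AE)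
 then show "integrable lborel lam" using fin by (intro integrableI_nonneg) (simp_all add: lam_nonneg)
 assume "B \<in> sets borel"
 from push_lebesgue[OF this] show "mass B = (\<integral>\<^sup>+w. ennreal (lam w) * indicator B w \<partial>lborel)"
  using eq by (auto intro: nn_integral_cong_AE elim: eventually_mono)
qed

text \<open>Two-sided convergence of volume ratios, with the lower error moved to the right so that
  no subtraction of extended reals occurs.\<close>

definition density_point :: "real \<times> 'a => bool" where
 "density_point z \<longleftrightarrow> (\<forall>k>0. \<forall>\<^sub>F d in at_right 0.
   mass (pbox d z) <= ennreal (lam z + k) * emeasure lborel (pbox d z) \<and>
   ennreal (lam z) * emeasure lborel (pbox d z) <= mass (pbox d z) + ennreal k * emeasure lborel (pbox d z))"

lemma AE_density_point: "AE z in lborel. density_point z"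
 using parab.lebesgue_points[OF lam_mass(1)]
proof eventually_elim
 case (elim z)
 have [measurable]: "lam \<in> borel_measurable borel" using lam_mass(1) by auto
 show ?case unfolding density_point_def
 proof (intro allI impI)
  fix k :: real assume k: "0 < k"
  have "\<forall>\<^sub>F d in at_right (0::real). 0 < d" by (rule eventually_at_right_less)
  with elim[rule_format, OF k] show "\<forall>\<^sub>F d in at_right 0.
   mass (pbox d z) <= ennreal (lam z + k) * emeasure lborel (pbox d z) \<and>
   ennreal (lam z) * emeasure lborel (pbox d z) <= mass (pbox d z) + ennreal k * emeasure lborel (pbox d z)"
  proof eventually_elim
   case (elim d)
   define P where "P = pbox d z"
   have [measurable]: "P \<in> sets borel" unfolding P_def using elim(2) by (rule parab.P_borel)
   have L: "(\<integral>\<^sup>+w. ennreal (abs (lam w - lam z)) * indicator P w \<partial>lborel) <= ennreal k * emeasure lborel P" using elim(1) by (simp add: P_def)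
   have c: "(\<integral>\<^sup>+w. ennreal a * indicator P w \<partial>lborel) = ennreal a * emeasure lborel P" for a
    by (subst nn_integral_cmult_indicator) auto
   have "mass P <= (\<integral>\<^sup>+w. ennreal (lam z) * indicator P w + ennreal (abs (lam w - lam z)) * indicator P w \<partial>lborel)"
    unfolding lam_mass(2)[OF \<open>P \<in> sets borel\<close>]
    by (intro nn_integral_mono) (auto simp: indicator_def lam_nonneg ennreal_plus[symmetric] simp del: ennreal_plus)
   also have "... = ennreal (lam z) * emeasure lborel P + (\<integral>\<^sup>+w. ennreal (abs (lam w - lam z)) * indicator P w \<partial>lborel)"
    unfolding c[symmetric] by (intro nn_integral_add) auto
   also have "... <= ennreal (lam z) * emeasure lborel P + ennreal k * emeasure lborel P" using L by (intro add_left_mono)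
   also have "... = ennreal (lam z + k) * emeasure lborel P" using k lam_nonneg[of z] by (simp add: distrib_right)
   finally have 1: "mass P <= ennreal (lam z + k) * emeasure lborel P" .
   have "ennreal (lam z) * emeasure lborel P <= (\<integral>\<^sup>+w. ennreal (lam w) * indicator P w + ennreal (abs (lam w - lam z)) * indicator P w \<partial>lborel)"
    unfolding c[symmetric]
    by (intro nn_integral_mono) (auto simp: indicator_def lam_nonneg ennreal_plus[symmetric] simp del: ennreal_plus)
   also have "... = mass P + (\<integral>\<^sup>+w. ennreal (abs (lam w - lam z)) * indicator P w \<partial>lborel)"
    unfolding lam_mass(2)[OF \<open>P \<in> sets borel\<close>] by (intro nn_integral_add) auto
   also have "... <= mass P + ennreal k * emeasure lborel P" using L by (intro add_left_mono)
   finally show ?case using 1 by (simp add: P_def)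
  qed
 qed
qed

lemma emeasure_pbox_scale:
 assumes "0 < d" "0 < a"
 shows "emeasure lborel (pbox (a * d) z) = ennreal (a ^ (DIM('a) + 2)) * emeasure lborel (pbox d (z :: real \<times> 'a))"
 using assms by (simp add: emeasure_pbox power_mult_distrib ennreal_mult[symmetric] mult_ac del: power_add power_Suc add_2_eq_Suc')

text \<open>The upper inclusion bounds \<open>lam\<close> through the coefficients perturbed by
  \<open>k\<close>, for every \<open>k > 0\<close>. In the limit, positivity of \<open>lam\<close>
  forces \<open>c\<close> and every \<open>q i\<close> to be positive, which makes the lower
  inclusion available, and its volume bound is the reverse inequality.\<close>

lemma jacobian:
 assumes ep: "expansion_point A \<phi> t0 c y0 x0 N e q" and y0: "1 < norm y0" "norm y0 < 2"
  and dp: "density_point (t0, y0)" and pos: "0 < lam (t0, y0)"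
 shows "lam (t0, y0) = c * (\<Prod>i<DIM('a) - 1. q i) / norm y0" "0 < c" "!!i. i < DIM('a) - 1 ==> 0 < q i"
proof -
 interpret expansion_point A \<phi> t0 c y0 x0 N e q by (rule ep)
 define z where "z = (t0, y0)"
 define V where "V d = emeasure lborel (pbox d z)" for d
 have V: "0 < V d" "V d < \<infinity>" if "0 < d" for d
  using parab.P_pos[OF that, of z] that by (simp_all add: V_def emeasure_pbox ennreal_mult_less_top)
 have cancel: "a <= b" if "ennreal a * V d <= ennreal b * V d" "0 < d" "0 <= b" for a b d
 proof -
  have "V d \<noteq> 0" "V d \<noteq> \<infinity>" using V[OF that(2)] by auto
  then have "ennreal a <= ennreal b" using that(1) unfolding mult.commute[of _ "V d"] by (subst (asm) ennreal_mult_le_mult_iff) auto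
  then show ?thesis using that(3) by (simp add: ennreal_le_iff)
 qed
 have dpt: "\<exists>d0>0. \<forall>d. 0 < d --> d < d0 --> mass (pbox d z) <= ennreal (lam z + k) * V d \<and> ennreal (lam z) * V d <= mass (pbox d z) + ennreal k * V d"
  if "0 < k" for k
  using dp that unfolding density_point_def eventually_at_right_field z_def[symmetric] V_def by auto
 have up: "lam z <= (c + k) * (\<Prod>i<DIM('a) - 1. q i + k) / s0 * (1 + k) ^ (DIM('a) + 2) + k" if k: "0 < k" for k
 proof -
  obtain d1 where d1: "0 < d1" "!!d. 0 < d ==> d < d1 ==> ennreal (lam z) * V d <= mass (pbox d z) + ennreal k * V d"
   using dpt[OF k] by blast
  obtain d2 where d2: "0 < d2" "!!d t y x. 0 < d ==> d < d2 ==> (t, y) \<in> pbox d z ==> x \<in> SL t ==> y \<bullet> x = F t y ==>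
   Xi (c + k) (\<lambda>i. q i + k) x (norm y) \<in> pbox ((1 + k) * d) z"
   using upper_inclusion[OF k k] unfolding z_def by blast
  define d where "d = min d1 d2 / 2"
  have d: "0 < d" "d < d1" "d < d2" using d1 d2 by (auto simp: d_def)
  define J where "J = (c + k) * (\<Prod>i<DIM('a) - 1. q i + k) / s0"
  have J0: "0 <= J" unfolding J_def using c_nonneg q_nonneg k s0 by (intro divide_nonneg_nonneg mult_nonneg_nonneg prod_nonneg) auto
  have "mass (pbox d z) <= (\<integral>\<^sup>+x. \<integral>\<^sup>+s. indicator (pbox ((1 + k) * d) z) (Xi (c + k) (\<lambda>i. q i + k) x s) \<partial>lborel \<partial>lborel)"
   unfolding mass_def
  proof (rule nn_integral_mono_AE, use AE_gauss_point in eventually_elim)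
   case (elim x)
   show ?case
   proof (cases "x \<in> A")
    case True
    with elim have g: "gauss_point x" by blast
    have "(\<integral>\<^sup>+s. indicator {1<..<2} s * indicator (pbox d z) (lift x s) \<partial>lborel) <= (\<integral>\<^sup>+s. indicator (pbox ((1 + k) * d) z) (Xi (c + k) (\<lambda>i. q i + k) x s) \<partial>lborel)"
    proof (rule nn_integral_mono)
     fix s :: real
     show "indicator {1<..<2} s * indicator (pbox d z) (lift x s) <= (indicator (pbox ((1 + k) * d) z) (Xi (c + k) (\<lambda>i. q i + k) x s) :: ennreal)"
     proof (cases "1 < s \<and> lift x s \<in> pbox d z")
      case t: True
      then have "0 < s" by simp
      note ls = lift_support[OF True g this]
      have "Xi (c + k) (\<lambda>i. q i + k) x (norm (s *\<^sub>R sgn (T x))) \<in> pbox ((1 + k) * d) z"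
       using t ls(1,2) unfolding lift_eq[OF True g] by (intro d2(2)[OF d(1,3), of "\<phi> x"]) auto
      then show ?thesis unfolding ls(3) by (simp add: indicator_def)
     qed (auto simp: indicator_def)
    qed
    then show ?thesis using True by simp
   qed simp
  qed
  also have "... = ennreal J * emeasure lborel (pbox ((1 + k) * d) z)"
   unfolding J_def using c_nonneg q_nonneg k d by (intro volume_Xi parab.P_borel) (auto intro: add_nonneg_pos)
  also have "... = ennreal (J * (1 + k) ^ (DIM('a) + 2)) * V d"
   using d k J0 by (subst emeasure_pbox_scale) (auto simp: ennreal_mult V_def mult.assoc)
  finally have "ennreal (lam z) * V d <= ennreal (J * (1 + k) ^ (DIM('a) + 2)) * V d + ennreal k * V d"
   using d1(2)[OF d(1,2)] by (meson add_right_mono order_trans)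
  also have "... = ennreal (J * (1 + k) ^ (DIM('a) + 2) + k) * V d" using J0 k by (subst ennreal_plus) (auto simp: distrib_right)
  finally show ?thesis unfolding J_def[symmetric] by (rule cancel) (use d J0 k in auto)
 qed
 have le: "lam z <= c * (\<Prod>i<DIM('a) - 1. q i) / s0"
 proof (rule tendsto_lowerbound)
  show "((\<lambda>k. (c + k) * (\<Prod>i<DIM('a) - 1. q i + k) / s0 * (1 + k) ^ (DIM('a) + 2) + k) \<longlongrightarrow> c * (\<Prod>i<DIM('a) - 1. q i) / s0) (at_right 0)"
   using s0 by (auto intro!: tendsto_eq_intros)
  show "\<forall>\<^sub>F k in at_right 0. lam z <= (c + k) * (\<Prod>i<DIM('a) - 1. q i + k) / s0 * (1 + k) ^ (DIM('a) + 2) + k"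
   using eventually_at_right_less[of "0::real"] by eventually_elim (rule up)
 qed simp
 have "0 < c * (\<Prod>i<DIM('a) - 1. q i)" using le pos s0 unfolding z_def[symmetric] by (metis divide_pos_pos less_le_trans zero_less_divide_iff order_less_asym)
 moreover have pn: "0 <= (\<Prod>i<DIM('a) - 1. q i)" using q_nonneg by (intro prod_nonneg) auto
 ultimately have c: "0 < c" and pp: "0 < (\<Prod>i<DIM('a) - 1. q i)" using c_nonneg by (auto simp: zero_less_mult_iff)
 have "q i \<noteq> 0" if "i < DIM('a) - 1" for i
 proof
  assume "q i = 0"
  then have "(\<Prod>i<DIM('a) - 1. q i) = 0" using that by (intro prod_zero) auto
  with pp show False by linarith
 qed
 then have q: "0 < q i" if "i < DIM('a) - 1" for i using q_nonneg[OF that] that by (simp add: less_le)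
 have low: "c * (\<Prod>i<DIM('a) - 1. q i) / s0 * (1 - k) ^ (DIM('a) + 2) <= lam z + k" if k: "0 < k" "k < 1" for k
 proof -
  define v where "v = 1 - k"
  have v: "0 < v" "v < 1" using k by (auto simp: v_def)
  obtain d1 where d1: "0 < d1" "!!d. 0 < d ==> d < d1 ==> mass (pbox d z) <= ennreal (lam z + k) * V d"
   using dpt[OF k(1)] by blast
  obtain d2 where d2: "0 < d2" "\<forall>d x s. 0 < d --> d < d2 --> Xi c q x s \<in> pbox (v * d) (t0, y0) --> x \<in> A \<and> abs (s - s0) < d \<and>
   (\<forall>n\<in>outer_unit_normals (sublevel A \<phi> (\<phi> x)) x. (\<phi> x, s *\<^sub>R n) \<in> pbox d (t0, y0))"
   using lower_inclusion[OF c _ v] q by (elim meta_impE exE conjE) (rule q, assumption, rule that)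
  \<comment> \<open>The margins \<open>s0 - 1\<close> and \<open>2 - s0\<close> keep the radial
    variable inside \<open>(1, 2)\<close>.\<close>
  define d where "d = min (min d1 d2) (min (s0 - 1) (2 - s0)) / 2"
  have s012: "1 < s0" "s0 < 2" using assms(2,3) by (auto simp: s0_def)
  have d: "0 < d" "d < d1" "d < d2" "d < s0 - 1" "d < 2 - s0"
   using d1 d2 s012 unfolding d_def by (simp_all add: min_less_iff_disj)
  define J where "J = c * (\<Prod>i<DIM('a) - 1. q i) / s0"
  have J0: "0 <= J" unfolding J_def using c pn s0 by simp
  have "ennreal (J * v ^ (DIM('a) + 2)) * V d = ennreal J * emeasure lborel (pbox (v * d) z)"
   using d v J0 by (subst emeasure_pbox_scale) (auto simp: ennreal_mult V_def mult.assoc)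
  also have "... = (\<integral>\<^sup>+x. \<integral>\<^sup>+s. indicator (pbox (v * d) z) (Xi c q x s) \<partial>lborel \<partial>lborel)"
   unfolding J_def using c q v d by (intro volume_Xi[symmetric] parab.P_borel) auto
  also have "... <= mass (pbox d z)" unfolding mass_def
  proof (rule nn_integral_mono_AE, use AE_gauss_point in eventually_elim)
   case (elim x)
   have X: "x \<in> A \<and> abs (s - s0) < d \<and> (\<forall>n\<in>outer_unit_normals (sublevel A \<phi> (\<phi> x)) x. (\<phi> x, s *\<^sub>R n) \<in> pbox d z)"
    if "Xi c q x s \<in> pbox (v * d) z" for s
    using d2(2)[rule_format, OF d(1,3)] that unfolding z_def by blast
   show ?case
   proof (cases "x \<in> A")
    case True
    with elim have g: "gauss_point x" by blast
    have "(\<integral>\<^sup>+s. indicator (pbox (v * d) z) (Xi c q x s) \<partial>lborel) <= (\<integral>\<^sup>+s. indicator {1<..<2} s * indicator (pbox d z) (lift x s) \<partial>lborel)"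
    proof (rule nn_integral_mono)
     fix s :: real
     show "indicator (pbox (v * d) z) (Xi c q x s) <= (indicator {1<..<2} s * indicator (pbox d z) (lift x s) :: ennreal)"
     proof (cases "Xi c q x s \<in> pbox (v * d) z")
      case t: True
      have "lift x s \<in> pbox d z" using X[OF t] g unfolding lift_eq[OF True g] by (simp add: gauss_point_def)
      moreover have "1 < s" "s < 2" using X[OF t] d by auto
      ultimately show ?thesis by (simp add: indicator_def)
     qed simp
    qed
    then show ?thesis using True by simp
   next
    case False
    then have "indicator (pbox (v * d) z) (Xi c q x s) = (0::ennreal)" for s using X by (auto simp: indicator_def)
    then show ?thesis by simp
   qed
  qed
  also have "... <= ennreal (lam z + k) * V d" by (rule d1(2)[OF d(1,2)])
  finally show ?thesis unfolding J_def[symmetric] v_def[symmetric] by (rule cancel) (use d lam_nonneg k in auto)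
 qed
 have "c * (\<Prod>i<DIM('a) - 1. q i) / s0 <= lam z"
 proof (rule tendsto_le)
  show "((\<lambda>k. c * (\<Prod>i<DIM('a) - 1. q i) / s0 * (1 - k) ^ (DIM('a) + 2)) \<longlongrightarrow> c * (\<Prod>i<DIM('a) - 1. q i) / s0) (at_right 0)"
   using s0 by (auto intro!: tendsto_eq_intros)
  show "((\<lambda>k. lam z + k) \<longlongrightarrow> lam z) (at_right 0)" by (auto intro!: tendsto_eq_intros)
  have "\<forall>\<^sub>F k in at_right 0. k \<in> {0<..<(1::real)}" by (rule eventually_at_right_real) simp
  then show "\<forall>\<^sub>F k in at_right 0. c * (\<Prod>i<DIM('a) - 1. q i) / s0 * (1 - k) ^ (DIM('a) + 2) <= lam z + k"
   by eventually_elim (use low in auto)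
 qed simp
 with le show "lam (t0, y0) = c * (\<Prod>i<DIM('a) - 1. q i) / norm y0" by (simp add: z_def s0_def)
 show "0 < c" by (rule c)
 show "!!i. i < DIM('a) - 1 ==> 0 < q i" by (rule q)
qed

end

section \<open>Signed and vector measures\<close>

text \<open>\<open>measure_of\<close> gives the zero measure unless the set function is countably
  additive. For variations, which are suprema, superadditivity and countable subadditivity are the
  natural estimates, and together they give additivity.\<close>

lemma emeasure_measure_of_superadditive:
 fixes \<mu> :: "'b set => ennreal"
 assumes \<mu>0: "\<mu> {} = 0" and super: "!!A B. A \<in> sets M ==> B \<in> sets M ==> A \<inter> B = {} ==> \<mu> A + \<mu> B <= \<mu> (A \<union> B)"
  and sub: "!!E::nat => 'b set. range E \<subseteq> sets M ==> disjoint_family E ==> \<mu> (\<Union>n. E n) <= (\<Sum>n. \<mu> (E n))"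
  and A: "A \<in> sets M"
 shows "emeasure (measure_of (space M) (sets M) \<mu>) A = \<mu> A"
proof (rule emeasure_measure_of[OF refl sets.space_closed])
 have mono: "\<mu> A <= \<mu> B" if "A \<in> sets M" "B \<in> sets M" "A \<subseteq> B" for A B
 proof -
  have "\<mu> A <= \<mu> A + \<mu> (B - A)" by simp
  also have "... <= \<mu> (A \<union> (B - A))" using that by (intro super) auto
  finally show ?thesis using that(3) by (simp add: Un_absorb1)
 qed
 have "countably_additive (sets M) \<mu>"
 proof (rule countably_additiveI)
  fix E :: "nat => 'b set" assume E: "range E \<subseteq> sets M" "disjoint_family E"
  have fin: "(\<Sum>i<n. \<mu> (E i)) <= \<mu> (\<Union>i<n. E i)" for n
  proof (induction n)
   case (Suc n)
   have "(\<Sum>i<Suc n. \<mu> (E i)) <= \<mu> (\<Union>i<n. E i) + \<mu> (E n)" using Suc.IH by (simp add: add_right_mono)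
   also have "... <= \<mu> ((\<Union>i<n. E i) \<union> E n)"
   proof (rule super)
    show "(\<Union>i<n. E i) \<inter> E n = {}" using disjoint_family_onD[OF E(2), of _ n] by fast
   qed (use E(1) in auto)
   also have "(\<Union>i<n. E i) \<union> E n = (\<Union>i<Suc n. E i)" by (auto simp: lessThan_Suc)
   finally show ?case .
  qed (simp add: \<mu>0)
  have "(\<Sum>i<n. \<mu> (E i)) <= \<mu> (\<Union>i. E i)" for n
   using E(1) by (intro order_trans[OF fin] mono) auto
  then have "(\<Sum>i. \<mu> (E i)) <= \<mu> (\<Union>i. E i)" by (simp add: suminf_eq_SUP SUP_least)
  then show "(\<Sum>i. \<mu> (E i)) = \<mu> (\<Union>i. E i)" using sub[OF E] by (rule antisym)
 qed
 moreover have "sets (measure_of (space M) (sets M) \<mu>) = sets M" by simp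
 ultimately show "countably_additive (sets (measure_of (space M) (sets M) \<mu>)) \<mu>" by simp
 show "positive (sets (measure_of (space M) (sets M) \<mu>)) \<mu>" by (simp add: positive_def \<mu>0)
qed (use A in simp)

lemma SUP_add_SUP_le:
 fixes c :: ennreal
 assumes "X \<noteq> {}" "Y \<noteq> {}" "!!x y. x \<in> X ==> y \<in> Y ==> f x + g y <= c"
 shows "(SUP x\<in>X. f x) + (SUP y\<in>Y. g y) <= c"
proof -
 have "f x + (SUP y\<in>Y. g y) <= c" if "x \<in> X" for x
  unfolding ennreal_SUP_add_right[OF assms(2)] by (intro SUP_least assms that)
 then show ?thesis unfolding ennreal_SUP_add_left[OF assms(1), symmetric] by (rule SUP_least)
qed

locale charge =
 fixes M :: "'b measure" and D :: "'b set => 'c::real_normed_vector"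
 assumes ca: "!!E::nat => 'b set. range E \<subseteq> sets M ==> disjoint_family E ==> (\<lambda>n. D (E n)) sums D (\<Union>n. E n)"
begin

lemma D_empty: "D {} = 0"
proof -
 have "(\<lambda>n::nat. D {}) sums D (\<Union>n::nat. {})" by (rule ca) (auto simp: disjoint_family_on_def)
 then have "summable (\<lambda>n::nat. D {})" by (rule sums_summable)
 then show ?thesis by (simp add: summable_const_iff)
qed

lemma D_union:
 assumes "A \<in> sets M" "B \<in> sets M" "A \<inter> B = {}"
 shows "D (A \<union> B) = D A + D B"
proof -
 have "(\<lambda>n. D (binaryset A B n)) sums D (\<Union>n. binaryset A B n)"
  by (rule ca) (use assms in \<open>auto simp: range_binaryset_eq disjoint_family_on_def binaryset_def\<close>)
 then show ?thesis using binaryset_sums[where f = D, OF D_empty, of A B] unfolding UN_binaryset_eq by (rule sums_unique2)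
qed

lemma D_diff: "A \<in> sets M ==> B \<in> sets M ==> A \<subseteq> B ==> D (B - A) = D B - D A"
 using D_union[of A "B - A"] by (simp add: Un_absorb1)

lemma convergent_decreasing:
 assumes E: "range E \<subseteq> sets M" and dec: "!!n::nat. E (Suc n) \<subseteq> E n"
 shows "convergent (\<lambda>n. D (E n))"
proof -
 define G where "G i = E i - E (Suc i)" for i
 have mono: "E n \<subseteq> E m" if "m <= n" for m n using dec that by (rule lift_Suc_antimono_le)
 have "G m \<inter> G n = {}" if "m < n" for m n using mono[of "Suc m" n] that by (auto simp: G_def)
 then have "disjoint_family G" unfolding disjoint_family_on_def by (metis Int_commute linorder_neqE_nat)
 then have "(\<lambda>n. D (G n)) sums D (\<Union>n. G n)"
 proof (rule ca[rotated])
  show "range G \<subseteq> sets M" using E by (auto simp: G_def)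
 qed
 then have "(\<lambda>n. D (E 0) - (\<Sum>i<n. D (G i))) \<longlonglongrightarrow> D (E 0) - D (\<Union>n. G n)" unfolding sums_def by (intro tendsto_intros)
 moreover have "D (E 0) - (\<Sum>i<n. D (G i)) = D (E n)" for n
 proof (induction n)
  case (Suc n)
  then show ?case using D_diff[of "E (Suc n)" "E n"] E dec[of n] by (auto simp: G_def range_subsetD algebra_simps)
 qed simp
 ultimately show ?thesis by (auto simp: convergent_def)
qed

text \<open>Superadditivity interleaves partitions of two disjoint sets; for subadditivity a
  partition of the union is intersected with the sets \<open>E i\<close> and the double sum is
  exchanged.\<close>

lemma emeasure_total_variation:
 assumes "A \<in> sets M"
 shows "emeasure (measure_of (space M) (sets M) (\<lambda>E. SUP F \<in> {F::nat => 'b set. range F \<subseteq> sets M \<and> disjoint_family F \<and> (\<Union>n. F n) = E}.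
   \<Sum>n. ennreal (norm (D (F n))))) A =
  (SUP F \<in> {F::nat => 'b set. range F \<subseteq> sets M \<and> disjoint_family F \<and> (\<Union>n. F n) = A}. \<Sum>n. ennreal (norm (D (F n))))"
  (is "emeasure (measure_of _ _ ?t) A = _")
proof (rule emeasure_measure_of_superadditive)
 define X where "X E = {F::nat => 'b set. range F \<subseteq> sets M \<and> disjoint_family F \<and> (\<Union>n. F n) = E}" for E
 have t: "?t E = (SUP F \<in> X E. \<Sum>n. ennreal (norm (D (F n))))" for E by (simp add: X_def)
 have ne: "X E \<noteq> {}" if "E \<in> sets M" for E
 proof -
  have "binaryset E {} \<in> X E" using that unfolding X_def by (auto simp: range_binaryset_eq UN_binaryset_eq disjoint_family_on_def binaryset_def)
  then show ?thesis by blast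
 qed
 show "?t {} = 0"
 proof -
  have "(\<Sum>n. ennreal (norm (D (F n)))) <= 0" if "F \<in> X {}" for F
  proof -
   have "F n = {}" for n using that by (auto simp: X_def)
   then show ?thesis by (simp add: D_empty)
  qed
  then have "?t {} <= 0" unfolding t by (intro SUP_least)
  then show ?thesis by simp
 qed
 show "?t A + ?t B <= ?t (A \<union> B)" if AB: "A \<in> sets M" "B \<in> sets M" "A \<inter> B = {}" for A B
  unfolding t
 proof (rule SUP_add_SUP_le[OF ne[OF AB(1)] ne[OF AB(2)]])
  fix F G assume FG: "F \<in> X A" "G \<in> X B"
  define H where "H n = (if even n then F (n div 2) else G (n div 2))" for n
  have HA: "H n \<subseteq> (if even n then A else B)" for n using FG by (auto simp: H_def X_def)
  have "H \<in> X (A \<union> B)"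
  proof -
   have "H m \<inter> H n = {}" if "m \<noteq> n" for m n
   proof (cases "even m = even n")
    case True
    then have "m div 2 \<noteq> n div 2" using that by (metis even_two_times_div_two odd_two_times_div_two_succ)
    then show ?thesis using True FG unfolding X_def disjoint_family_on_def H_def by auto
   next
    case False
    then show ?thesis using HA[of m] HA[of n] AB(3) by (auto split: if_splits)
   qed
   moreover have "A \<union> B \<subseteq> (\<Union>n. H n)"
   proof
    fix x assume "x \<in> A \<union> B"
    then obtain k where "x \<in> F k \<or> x \<in> G k" using FG by (auto simp: X_def)
    then have "x \<in> H (2 * k) \<or> x \<in> H (Suc (2 * k))" by (simp add: H_def)
    then show "x \<in> (\<Union>n. H n)" by blast
   qed
   moreover have "range H \<subseteq> sets M" using FG by (auto simp: H_def X_def)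
   moreover have "(\<Union>n. H n) \<subseteq> A \<union> B" 
   proof
    fix x assume "x \<in> (\<Union>n. H n)"
    then obtain n where "x \<in> H n" by blast
    then show "x \<in> A \<union> B" using HA[of n] by (cases "even n") auto
   qed
   ultimately show ?thesis unfolding X_def disjoint_family_on_def by blast
  qed
  moreover have "(\<Sum>n. ennreal (norm (D (F n)))) + (\<Sum>n. ennreal (norm (D (G n)))) <= (\<Sum>n. ennreal (norm (D (H n))))"
  proof -
   have "(\<Sum>i<N. ennreal (norm (D (F i))) + ennreal (norm (D (G i)))) <= (\<Sum>n. ennreal (norm (D (H n))))" for N
   proof -
    have "(\<Sum>i<N. ennreal (norm (D (F i))) + ennreal (norm (D (G i)))) = (\<Sum>n<2 * N. ennreal (norm (D (H n))))"
     by (induction N) (simp_all add: H_def add.assoc)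
    also have "... <= (\<Sum>n. ennreal (norm (D (H n))))" by (rule sum_le_suminf) auto
    finally show ?thesis .
   qed
   then show ?thesis by (simp add: suminf_add suminf_eq_SUP[of "\<lambda>i. ennreal (norm (D (F i))) + ennreal (norm (D (G i)))"] SUP_least)
  qed
  ultimately show "(\<Sum>n. ennreal (norm (D (F n)))) + (\<Sum>n. ennreal (norm (D (G n)))) <= (SUP F \<in> X (A \<union> B). \<Sum>n. ennreal (norm (D (F n))))"
   by (intro order_trans[OF _ SUP_upper[of H]])
 qed
 show "?t (\<Union>n. E n) <= (\<Sum>n. ?t (E n))" if E: "range E \<subseteq> sets M" "disjoint_family E" for E :: "nat => 'b set"
  unfolding t
 proof (rule SUP_least)
  fix F assume "F \<in> X (\<Union>n. E n)"
  then have F: "range F \<subseteq> sets M" "disjoint_family F" "(\<Union>n. F n) = (\<Union>n. E n)" by (auto simp: X_def)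
  have "ennreal (norm (D (F n))) <= (\<Sum>i. ennreal (norm (D (F n \<inter> E i))))" for n
  proof -
   have "disjoint_family (\<lambda>i. F n \<inter> E i)" using E(2) unfolding disjoint_family_on_def by blast
   then have "(\<lambda>i. D (F n \<inter> E i)) sums D (\<Union>i. F n \<inter> E i)" using F(1) E(1) by (intro ca) auto
   moreover have "(\<Union>i. F n \<inter> E i) = F n" using F(3) by blast
   ultimately have s: "(\<lambda>i. D (F n \<inter> E i)) sums D (F n)" by simp
   then have lim: "(\<lambda>m. ennreal (norm (\<Sum>i<m. D (F n \<inter> E i)))) \<longlonglongrightarrow> ennreal (norm (D (F n)))"
    unfolding sums_def by (intro tendsto_ennrealI tendsto_norm)
   have "ennreal (norm (\<Sum>i<m. D (F n \<inter> E i))) <= (\<Sum>i. ennreal (norm (D (F n \<inter> E i))))" for m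
   proof -
    have "ennreal (norm (\<Sum>i<m. D (F n \<inter> E i))) <= ennreal (\<Sum>i<m. norm (D (F n \<inter> E i)))" by (intro ennreal_leI norm_sum)
    also have "... = (\<Sum>i<m. ennreal (norm (D (F n \<inter> E i))))" by (simp add: sum_ennreal)
    also have "... <= (\<Sum>i. ennreal (norm (D (F n \<inter> E i))))" by (rule sum_le_suminf) auto
    finally show ?thesis .
   qed
   then show ?thesis by (intro LIMSEQ_le_const2[OF lim]) auto
  qed
  then have "(\<Sum>n. ennreal (norm (D (F n)))) <= (\<Sum>n. \<Sum>i. ennreal (norm (D (F n \<inter> E i))))" by (intro suminf_le) auto
  also have "... = (\<Sum>i. \<Sum>n. ennreal (norm (D (F n \<inter> E i))))"
   unfolding nn_integral_count_space_nat[symmetric] by (rule pair_sigma_finite.Fubini'[symmetric]) (auto intro!: pair_sigma_finite.intro sigma_finite_measure_count_space simp: pair_measure_countable)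
  also have "... <= (\<Sum>i. SUP F \<in> X (E i). \<Sum>n. ennreal (norm (D (F n))))"
  proof (intro suminf_le)
   fix i
   have "(\<Union>n. F n \<inter> E i) = E i" using F(3) by blast
   moreover have "disjoint_family (\<lambda>n. F n \<inter> E i)" using F(2) unfolding disjoint_family_on_def by blast
   ultimately have "(\<lambda>n. F n \<inter> E i) \<in> X (E i)" using F(1) E(1) unfolding X_def by auto
   then show "(\<Sum>n. ennreal (norm (D (F n \<inter> E i)))) <= (SUP F \<in> X (E i). \<Sum>n. ennreal (norm (D (F n))))"
    by (intro SUP_upper2[of "\<lambda>n. F n \<inter> E i"]) auto
  qed auto
  finally show "(\<Sum>n. ennreal (norm (D (F n)))) <= (\<Sum>i. SUP F \<in> X (E i). \<Sum>n. ennreal (norm (D (F n))))" .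
 qed
qed fact

end

locale signed_charge = charge M \<nu> for M :: "'b measure" and \<nu> :: "'b set => real"
begin

lemma uminus_charge: "signed_charge M (\<lambda>E. - \<nu> E)"
 by unfold_locales (intro sums_minus ca)

lemma positive_variation_eq:
 assumes "A \<in> sets M"
 shows "emeasure (positive_variation M \<nu>) A = (SUP F \<in> {F \<in> sets M. F \<subseteq> A}. ennreal (\<nu> F))"
 unfolding positive_variation_def
proof (rule emeasure_measure_of_superadditive)
 show "(SUP F \<in> {F \<in> sets M. F \<subseteq> {}}. ennreal (\<nu> F)) = 0"
 proof -
  have "{F \<in> sets M. F \<subseteq> {}} = {{}}" by auto
  then show ?thesis by (simp add: D_empty)
 qed
 show "(SUP F \<in> {F \<in> sets M. F \<subseteq> A}. ennreal (\<nu> F)) + (SUP F \<in> {F \<in> sets M. F \<subseteq> B}. ennreal (\<nu> F)) <= (SUP F \<in> {F \<in> sets M. F \<subseteq> A \<union> B}. ennreal (\<nu> F))"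
  if "A \<in> sets M" "B \<in> sets M" "A \<inter> B = {}" for A B
 proof (rule SUP_add_SUP_le)
  show "{F \<in> sets M. F \<subseteq> A} \<noteq> {}" "{F \<in> sets M. F \<subseteq> B} \<noteq> {}" using that by blast+
  fix F G assume FG: "F \<in> {F \<in> sets M. F \<subseteq> A}" "G \<in> {F \<in> sets M. F \<subseteq> B}"
  then have un: "\<nu> (F \<union> G) = \<nu> F + \<nu> G" using that(3) by (intro D_union) auto
  have up: "ennreal (\<nu> H) <= (SUP F \<in> {F \<in> sets M. F \<subseteq> A \<union> B}. ennreal (\<nu> F))" if "H \<in> sets M" "H \<subseteq> A \<union> B" for H
   using that by (intro SUP_upper) auto
  \<comment> \<open>Truncation by \<open>ennreal\<close> destroys additivity when a value is
    negative, but then the other set alone does at least as well.\<close>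
  consider "0 <= \<nu> F \<and> 0 <= \<nu> G" | "\<nu> F <= 0" | "\<nu> G <= 0" by linarith
  then show "ennreal (\<nu> F) + ennreal (\<nu> G) <= (SUP F \<in> {F \<in> sets M. F \<subseteq> A \<union> B}. ennreal (\<nu> F))"
  proof cases
   case 1
   then show ?thesis using up[of "F \<union> G"] FG by (auto simp: un)
  next
   case 2
   then show ?thesis using up[of G] FG by (auto simp: ennreal_neg)
  next
   case 3
   then show ?thesis using up[of F] FG by (auto simp: ennreal_neg)
  qed
 qed
 show "(SUP F \<in> {F \<in> sets M. F \<subseteq> (\<Union>n. E n)}. ennreal (\<nu> F)) <= (\<Sum>n. SUP F \<in> {F \<in> sets M. F \<subseteq> E n}. ennreal (\<nu> F))"
  if E: "range E \<subseteq> sets M" "disjoint_family E" for E :: "nat => 'b set"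
 proof (rule SUP_least)
  fix F assume F: "F \<in> {F \<in> sets M. F \<subseteq> (\<Union>n. E n)}"
  have "(\<lambda>i. \<nu> (F \<inter> E i)) sums \<nu> (\<Union>i. F \<inter> E i)" using F E by (intro ca) (auto simp: disjoint_family_on_def)
  moreover have "(\<Union>i. F \<inter> E i) = F" using F by blast
  ultimately have lim: "(\<lambda>m. ennreal (\<Sum>i<m. \<nu> (F \<inter> E i))) \<longlonglongrightarrow> ennreal (\<nu> F)" unfolding sums_def by (intro tendsto_ennrealI) simp
  have "ennreal (\<Sum>i<m. \<nu> (F \<inter> E i)) <= (\<Sum>n. SUP F \<in> {F \<in> sets M. F \<subseteq> E n}. ennreal (\<nu> F))" for m
  proof -
   have "ennreal (\<Sum>i<m. \<nu> (F \<inter> E i)) <= ennreal (\<Sum>i<m. max 0 (\<nu> (F \<inter> E i)))" by (intro ennreal_leI sum_mono) auto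
   also have "... = (\<Sum>i<m. ennreal (\<nu> (F \<inter> E i)))" 
   proof -
    have "ennreal (\<nu> (F \<inter> E i)) = ennreal (max 0 (\<nu> (F \<inter> E i)))" for i by (auto simp: max_def ennreal_neg)
    then show ?thesis by (simp only: sum_ennreal max.cobounded1)
   qed
   also have "... <= (\<Sum>i<m. SUP F \<in> {F \<in> sets M. F \<subseteq> E i}. ennreal (\<nu> F))"
    using F E(1) by (intro sum_mono SUP_upper) auto
   also have "... <= (\<Sum>n. SUP F \<in> {F \<in> sets M. F \<subseteq> E n}. ennreal (\<nu> F))" by (rule sum_le_suminf) auto
   finally show ?thesis .
  qed
  then show "ennreal (\<nu> F) <= (\<Sum>n. SUP F \<in> {F \<in> sets M. F \<subseteq> E n}. ennreal (\<nu> F))" by (intro LIMSEQ_le_const2[OF lim]) auto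
 qed
qed fact

lemma sets_pv [simp]: "sets (positive_variation M \<nu>) = sets M" "space (positive_variation M \<nu>) = space M"
 by (simp_all add: positive_variation_def)

text \<open>A set of infinite variation contains some \<open>F\<close> with huge charge. Either
  \<open>F\<close> or its complement in the set again has infinite variation, and both have large
  charge in absolute value. Iterating gives a decreasing sequence along which the charge is
  unbounded, against convergence.\<close>

lemma finite_pv: "finite_measure (positive_variation M \<nu>)"
proof (rule finite_measureI, rule ccontr)
 let ?P = "positive_variation M \<nu>"
 define good where "good E \<longleftrightarrow> E \<in> sets M \<and> emeasure ?P E = \<infinity>" for E
 assume "\<not> emeasure ?P (space ?P) \<noteq> \<infinity>"
 then have "good (space M)" by (simp add: good_def)
 moreover have "\<exists>E'. good E' \<and> (E' \<subseteq> E \<and> real n < abs (\<nu> E'))" if E: "good E" for E n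
 proof -
  have "ennreal (real n + abs (\<nu> E)) < (SUP F \<in> {F \<in> sets M. F \<subseteq> E}. ennreal (\<nu> F))"
   using E positive_variation_eq[of E] by (simp add: good_def)
  then obtain F where F: "F \<in> sets M" "F \<subseteq> E" "ennreal (real n + abs (\<nu> E)) < ennreal (\<nu> F)" unfolding less_SUP_iff by blast
  then have nF: "real n + abs (\<nu> E) < \<nu> F" by (subst (asm) ennreal_less_iff) auto
  have "emeasure ?P F + emeasure ?P (E - F) = emeasure ?P E"
   using F E by (subst plus_emeasure) (auto simp: good_def Un_absorb1)
  then have "good F \<or> good (E - F)" using E F by (auto simp: good_def)
  moreover have "real n < abs (\<nu> F)" using nF by linarith
  moreover have "real n < abs (\<nu> (E - F))" using nF D_diff[of F E] F E by (simp add: good_def)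
  ultimately show ?thesis using F(2) by blast
 qed
 ultimately obtain E where E: "!!n. good (E n)" "!!n. E (Suc n) \<subseteq> E n \<and> real n < abs (\<nu> (E (Suc n)))"
  using dependent_nat_choice[of "\<lambda>_. good" "\<lambda>n E E'. E' \<subseteq> E \<and> real n < abs (\<nu> E')"] by blast
 have "convergent (\<lambda>n. \<nu> (E n))" using E by (intro convergent_decreasing) (auto simp: good_def)
 then have "Bseq (\<lambda>n. \<nu> (E n))" by (rule convergent_imp_Bseq)
 then obtain K where K: "!!n. norm (\<nu> (E n)) <= K" unfolding Bseq_def by blast
 obtain n :: nat where "K < real n" using reals_Archimedean2 by blast
 then show False using K[of "Suc n"] E(2)[of n] by simp
qed

text \<open>For \<open>F\<close> inside \<open>A\<close>,
  \<open>\<nu> F = \<nu> A - \<nu> (A - F)\<close>, and the negative variation bounds the last term.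
  Used for \<open>\<nu>\<close> and for its negative, this gives the Jordan decomposition without a
  Hahn set.\<close>

lemma measure_pv_le:
 assumes A: "A \<in> sets M"
 shows "measure (positive_variation M \<nu>) A <= \<nu> A + measure (positive_variation M (\<lambda>E. - \<nu> E)) A"
proof -
 interpret m: signed_charge M "\<lambda>E. - \<nu> E" by (rule uminus_charge)
 interpret P: finite_measure "positive_variation M \<nu>" by (rule finite_pv)
 interpret N: finite_measure "positive_variation M (\<lambda>E. - \<nu> E)" by (rule m.finite_pv)
 have N: "- \<nu> F <= measure (positive_variation M (\<lambda>E. - \<nu> E)) A" if "F \<in> sets M" "F \<subseteq> A" for F
 proof -
  have "ennreal (- \<nu> F) <= emeasure (positive_variation M (\<lambda>E. - \<nu> E)) A"
   unfolding m.positive_variation_eq[OF A] using that by (intro SUP_upper) auto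
  then show ?thesis unfolding N.emeasure_eq_measure by (simp add: ennreal_le_iff)
 qed
 have "emeasure (positive_variation M \<nu>) A <= ennreal (\<nu> A + measure (positive_variation M (\<lambda>E. - \<nu> E)) A)"
  unfolding positive_variation_eq[OF A]
 proof (rule SUP_least)
  fix F assume "F \<in> {F \<in> sets M. F \<subseteq> A}"
  then show "ennreal (\<nu> F) <= ennreal (\<nu> A + measure (positive_variation M (\<lambda>E. - \<nu> E)) A)"
   using N[of "A - F"] D_diff[of F A] A by (intro ennreal_leI) auto
 qed
 moreover have "0 <= \<nu> A + measure (positive_variation M (\<lambda>E. - \<nu> E)) A" using N[OF A] by simp
 ultimately show ?thesis unfolding P.emeasure_eq_measure by (simp add: ennreal_le_iff)
qed

lemma jordan_decomposition:
 assumes A: "A \<in> sets M"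
 shows "\<nu> A = measure (positive_variation M \<nu>) A - measure (positive_variation M (\<lambda>E. - \<nu> E)) A"
proof -
 interpret m: signed_charge M "\<lambda>E. - \<nu> E" by (rule uminus_charge)
 show ?thesis using measure_pv_le[OF A] m.measure_pv_le[OF A] by simp
qed

end

text \<open>Cutting \<open>E\<close> along preimages of small balls makes \<open>h\<close> nearly
  constant on each piece, where the norm of the integral almost equals the integral of the
  norm.\<close>

lemma variation_of_density:
 fixes h :: "'a::euclidean_space => 'c::euclidean_space" and D :: "'a set => 'c"
 assumes h: "integrable lborel h" and \<Omega>: "\<Omega> \<in> sets borel" and E: "E \<in> sets borel" "E \<subseteq> \<Omega>" "emeasure lborel E < \<infinity>"
  and D: "!!F. F \<in> sets borel ==> F \<subseteq> E ==> D F = (LINT x|lborel. indicator F x *\<^sub>R h x)"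
 shows "(SUP F \<in> {F::nat => 'a set. range F \<subseteq> sets (restrict_space borel \<Omega>) \<and> disjoint_family F \<and> (\<Union>n. F n) = E}. \<Sum>n. ennreal (norm (D (F n)))) =
  (\<integral>\<^sup>+x. ennreal (norm (h x)) * indicator E x \<partial>lborel)" (is "Sup (?s ` ?X) = ?I")
proof (rule antisym)
 have [measurable]: "h \<in> borel_measurable borel" using h by auto
 define m where "m = density lborel (\<lambda>x. ennreal (norm (h x)))"
 have m: "emeasure m F = (\<integral>\<^sup>+x. ennreal (norm (h x)) * indicator F x \<partial>lborel)" if "F \<in> sets borel" for F
  unfolding m_def using that by (subst emeasure_density) auto
 have X: "range F \<subseteq> sets borel" "disjoint_family F" "(\<Union>n. F n) = E" if "F \<in> ?X" for F
  using that \<Omega> by (auto simp: sets_restrict_space_iff)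
 have sum_m: "(\<Sum>n. emeasure m (F n)) = emeasure m E" if "F \<in> ?X" for F
  using X[OF that] suminf_emeasure[of F m] by (simp add: m_def)
 have int: "integrable lborel (\<lambda>x. indicator F x *\<^sub>R h x)" if "F \<in> sets borel" for F
  using that h by (intro integrable_mult_indicator) auto
 show "Sup (?s ` ?X) <= ?I"
 proof (rule SUP_least)
  fix F assume F: "F \<in> ?X"
  have "?s F <= (\<Sum>n. emeasure m (F n))"
  proof (intro suminf_le)
   fix n
   have Fn: "F n \<in> sets borel" "F n \<subseteq> E" using X[OF F] by auto
   have "ennreal (norm (D (F n))) <= (\<integral>\<^sup>+x. ennreal (norm (indicator (F n) x *\<^sub>R h x)) \<partial>lborel)"
    unfolding D[OF Fn] using int[OF Fn(1)] by (rule integral_norm_bound_ennreal)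
   also have "... = emeasure m (F n)" unfolding m[OF Fn(1)] by (intro nn_integral_cong) (auto simp: indicator_def)
   finally show "ennreal (norm (D (F n))) <= emeasure m (F n)" .
  qed auto
  then show "?s F <= ?I" unfolding sum_m[OF F] m[OF E(1)] .
 qed
 show "?I <= Sup (?s ` ?X)"
 proof (rule ennreal_le_epsilon)
  fix e :: real assume e: "0 < e"
  define L where "L = measure lborel E"
  have LE: "emeasure lborel E = ennreal L" using E(3) by (simp add: L_def emeasure_eq_ennreal_measure)
  \<comment> \<open>Each piece loses at most \<open>2 * k\<close> times its volume, in total at most
    \<open>e\<close>; the added 1 covers \<open>L = 0\<close>.\<close>
  define k where "k = e / (2 * L + 1)"
  have L0: "0 <= L" by (simp add: L_def)
  have k: "0 < k" "2 * k * L <= e" using e L0 by (simp_all add: k_def pos_divide_le_eq)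
  obtain C :: "'c set" where C: "countable C" "!!S. open S ==> S \<noteq> {} ==> \<exists>v\<in>C. v \<in> S" using countable_dense_setE by blast
  define a where "a n = from_nat_into C n" for n
  define B where "B n = ball (a n) k" for n
  define F where "F n = E \<inter> h -` disjointed B n" for n
  have Fb: "F n \<in> sets borel" for n
  proof -
   have "disjointed B n \<in> sets borel" by (rule sets.range_disjointed_sets[THEN range_subsetD]) (auto simp: B_def)
   then have "h -` disjointed B n \<in> sets borel" using measurable_sets_borel[of h] by simp
   then show ?thesis using E(1) by (auto simp: F_def)
  qed
  have "y \<in> (\<Union>n. B n)" for y
  proof -
   have "\<exists>v\<in>C. v \<in> ball y k" using k(1) by (intro C(2)) auto
   then obtain v where v: "v \<in> C" "dist y v < k" by auto
   then obtain n where "a n = v" unfolding a_def using from_nat_into_surj[OF C(1)] by blast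
   then show ?thesis using v by (auto simp: B_def dist_commute)
  qed
  then have "(\<Union>n. disjointed B n) = UNIV" unfolding UN_disjointed_eq by blast
  then have "(\<Union>n. F n) = E" unfolding F_def by blast
  moreover have "disjoint_family F" using disjoint_family_disjointed[of B] unfolding F_def disjoint_family_on_def by blast
  ultimately have FX: "F \<in> ?X" using Fb E(2) \<Omega> by (auto simp: sets_restrict_space_iff F_def)
  have each: "emeasure m (F n) <= ennreal (norm (D (F n))) + ennreal (2 * k) * emeasure lborel (F n)" for n
  proof -
   have FE: "F n \<subseteq> E" by (auto simp: F_def)
   have fin: "emeasure lborel (F n) < \<infinity>" using emeasure_mono[OF FE, of lborel] E by (simp add: order_le_less_trans)
   define l where "l = measure lborel (F n)"
   have l: "emeasure lborel (F n) = ennreal l" "0 <= l" using fin by (simp_all add: l_def emeasure_eq_ennreal_measure)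
   have near: "norm (h x - a n) <= k" if "x \<in> F n" for x
    using that disjointed_subset[of B n] by (force simp: F_def B_def dist_norm norm_minus_commute)
   have ic: "integrable lborel (\<lambda>x. indicator (F n) x *\<^sub>R b)" for b :: 'c using Fb fin by (intro integrable_scaleR_left) (auto simp: integrable_indicator_iff)
   have cl: "(LINT x|lborel. indicator (F n) x *\<^sub>R b) = l *\<^sub>R b" for b :: 'c
    using Fb fin by (simp add: l_def integrable_indicator_iff)
   have "norm (D (F n) - l *\<^sub>R a n) = norm (LINT x|lborel. indicator (F n) x *\<^sub>R h x - indicator (F n) x *\<^sub>R a n)"
    unfolding D[OF Fb FE] cl[symmetric] by (subst Bochner_Integration.integral_diff[OF int[OF Fb] ic]) simp
   also have "... <= (LINT x|lborel. indicator (F n) x * k)"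
   proof (rule order_trans[OF integral_norm_bound], rule integral_mono)
    show "integrable lborel (\<lambda>x. norm (indicator (F n) x *\<^sub>R h x - indicator (F n) x *\<^sub>R a n))" using int[OF Fb] ic by (intro integrable_norm Bochner_Integration.integrable_diff)
    show "integrable lborel (\<lambda>x. indicator (F n) x * k)" using Fb fin by (intro integrable_mult_left) (auto simp: integrable_indicator_iff)
    show "norm (indicator (F n) x *\<^sub>R h x - indicator (F n) x *\<^sub>R a n) <= indicator (F n) x * k" for x
     using near[of x] by (auto simp: indicator_def)
   qed
   also have "... = k * l" using Fb by (simp add: l_def mult.commute)
   finally have "norm (l *\<^sub>R a n) <= norm (D (F n)) + k * l" using norm_triangle_ineq3[of "D (F n)" "l *\<^sub>R a n"] by linarith
   then have le: "(norm (a n) + k) * l <= norm (D (F n)) + 2 * k * l" using l(2) by (simp add: distrib_right mult.commute[of l])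
   have "emeasure m (F n) <= (\<integral>\<^sup>+x. ennreal (norm (a n) + k) * indicator (F n) x \<partial>lborel)"
    unfolding m[OF Fb]
   proof (rule nn_integral_mono)
    fix x
    show "ennreal (norm (h x)) * indicator (F n) x <= ennreal (norm (a n) + k) * indicator (F n) x"
    proof (cases "x \<in> F n")
     case True
     have "norm (h x) <= norm (a n) + k" using near[OF True] norm_triangle_sub[of "h x" "a n"] by linarith
     then show ?thesis using True by (simp add: ennreal_leI)
    qed simp
   qed
   also have "... = ennreal ((norm (a n) + k) * l)" using Fb l k(1) by (simp add: nn_integral_cmult_indicator ennreal_mult add_nonneg_nonneg)
   also have "... <= ennreal (norm (D (F n)) + 2 * k * l)" using le by (rule ennreal_leI)
   also have "... = ennreal (norm (D (F n))) + ennreal (2 * k) * emeasure lborel (F n)" unfolding l(1) using k(1) l(2) by (simp add: ennreal_mult)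
   finally show ?thesis .
  qed
  have "?I = (\<Sum>n. emeasure m (F n))" using sum_m[OF FX] m[OF E(1)] by simp
  also have "... <= (\<Sum>n. ennreal (norm (D (F n))) + ennreal (2 * k) * emeasure lborel (F n))" using each by (intro suminf_le) auto
  also have "... = ?s F + ennreal (2 * k) * (\<Sum>n. emeasure lborel (F n))" by (subst suminf_add[symmetric]) auto
  also have "(\<Sum>n. emeasure lborel (F n)) = ennreal L" using X[OF FX] suminf_emeasure[of F lborel] LE by simp
  also have "?s F + ennreal (2 * k) * ennreal L <= Sup (?s ` ?X) + ennreal e"
   using k L0 by (intro add_mono SUP_upper FX) (simp add: ennreal_mult[symmetric] ennreal_leI)
  finally show "?I <= Sup (?s ` ?X) + ennreal e" .
 qed
qed

section \<open>Smooth bump functions and distributional derivatives\<close>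

text \<open>With \<open>P = 1\<close> and \<open>r\<close> the squared relative distance this is the
  standard mollifier. Polynomial factors in \<open>1 / (1 - r)\<close> close the class under
  differentiation, which sends \<open>P\<close> to \<open>bump_step P\<close>.\<close>

definition bump_poly :: "real poly => real => real" where
 "bump_poly P r = (if r < 1 then poly P (1 / (1 - r)) * exp (- (1 / (1 - r))) else 0)"

definition bump_step :: "real poly => real poly" where "bump_step P = [:0, 0, 1:] * (pderiv P - P)"

lemma poly_exp_tendsto_0: "((\<lambda>u. poly P u * exp (- u)) \<longlongrightarrow> (0::real)) at_top"
proof -
 have "((\<lambda>u. \<Sum>i\<le>degree P. coeff P i * (u ^ i / exp u)) \<longlongrightarrow> (\<Sum>i\<le>degree P. coeff P i * 0)) at_top"
  by (intro tendsto_sum tendsto_mult tendsto_const tendsto_power_div_exp_0)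
 then show ?thesis by (simp add: poly_altdef sum_distrib_right exp_minus divide_inverse mult.assoc)
qed

lemma bump_poly_derivative: "(bump_poly P has_real_derivative bump_poly (bump_step P) r) (at r)"
proof -
 consider "r < 1" | "1 < r" | "r = 1" by linarith
 then show ?thesis
 proof cases
  case 1
  have "((\<lambda>r. poly P (1 / (1 - r)) * exp (- (1 / (1 - r)))) has_real_derivative bump_poly (bump_step P) r) (at r)"
  proof (rule DERIV_cong)
   show "((\<lambda>r. poly P (1 / (1 - r)) * exp (- (1 / (1 - r)))) has_real_derivative
     poly P (1 / (1 - r)) * (exp (- (1 / (1 - r))) * - ((1 / (1 - r))\<^sup>2)) +
     (poly (pderiv P) (1 / (1 - r)) * (1 / (1 - r))\<^sup>2) * exp (- (1 / (1 - r)))) (at r)"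
    using 1 by (auto intro!: derivative_eq_intros DERIV_chain2[OF poly_DERIV] simp: power2_eq_square divide_simps)
  qed (use 1 in \<open>simp add: bump_poly_def bump_step_def power2_eq_square algebra_simps\<close>)
  then show ?thesis
   by (rule has_field_derivative_transform_within_open[of _ _ _ "{..<1}"]) (use 1 in \<open>auto simp: bump_poly_def\<close>)
 next
  case 2
  have "((\<lambda>r. 0) has_real_derivative bump_poly (bump_step P) r) (at r)" using 2 by (simp add: bump_poly_def)
  then show ?thesis
   by (rule has_field_derivative_transform_within_open[of _ _ _ "{1<..}"]) (use 2 in \<open>auto simp: bump_poly_def\<close>)
 next
  case 3
  have "((\<lambda>y. (bump_poly P y - bump_poly P 1) / (y - 1)) \<longlongrightarrow> 0) (at 1)"
  proof (rule filterlim_split_at)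
   have "((\<lambda>y. 1 - y) \<longlongrightarrow> 1 - 1) (at_left (1::real))" by (intro tendsto_intros)
   then have "filterlim (\<lambda>y. inverse (1 - y)) at_top (at_left (1::real))"
    by (intro filterlim_inverse_at_top) (auto simp: eventually_at_filter)
   from filterlim_compose[OF poly_exp_tendsto_0[of "- (pCons 0 P)"] this]
   have "((\<lambda>y. poly (- (pCons 0 P)) (inverse (1 - y)) * exp (- inverse (1 - y))) \<longlongrightarrow> 0) (at_left (1::real))" .
   then show "((\<lambda>y. (bump_poly P y - bump_poly P 1) / (y - 1)) \<longlongrightarrow> 0) (at_left 1)"
   proof (rule Lim_transform_eventually)
    have "poly (- (pCons 0 P)) (inverse (1 - y)) * exp (- inverse (1 - y)) = (bump_poly P y - bump_poly P 1) / (y - 1)" if "y < 1" for y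
    proof -
     have "inverse (y - 1) = - inverse (1 - y)" by (metis inverse_minus_eq minus_diff_eq)
     then show ?thesis using that by (simp add: bump_poly_def divide_inverse)
    qed
    then show "\<forall>\<^sub>F y in at_left 1. poly (- (pCons 0 P)) (inverse (1 - y)) * exp (- inverse (1 - y)) = (bump_poly P y - bump_poly P 1) / (y - 1)"
     by (auto simp: eventually_at_filter)
   qed
   show "((\<lambda>y. (bump_poly P y - bump_poly P 1) / (y - 1)) \<longlongrightarrow> 0) (at_right 1)"
    by (rule Lim_transform_eventually[OF tendsto_const]) (auto simp: eventually_at_filter bump_poly_def)
  qed
  then show ?thesis using 3 by (simp add: has_field_derivative_iff bump_poly_def)
 qed
qed

text \<open>A class closed under directional derivatives, so that smoothness of every order in
  \<open>test_field\<close> becomes a plain induction.\<close>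

inductive bump_fun :: "'a::euclidean_space => real => ('a => real) => bool" for a \<delta> where
 base: "real_polynomial_function q ==> bump_fun a \<delta> (\<lambda>x. q x * bump_poly P ((x - a) \<bullet> (x - a) / \<delta>\<^sup>2))"
| add: "bump_fun a \<delta> f ==> bump_fun a \<delta> g ==> bump_fun a \<delta> (\<lambda>x. f x + g x)"

lemma real_polynomial_function_derivative:
 assumes "real_polynomial_function (q :: 'a::euclidean_space => real)"
 shows "\<exists>q'. (\<forall>v. real_polynomial_function (\<lambda>x. q' x v)) \<and> (\<forall>x. (q has_derivative q' x) (at x))"
 using assms
proof induction
 case (linear f)
 then show ?case by (intro exI[of _ "\<lambda>_. f"]) (auto intro: bounded_linear_imp_has_derivative real_polynomial_function.intros)
next
 case (const c)
 show ?case by (intro exI[of _ "\<lambda>_ _. 0"]) (auto intro: real_polynomial_function.intros)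
next
 case (add f g)
 then obtain f' g' where "!!v. real_polynomial_function (\<lambda>x. f' x v)" "!!v. real_polynomial_function (\<lambda>x. g' x v)"
  "!!x. (f has_derivative f' x) (at x)" "!!x. (g has_derivative g' x) (at x)" by metis
 then show ?case by (intro exI[of _ "\<lambda>x v. f' x v + g' x v"]) (auto intro: real_polynomial_function.intros has_derivative_add)
next
 case (mult f g)
 then obtain f' g' where "!!v. real_polynomial_function (\<lambda>x. f' x v)" "!!v. real_polynomial_function (\<lambda>x. g' x v)"
  "!!x. (f has_derivative f' x) (at x)" "!!x. (g has_derivative g' x) (at x)" by metis
 then show ?case using mult.hyps
  by (intro exI[of _ "\<lambda>x v. f x * g' x v + f' x v * g x"] conjI allI has_derivative_mult)
    (auto intro!: real_polynomial_function.intros(3,4))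
qed

lemma bump_base_derivative:
 fixes a :: "'a::euclidean_space"
 assumes "(q has_derivative q') (at x)"
 shows "((\<lambda>x. q x * bump_poly P ((x - a) \<bullet> (x - a) / d\<^sup>2)) has_derivative
  (\<lambda>v. q' v * bump_poly P ((x - a) \<bullet> (x - a) / d\<^sup>2) + (q x * (2 * ((x - a) \<bullet> v) / d\<^sup>2)) * bump_poly (bump_step P) ((x - a) \<bullet> (x - a) / d\<^sup>2))) (at x)"
proof -
 have s: "((\<lambda>x. (x - a) \<bullet> (x - a) / d\<^sup>2) has_derivative (\<lambda>v. 2 * ((x - a) \<bullet> v) / d\<^sup>2)) (at x)"
  by (intro bounded_linear.has_derivative[OF bounded_linear_divide]) (auto intro!: derivative_eq_intros simp: inner_commute)
 have "((\<lambda>x. bump_poly P ((x - a) \<bullet> (x - a) / d\<^sup>2)) has_derivative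
   (\<lambda>v. bump_poly (bump_step P) ((x - a) \<bullet> (x - a) / d\<^sup>2) * (2 * ((x - a) \<bullet> v) / d\<^sup>2))) (at x)"
  by (rule has_derivative_compose[OF s bump_poly_derivative[unfolded has_field_derivative_def]])
 from has_derivative_mult[OF assms this] show ?thesis by (simp add: mult_ac add.commute)
qed

lemma bump_fun_derivative:
 assumes "bump_fun (a :: 'a::euclidean_space) d f"
 shows "\<exists>f'. (\<forall>v. bump_fun a d (\<lambda>x. f' x v)) \<and> (\<forall>x. (f has_derivative f' x) (at x))"
 using assms
proof induction
 case (base q P)
 obtain q' where q': "!!v. real_polynomial_function (\<lambda>x. q' x v)" "!!x. (q has_derivative q' x) (at x)"
  using real_polynomial_function_derivative[OF base] by blast
 have "real_polynomial_function (\<lambda>x. q x * (2 / d\<^sup>2 * (v \<bullet> x + - (v \<bullet> a))))" for v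
  by (rule real_polynomial_function.intros(4)[OF base real_polynomial_function.intros(4)[OF real_polynomial_function.intros(2) real_polynomial_function.intros(3)[OF real_polynomial_function.intros(1)[OF bounded_linear_inner_right] real_polynomial_function.intros(2)]]])
 moreover have "(\<lambda>x. q x * (2 / d\<^sup>2 * (v \<bullet> x + - (v \<bullet> a)))) = (\<lambda>x. q x * (2 * ((x - a) \<bullet> v) / d\<^sup>2))" for v
  by (simp add: inner_diff_left inner_commute[of v])
 ultimately have "real_polynomial_function (\<lambda>x. q x * (2 * ((x - a) \<bullet> v) / d\<^sup>2))" for v by metis
 then show ?case
  using q'(1) by (intro exI[of _ "\<lambda>x v. q' x v * bump_poly P ((x - a) \<bullet> (x - a) / d\<^sup>2) +
   (q x * (2 * ((x - a) \<bullet> v) / d\<^sup>2)) * bump_poly (bump_step P) ((x - a) \<bullet> (x - a) / d\<^sup>2)"]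
   conjI allI bump_base_derivative[OF q'(2)] bump_fun.add bump_fun.base)
next
 case (add f g)
 then obtain f' g' where "!!v. bump_fun a d (\<lambda>x. f' x v)" "!!v. bump_fun a d (\<lambda>x. g' x v)"
  "!!x. (f has_derivative f' x) (at x)" "!!x. (g has_derivative g' x) (at x)" by metis
 then show ?case by (intro exI[of _ "\<lambda>x v. f' x v + g' x v"]) (auto intro: bump_fun.intros has_derivative_add)
qed

lemma bump_fun_cont: "bump_fun a d f ==> continuous_on S f"
 using bump_fun_derivative[of a d f] by (meson continuous_at_imp_continuous_on has_derivative_continuous)

lemma k_times_cont_diff_bump: "bump_fun a h f ==> k_times_cont_diff k (\<lambda>x. f x *\<^sub>R b)"
proof (induction k arbitrary: f)
 case 0
 then show ?case by (auto intro!: continuous_intros bump_fun_cont)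
next
 case (Suc k)
 obtain f' where f': "!!v. bump_fun a h (\<lambda>x. f' x v)" "!!x. (f has_derivative f' x) (at x)"
  using bump_fun_derivative[OF Suc.prems] by blast
 have d: "((\<lambda>x. f x *\<^sub>R b) has_derivative (\<lambda>v. f' x v *\<^sub>R b)) (at x)" for x by (rule has_derivative_scaleR_left[OF f'(2)])
 then have "frechet_derivative (\<lambda>x. f x *\<^sub>R b) (at x) = (\<lambda>v. f' x v *\<^sub>R b)" for x by (rule frechet_derivative_at[symmetric])
 then show ?case using Suc.IH[OF f'(1)] d by (auto simp: differentiable_on_def differentiable_def)
qed

lemma bump_fun_outside:
 assumes "bump_fun a d f" "0 < d" "d <= norm (x - a)"
 shows "f x = 0"
 using assms(1)
proof induction
 case (base q P)
 have "d\<^sup>2 <= (norm (x - a))\<^sup>2" using assms(2,3) by (intro power_mono) auto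
 then have "1 <= (x - a) \<bullet> (x - a) / d\<^sup>2" using assms(2) by (simp add: dot_square_norm pos_le_divide_eq)
 then show ?case by (simp add: bump_poly_def)
qed simp

lemma bump_fun_bounded:
 assumes f: "bump_fun a d f" and d: "0 < d"
 obtains M where "0 <= M" "!!x. abs (f x) <= M * indicator (cball a d) x"
proof -
 have "compact (f ` cball a d)" by (intro compact_continuous_image bump_fun_cont[OF f] compact_cball)
 then obtain M where "\<forall>y\<in>f ` cball a d. norm y <= M" using compact_imp_bounded bounded_iff by metis
 then have M: "abs (f x) <= M" if "x \<in> cball a d" for x using that by auto
 have "abs (f x) <= max 0 M * indicator (cball a d) x" for x
  using M[of x] bump_fun_outside[OF f d, of x] by (auto simp: indicator_def dist_norm norm_minus_commute max_def)
 then show thesis by (intro that[of "max 0 M"]) auto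
qed

lemma bump_fun_borel: "bump_fun a d f ==> f \<in> borel_measurable borel"
 by (intro borel_measurable_continuous_onI bump_fun_cont)

lemma integrable_cball: "integrable lborel (\<lambda>x. M * indicator (cball (a::'a::euclidean_space) r) x :: real)"
 using emeasure_lborel_cball_finite[of a r] by (intro integrable_mult_right) (simp add: integrable_indicator_iff)

lemma bump_fun_integrable:
 assumes f: "bump_fun a d f" and d: "0 < d"
 shows "integrable lborel f"
proof -
 obtain M where M: "!!x. abs (f x) <= M * indicator (cball a d) x" using bump_fun_bounded[OF f d] by blast
 show ?thesis
  by (rule Bochner_Integration.integrable_bound[OF integrable_cball[of M a d]])
    (use order_trans[OF M abs_ge_self] bump_fun_borel[OF f] in auto)
qed

lemma lborel_integral_translate:
 fixes f :: "'a::euclidean_space => real"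
 assumes "integrable lborel f"
 shows "integrable lborel (\<lambda>x. f (x + c))" "(LINT x|lborel. f (x + c)) = (LINT x|lborel. f x)"
proof -
 have [measurable]: "f \<in> borel_measurable borel" using assms by auto
 have "integrable (distr lborel borel ((+) c)) f" unfolding lborel_distr_plus by (rule assms)
 then show "integrable lborel (\<lambda>x. f (x + c))" by (subst (asm) integrable_distr_eq) (auto simp: add.commute)
 have "(LINT x|lborel. f x) = (LINT x|distr lborel borel ((+) c). f x)" by (simp only: lborel_distr_plus)
 also have "... = (LINT x|lborel. f (x + c))" by (subst integral_distr) (auto simp: add.commute)
 finally show "(LINT x|lborel. f (x + c)) = (LINT x|lborel. f x)" by simp
qed

text \<open>Difference quotients integrate to zero by translation invariance; the mean value theorem
  dominates them by a multiple of the indicator of a ball.\<close>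

lemma integral_bump_derivative:
 assumes f: "bump_fun a d f" and d: "0 < d" and f': "bump_fun a d (\<lambda>x. f' x v)" "!!x. (f has_derivative f' x) (at x)"
 shows "(LINT x|lborel. f' x v) = 0"
proof -
 define h where "h n = 1 / real (Suc n)" for n
 have h: "0 < h n" "h n <= 1" for n by (auto simp: h_def)
 have h0: "h \<longlonglongrightarrow> 0" using LIMSEQ_Suc[OF lim_1_over_n] by (simp add: h_def[abs_def])
 define g where "g n x = (f (x + h n *\<^sub>R v) - f x) / h n" for n x
 obtain M where M: "0 <= M" "!!x. abs (f' x v) <= M * indicator (cball a d) x" using bump_fun_bounded[OF f'(1) d] by blast
 have line: "((\<lambda>r. f (x + r *\<^sub>R v)) has_real_derivative f' (x + r *\<^sub>R v) v) (at r)" for x r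
 proof -
  have "((\<lambda>r. x + r *\<^sub>R v) has_derivative (\<lambda>r. r *\<^sub>R v)) (at r)" by (auto intro!: derivative_eq_intros)
  from has_derivative_compose[OF this f'(2)] have "((\<lambda>r. f (x + r *\<^sub>R v)) has_derivative (\<lambda>s. f' (x + r *\<^sub>R v) (s *\<^sub>R v))) (at r)" .
  moreover have "f' (x + r *\<^sub>R v) (s *\<^sub>R v) = s * f' (x + r *\<^sub>R v) v" for s
   using linear_scale[OF has_derivative_linear[OF f'(2)]] by simp
  ultimately show ?thesis by (simp add: has_field_derivative_def mult.commute[of _ "f' _ _"])
 qed
 have int: "integrable lborel f" by (rule bump_fun_integrable[OF f d])
 have [measurable]: "f \<in> borel_measurable borel" "(\<lambda>x. f' x v) \<in> borel_measurable borel" using f f'(1) by (auto intro: bump_fun_borel)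
 have "(\<lambda>n. LINT x|lborel. g n x) \<longlonglongrightarrow> (LINT x|lborel. f' x v)"
 proof (rule integral_dominated_convergence)
  show "integrable lborel (\<lambda>x. M * indicator (cball a (d + norm v)) x)" by (rule integrable_cball)
  show "AE x in lborel. (\<lambda>n. g n x) \<longlonglongrightarrow> f' x v"
  proof (rule AE_I2)
   fix x
   have "((\<lambda>y. (f (x + y *\<^sub>R v) - f x) / y) \<longlongrightarrow> f' x v) (at 0)" using line[of x 0] by (simp add: has_field_derivative_iff)
   moreover have "filterlim h (at 0) sequentially" using h0 h by (auto simp: filterlim_at eventually_sequentially intro!: exI[of _ 0] less_imp_neq[THEN not_sym])
   ultimately show "(\<lambda>n. g n x) \<longlonglongrightarrow> f' x v" unfolding g_def by (rule filterlim_compose)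
  qed
  show "AE x in lborel. norm (g n x) <= M * indicator (cball a (d + norm v)) x" for n
  proof (rule AE_I2)
   fix x
   obtain r where r: "0 < r" "r < h n" "f (x + h n *\<^sub>R v) - f (x + 0 *\<^sub>R v) = (h n - 0) * f' (x + r *\<^sub>R v) v"
    using MVT2[OF h(1)[of n], of "\<lambda>r. f (x + r *\<^sub>R v)" "\<lambda>r. f' (x + r *\<^sub>R v) v"] line by blast
   then have "g n x = f' (x + r *\<^sub>R v) v" using h(1)[of n] by (simp add: g_def)
   moreover have "indicator (cball a d) (x + r *\<^sub>R v) <= (indicator (cball a (d + norm v)) x :: real)"
   proof (cases "x + r *\<^sub>R v \<in> cball a d")
    case True
    have "norm (r *\<^sub>R v) <= norm v" using r h(2)[of n] by (simp add: mult_left_le_one_le)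
    moreover have "norm (x - a) <= norm (x + r *\<^sub>R v - a) + norm (r *\<^sub>R v)" using norm_triangle_ineq4[of "x + r *\<^sub>R v - a" "r *\<^sub>R v"] by simp
    ultimately show ?thesis using True by (simp add: dist_norm norm_minus_commute)
   qed simp
   then have "M * indicator (cball a d) (x + r *\<^sub>R v) <= M * indicator (cball a (d + norm v)) x" using M(1) by (intro mult_left_mono)
   ultimately show "norm (g n x) <= M * indicator (cball a (d + norm v)) x" using M(2)[of "x + r *\<^sub>R v"] by simp
  qed
 qed (unfold g_def, measurable)
 moreover have "(LINT x|lborel. g n x) = 0" for n
  unfolding g_def using lborel_integral_translate[OF int, of "h n *\<^sub>R v"] int by simp
 ultimately show ?thesis by (simp add: LIMSEQ_const_iff)
qed

definition bump :: "'a::euclidean_space => real => 'a => real" where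
 "bump a d x = bump_poly 1 ((x - a) \<bullet> (x - a) / d\<^sup>2)"

definition bump_deriv :: "'a::euclidean_space => real => 'a => 'a => real" where
 "bump_deriv a d x v = 2 * ((x - a) \<bullet> v) / d\<^sup>2 * bump_poly (bump_step 1) ((x - a) \<bullet> (x - a) / d\<^sup>2)"

lemma bump_fun_bump: "bump_fun a d (bump a d)"
 using bump_fun.base[of "\<lambda>_. 1" a d 1] by (simp add: bump_def[abs_def] real_polynomial_function.intros(2))

lemma bump_derivative: "(bump a d has_derivative bump_deriv a d x) (at x)"
 using bump_base_derivative[of "\<lambda>_. 1" "\<lambda>_. 0" x 1 a d] by (simp add: bump_def[abs_def] bump_deriv_def[abs_def])

lemma bump_fun_affine_deriv:
 assumes "bounded_linear l"
 shows "bump_fun a d (\<lambda>x. (l (x - a) + k) * bump_deriv a d x v)" "bump_fun a d (\<lambda>x. (l (x - a) + k) * bump a d x)"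
proof -
 have l: "real_polynomial_function (\<lambda>x. l x + (k - l a))"
  by (rule real_polynomial_function.intros(3)[OF real_polynomial_function.intros(1)[OF assms] real_polynomial_function.intros(2)])
 have "real_polynomial_function (\<lambda>x. (l x + (k - l a)) * (2 / d\<^sup>2 * (v \<bullet> x + - (v \<bullet> a))))"
  by (rule real_polynomial_function.intros(4)[OF l real_polynomial_function.intros(4)[OF real_polynomial_function.intros(2) real_polynomial_function.intros(3)[OF real_polynomial_function.intros(1)[OF bounded_linear_inner_right] real_polynomial_function.intros(2)]]])
 from bump_fun.base[OF this, of a d "bump_step 1"] show "bump_fun a d (\<lambda>x. (l (x - a) + k) * bump_deriv a d x v)"
  by (simp add: bump_deriv_def linear_diff[OF bounded_linear.linear[OF assms]] inner_diff_left inner_commute algebra_simps)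
 from bump_fun.base[OF l, of a d 1] show "bump_fun a d (\<lambda>x. (l (x - a) + k) * bump a d x)"
  by (simp add: bump_def linear_diff[OF bounded_linear.linear[OF assms]] algebra_simps)
qed

text \<open>Affine functions are enough because the potential is compared with its first-order
  Taylor polynomial.\<close>

lemma bump_by_parts:
 assumes l: "bounded_linear l" and d: "0 < d"
 shows "(LINT x|lborel. (l (x - a) + k) * bump_deriv a d x v) = - (l v * (LINT x|lborel. bump a d x))"
proof -
 define f' where "f' x v = (l (x - a) + k) * bump_deriv a d x v + l v * bump a d x" for x v
 have "((\<lambda>x. (l (x - a) + k) * bump a d x) has_derivative f' x) (at x)" for x
  unfolding f'_def by (auto intro!: derivative_eq_intros bump_derivative bounded_linear.has_derivative[OF l])
 moreover have "bump_fun a d (\<lambda>x. l v * bump a d x)" using bump_fun_affine_deriv(2)[of "\<lambda>_. 0" a d "l v"] by simp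
 then have "bump_fun a d (\<lambda>x. f' x v)" unfolding f'_def by (intro bump_fun.add bump_fun_affine_deriv(1)[OF l])
 ultimately have "(LINT x|lborel. f' x v) = 0" by (intro integral_bump_derivative[OF bump_fun_affine_deriv(2)[OF l] d])
 moreover have "(LINT x|lborel. f' x v) = (LINT x|lborel. (l (x - a) + k) * bump_deriv a d x v) + l v * (LINT x|lborel. bump a d x)"
  unfolding f'_def
  by (subst Bochner_Integration.integral_add)
    (auto intro!: bump_fun_integrable[OF bump_fun_affine_deriv(1)[OF l] d] integrable_mult_right bump_fun_integrable[OF bump_fun_bump d])
 ultimately show ?thesis by simp
qed

text \<open>On the ball of half radius \<open>r <= 1 / 4\<close>, so
  \<open>1 / (1 - r) <= 2\<close>. The resulting lower bound makes the mass of the bump comparable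
  with the volume of its ball.\<close>

lemma bump_bounds:
 assumes d: "0 < d"
 shows "0 <= bump a d x" "bump a d x <= indicator (ball a d) x"
  "exp (- 2) * indicator (ball a (d / 2)) x <= bump a d x"
proof -
 define r where "r = (x - a) \<bullet> (x - a) / d\<^sup>2"
 have r: "r = (norm (x - a) / d)\<^sup>2" by (simp add: r_def dot_square_norm power_divide)
 show "0 <= bump a d x" by (simp add: bump_def bump_poly_def)
 have le1: "bump a d x <= 1" by (simp add: bump_def bump_poly_def)
 show "bump a d x <= indicator (ball a d) x"
  using le1 bump_fun_outside[OF bump_fun_bump d, of x a] by (cases "x \<in> ball a d") (auto simp: dist_norm norm_minus_commute[of a])
 show "exp (- 2) * indicator (ball a (d / 2)) x <= bump a d x"
 proof (cases "x \<in> ball a (d / 2)")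
  case True
  then have "norm (x - a) / d <= 1 / 2" using d by (simp add: dist_norm norm_minus_commute divide_simps)
  then have "r <= (1 / 2)\<^sup>2" unfolding r using d by (intro power_mono) auto
  then have "r <= 1 / 4" by (simp add: power2_eq_square)
  then have "1 / (1 - r) <= 2" "r < 1" by (auto simp: divide_simps)
  then show ?thesis using True by (simp add: bump_def bump_poly_def r_def)
 qed (simp add: bump_def bump_poly_def)
qed

lemma bump_deriv_bound: "\<exists>M>0. \<forall>(a::'a::euclidean_space) d x b. 0 < d --> norm b <= 1 --> abs (bump_deriv a d x b) <= M / d * indicator (ball a d) x"
proof -
 have "continuous_on {0..1} (bump_poly (bump_step 1))" using bump_poly_derivative by (meson DERIV_isCont continuous_at_imp_continuous_on)
 then have "compact (bump_poly (bump_step 1) ` {0..1})" by (intro compact_continuous_image) auto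
 then obtain M where "\<forall>y\<in>bump_poly (bump_step 1) ` {0..1}. norm y <= M" using compact_imp_bounded bounded_iff by metis
 then have M: "abs (bump_poly (bump_step 1) r) <= M" if "0 <= r" "r <= 1" for r using that by auto
 have M0: "0 <= M" using M[of 0] by simp
 have "abs (bump_deriv a d x b) <= (2 * M + 1) / d * indicator (ball a d) x" if d: "0 < d" and b: "norm b <= 1" for a :: 'a and d x b
 proof (cases "x \<in> ball a d")
  case True
  then have n: "norm (x - a) <= d" by (simp add: dist_norm norm_minus_commute)
  have "(x - a) \<bullet> (x - a) <= d\<^sup>2" unfolding dot_square_norm using n by (intro power_mono) auto
  then have "abs (bump_poly (bump_step 1) ((x - a) \<bullet> (x - a) / d\<^sup>2)) <= M" using d by (intro M) auto
  moreover have "abs ((x - a) \<bullet> b) <= d * 1" using n b d by (intro order_trans[OF Cauchy_Schwarz_ineq2] mult_mono) auto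
  then have "abs (2 * ((x - a) \<bullet> b) / d\<^sup>2) <= 2 / d" using d by (simp add: abs_mult divide_simps power2_eq_square)
  ultimately have "abs (bump_deriv a d x b) <= 2 / d * M" unfolding bump_deriv_def abs_mult[of "_ / _"] using d by (intro mult_mono) auto
  also have "... <= (2 * M + 1) / d" using d by (simp add: divide_right_mono)
  finally show ?thesis using True by simp
 next
  case False
  then have "bump_deriv a d x b = 0" using bump_fun_outside[OF bump_fun_affine_deriv(1)[of "\<lambda>_. 0" a d 1 b] d, of x]
   by (simp add: dist_norm norm_minus_commute)
  then show ?thesis using False by simp
 qed
 then show ?thesis using M0 by (intro exI[of _ "2 * M + 1"]) auto
qed

section \<open>Densities of signed measures and gradients of BV functions\<close>

lemma positive_variation_derivative:
 fixes \<Omega> :: "'a::euclidean_space set" and \<nu> :: "'a set => real"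
 assumes \<nu>: "signed_charge (restrict_space borel \<Omega>) \<nu>" and \<Omega>: "\<Omega> \<in> sets borel"
 obtains f N where "integrable lborel f" "N \<in> null_sets lborel"
  "!!E. E \<in> sets borel ==> E \<subseteq> \<Omega> - N ==> measure (positive_variation (restrict_space borel \<Omega>) \<nu>) E = (LINT x|lborel. indicator E x * f x)"
  "AE z in lborel. \<forall>k>0. tests (\<lambda>d z. ball z d) (positive_variation (restrict_space borel \<Omega>) \<nu>) (f z) k z"
proof -
 interpret signed_charge "restrict_space borel \<Omega>" \<nu> by fact
 let ?P = "positive_variation (restrict_space borel \<Omega>) \<nu>"
 interpret P: finite_measure ?P by (rule finite_pv)
 have id: "(\<lambda>x. x) \<in> ?P \<rightarrow>\<^sub>M borel"
  by (subst measurable_cong_sets[OF sets_pv(1) refl]) (rule measurable_restrict_space1[OF measurable_ident_sets[OF refl]])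
 \<comment> \<open>Extension by zero from \<open>\<Omega>\<close> to the whole space, where the
   differentiation theory is stated.\<close>
 define m where "m = distr ?P borel (\<lambda>x. x)"
 have em: "emeasure m E = emeasure ?P (E \<inter> \<Omega>)" if "E \<in> sets borel" for E
  unfolding m_def using that id by (subst emeasure_distr) (auto simp: space_restrict_space)
 have "emeasure m UNIV = emeasure ?P \<Omega>" using em[of UNIV] by simp
 then have ms: "sets m = sets borel" "emeasure m UNIV < \<infinity>"
  using top.not_eq_extremum[THEN iffD1, OF P.emeasure_finite[unfolded infinity_ennreal_def]] by (simp_all add: m_def)
 obtain f N where f: "integrable lborel f" "!!x. 0 <= f x" "N \<in> null_sets lborel"
  "density m (indicator (- N)) = density lborel (\<lambda>x. ennreal (f x))" by (rule lebesgue_decomposition[OF ms]) blast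
 have [measurable]: "f \<in> borel_measurable borel" "N \<in> sets borel" using f(1) null_setsD2[OF f(3)] by auto
 show thesis
 proof (rule that[OF f(1,3)])
  show "AE z in lborel. \<forall>k>0. tests (\<lambda>d z. ball z d) (?P) (f z) k z"
   using balls.measure_derivative[OF ms f] by (rule eventually_mono) (simp add: m_def integral_distr[OF id] cong: ball_cong)
 next
  fix E assume E: "E \<in> sets borel" "E \<subseteq> \<Omega> - N"
  have "emeasure ?P E = emeasure m E" using em[OF E(1)] E(2) by (simp add: Int_absorb2 subset_iff)
  also have "... = emeasure (density m (indicator (- N))) E"
  proof -
   have "emeasure (density m (indicator (- N))) E = (\<integral>\<^sup>+x. indicator (- N) x * indicator E x \<partial>m)"
    using E(1) ms(1) by (intro emeasure_density) (auto simp: measurable_cong_sets[OF ms(1) refl])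
   also have "... = (\<integral>\<^sup>+x. indicator E x \<partial>m)" using E(2) by (intro nn_integral_cong) (auto simp: indicator_def)
   finally show ?thesis using E(1) ms(1) by simp
  qed
  also have "... = (\<integral>\<^sup>+x. ennreal (indicator E x * f x) \<partial>lborel)" unfolding f(4) using E(1)
   by (subst emeasure_density) (auto intro!: nn_integral_cong simp: indicator_def)
  also have "... = ennreal (LINT x|lborel. indicator E x * f x)"
   using f(1,2) E(1) by (intro nn_integral_eq_integral) (auto intro: integrable_real_mult_indicator simp: mult.commute)
  finally show "measure ?P E = (LINT x|lborel. indicator E x * f x)"
   unfolding P.emeasure_eq_measure using f(2) by (subst (asm) ennreal_inj) auto
 qed
qed

lemma vector_measure_integral_bump:
 assumes b: "b \<in> Basis"
 shows "vector_measure_integral M D (\<lambda>x. bump a d x *\<^sub>R b) = signed_integral M (\<lambda>E. D E \<bullet> b) (bump a d)"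
proof -
 have "vector_measure_integral M D (\<lambda>x. bump a d x *\<^sub>R b) = (\<Sum>b'\<in>Basis. if b' = b then signed_integral M (\<lambda>E. D E \<bullet> b) (bump a d) else 0)"
  unfolding vector_measure_integral_def by (intro sum.cong) (auto simp: b inner_Basis signed_integral_def)
 then show ?thesis using b by simp
qed

text \<open>Test with a bump of radius \<open>d\<close> in direction \<open>b\<close>. The affine
  part of \<open>\<phi>\<close> contributes exactly \<open>g \<bullet> b\<close> times the mass of
  the bump. The remainder is \<open>o(d)\<close> against a derivative of order \<open>1 / d\<close>,
  hence \<open>o(1)\<close> times the volume of the ball. On the other side the variations give
  \<open>p - n\<close> times the same mass, with an error of this kind.\<close>

lemma bv_gradient_at:
 fixes \<phi> :: "'a::euclidean_space => real"
 assumes \<Omega>: "open \<Omega>" "z \<in> \<Omega>" and bv: "has_bv_derivative \<phi> D \<Omega>" and g: "(\<phi> has_derivative (\<lambda>w. g \<bullet> w)) (at z)" and b: "b \<in> Basis"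
  and p: "\<forall>j>0. tests (\<lambda>d z. ball z d) (positive_variation (restrict_space borel \<Omega>) (\<lambda>E. D E \<bullet> b)) p j z"
  and n: "\<forall>j>0. tests (\<lambda>d z. ball z d) (positive_variation (restrict_space borel \<Omega>) (\<lambda>E. - (D E \<bullet> b))) n j z"
 shows "p - n = g \<bullet> b"
proof -
 obtain M where M: "0 < M" "!!d x. 0 < d ==> abs (bump_deriv z d x b) <= M / d * indicator (ball z d) x"
  using bump_deriv_bound[where 'a='a] b by (metis norm_Basis order_refl)
 \<comment> \<open>A lower bound for the mass of the bump relative to the volume of its
   ball.\<close>
 define k :: real where "k = exp (- 2) * (1 / 2) ^ DIM('a)"
 have k: "(0::real) < k" by (simp add: k_def)
 have est: "abs (p - n - g \<bullet> b) * k <= (2 + M) * j" if j: "0 < j" for j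
 proof -
  obtain d1 where d1: "d1 > 0" "!!d u. 0 < d ==> d < d1 ==> u \<in> borel_measurable borel ==> (!!x. 0 <= u x \<and> u x <= indicat_real (ball z d) x) ==>
    abs ((LINT x|positive_variation (restrict_space borel \<Omega>) (\<lambda>E. D E \<bullet> b). u x) - p * (LINT x|lborel. u x)) <= j * measure lborel (ball z d)"
   using p[rule_format, OF j] unfolding eventually_at_right_field by auto
  obtain d2 where d2: "d2 > 0" "!!d u. 0 < d ==> d < d2 ==> u \<in> borel_measurable borel ==> (!!x. 0 <= u x \<and> u x <= indicat_real (ball z d) x) ==>
    abs ((LINT x|positive_variation (restrict_space borel \<Omega>) (\<lambda>E. - (D E \<bullet> b)). u x) - n * (LINT x|lborel. u x)) <= j * measure lborel (ball z d)"
   using n[rule_format, OF j] unfolding eventually_at_right_field by auto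
  obtain d3 where d3: "d3 > 0" "!!x. norm (x - z) < d3 ==> abs (\<phi> x - \<phi> z - g \<bullet> (x - z)) <= j * norm (x - z)"
   using g j unfolding has_derivative_at_alt real_norm_def by blast
  obtain d4 where d4: "d4 > 0" "cball z d4 \<subseteq> \<Omega>" using \<Omega> open_contains_cball by blast
  define d where "d = min (min d1 d2) (min d3 d4) / 2"
  have d: "0 < d" "d < d1" "d < d2" "d < d3" "d < d4" using d1 d2 d3 d4 unfolding d_def by (simp_all add: min_less_iff_disj)
  have sub: "cball z d \<subseteq> \<Omega>" using d(5) d4(2) subset_cball[of d d4 z] by auto
  define u where "u = bump z d"
  define I where "I = (LINT x|lborel. u x)"
  define B where "B = measure lborel (ball z d)"
  have u: "u \<in> borel_measurable borel" "integrable lborel u" "0 <= u x \<and> u x <= indicat_real (ball z d) x" for x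
   unfolding u_def using bump_fun_borel[OF bump_fun_bump] bump_fun_integrable[OF bump_fun_bump d(1)] bump_bounds[OF d(1)] by auto
  have B: "0 < B" using d(1) by (simp add: B_def content_ball_pos)
  have IB: "k * B <= I"
  proof -
   have "k * B = (LINT x|lborel. exp (- 2) * indicator (ball z (d / 2)) x)"
    using d(1) by (simp add: k_def B_def content_ball power_divide)
   also have "... <= I" unfolding I_def
    by (intro integral_mono u(2) integrable_mult_right) (auto simp: u_def bump_bounds[OF d(1)] integrable_indicator_iff emeasure_bounded_finite[simplified])
   finally show ?thesis .
  qed
  have bd_fun: "bump_fun z d (\<lambda>x. bump_deriv z d x b)" using bump_fun_affine_deriv(1)[of "\<lambda>_. 0" z d 1 b] by simp
  have [measurable]: "(\<lambda>x. bump_deriv z d x b) \<in> borel_measurable borel" by (rule bump_fun_borel[OF bd_fun])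
  have \<Omega>b [measurable]: "\<Omega> \<in> sets borel" using \<Omega>(1) by simp
  have fd: "frechet_derivative (\<lambda>x. u x *\<^sub>R b) (at x) = (\<lambda>v. bump_deriv z d x v *\<^sub>R b)" for x
   unfolding u_def by (rule frechet_derivative_at[symmetric, OF has_derivative_scaleR_left[OF bump_derivative]])
  have div: "divergence (\<lambda>x. u x *\<^sub>R b) x = bump_deriv z d x b" for x
  proof -
   have "divergence (\<lambda>x. u x *\<^sub>R b) x = (\<Sum>b'\<in>Basis. if b' = b then bump_deriv z d x b else 0)"
    unfolding divergence_def fd using b by (intro sum.cong) (auto simp: inner_Basis)
   then show ?thesis using b by simp
  qed
  have supp: "{x. u x *\<^sub>R b \<noteq> 0} \<subseteq> cball z d"
  proof
   fix x assume "x \<in> {x. u x *\<^sub>R b \<noteq> 0}"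
   then show "x \<in> cball z d" using u(3)[of x] by (cases "x \<in> ball z d") auto
  qed
  then have cl: "closure {x. u x *\<^sub>R b \<noteq> 0} \<subseteq> cball z d" by (rule closure_minimal) simp
  have "test_field \<Omega> (\<lambda>x. u x *\<^sub>R b)" unfolding test_field_def
  proof (intro conjI allI)
   show "k_times_cont_diff k (\<lambda>x. u x *\<^sub>R b)" for k unfolding u_def by (rule k_times_cont_diff_bump[OF bump_fun_bump])
   show "compact (closure {x. u x *\<^sub>R b \<noteq> 0})" using bounded_subset[OF bounded_cball supp] by simp
   show "closure {x. u x *\<^sub>R b \<noteq> 0} \<subseteq> \<Omega>" using cl sub by blast
  qed
  then have eq: "signed_integral (restrict_space borel \<Omega>) (\<lambda>E. D E \<bullet> b) u = - (LINT x|restrict_space lborel \<Omega>. \<phi> x * bump_deriv z d x b)"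
   using bv unfolding has_bv_derivative_def div[symmetric] u_def by (metis vector_measure_integral_bump[OF b])
  have \<phi>i: "integrable lborel (\<lambda>x. indicator \<Omega> x * \<phi> x)"
   using bv unfolding has_bv_derivative_def by (subst (asm) integrable_restrict_space) (auto simp: \<Omega>b)
  have out: "bump_deriv z d x b = 0" if "x \<notin> ball z d" for x using M(2)[OF d(1), of x] that by simp
  define e where "e x = indicator \<Omega> x * (\<phi> x * bump_deriv z d x b) - (g \<bullet> (x - z) + \<phi> z) * bump_deriv z d x b" for x
  have i1: "integrable lborel (\<lambda>x. indicator \<Omega> x * (\<phi> x * bump_deriv z d x b))"
  proof (rule Bochner_Integration.integrable_bound[OF integrable_mult_right[OF \<phi>i]])
   have "(\<lambda>x. indicator \<Omega> x * \<phi> x) \<in> borel_measurable lborel" using \<phi>i by auto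
   then have "(\<lambda>x. indicator \<Omega> x * \<phi> x * bump_deriv z d x b) \<in> borel_measurable lborel" by measurable
   then show "(\<lambda>x. indicator \<Omega> x * (\<phi> x * bump_deriv z d x b)) \<in> borel_measurable lborel" by (simp add: mult.assoc)
   show "AE x in lborel. norm (indicator \<Omega> x * (\<phi> x * bump_deriv z d x b)) <= norm (M / d * (indicator \<Omega> x * \<phi> x))"
   proof (rule AE_I2)
    fix x
    have "abs (bump_deriv z d x b) <= M / d" using M(2)[OF d(1), of x] M(1) d(1) by (cases "x \<in> ball z d") auto
    then have "abs (bump_deriv z d x b) * abs (indicator \<Omega> x * \<phi> x) <= M / d * abs (indicator \<Omega> x * \<phi> x)" by (intro mult_right_mono) auto
    then show "norm (indicator \<Omega> x * (\<phi> x * bump_deriv z d x b)) <= norm (M / d * (indicator \<Omega> x * \<phi> x))"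
     using M(1) d(1) by (simp add: abs_mult mult_ac)
   qed
  qed
  have i2: "integrable lborel (\<lambda>x. (g \<bullet> (x - z) + \<phi> z) * bump_deriv z d x b)"
   by (intro bump_fun_integrable[OF bump_fun_affine_deriv(1) d(1)] bounded_linear_inner_right)
  have "(LINT x|restrict_space lborel \<Omega>. \<phi> x * bump_deriv z d x b) = (LINT x|lborel. indicator \<Omega> x * (\<phi> x * bump_deriv z d x b))"
   by (subst integral_restrict_space) (auto simp: \<Omega>b)
  also have "... = (LINT x|lborel. e x) + (LINT x|lborel. (g \<bullet> (x - z) + \<phi> z) * bump_deriv z d x b)"
   unfolding e_def using i1 i2 by simp
  also have "(LINT x|lborel. (g \<bullet> (x - z) + \<phi> z) * bump_deriv z d x b) = - (g \<bullet> b * I)"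
   unfolding I_def u_def by (rule bump_by_parts[OF bounded_linear_inner_right d(1)])
  finally have eq2: "signed_integral (restrict_space borel \<Omega>) (\<lambda>E. D E \<bullet> b) u = g \<bullet> b * I - (LINT x|lborel. e x)" using eq by simp
  have "abs (LINT x|lborel. e x) <= (LINT x|lborel. (j * M) * indicator (ball z d) x)"
  proof (rule order_trans[OF integral_norm_bound[where 'a=real, unfolded real_norm_def]], rule integral_mono)
   show "integrable lborel (\<lambda>x. abs (e x))" unfolding e_def using i1 i2 by (intro integrable_abs Bochner_Integration.integrable_diff)
   show "integrable lborel (\<lambda>x. (j * M) * indicator (ball z d) x)"
    by (intro integrable_mult_right) (auto simp: integrable_indicator_iff emeasure_bounded_finite[simplified])
   fix x
   show "abs (e x) <= (j * M) * indicator (ball z d) x"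
   proof (cases "x \<in> ball z d")
    case True
    then have x: "norm (x - z) < d" "x \<in> \<Omega>" using sub by (auto simp: dist_norm norm_minus_commute)
    have "abs (\<phi> x - \<phi> z - g \<bullet> (x - z)) <= j * d"
     by (rule order_trans[OF d3(2)[OF less_trans[OF x(1) d(4)]]]) (use x(1) j in \<open>simp add: mult_left_mono\<close>)
    moreover have "abs (bump_deriv z d x b) <= M / d" using M(2)[OF d(1), of x] True by simp
    ultimately have "abs ((\<phi> x - \<phi> z - g \<bullet> (x - z)) * bump_deriv z d x b) <= (j * d) * (M / d)"
     unfolding abs_mult using j d(1) by (intro mult_mono) auto
    then show ?thesis using True x(2) d(1) by (simp add: e_def algebra_simps)
   qed (simp add: e_def out)
  qed
  also have "... = j * M * B" by (simp add: B_def)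
  finally have err: "abs (LINT x|lborel. e x) <= j * M * B" .
  have "abs ((LINT x|positive_variation (restrict_space borel \<Omega>) (\<lambda>E. D E \<bullet> b). u x) - p * I) <= j * B"
   "abs ((LINT x|positive_variation (restrict_space borel \<Omega>) (\<lambda>E. - (D E \<bullet> b)). u x) - n * I) <= j * B"
   unfolding I_def B_def by (rule d1(2)[OF d(1,2) u(1,3)], rule d2(2)[OF d(1,3) u(1,3)])
  with err have "abs ((p - n - g \<bullet> b) * I) <= 2 * (j * B) + j * M * B"
   using eq2 unfolding signed_integral_def left_diff_distrib abs_le_iff by linarith
  moreover have I0: "0 <= I" using IB mult_pos_pos[OF k B] by linarith
  ultimately have "abs (p - n - g \<bullet> b) * I <= ((2 + M) * j) * B" unfolding abs_mult abs_of_nonneg[OF I0] by (simp add: algebra_simps)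
  moreover have "abs (p - n - g \<bullet> b) * (k * B) <= abs (p - n - g \<bullet> b) * I" using IB by (intro mult_left_mono) auto
  ultimately have "(abs (p - n - g \<bullet> b) * k) * B <= ((2 + M) * j) * B" by (simp only: mult.assoc)
  then show ?thesis using B by (simp only: mult_le_cancel_right_pos)
 qed
 have "abs (p - n - g \<bullet> b) * k <= 0"
 proof (rule field_le_epsilon)
  fix e :: real assume "0 < e"
  then show "abs (p - n - g \<bullet> b) * k <= 0 + e" using est[of "e / (2 + M)"] M(1) by simp
 qed
 then show ?thesis using k by (simp add: mult_le_0_iff)
qed

text \<open>Outside a null set that carries all singular parts, \<open>D\<close> has a density
  \<open>G\<close>, so its total variation has density \<open>norm G\<close>, and uniqueness of
  densities identifies this with \<open>Da\<close>. At points of differentiability \<open>G\<close>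
  is the gradient.\<close>

theorem bv_density_eq_norm_gradient:
 fixes \<phi> Da :: "'a::euclidean_space => real"
 assumes \<Omega>: "open \<Omega>" "bounded \<Omega>" and bv: "has_bv_derivative \<phi> D \<Omega>"
  and ac: "is_ac_density (restrict_space lborel \<Omega>) (total_variation (restrict_space borel \<Omega>) D) Da"
 shows "AE x in lborel. x \<in> \<Omega> --> (\<forall>g. (\<phi> has_derivative (\<lambda>w. g \<bullet> w)) (at x) --> Da x = norm g)"
proof -
 let ?M = "restrict_space borel \<Omega>"
 have \<Omega>b [measurable]: "\<Omega> \<in> sets borel" using \<Omega>(1) by simp
 have sM: "E \<in> sets ?M \<longleftrightarrow> E \<in> sets borel \<and> E \<subseteq> \<Omega>" for E using \<Omega>b by (simp add: sets_restrict_space_iff conj_commute)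
 have vm: "vector_measure ?M D" using bv by (simp add: has_bv_derivative_def)
 interpret charge ?M D using vm by unfold_locales (simp add: vector_measure_def)
 have sc: "signed_charge ?M (\<lambda>E. D E \<bullet> b)" for b
  by unfold_locales (intro bounded_linear.sums[OF bounded_linear_inner_left] ca)
 have scm: "signed_charge ?M (\<lambda>E. - (D E \<bullet> b))" for b by (rule signed_charge.uminus_charge[OF sc])
 define P where "P b = positive_variation ?M (\<lambda>E. D E \<bullet> b)" for b
 define Q where "Q b = positive_variation ?M (\<lambda>E. - (D E \<bullet> b))" for b
 define der where "der m f z \<longleftrightarrow> (\<forall>k>0. tests (\<lambda>h z. ball z h) m (f z) k z)" for m and f :: "'a => real" and z
 have "\<exists>f N. integrable lborel f \<and> N \<in> null_sets lborel \<and>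
   (\<forall>E. E \<in> sets borel --> E \<subseteq> \<Omega> - N --> measure (P b) E = (LINT x|lborel. indicator E x * f x)) \<and> (AE z in lborel. der (P b) f z)" for b
  by (rule positive_variation_derivative[OF sc[of b] \<Omega>b]) (unfold P_def der_def, blast)
 then obtain p Np where p: "!!b. integrable lborel (p b)" "!!b. Np b \<in> null_sets lborel"
   "!!b E. E \<in> sets borel ==> E \<subseteq> \<Omega> - Np b ==> measure (P b) E = (LINT x|lborel. indicator E x * p b x)"
   "!!b. AE z in lborel. der (P b) (p b) z" by metis
 have "\<exists>f N. integrable lborel f \<and> N \<in> null_sets lborel \<and>
   (\<forall>E. E \<in> sets borel --> E \<subseteq> \<Omega> - N --> measure (Q b) E = (LINT x|lborel. indicator E x * f x)) \<and> (AE z in lborel. der (Q b) f z)" for b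
  by (rule positive_variation_derivative[OF scm[of b] \<Omega>b]) (unfold Q_def der_def, blast)
 then obtain n Nn where n: "!!b. integrable lborel (n b)" "!!b. Nn b \<in> null_sets lborel"
   "!!b E. E \<in> sets borel ==> E \<subseteq> \<Omega> - Nn b ==> measure (Q b) E = (LINT x|lborel. indicator E x * n b x)"
   "!!b. AE z in lborel. der (Q b) (n b) z" by metis
 define G where "G x = (\<Sum>b\<in>Basis. (p b x - n b x) *\<^sub>R b)" for x
 have G: "integrable lborel G" unfolding G_def using p(1) n(1)
  by (intro Bochner_Integration.integrable_sum integrable_scaleR_left Bochner_Integration.integrable_diff)
 have Gb: "G x \<bullet> b = p b x - n b x" if "b \<in> Basis" for x b
  unfolding G_def inner_sum_left using that by (simp add: inner_Basis if_distrib cong: if_cong)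
 have [measurable]: "G \<in> borel_measurable borel" using G by auto
 obtain S N1 where S: "sets S = sets (restrict_space lborel \<Omega>)" "N1 \<in> sets (restrict_space lborel \<Omega>)"
  "emeasure (restrict_space lborel \<Omega>) N1 = 0" "emeasure S (space (restrict_space lborel \<Omega>) - N1) = 0"
  "!!E. E \<in> sets (restrict_space lborel \<Omega>) ==> emeasure (total_variation ?M D) E =
    emeasure (density (restrict_space lborel \<Omega>) (\<lambda>x. ennreal (Da x))) E + emeasure S E"
  using ac unfolding is_ac_density_def by blast
 have Da: "Da \<in> borel_measurable (restrict_space lborel \<Omega>)" "!!x. x \<in> \<Omega> ==> 0 <= Da x"
  using ac by (auto simp: is_ac_density_def)
 have sL: "E \<in> sets (restrict_space lborel \<Omega>) \<longleftrightarrow> E \<in> sets borel \<and> E \<subseteq> \<Omega>" for E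
  using \<Omega>b by (simp add: sets_restrict_space_iff conj_commute)
 have N1: "N1 \<in> null_sets lborel" using S(2,3) \<Omega>b unfolding sL by (subst (asm) emeasure_restrict_space) auto
 \<comment> \<open>Joins the exceptional sets of both variations of every component to the null set
   on which the singular part \<open>S\<close> is concentrated.\<close>
 define N0 where "N0 = N1 \<union> (\<Union>b\<in>Basis. Np b \<union> Nn b)"
 have N0: "N0 \<in> null_sets lborel" unfolding N0_def using N1 p(2) n(2) by (intro null_sets.Un null_sets.finite_UN) auto
 have [measurable]: "N0 \<in> sets borel" using null_setsD2[OF N0] by simp
 have DF: "D F = (LINT x|lborel. indicator F x *\<^sub>R G x)" if F: "F \<in> sets borel" "F \<subseteq> \<Omega> - N0" for F
 proof (rule euclidean_eqI)
  fix b :: 'a assume b: "b \<in> Basis"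
  have int: "integrable lborel (\<lambda>x. indicator F x * p b x)" "integrable lborel (\<lambda>x. indicator F x * n b x)"
   using integrable_mult_indicator[OF _ p(1)[of b], of F] integrable_mult_indicator[OF _ n(1)[of b], of F] F(1) by simp_all
  have "D F \<bullet> b = measure (P b) F - measure (Q b) F"
   unfolding P_def Q_def using F sM by (intro signed_charge.jordan_decomposition[OF sc]) auto
  also have "... = (LINT x|lborel. indicator F x * p b x) - (LINT x|lborel. indicator F x * n b x)"
  proof -
   have "F \<subseteq> \<Omega> - Np b" "F \<subseteq> \<Omega> - Nn b" using F(2) b by (auto simp: N0_def)
   then show ?thesis using p(3)[OF F(1)] n(3)[OF F(1)] by simp
  qed
  also have "... = (LINT x|lborel. (indicator F x *\<^sub>R G x) \<bullet> b)"
   unfolding Bochner_Integration.integral_diff[OF int, symmetric] by (simp add: Gb[OF b] right_diff_distrib)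
  also have "... = (LINT x|lborel. indicator F x *\<^sub>R G x) \<bullet> b"
   using F(1) G by (intro integral_inner_left impI integrable_mult_indicator) auto
  finally show "D F \<bullet> b = (LINT x|lborel. indicator F x *\<^sub>R G x) \<bullet> b" .
 qed
 define f1 where "f1 x = ennreal (norm (G x)) * indicator (\<Omega> - N0) x" for x
 define f2 where "f2 x = ennreal (Da x) * indicator \<Omega> x * indicator (- N0) x" for x
 have f1 [measurable]: "f1 \<in> borel_measurable borel" unfolding f1_def by measurable
 have "(\<lambda>x. ennreal (Da x)) \<in> borel_measurable (restrict_space lborel \<Omega>)" using Da(1) by measurable
 then have "(\<lambda>x. ennreal (Da x) * indicator \<Omega> x) \<in> borel_measurable lborel"
  using \<Omega>b by (subst (asm) borel_measurable_restrict_space_iff_ennreal) auto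
 then have f2 [measurable]: "f2 \<in> borel_measurable borel" unfolding f2_def by measurable
 have "density lborel f1 = density lborel f2"
 proof (rule measure_eqI)
  fix X assume "X \<in> sets (density lborel f1)"
  then have [measurable]: "X \<in> sets borel" by simp
  define E where "E = X \<inter> (\<Omega> - N0)"
  have E: "E \<in> sets borel" "E \<subseteq> \<Omega> - N0" "E \<subseteq> \<Omega>" unfolding E_def by auto
  have fin: "emeasure lborel E < \<infinity>" by (rule emeasure_bounded_finite[OF bounded_subset[OF \<Omega>(2) E(3)]])
  have "emeasure (density lborel f1) X = (\<integral>\<^sup>+x. ennreal (norm (G x)) * indicator E x \<partial>lborel)"
   by (subst emeasure_density) (auto intro!: nn_integral_cong simp: f1_def E_def indicator_def)
  also have "... = emeasure (total_variation ?M D) E"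
   unfolding total_variation_def
   by (subst emeasure_total_variation, use sM E in blast, rule variation_of_density[OF G \<Omega>b E(1,3) fin, symmetric]) (use DF E in auto)
  also have "... = emeasure (density (restrict_space lborel \<Omega>) (\<lambda>x. ennreal (Da x))) E + emeasure S E"
   using sL E by (intro S(5)) auto
  also have "emeasure S E = 0"
  proof -
   have "emeasure S E <= emeasure S (space (restrict_space lborel \<Omega>) - N1)"
   proof (rule emeasure_mono)
    show "E \<subseteq> space (restrict_space lborel \<Omega>) - N1" using E(2) by (auto simp: N0_def space_restrict_space)
    show "space (restrict_space lborel \<Omega>) - N1 \<in> sets S" unfolding S(1) by (intro sets.compl_sets S(2))
   qed
   then show ?thesis using S(4) by simp
  qed
  also have "emeasure (density (restrict_space lborel \<Omega>) (\<lambda>x. ennreal (Da x))) E = (\<integral>\<^sup>+x. ennreal (Da x) * indicator E x * indicator \<Omega> x \<partial>lborel)"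
   using sL E Da(1) \<Omega>b by (subst emeasure_density) (auto simp: nn_integral_restrict_space)
  also have "... = emeasure (density lborel f2) X"
   by (subst emeasure_density) (auto intro!: nn_integral_cong simp: f2_def E_def indicator_def)
  finally show "emeasure (density lborel f1) X = emeasure (density lborel f2) X" by simp
 qed simp
 then have "AE x in lborel. f1 x = f2 x" by (intro sigma_finite_measure.density_unique[OF sigma_finite_lborel]) simp_all
 moreover have "AE z in lborel. \<forall>b\<in>Basis. der (P b) (p b) z \<and> der (Q b) (n b) z"
  by (rule AE_finite_allI) (auto intro: AE_conjI p(4) n(4))
 ultimately show ?thesis using AE_not_in[OF N0]
 proof eventually_elim
  case (elim z)
  show ?case
  proof (intro impI allI)
   assume z: "z \<in> \<Omega>"
   fix g assume g: "(\<phi> has_derivative (\<lambda>w. g \<bullet> w)) (at z)"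
   have "G z = g"
   proof (rule euclidean_eqI)
    fix b :: 'a assume b: "b \<in> Basis"
    with elim have d: "der (P b) (p b) z" "der (Q b) (n b) z" by auto
    have "p b z - n b z = g \<bullet> b"
     using d unfolding der_def P_def Q_def by (rule bv_gradient_at[OF \<Omega>(1) z bv g b])
    then show "G z \<bullet> b = g \<bullet> b" using Gb[OF b] by simp
   qed
   moreover have "ennreal (norm (G z)) = ennreal (Da z)" using elim z by (simp add: f1_def f2_def)
   ultimately show "Da z = norm g" using Da(2)[OF z] by (simp add: ennreal_inj)
  qed
 qed
qed

section \<open>Gauss curvature\<close>

lemma sqrt_expansion: "0 <= r ==> r <= 1 ==> abs (sqrt (1 - r) - 1 + r / 2) <= r\<^sup>2 / 2" for r :: real
proof -
 assume r: "0 <= r" "r <= 1"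
 define a where "a = sqrt (1 - r)"
 have a: "0 <= a" "a * a = 1 - r" using r by (auto simp: a_def)
 have "a <= 1" using r by (simp add: a_def)
 then have "1 - a <= (1 - a) * (1 + a)" using a(1) by (simp add: mult_le_cancel_left1)
 also have "... = r" using a(2) by (simp add: algebra_simps)
 finally have "(1 - a)\<^sup>2 <= r\<^sup>2" using \<open>a <= 1\<close> by (intro power_mono) auto
 moreover have "a - 1 + r / 2 = - ((1 - a)\<^sup>2 / 2)" using a(2) by (simp add: power2_eq_square field_simps)
 ultimately show ?thesis by (simp add: a_def)
qed

context expansion_point begin

text \<open>Scale the chart point by \<open>s0\<close> and expand at \<open>y0\<close>: the
  tangential displacement produces \<open>s0 * q i\<close>, while the drop
  \<open>sqrt (1 - r) - 1\<close> of the normal component, about \<open>- r / 2\<close>, produces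
  \<open>- H\<close> on the diagonal. The term \<open>H\<close> times the identity in the curvature
  cancels it.\<close>

lemma alexandrov_hessian:
 defines "H \<equiv> F t0 n0" and "d \<equiv> DIM('a) - 1"
 defines "Q \<equiv> mat d d (\<lambda>(i, j). if i = j then s0 * q i - H else 0)"
 shows "has_alexandrov_hessian (F t0) n0 e Q" "det (H \<cdot>\<^sub>m 1\<^sub>m d + Q) = (\<Prod>i<d. s0 * q i)"
proof -
 have sp: "scalar_prod v w = (\<Sum>i<d. v $ i * w $ i)" if "w \<in> carrier_vec d" for v w :: "real Matrix.vec"
  using that by (simp add: scalar_prod_def atLeast0LessThan)
 have Qc: "Q \<in> carrier_mat d d" by (simp add: Q_def)
 have Q\<theta>: "scalar_prod (Q *\<^sub>v \<theta>) \<theta> = (\<Sum>i<d. (s0 * q i - H) * (\<theta> $ i)\<^sup>2)" if \<theta>: "\<theta> \<in> carrier_vec d" for \<theta>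
  unfolding sp[OF \<theta>]
 proof (intro sum.cong refl)
  fix i assume i: "i \<in> {..<d}"
  have "(Q *\<^sub>v \<theta>) $ i = (\<Sum>j<d. if j = i then (s0 * q i - H) * \<theta> $ i else 0)"
  proof -
   have "(Q *\<^sub>v \<theta>) $ i = (\<Sum>j<d. (if i = j then s0 * q i - H else 0) * \<theta> $ j)" using i \<theta> by (simp add: Q_def sp[OF \<theta>])
   also have "... = (\<Sum>j<d. if j = i then (s0 * q i - H) * \<theta> $ i else 0)" by (intro sum.cong) auto
   finally show ?thesis .
  qed
  then show "(Q *\<^sub>v \<theta>) $ i * \<theta> $ i = (s0 * q i - H) * (\<theta> $ i)\<^sup>2" using i by (simp add: power2_eq_square)
 qed
 define p where "p = Matrix.vec d (\<lambda>i. x0 \<bullet> e i)"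
 have Hx: "n0 \<bullet> x0 = H" using x0(1) F_hom[of s0 t0 n0] s0 y0_eq unfolding H_def by (metis inner_scaleR_left less_imp_le mult_cancel_left order_less_irrefl)
 show "has_alexandrov_hessian (F t0) n0 e Q"
  unfolding has_alexandrov_hessian_def d_def[symmetric]
 proof (intro conjI bexI[of _ p] allI impI)
  show "transpose_mat Q = Q" by (rule eq_matI) (auto simp: Q_def)
  fix k :: real assume k: "0 < k"
  \<comment> \<open>Since \<open>norm u <= 2 * s0 * a\<close>, this precision becomes
    \<open>s0 * (k / 2 * r)\<close>; after division by \<open>s0\<close> it is half of the allowed
    error, the other half going to the expansion of the square root.\<close>
  have "0 < k / (8 * s0)" using k s0 by simp
  from expand[OF this] obtain h0 where h0: "h0 > 0" "!!h l u. 0 < h ==> h < h0 ==> abs l <= h\<^sup>2 ==> norm u <= h ==>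
   abs (tay l u) <= k / (8 * s0) * h\<^sup>2" by blast
  define h where "h = min (min 1 (k / (abs H + 1))) (h0 / (2 * s0))"
  show "\<exists>h>0. \<forall>\<theta>\<in>carrier_vec d. sqrt (scalar_prod \<theta> \<theta>) < h -->
    abs (F t0 (sphere_chart n0 e \<theta>) - F t0 n0 - scalar_prod p \<theta> - 1 / 2 * scalar_prod (Q *\<^sub>v \<theta>) \<theta>) <= k * scalar_prod \<theta> \<theta>"
  proof (intro exI[of _ h] conjI ballI impI)
   show "0 < h" using k h0(1) s0 by (simp add: h_def)
   fix \<theta> :: "real Matrix.vec" assume \<theta>: "\<theta> \<in> carrier_vec d" and small: "sqrt (scalar_prod \<theta> \<theta>) < h"
   define r where "r = scalar_prod \<theta> \<theta>"
   have r: "r = (\<Sum>i<d. (\<theta> $ i)\<^sup>2)" by (simp add: r_def sp[OF \<theta>] power2_eq_square)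
   have r0: "0 <= r" unfolding r by (intro sum_nonneg) auto
   define a where "a = sqrt r"
   have a: "0 <= a" "a * a = r" "a < 1" "a < k / (abs H + 1)" "a < h0 / (2 * s0)"
    using r0 small by (auto simp: a_def r_def h_def)
   have ra: "r <= a" using mult_left_le[of a a] a(1-3) by simp
   have r1: "r <= 1" using ra a(3) by simp
   define b where "b = sqrt (1 - r) - 1"
   have bb: "abs (b + r / 2) <= r\<^sup>2 / 2" using sqrt_expansion[OF r0 r1] by (simp add: b_def)
   define v where "v = (\<Sum>i<d. (\<theta> $ i) *\<^sub>R e i)"
   define u where "u = s0 *\<^sub>R (v + b *\<^sub>R n0)"
   have vi: "v \<bullet> e i = \<theta> $ i" if "i < d" for i using inner_frame_sum that by (simp add: v_def d_def)
   have vn: "v \<bullet> n0 = 0" unfolding v_def d_def by (rule inner_frame_sum_n0)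
   have "(norm v)\<^sup>2 = r" unfolding norm_frame vn r d_def[symmetric] using vi by simp
   then have nv: "norm v = a" by (simp add: a_def real_sqrt_unique)
   have "r\<^sup>2 <= r" using r0 r1 by (simp add: power2_eq_square mult_left_le)
   then have "abs b <= r" using bb r0 unfolding abs_le_iff by linarith
   then have "norm (v + b *\<^sub>R n0) <= 2 * a" using norm_triangle_ineq[of v "b *\<^sub>R n0"] nv n0 ra by simp
   then have nu: "norm u <= 2 * s0 * a" using s0 by (simp add: u_def)
   have "abs (tay 0 u) <= k / (8 * s0) * (2 * s0 * a)\<^sup>2"
   proof (cases "a = 0")
    case True
    then have "u = 0" using nu by simp
    then show ?thesis using k s0 by simp
   next
    case False
    then show ?thesis using a s0 nu by (intro h0(2)) (auto simp: pos_less_divide_eq mult_ac)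
   qed
   also have "k / (8 * s0) * (2 * s0 * a)\<^sup>2 = s0 * (k / 2 * r)" using s0 by (simp add: power2_eq_square a(2)[symmetric])
   finally have ex: "abs (F t0 (y0 + u) - F t0 y0 - x0 \<bullet> u - N u \<bullet> u / 2) <= s0 * (k / 2 * r)" by simp
   have chart: "y0 + u = s0 *\<^sub>R sphere_chart n0 e \<theta>"
    unfolding u_def sphere_chart_def d_def[symmetric] v_def[symmetric] r_def[symmetric] b_def by (subst y0_eq) (simp add: algebra_simps)
   have 1: "F t0 (y0 + u) = s0 * F t0 (sphere_chart n0 e \<theta>)" "F t0 y0 = s0 * H"
    using s0 x0(1) Hx by (simp_all add: chart F_hom y0_inner)
   have 2: "x0 \<bullet> u = s0 * (scalar_prod p \<theta> + b * H)"
    by (simp add: u_def v_def inner_add_right inner_sum_right Hx[unfolded inner_commute[of n0]] sp[OF \<theta>] p_def mult.commute)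
   have "u \<bullet> e i = s0 * \<theta> $ i" if "i < d" for i using vi[OF that] e_n0[of i] that by (simp add: u_def inner_add_left d_def)
   then have 3: "N u \<bullet> u = s0 * (\<Sum>i<d. s0 * q i * (\<theta> $ i)\<^sup>2)"
    unfolding N_inner d_def[symmetric] sum_distrib_left by (intro sum.cong) (auto simp: power2_eq_square)
   have 4: "scalar_prod (Q *\<^sub>v \<theta>) \<theta> = (\<Sum>i<d. s0 * q i * (\<theta> $ i)\<^sup>2) - H * r"
    unfolding Q\<theta>[OF \<theta>] r sum_distrib_left sum_subtractf[symmetric] by (simp add: left_diff_distrib)
   define X where "X = F t0 (sphere_chart n0 e \<theta>) - F t0 n0 - scalar_prod p \<theta> - 1 / 2 * scalar_prod (Q *\<^sub>v \<theta>) \<theta>"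
   have "F t0 (y0 + u) - F t0 y0 - x0 \<bullet> u - N u \<bullet> u / 2 = s0 * (X - H * (b + r / 2))"
    unfolding 1 2 3 X_def 4 H_def[symmetric] by (simp add: algebra_simps)
   with ex have "s0 * abs (X - H * (b + r / 2)) <= s0 * (k / 2 * r)" using s0 by (simp add: abs_mult)
   then have "abs (X - H * (b + r / 2)) <= k / 2 * r" using s0 by simp
   moreover have "abs (H * (b + r / 2)) <= k / 2 * r"
   proof -
    have "abs (H * (b + r / 2)) <= (abs H + 1) * (r\<^sup>2 / 2)" unfolding abs_mult using bb by (intro mult_mono) auto
    also have "... = ((abs H + 1) * r) * (r / 2)" by (simp add: power2_eq_square)
    also have "... <= k * (r / 2)"
    proof (rule mult_right_mono)
     have "(abs H + 1) * r <= (abs H + 1) * a" using ra by (intro mult_left_mono) auto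
     also have "... <= k" using a(4) by (simp add: pos_less_divide_eq mult.commute)
     finally show "(abs H + 1) * r <= k" .
    qed (use r0 in simp)
    finally show ?thesis by simp
   qed
   ultimately have "abs X <= k * r" unfolding abs_le_iff by linarith
   then show "abs (F t0 (sphere_chart n0 e \<theta>) - F t0 n0 - scalar_prod p \<theta> - 1 / 2 * scalar_prod (Q *\<^sub>v \<theta>) \<theta>) <= k * scalar_prod \<theta> \<theta>"
    by (simp add: X_def r_def)
  qed
 qed (auto simp: p_def Qc)
 have dg: "H \<cdot>\<^sub>m 1\<^sub>m d + Q = mat d d (\<lambda>(i, j). if i = j then s0 * q i else 0)" (is "_ = ?D")
  by (rule eq_matI) (auto simp: Q_def)
 have "det ?D = prod_list (diag_mat ?D)"
  by (rule det_upper_triangular[of _ d]) (auto simp: upper_triangular_def)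
 also have "... = (\<Prod>i<d. s0 * q i)" by (simp add: prod_list_diag_prod atLeast0LessThan)
 finally show "det (H \<cdot>\<^sub>m 1\<^sub>m d + Q) = (\<Prod>i<d. s0 * q i)" unfolding dg .
qed

lemma gauss_curvature:
 assumes q: "!!i. i < DIM('a) - 1 ==> 0 < q i" and normals: "outer_unit_normals (SL t0) x0 = {n0}"
 shows "has_gauss_curvature (SL t0) x0 (1 / (\<Prod>i<DIM('a) - 1. s0 * q i))"
proof -
 have "x0 \<notin> interior (SL t0)"
 proof
  assume "x0 \<in> interior (SL t0)"
  then obtain k where k: "k > 0" "cball x0 k \<subseteq> SL t0" by (meson mem_interior_cball)
  have "x0 + k *\<^sub>R n0 \<in> SL t0" using k n0(1) by (intro subsetD[OF k(2)]) (simp add: dist_norm)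
  moreover have "n0 \<in> outer_unit_normals (SL t0) x0" unfolding normals by simp
  ultimately have "n0 \<bullet> (x0 + k *\<^sub>R n0 - x0) <= 0" by (auto simp: outer_unit_normals_def)
  then show False using k(1) n0 by simp
 qed
 then have "x0 \<in> frontier (SL t0)" using x0(2) compact_SL[of t0] by (simp add: frontier_def compact_imp_closed)
 moreover have "(\<Prod>i<DIM('a) - 1. s0 * q i) \<noteq> 0" using q s0 by (intro less_imp_neq[THEN not_sym] prod_pos) auto
 moreover have "tangent_basis n0 e" using tangent by (simp add: n0_def)
 ultimately show ?thesis
  unfolding has_gauss_curvature_def normals F_def[symmetric]
  using alexandrov_hessian compact_SL convex_SL interior_SL[OF t0]
  by (intro conjI exI[of _ n0] disjI1 exI[of _ e] exI[of _ "mat (DIM('a) - 1) (DIM('a) - 1) (\<lambda>(i, j). if i = j then s0 * q i - F t0 n0 else 0)"]) simp_all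
qed

end

section \<open>The curvature identity\<close>

context gauss_transport begin

text \<open>With \<open>w\<close> the product of the \<open>q i\<close>, the Jacobian identity reads
  \<open>(\<phi> x / s) ^ (DIM('a) - 1) * \<rho>1 (T x) / \<rho>0 x = c * w / s\<close>, the
  curvature is \<open>1 / (s ^ (DIM('a) - 1) * w)\<close> and the gradient has norm
  \<open>s / c\<close>; all powers of the auxiliary \<open>s\<close> cancel.\<close>

lemma curvature_identity_at:
 assumes x: "x \<in> A" "gauss_point x" and s: "1 < s" "s < 2"
  and ex: "parabolic_expansion (lift x s) c p N" and dp: "density_point (lift x s)"
  and Da: "!!g. (\<phi> has_derivative (\<lambda>w. g \<bullet> w)) (at x) ==> D = norm g"
 shows "\<exists>K. has_gauss_curvature (sublevel A \<phi> (\<phi> x)) x K \<and> K * D * \<phi> x ^ (DIM('a) - 1) * \<rho>1 (T x) = \<rho>0 x"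
proof -
 define n where "n = sgn (T x)"
 have g: "m0 < \<phi> x" "0 < \<phi> x" "norm (T x) = \<phi> x" "outer_unit_normals (sublevel A \<phi> (\<phi> x)) x = {n}"
  "0 < \<rho>0 x" "0 < \<rho>1 (T x)" "norm (T x) <= R" using x(2) by (auto simp: gauss_point_def n_def)
 have z: "lift x s = (\<phi> x, s *\<^sub>R n)" unfolding n_def by (rule lift_eq[OF x])
 have s0': "0 < s" using s by simp
 note ls = lift_support[OF x s0', folded n_def]
 have y0: "s *\<^sub>R n \<noteq> 0" using ls(3) s0' by auto
 have "p = x" by (rule expansion_unique_support[OF ex[unfolded z] y0 g(1) ls(1,2)])
 then have ex': "parabolic_expansion (\<phi> x, s *\<^sub>R n) c x N" using ex z by simp
 obtain e q where ep: "expansion_point A \<phi> (\<phi> x) c (s *\<^sub>R n) x N e q" by (rule expansion_pointI[OF ex' y0 g(1)])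
 interpret E: expansion_point A \<phi> "\<phi> x" c "s *\<^sub>R n" x N e q by (rule ep)
 have n1: "norm n = 1" using ls(3) s0' by simp
 have sn: "sgn (s *\<^sub>R n) = n" using n1 s0' by (simp add: sgn_div_norm)
 have Es: "E.s0 = s" "E.n0 = n" using ls(3) sn by (simp_all add: E.s0_def E.n0_def)
 have lam: "lam (\<phi> x, s *\<^sub>R n) = (\<phi> x / s) ^ (DIM('a) - 1) * \<rho>1 (T x) / \<rho>0 x"
 proof -
  have "\<phi> x *\<^sub>R n = T x" using g(2,3) by (simp add: n_def sgn_div_norm)
  then have "\<kappa> (\<phi> x, s *\<^sub>R n) * inverse (r0 x) = ennreal ((\<phi> x / s) ^ (DIM('a) - 1)) * ennreal (\<rho>1 (T x)) * inverse (ennreal (\<rho>0 x))"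
   using s g ls(3) x(1) n1 by (simp add: \<kappa>_def sn r1_def r0_def)
  also have "... = ennreal ((\<phi> x / s) ^ (DIM('a) - 1) * \<rho>1 (T x) / \<rho>0 x)"
   using g s0' by (simp add: inverse_ennreal divide_inverse ennreal_mult[symmetric])
  finally show ?thesis unfolding lam_def S_expansion[OF ex'] using g s0' by (simp add: enn2real_ennreal)
 qed
 have "0 < lam (\<phi> x, s *\<^sub>R n)" unfolding lam using g s0' by simp
 note j = jacobian[OF ep _ _ dp[unfolded z] this, unfolded ls(3), OF s]
 have "(\<phi> has_derivative (\<lambda>w. ((s *\<^sub>R n) \<bullet> w) / c)) (at x)" using E.differentiable_phi(2) j by blast
 then have "(\<phi> has_derivative (\<lambda>w. ((s / c) *\<^sub>R n) \<bullet> w)) (at x)" by simp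
 then have D: "D = s / c" using Da n1 s0' j(2) by fastforce
 have SLx: "SL (\<phi> x) = sublevel A \<phi> (\<phi> x)" by (rule SL_phi[OF x(1)])
 define w where "w = (\<Prod>i<DIM('a) - 1. q i)"
 have w: "0 < w" unfolding w_def using j(3) by (intro prod_pos) auto
 have "has_gauss_curvature (SL (\<phi> x)) x (1 / (\<Prod>i<DIM('a) - 1. E.s0 * q i))"
  using g(4) by (intro E.gauss_curvature j(3)) (auto simp: SLx Es)
 then have K: "has_gauss_curvature (sublevel A \<phi> (\<phi> x)) x (1 / (s ^ (DIM('a) - 1) * w))"
  by (simp add: Es SLx prod.distrib w_def)
 have "(\<phi> x / s) ^ (DIM('a) - 1) * \<rho>1 (T x) / \<rho>0 x = c * w / s" using j(1) unfolding lam w_def .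
 then have "\<phi> x ^ (DIM('a) - 1) * \<rho>1 (T x) * s = c * w * \<rho>0 x * s ^ (DIM('a) - 1)"
  using g s0' by (simp add: power_divide field_simps)
 then have "1 / (s ^ (DIM('a) - 1) * w) * D * \<phi> x ^ (DIM('a) - 1) * \<rho>1 (T x) = \<rho>0 x"
  using s0' w j(2) by (simp add: D field_simps)
 with K show ?thesis by blast
qed

theorem curvature_identity:
 assumes bv: "has_bv_derivative \<phi> D\<phi> (interior A)"
  and ac: "is_ac_density (restrict_space lborel (interior A)) (total_variation (restrict_space borel (interior A)) D\<phi>) D\<^sub>a\<phi>"
 shows "AE x in lborel. x \<in> A --> (\<exists>K. has_gauss_curvature (sublevel A \<phi> (\<phi> x)) x K \<and>
  K * D\<^sub>a\<phi> x * \<phi> x ^ (DIM('a) - 1) * \<rho>1 (T x) = \<rho>0 x)"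
proof -
 \<comment> \<open>The derivative of \<open>\<phi>\<close> is taken on \<open>interior A\<close>;
   for a convex set the boundary is null.\<close>
 have "frontier A \<in> null_sets lborel"
  using negligible_convex_frontier[OF convex_A] by (simp add: negligible_iff_null_sets null_sets_completion_iff)
 note front = AE_not_in[OF this]
 have "AE z in lborel. density_point z \<and> (\<exists>c p N. parabolic_expansion z c p N)"
  using AE_density_point AE_parabolic_expansion by eventually_elim blast
 note good = AE_lift[OF this]
 have bnd: "bounded (interior A)" using compact_A by (simp add: compact_imp_bounded bounded_interior)
 show ?thesis
  using front good AE_gauss_point bv_density_eq_norm_gradient[OF open_interior bnd bv ac]
 proof eventually_elim
  case (elim x)
  show ?case
  proof
   assume x: "x \<in> A"
   \<comment> \<open>One good \<open>s\<close> suffices because the conclusion does not contain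
     \<open>s\<close>; almost every \<open>s\<close> in an interval of positive length is
     good.\<close>
   have "\<exists>s\<in>{1<..<2}. density_point (lift x s) \<and> (\<exists>c p N. parabolic_expansion (lift x s) c p N)"
   proof (rule ccontr)
    assume none: "\<not> ?thesis"
    have "AE s in lborel. s \<in> {1<..<2} --> density_point (lift x s) \<and> (\<exists>c p N. parabolic_expansion (lift x s) c p N)"
     using elim x by blast
    then have "AE s in lborel. s \<notin> {1<..<2::real}" by (rule eventually_mono) (use none in blast)
    then show False by (subst (asm) AE_iff_measurable[of "{1<..<2}"]) auto
   qed
   then obtain s c p N where "1 < s" "s < 2" "density_point (lift x s)" "parabolic_expansion (lift x s) c p N" by auto
   moreover have "x \<in> interior A" using elim x closure_subset by (auto simp: frontier_def)
   ultimately show "\<exists>K. has_gauss_curvature (sublevel A \<phi> (\<phi> x)) x K \<and> K * D\<^sub>a\<phi> x * \<phi> x ^ (DIM('a) - 1) * \<rho>1 (T x) = \<rho>0 x"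
    using elim x by (intro curvature_identity_at) auto
  qed
 qed
qed

end

theorem theorem3p15:
  fixes A :: "'a::euclidean_space set" and R :: real
    and \<rho>0 \<rho>1 :: "'a \<Rightarrow> real" and T :: "'a \<Rightarrow> 'a" and \<phi> :: "'a \<Rightarrow> real"
    and D\<phi> :: "'a set \<Rightarrow> 'a" and D\<^sub>a\<phi> :: "'a \<Rightarrow> real"
  assumes "compact A" and "convex A" and "emeasure lborel A > 0" and "R > 0"
    and "equivalent_prob_density A \<rho>0"
    and "equivalent_prob_density (cball 0 R) \<rho>1"
    and "gauss_mass_transport A R \<rho>0 \<rho>1 T \<phi>"
    and "has_bv_derivative \<phi> D\<phi> (interior A)"
    and "is_ac_density (restrict_space lborel (interior A))
           (total_variation (restrict_space borel (interior A)) D\<phi>) D\<^sub>a\<phi>"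
  shows "AE x in measure_with_density A \<rho>0. \<exists>K.
           has_gauss_curvature (sublevel A \<phi> (\<phi> x)) x K \<and>
           K * D\<^sub>a\<phi> x * \<phi> x ^ (DIM('a) - 1) * \<rho>1 (T x) = \<rho>0 x"
proof -
 have A: "A \<in> sets borel" using assms(1) by (simp add: compact_imp_closed borel_closed)
 have "interior A \<noteq> {}"
 proof
  assume "interior A = {}"
  then have "negligible A" using negligible_convex_interior[OF assms(2)] by simp
  then show False using assms(3) A by (simp add: negligible_iff_null_sets null_sets_completion_iff null_sets_def)
 qed
 then interpret gauss_transport A \<phi> R \<rho>0 \<rho>1 T
  using assms(1,2,5-7) by unfold_locales (auto simp: gauss_mass_transport_def)
 have m: "sets (restrict_space lborel A) = sets (restrict_space borel A)" by (intro sets_restrict_space_cong) simp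
 have [measurable]: "\<rho>0 \<in> borel_measurable (restrict_space lborel A)"
  using assms(5) by (simp add: equivalent_prob_density_def measurable_cong_sets[OF m refl])
 have "AE x in restrict_space lborel A. \<exists>K. has_gauss_curvature (sublevel A \<phi> (\<phi> x)) x K \<and>
   K * D\<^sub>a\<phi> x * \<phi> x ^ (DIM('a) - 1) * \<rho>1 (T x) = \<rho>0 x"
  using curvature_identity[OF assms(8,9)] A by (subst AE_restrict_space_iff) auto
 then show ?thesis unfolding measure_with_density_def by (subst AE_density) auto
qed

end
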